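(* Let $s>0$. As $T\to\infty$, we have for every $y\in(-1,1)$ $$\mathbb{P}_y(\Gamma_T\le s)\sim\frac{\cos\left(\frac{\pi y}{2}\right)2^{\frac{19}{6}}}{\sqrt{3}\,\pi^{\frac{13}{6}}s^{\frac16}T^{\frac13}}\exp\left(-\frac{\pi^2}{8}T+\frac{3}{2^{\frac73}}\pi^{\frac43}s^{\frac13}T^{\frac23}-\frac{3}{2^{\frac53}}\pi^{\frac23}s^{\frac23}T^{\frac13}+\frac{\pi^2+12}{24}s\right),$$ as well as $$\lim_{T\to\infty}\frac{\mathbb{P}_x(\Gamma_T\le s)}{\mathbb{P}_y(\Gamma_T\le s)}=0,\qquad x\in\mathbb{R}\setminus(-1,1),\ y\in(-1,1).$$
   Context: For $z\in\mathbb{R}$, under $\mathbb{P}_z$, $B=(B_t)_{t\ge0}$ is a one-dimensional Brownian motion starting in $z$. For $T\ge0$, $\Gamma_T:=\int_0^T\mathbf{1}_{\{|B_t|\ge1\}}\,\mathrm{d}t$. The notation $f(T)\sim g(T)$ means $f(T)/g(T)\to1$. *)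

theory Defs
  imports "HOL-Probability.Probability" "HOL-Library.Landau_Symbols"
begin

unbundle asymp_equiv_syntax

text \<open>
  Only times \<open>t \<ge> 0\<close> matter; the values \<open>B t\<close> for \<open>t < 0\<close> are unconstrained.
  The starting point is prescribed almost surely, so that one process \<open>B\<close> on one measurable
  space can start at different points under different measures. Continuity is required of every
  path, which makes occupation times of closed sets random variables.
\<close>

locale brownian_motion = prob_space M
  for M :: "'w measure" and B :: "real \<Rightarrow> 'w \<Rightarrow> real" and z :: real +
  assumes measurable_B: "\<And>t. 0 \<le> t \<Longrightarrow> random_variable borel (B t)"
    and start: "AE \<omega> in M. B 0 \<omega> = z"
    and continuous_paths: "\<And>\<omega>. \<omega> \<in> space M \<Longrightarrow> continuous_on {0..} (\<lambda>t. B t \<omega>)"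
    and independent_increments:
      "\<And>(t :: nat \<Rightarrow> real) n. 0 \<le> t 0 \<Longrightarrow> (\<And>i. i < n \<Longrightarrow> t i < t (Suc i)) \<Longrightarrow>
        indep_vars (\<lambda>_. borel) (\<lambda>i \<omega>. B (t (Suc i)) \<omega> - B (t i) \<omega>) {..<n}"
    and normal_increments:
      "\<And>r t. 0 \<le> r \<Longrightarrow> r < t \<Longrightarrow>
        distributed M lborel (\<lambda>\<omega>. B t \<omega> - B r \<omega>) (normal_density 0 (sqrt (t - r)))"

definition occupation_time :: "(real \<Rightarrow> 'w \<Rightarrow> real) \<Rightarrow> real \<Rightarrow> 'w \<Rightarrow> real" where
  "occupation_time B T \<omega> = (LBINT t:{0..T}. indicator {x. 1 \<le> \<bar>x\<bar>} (B t \<omega>))"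

end

theory Submission
  imports Defs "HOL-Real_Asymp.Real_Asymp" "HOL-Complex_Analysis.Complex_Analysis"
begin

text \<open>
  Let \<open>\<theta> z = a tanh a\<close> with \<open>a = sqrt (2 z)\<close>. By the Feynman--Kac formula the double Laplace transform of
  \<open>\<P>(\<Gamma>\<^sub>T > s)\<close> in \<open>T\<close> and \<open>s\<close> is explicit; it is rational in \<open>sqrt (2 (l + m))\<close>, and inverting it in \<open>m\<close> gives
  \<open>\<integral> exp (- l T) \<P>(\<Gamma>\<^sub>T \<le> s) dT = (1 - M l) / l\<close>, where \<open>M l\<close> is \<open>exp (- l s)\<close> times the transform of the
  first hitting time of \<open>{-1, 1}\<close> (if \<open>\<bar>x\<bar> < 1\<close>) times \<open>E exp (- \<theta> l * max 0 (\<bar>N\<bar> - d))\<close> for \<open>N\<close> normal of variance \<open>s\<close> and \<open>d\<close> the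
  distance of the starting point to \<open>[-1, 1]\<close>. In terms of paths, \<open>\<theta> l\<close> is the rate at which the local time at
  \<open>\<plusminus>1\<close> is killed by the excursions into \<open>(-1, 1)\<close>.

  \<open>M\<close> is holomorphic on \<open>Re z > - \<pi>\<^sup>2 / 8\<close>, and \<open>\<theta>\<close> has a simple pole at the boundary point
  \<open>- \<pi>\<^sup>2 / 8\<close>, so \<open>M\<close> behaves like \<open>exp (c\<^sup>2 s / (2 h\<^sup>2) - 3 c s / (2 h) + \<dots>)\<close>, \<open>c = \<pi>\<^sup>2 / 4\<close>, at
  \<open>z = h - \<pi>\<^sup>2 / 8\<close>. The inversion integral on the vertical line through
  \<open>\<rho> - \<pi>\<^sup>2 / 8\<close>, with \<open>\<rho>\<^sup>3 T = c\<^sup>2 s\<close> the saddle point of \<open>h T + c\<^sup>2 s / (2 h\<^sup>2)\<close>, converges to a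
  Gaussian integral on the scale \<open>\<rho>\<^sup>2\<close>. To have absolute convergence this is done for
  \<open>\<integral>\<^sub>0\<^sup>T \<P>(\<Gamma>\<^sub>t \<le> s) dt\<close>; monotonicity of the integrand gives back the asymptotics of
  \<open>\<P>(\<Gamma>\<^sub>T \<le> s)\<close> itself. For \<open>\<bar>x\<bar> \<ge> 1\<close> the simple pole of the hitting time transform is missing,
  which costs a factor \<open>\<rho>\<close> and yields the second claim.
\<close>

section \<open>Laplace transforms on the half line\<close>

text \<open>Both inversions are verified, not derived: a candidate is written down and compared with
  the unknown through uniqueness of the Laplace transform. In the Feynman-Kac step the whole line is
  killed at rate \<open>l + m\<close> and the missing \<open>m\<close> on the open interval is a
  nonnegative perturbation. The equation then becomes an integral equation with an explicit kernel,
  and all interchanges are between nonnegative integrals. The precision at the pole is dictated by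
  the exponent \<open>theta^2 * s / 2\<close>, which is the logarithm of the half-normal transform
  up to a factor 2 and a bounded error. With \<open>z = h - pi^2 / 8\<close> and
  \<open>c = pi^2 / 4\<close>,
  \<open>theta = - c / h + 3 / 2 + (1 / 3 + 1 / pi^2) * h + o(h)\<close>, and the linear term
  matters because its product with \<open>- c / h\<close> has order 1. The term
  \<open>- 3 * c * s / (2 * h)\<close> is not part of the function whose saddle point is taken;
  along the line it leaves a phase \<open>exp (3 * \<i> * c * s * v / 2)\<close>, whose Gaussian
  mean is \<open>exp (- 3 * s / 8)\<close>. Together with \<open>exp (pi^2 * s / 8)\<close> from
  \<open>exp (- z * s)\<close> these constants add up to
  \<open>(pi^2 + 12) / 24 * s\<close>.\<close>

lemma exp_ici_integral:
  fixes p :: real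
  assumes "0 < p"
  shows "set_integrable lborel {0..} (\<lambda>t. exp (- p * t))"
    and "(LBINT t:{0..}. exp (- p * t)) = 1 / p"
proof -
  have e: "exponential_density p = (\<lambda>t. p * (indicator {0..} t * exp (- p * t)))"
    by (auto simp: exponential_density_def indicator_def fun_eq_iff)
  interpret D: prob_space "density lborel (exponential_density p)"
    by (rule prob_space_exponential_density[OF assms])
  have nn: "(\<integral>\<^sup>+t. ennreal (exponential_density p t) \<partial>lborel) = 1"
    using D.emeasure_space_1 by (simp add: emeasure_density)
  have i: "integrable lborel (exponential_density p)"
    using nn by (intro integrableI_nonneg) (auto simp: exponential_density_nonneg[OF assms])
  have "integrable lborel (\<lambda>t. (1/p) * exponential_density p t)"
    using i by (intro integrable_mult_right)
  then show "set_integrable lborel {0..} (\<lambda>t. exp (- p * t))"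
    using assms by (simp add: set_integrable_def e)
  have "integral\<^sup>L lborel (exponential_density p) = 1"
    using nn i by (intro integral_eq_nn_integral[THEN trans]) (auto simp: exponential_density_nonneg[OF assms])
  then show "(LBINT t:{0..}. exp (- p * t)) = 1 / p"
    using assms by (simp add: set_lebesgue_integral_def e field_simps)
qed

text \<open>Half of the decay absorbs the growth:
  \<open>1 + t \<le> (1 + 2 / p) * exp (p * t / 2)\<close> for \<open>t \<ge> 0\<close>. Linear
  growth is the class needed because uniqueness and inversion are applied to primitives of bounded
  functions.\<close>

lemma set_integrable_exp_linear_bound:
  fixes f :: "real \<Rightarrow> 'a :: {banach, second_countable_topology, real_normed_field}"
  assumes f: "set_borel_measurable lborel {0..} f"
    and bound: "\<And>t. 0 \<le> t \<Longrightarrow> norm (f t) \<le> C * (1 + t)" and p: "0 < p"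
  shows "set_integrable lborel {0..} (\<lambda>t. of_real (exp (- p * t)) * f t)"
proof (rule set_integrable_bound)
  show "set_integrable lborel {0..} (\<lambda>t. (C * (1 + 2 / p)) * exp (- (p/2) * t))"
    using exp_ici_integral(1)[of "p/2"] p by (intro set_integrable_mult_right) auto
  show "set_borel_measurable lborel {0..} (\<lambda>t. of_real (exp (- p * t)) * f t)"
  proof -
    have "(\<lambda>t. of_real (exp (- p * t)) * (indicator {0..} t *\<^sub>R f t)) \<in> borel_measurable lborel"
      using f unfolding set_borel_measurable_def by measurable
    then show ?thesis by (simp add: set_borel_measurable_def mult_ac)
  qed
  show "AE t in lborel. t \<in> {0..} \<longrightarrow> norm (of_real (exp (- p * t)) * f t) \<le> norm (C * (1 + 2 / p) * exp (- (p / 2) * t))"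
  proof (intro AE_I2 impI)
    fix t :: real assume "t \<in> {0..}"
    then have t: "0 \<le> t" by simp
    have C: "0 \<le> C" using order_trans[OF norm_ge_zero bound[of 0]] by simp
    have "1 + t \<le> (1 + 2 / p) * (1 + p * t / 2)"
      using t p by (simp add: field_simps)
    also have "\<dots> \<le> (1 + 2 / p) * exp (p * t / 2)"
      using p by (intro mult_left_mono exp_ge_add_one_self) auto
    finally have "C * (1 + t) \<le> C * ((1 + 2 / p) * exp (p * t / 2))"
      using C by (intro mult_left_mono)
    then have "norm (f t) \<le> C * ((1 + 2 / p) * exp (p * t / 2))" using bound[OF t] by linarith
    then have "exp (- p * t) * norm (f t) \<le> exp (- p * t) * (C * ((1 + 2 / p) * exp (p * t / 2)))"
      by (intro mult_left_mono) auto
    also have "\<dots> = C * (1 + 2 / p) * (exp (- p * t) * exp (p * t / 2))" by (simp add: mult_ac)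
    also have "exp (- p * t) * exp (p * t / 2) = exp (- (p / 2) * t)"
      by (subst exp_add[symmetric]) (simp add: field_simps)
    finally show "norm (of_real (exp (- p * t)) * f t) \<le> norm (C * (1 + 2 / p) * exp (- (p / 2) * t))"
      using C p by (simp add: norm_mult abs_mult)
  qed
qed

text \<open>Lerch's theorem as a moment problem. The substitution \<open>u = exp (- t)\<close> turns
  the transform at \<open>n\<close> into a moment on \<open>[0, 1]\<close>, so the integers suffice,
  and polynomial approximation of the function itself shows that the integral of
  \<open>exp (- 2 * t) * (f t)^2\<close> vanishes.\<close>

lemma laplace_uniqueness_continuous:
  fixes f :: "real \<Rightarrow> real"
  assumes cont: "continuous_on {0..} f"
    and bound: "\<And>t. 0 \<le> t \<Longrightarrow> \<bar>f t\<bar> \<le> C * (1 + t)"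
    and zero: "\<And>n::nat. 1 \<le> n \<Longrightarrow> (LBINT t:{0..}. exp (- real n * t) * f t) = 0"
    and t0: "0 \<le> t0"
  shows "f t0 = 0"
proof -
  have meas: "set_borel_measurable lborel {0..} f"
    using borel_measurable_continuous_on_indicator[OF _ cont]
    by (simp add: set_borel_measurable_def)
  have int: "set_integrable lborel {0..} (\<lambda>t. exp (- p * t) * f t)" if "0 < p" for p
    using set_integrable_exp_linear_bound[OF meas, of C p] bound that by simp
  \<comment> \<open>The factor \<open>u\<close> is borrowed from the exponential weight: by the
    linear growth of \<open>f\<close> and \<open>u * (1 - ln u) \<longlonglongrightarrow> 0\<close>,
    \<open>g\<close> is continuous up to \<open>u = 0\<close>, where \<open>f (- ln u)\<close> need
    not have a limit.\<close>
  define g where "g u = (if u \<le> 0 then 0 else u * f (- ln u))" for u :: real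
  have g_cont: "continuous_on {0..1} g"
  proof (rule continuous_on_eq_continuous_within[THEN iffD2], rule ballI)
    fix u :: real assume u: "u \<in> {0..1}"
    show "continuous (at u within {0..1}) g"
    proof (cases "u = 0")
      case True
      have C: "0 \<le> C" using order_trans[OF abs_ge_zero bound[of 0]] by simp
      have "(g \<longlongrightarrow> 0) (at_right 0)"
      proof (rule Lim_null_comparison)
        show "\<forall>\<^sub>F x in at_right (0::real). norm (g x) \<le> C * (x * (1 - ln x))"
          unfolding eventually_at_right_field
        proof (intro exI[of _ 1] conjI allI impI)
          fix y :: real assume "0 < y" "y < 1"
          then have "\<bar>f (- ln y)\<bar> \<le> C * (1 - ln y)" using bound[of "- ln y"] by auto
          then show "norm (g y) \<le> C * (y * (1 - ln y))"
            using \<open>0 < y\<close> by (simp add: g_def abs_mult mult.left_commute)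
        qed simp
        have "((\<lambda>x::real. x * (1 - ln x)) \<longlongrightarrow> 0) (at_right 0)"
          by real_asymp
        then show "((\<lambda>x. C * (x * (1 - ln x))) \<longlongrightarrow> 0) (at_right 0)"
          by (auto intro: tendsto_mult_right_zero)
      qed
      then have "(g \<longlongrightarrow> g 0) (at 0 within {0..})" by (simp add: g_def at_within_Ici_at_right)
      then show ?thesis unfolding True continuous_within
        by (rule tendsto_within_subset) auto
    next
      case False
      have "continuous_on {0<..1} (\<lambda>u. u * f (- ln u))"
        by (intro continuous_intros continuous_on_compose2[OF cont]) auto
      then have "continuous_on {0<..1} g"
        by (rule continuous_on_eq) (auto simp: g_def)
      then have "continuous (at u within {0<..1}) g"
        using u False by (auto simp: continuous_on_eq_continuous_within)
      moreover have "at u within {0<..1} = at u within {0..1}"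
        by (rule at_within_nhd[of _ "{0<..}"]) (use u False in auto)
      ultimately show ?thesis by (simp add: continuous_within)
    qed
  qed
  define N where "N = (LBINT t:{0..}. exp (- t) * \<bar>f t\<bar>)"
  have int_abs: "set_integrable lborel {0..} (\<lambda>t. exp (- t) * \<bar>f t\<bar>)"
    using set_integrable_abs[OF int[of 1]] by (simp add: abs_mult)
  have N0: "0 \<le> N" unfolding N_def set_lebesgue_integral_def by (intro integral_nonneg_AE) auto
  let ?S = "LBINT t:{0..}. exp (- t) * exp (- t) * (f t)^2"
  \<comment> \<open>The factor \<open>exp (- t)\<close> in front of \<open>q (exp (- t))\<close>
    shifts every exponent by one, so that even the constant term of \<open>q\<close> leads to an
    admissible \<open>n \<ge> 1\<close>.\<close>
  have poly0: "set_integrable lborel {0..} (\<lambda>t. exp (- t) * q (exp (- t)) * f t) \<and>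
      (LBINT t:{0..}. exp (- t) * q (exp (- t)) * f t) = 0"
    if "real_polynomial_function q" for q
  proof -
    obtain a n where q: "q = (\<lambda>x. \<Sum>i\<le>n. a i * x ^ i)"
      using \<open>real_polynomial_function q\<close> real_polynomial_function_iff_sum by blast
    have eq: "exp (- t) * q (exp (- t)) * f t = (\<Sum>i\<le>n. a i * (exp (- real (Suc i) * t) * f t))" for t
    proof -
      have "exp (- t) * exp (- t) ^ i = exp (- real (Suc i) * t)" for i
        by (simp add: exp_of_nat_mult[symmetric] exp_add[symmetric] algebra_simps)
      then show ?thesis
        by (simp add: q sum_distrib_left sum_distrib_right mult_ac)
    qed
    have i: "set_integrable lborel {0..} (\<lambda>t. a i * (exp (- real (Suc i) * t) * f t))" for i
      using int[of "real (Suc i)"] by (intro set_integrable_mult_right) auto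
    have z: "(LBINT t:{0..}. a i * (exp (- real (Suc i) * t) * f t)) = 0" for i
      using zero[of "Suc i"] by (subst set_integral_mult_right) simp
    have i': "integrable lborel (\<lambda>t. indicator {0..} t *\<^sub>R (a i * (exp (- real (Suc i) * t) * f t)))" for i
      using i[of i] by (simp only: set_integrable_def)
    have "integrable lborel (\<lambda>t. \<Sum>i\<le>n. indicator {0..} t *\<^sub>R (a i * (exp (- real (Suc i) * t) * f t)))"
      by (intro Bochner_Integration.integrable_sum i')
    moreover have "(LBINT t. \<Sum>i\<le>n. indicator {0..} t *\<^sub>R (a i * (exp (- real (Suc i) * t) * f t))) = 0"
      by (subst Bochner_Integration.integral_sum[OF i'])
        (rule sum.neutral, rule ballI, rule z[unfolded set_lebesgue_integral_def])
    ultimately show ?thesis unfolding eq set_integrable_def set_lebesgue_integral_def scaleR_sum_right by blast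
  qed
  have "bounded (g ` {0..1})" by (intro compact_imp_bounded compact_continuous_image g_cont) auto
  then have "\<exists>K. \<forall>u\<in>{0..1}. \<bar>g u\<bar> \<le> K" by (simp add: bounded_iff)
  then obtain K where K: "\<And>u. u \<in> {0..1} \<Longrightarrow> \<bar>g u\<bar> \<le> K" by blast
  have int2: "set_integrable lborel {0..} (\<lambda>t. exp (- t) * exp (- t) * (f t)^2)"
  proof (rule set_integrable_bound)
    show "set_integrable lborel {0..} (\<lambda>t. K * (exp (- t) * \<bar>f t\<bar>))"
      by (intro set_integrable_mult_right) (rule int_abs)
    show "set_borel_measurable lborel {0..} (\<lambda>t. exp (- t) * exp (- t) * (f t)^2)"
    proof -
      have "(\<lambda>t. exp (- t) * exp (- t) * (indicator {0..} t *\<^sub>R f t)^2) \<in> borel_measurable lborel"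
        using meas unfolding set_borel_measurable_def by measurable
      also have "(\<lambda>t. exp (- t) * exp (- t) * (indicator {0..} t *\<^sub>R f t)^2)
          = (\<lambda>t. indicator {0..} t *\<^sub>R (exp (- t) * exp (- t) * (f t)^2))"
        by (auto simp: indicator_def)
      finally show ?thesis by (simp add: set_borel_measurable_def)
    qed
    show "AE t in lborel. t \<in> {0..} \<longrightarrow> norm (exp (- t) * exp (- t) * (f t)^2) \<le> norm (K * (exp (- t) * \<bar>f t\<bar>))"
    proof (intro AE_I2 impI)
      fix t :: real assume "t \<in> {0..}"
      then have "\<bar>exp (- t) * f t\<bar> \<le> K" using K[of "exp (- t)"] by (simp add: g_def)
      then have "\<bar>exp (- t) * f t\<bar> * (exp (- t) * \<bar>f t\<bar>) \<le> K * (exp (- t) * \<bar>f t\<bar>)"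
        by (intro mult_right_mono) auto
      also have "\<dots> \<le> \<bar>K\<bar> * (exp (- t) * \<bar>f t\<bar>)" by (intro mult_right_mono) auto
      finally show "norm (exp (- t) * exp (- t) * (f t)^2) \<le> norm (K * (exp (- t) * \<bar>f t\<bar>))"
        by (simp add: power2_eq_square abs_mult mult_ac)
    qed
  qed
  \<comment> \<open>Subtracting the vanishing integral against \<open>q\<close> leaves the product
    of \<open>g - q\<close>, taken at \<open>exp (- t)\<close> and smaller than \<open>e\<close>,
    with \<open>exp (- t) * f t\<close>, whose absolute integral is \<open>N\<close>.\<close>
  have "?S \<le> e * N" if "0 < e" for e
  proof -
    obtain q where q: "real_polynomial_function q" "\<And>u. u \<in> {0..1} \<Longrightarrow> \<bar>g u - q u\<bar> < e"
      using Stone_Weierstrass_real_polynomial_function[OF _ g_cont \<open>0 < e\<close>] by auto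
    have "?S = ?S - (LBINT t:{0..}. exp (- t) * q (exp (- t)) * f t)"
      using poly0[OF q(1)] by simp
    also have "\<dots> = (LBINT t:{0..}. exp (- t) * exp (- t) * (f t)^2 - exp (- t) * q (exp (- t)) * f t)"
      using int2 poly0[OF q(1)] by (subst set_integral_diff) auto
    also have "\<dots> \<le> (LBINT t:{0..}. e * (exp (- t) * \<bar>f t\<bar>))"
    proof (rule set_integral_mono)
      show "set_integrable lborel {0..} (\<lambda>t. exp (- t) * exp (- t) * (f t)^2 - exp (- t) * q (exp (- t)) * f t)"
        using int2 poly0[OF q(1)] by (intro set_integral_diff) auto
      show "set_integrable lborel {0..} (\<lambda>t. e * (exp (- t) * \<bar>f t\<bar>))"
        by (intro set_integrable_mult_right) (rule int_abs)
      fix t :: real assume "t \<in> {0..}"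
      then have "\<bar>exp (- t) * f t - q (exp (- t))\<bar> \<le> e" using q(2)[of "exp (- t)"] by (simp add: g_def)
      then have "\<bar>exp (- t) * f t - q (exp (- t))\<bar> * (exp (- t) * \<bar>f t\<bar>) \<le> e * (exp (- t) * \<bar>f t\<bar>)"
        by (intro mult_right_mono) auto
      moreover have "exp (- t) * exp (- t) * (f t)^2 - exp (- t) * q (exp (- t)) * f t
        = (exp (- t) * f t - q (exp (- t))) * (exp (- t) * f t)" by (simp add: algebra_simps power2_eq_square)
      moreover have "(exp (- t) * f t - q (exp (- t))) * (exp (- t) * f t)
        \<le> \<bar>exp (- t) * f t - q (exp (- t))\<bar> * (exp (- t) * \<bar>f t\<bar>)"
        by (rule order_trans[OF abs_ge_self]) (simp add: abs_mult)
      ultimately show "exp (- t) * exp (- t) * (f t)^2 - exp (- t) * q (exp (- t)) * f t \<le> e * (exp (- t) * \<bar>f t\<bar>)"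
        by linarith
    qed
    also have "\<dots> = e * N" by (simp add: N_def set_integral_mult_right)
    finally show ?thesis .
  qed
  note S_le = this
  have "?S \<le> 0"
  proof (rule field_le_epsilon)
    fix e :: real assume "0 < e"
    have "?S \<le> (e / (N + 1)) * N" using \<open>0 < e\<close> N0 by (intro S_le) auto
    also have "\<dots> \<le> e" using \<open>0 < e\<close> N0 by (simp add: field_simps)
    finally show "?S \<le> 0 + e" by simp
  qed
  moreover have "0 \<le> ?S" unfolding set_lebesgue_integral_def by (intro integral_nonneg_AE) auto
  ultimately have "?S = 0" by simp
  then have AE0: "AE t in lborel. indicator {0..} t *\<^sub>R (exp (- t) * exp (- t) * (f t)^2) = 0"
    using int2 unfolding set_lebesgue_integral_def set_integrable_def
    by (subst (asm) integral_nonneg_eq_0_iff_AE) auto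
  show ?thesis
  proof (rule ccontr)
    assume "f t0 \<noteq> 0"
    moreover have "continuous (at_right t0) f"
      using cont t0 by (auto simp: continuous_on_eq_continuous_within continuous_within intro: tendsto_within_subset)
    ultimately have "\<forall>\<^sub>F t in at_right t0. f t \<noteq> 0"
      by (simp add: continuous_within tendsto_imp_eventually_ne)
    then obtain b where b: "t0 < b" "\<And>t. t0 < t \<Longrightarrow> t < b \<Longrightarrow> f t \<noteq> 0"
      unfolding eventually_at_right_field by auto
    have "AE t in lborel. t \<notin> {t0<..<b}" using AE0
      by eventually_elim (use b t0 in \<open>auto simp: indicator_def split: if_splits\<close>)
    then have "{t0<..<b} \<in> null_sets lborel" by (simp add: AE_iff_null_sets)
    then show False using b(1) by (simp add: null_sets_def)
  qed
qed


lemma exp_tail_integral: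
  fixes p :: real
  assumes "0 < p"
  shows "set_integrable lborel {r..} (\<lambda>t. exp (- p * t))"
    and "(LBINT t:{r..}. exp (- p * t)) = exp (- p * r) / p"
proof -
  have eq: "(\<lambda>t. indicator {r..} (r + 1 * t) *\<^sub>R exp (- p * (r + 1 * t)))
      = (\<lambda>t. exp (- p * r) * (indicator {0..} t *\<^sub>R exp (- p * t)))"
    by (auto simp: indicator_def fun_eq_iff exp_add[symmetric] algebra_simps)
  have "integrable lborel (\<lambda>t. indicator {r..} (r + 1 * t) *\<^sub>R exp (- p * (r + 1 * t)))"
    unfolding eq using exp_ici_integral(1)[OF assms] by (intro integrable_mult_right) (simp add: set_integrable_def)
  then show "set_integrable lborel {r..} (\<lambda>t. exp (- p * t))"
    unfolding set_integrable_def by (rule lborel_integrable_real_affine_iff[THEN iffD1, rotated]) simp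
  have "(LBINT t:{r..}. exp (- p * t)) = (LBINT t. indicator {r..} (r + 1 * t) *\<^sub>R exp (- p * (r + 1 * t)))"
    unfolding set_lebesgue_integral_def by (subst lborel_integral_real_affine[where c=1 and t=r]) auto
  also have "\<dots> = exp (- p * r) * (1 / p)"
    unfolding eq using exp_ici_integral(2)[OF assms] by (simp add: set_lebesgue_integral_def)
  finally show "(LBINT t:{r..}. exp (- p * t)) = exp (- p * r) / p" by simp
qed

text \<open>Fubini on the triangle \<open>0 \<le> r \<le> t\<close>: the inner integral over
  \<open>t \<ge> r\<close> is \<open>exp (- p * r) / p\<close>.\<close>

lemma laplace_integral_of_primitive:
  fixes h :: "real \<Rightarrow> real"
  assumes meas: "set_borel_measurable lborel {0..} h"
    and bound: "\<And>t. 0 \<le> t \<Longrightarrow> \<bar>h t\<bar> \<le> C" and p: "0 < p"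
  shows "(LBINT t:{0..}. exp (- p * t) * (LBINT r:{0..t}. h r)) = (LBINT r:{0..}. exp (- p * r) * h r) / p"
proof -
  define h' where "h' r = indicator {0..} r * h r" for r
  have [measurable]: "h' \<in> borel_measurable borel"
    using meas unfolding set_borel_measurable_def h'_def by simp
  have h': "\<bar>h' r\<bar> \<le> C" for r using bound[of r] bound[of 0] by (auto simp: h'_def indicator_def)
  let ?k = "\<lambda>r t. indicator {r..} t * (exp (- p * t) * h' r)"
  have tail: "(LBINT t. ?k r t) = h' r * (exp (- p * r) / p)" for r
    using exp_tail_integral(2)[OF p, of r]
    by (simp add: set_lebesgue_integral_def mult.assoc[symmetric] mult.commute[of "h' r"])
  have "set_integrable lborel {0..} (\<lambda>t. of_real (exp (- p * t)) * h t)"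
  proof (rule set_integrable_exp_linear_bound[OF meas _ p])
    fix t :: real assume "0 \<le> t"
    have "0 \<le> C" using bound[of 0] by (meson abs_ge_zero order_trans order_refl)
    then show "norm (h t) \<le> C * (1 + t)" using order_trans[OF bound[OF \<open>0 \<le> t\<close>], of "C * (1 + t)"] \<open>0 \<le> t\<close> by (simp add: algebra_simps)
  qed
  then have inth: "integrable lborel (\<lambda>r. exp (- p * r) * h' r)"
    by (simp add: set_integrable_def h'_def mult_ac)
  have meas_k: "(\<lambda>(r, t). ?k r t) \<in> borel_measurable (lborel \<Otimes>\<^sub>M lborel)"
  proof -
    have "(\<lambda>x. (if fst x \<le> snd x then 1 else 0) * (exp (- p * snd x) * h' (fst x))) \<in> borel_measurable (lborel \<Otimes>\<^sub>M lborel)"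
      by measurable
    then show ?thesis by (simp add: indicator_def case_prod_beta of_bool_def)
  qed
  have int_k: "integrable (lborel \<Otimes>\<^sub>M lborel) (\<lambda>(r, t). ?k r t)"
  proof (rule lborel_pair.Fubini_integrable[OF meas_k])
    have "integrable lborel (\<lambda>r. \<bar>exp (- p * r) * h' r\<bar> / p)"
      using inth by (intro integrable_divide integrable_abs)
    moreover have "(LBINT t. norm (case (r, t) of (r, t) \<Rightarrow> ?k r t)) = \<bar>exp (- p * r) * h' r\<bar> / p" for r
    proof -
      have "(LBINT t. norm (?k r t)) = (LBINT t. \<bar>h' r\<bar> * (indicator {r..} t * exp (- p * t)))"
        by (intro Bochner_Integration.integral_cong) (auto simp: abs_mult indicator_def)
      then show ?thesis using exp_tail_integral(2)[OF p, of r] by (simp add: set_lebesgue_integral_def abs_mult)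
    qed
    ultimately show "integrable lborel (\<lambda>r. LBINT t. norm (case (r, t) of (r, t) \<Rightarrow> ?k r t))" by simp
    show "AE r in lborel. integrable lborel (\<lambda>t. case (r, t) of (r, t) \<Rightarrow> ?k r t)"
    proof (intro AE_I2)
      fix r :: real
      have "integrable lborel (\<lambda>t. h' r * (indicator {r..} t *\<^sub>R exp (- p * t)))"
        using exp_tail_integral(1)[OF p, of r] by (intro integrable_mult_right) (simp add: set_integrable_def)
      then show "integrable lborel (\<lambda>t. case (r, t) of (r, t) \<Rightarrow> ?k r t)" by (simp add: mult_ac)
    qed
  qed
  have "(LBINT t:{0..}. exp (- p * t) * (LBINT r:{0..t}. h r)) = (LBINT t. LBINT r. ?k r t)"
  proof -
    have "(LBINT t:{0..}. exp (- p * t) * (LBINT r:{0..t}. h r)) =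
      (LBINT t. LBINT r. indicator {0..} t * (exp (- p * t) * (indicator {0..t} r * h r)))"
      by (simp add: set_lebesgue_integral_def)
    also have "\<dots> = (LBINT t. LBINT r. ?k r t)"
      by (intro Bochner_Integration.integral_cong refl) (auto simp: indicator_def h'_def)
    finally show ?thesis .
  qed
  also have "\<dots> = (LBINT r. LBINT t. ?k r t)"
    using lborel_pair.Fubini_integral[OF int_k] by simp
  also have "\<dots> = (LBINT r:{0..}. exp (- p * r) * h r) / p"
    unfolding tail by (simp add: h'_def set_lebesgue_integral_def mult_ac)
  finally show ?thesis .
qed

text \<open>The primitive of \<open>h\<close> is Lipschitz and its transform is that of
  \<open>h\<close> divided by the argument, so the continuous case makes the primitive vanish. Right
  continuity at the single point \<open>t0\<close> then recovers the value there. This is the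
  regularity that distribution functions have.\<close>

lemma laplace_uniqueness_right_continuous:
  fixes h :: "real \<Rightarrow> real"
  assumes meas: "set_borel_measurable lborel {0..} h"
    and bound: "\<And>t. 0 \<le> t \<Longrightarrow> \<bar>h t\<bar> \<le> C"
    and zero: "\<And>n::nat. 1 \<le> n \<Longrightarrow> (LBINT t:{0..}. exp (- real n * t) * h t) = 0"
    and t0: "0 \<le> t0" and rc: "continuous (at_right t0) h"
  shows "h t0 = 0"
proof -
  have C: "0 \<le> C" using bound[of 0] by (meson abs_ge_zero order_trans order_refl)
  have int: "set_integrable lborel {a..b} h" if "0 \<le> a" for a b
  proof (rule set_integrable_bound[where f="\<lambda>_. C"])
    have "set_borel_measurable lborel ({0..} \<inter> {a..b}) h"
      using meas by (intro set_borel_measurable_subset[OF meas]) auto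
    moreover have "{0..} \<inter> {a..b} = {a..b}" using that by auto
    ultimately show "set_borel_measurable lborel {a..b} h" by (simp only:)
    show "AE x in lborel. x \<in> {a..b} \<longrightarrow> norm (h x) \<le> norm C"
      using bound C that by (intro AE_I2) auto
    show "set_integrable lborel {a..b} (\<lambda>_. C)"
      using borel_integrable_compact[of "{a..b}" "\<lambda>_. C"] by (simp add: set_integrable_def)
  qed
  define F where "F t = (LBINT r:{0..t}. h r)" for t
  have F_diff: "F b - F a = (LBINT r:{a..b}. h r)" if "0 \<le> a" "a \<le> b" for a b
  proof -
    have i: "integrable lborel (\<lambda>r. indicator {0..b} r *\<^sub>R h r)" "integrable lborel (\<lambda>r. indicator {0..a} r *\<^sub>R h r)"
      "integrable lborel (\<lambda>r. indicator {a..b} r *\<^sub>R h r)"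
      using int[of 0 b] int[of 0 a] int[of a b] that by (auto simp: set_integrable_def)
    show ?thesis unfolding F_def set_lebesgue_integral_def Bochner_Integration.integral_diff[OF i(1,2), symmetric]
    proof (rule integral_cong_AE)
      show "AE r in lborel. indicator {0..b} r *\<^sub>R h r - indicator {0..a} r *\<^sub>R h r = indicator {a..b} r *\<^sub>R h r"
        using AE_lborel_singleton[of a] by eventually_elim (use that in \<open>auto simp: indicator_def\<close>)
    qed (use i in \<open>auto dest: borel_measurable_integrable\<close>)
  qed
  have F_lip: "\<bar>F b - F a\<bar> \<le> C * (b - a)" if "0 \<le> a" "a \<le> b" for a b
  proof -
    have "\<bar>LBINT r:{a..b}. h r\<bar> \<le> (LBINT r:{a..b}. \<bar>h r\<bar>)"
      using set_integral_norm_bound[OF int[of a b]] that by simp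
    also have "\<dots> \<le> (LBINT r:{a..b}. C)"
    proof (rule set_integral_mono)
      show "set_integrable lborel {a..b} (\<lambda>r. \<bar>h r\<bar>)" using int[of a b] that by (intro set_integrable_abs) auto
      show "set_integrable lborel {a..b} (\<lambda>r. C)" unfolding set_integrable_def by (intro borel_integrable_compact) auto
    qed (use bound that in auto)
    also have "\<dots> = C * (b - a)" using that by (simp add: set_lebesgue_integral_def)
    finally show ?thesis using F_diff[OF that] by simp
  qed
  have F0: "F t = 0" if "0 \<le> t" for t
  proof (rule laplace_uniqueness_continuous[OF _ _ _ that])
    show "continuous_on {0..} F"
    proof (rule lipschitz_on_continuous_on)
      show "C-lipschitz_on {0..} F"
      proof (rule lipschitz_onI[OF _ C])
        fix x y :: real assume "x \<in> {0..}" "y \<in> {0..}"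
        then show "dist (F x) (F y) \<le> C * dist x y"
          using F_lip[of x y] F_lip[of y x] by (cases "x \<le> y") (auto simp: dist_real_def abs_minus_commute)
      qed
    qed
    have F00: "F 0 = 0" unfolding F_def set_lebesgue_integral_def
      by (rule integral_eq_zero_AE, rule AE_I[of _ _ "{0}"]) (auto simp: indicator_def)
    show "\<bar>F t\<bar> \<le> C * (1 + t)" if "0 \<le> t" for t
      using F_lip[of 0 t] that F00 C by (auto simp: algebra_simps)
    show "(LBINT t:{0..}. exp (- real n * t) * F t) = 0" if "1 \<le> n" for n :: nat
      using laplace_integral_of_primitive[OF meas bound, of "real n"] zero[OF that] that by (simp add: F_def)
  qed
  \<comment> \<open>\<open>e\<close> is a sign. A positive \<open>e * h t0\<close> would force the
    primitive of \<open>e * h\<close> to increase to the right of \<open>t0\<close>.\<close>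
  have no: "\<not> 0 < e * h t0" if e: "e = 1 \<or> e = -1" for e
  proof
    assume pos: "0 < e * h t0"
    have "((\<lambda>t. e * h t) \<longlongrightarrow> e * h t0) (at_right t0)"
      using rc by (intro tendsto_intros) (simp add: continuous_within)
    then have "\<forall>\<^sub>F t in at_right t0. e * h t0 / 2 < e * h t"
      using pos by (intro order_tendstoD) auto
    then obtain b where b: "t0 < b" "\<And>t. t0 < t \<Longrightarrow> t < b \<Longrightarrow> e * h t0 / 2 < e * h t"
      unfolding eventually_at_right_field by auto
    define m where "m = (t0 + b) / 2"
    have m: "t0 < m" "m < b" using b by (auto simp: m_def)
    have "(LBINT r:{t0..m}. e * h t0 / 2) \<le> (LBINT r:{t0..m}. e * h r)"
    proof (rule set_integral_mono)
      show "set_integrable lborel {t0..m} (\<lambda>r. e * h t0 / 2)"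
        unfolding set_integrable_def by (intro borel_integrable_compact) auto
      show "set_integrable lborel {t0..m} (\<lambda>r. e * h r)" using int[OF t0] by (intro set_integrable_mult_right) auto
      fix r assume r: "r \<in> {t0..m}"
      show "e * h t0 / 2 \<le> e * h r"
        using b(2)[of r] r m pos by (cases "r = t0") auto
    qed
    also have "\<dots> = e * (F m - F t0)" using F_diff[of t0 m] t0 m by (simp add: set_integral_mult_right)
    also have "\<dots> = 0" using F0[of m] F0[of t0] t0 m by simp
    finally have "e * h t0 / 2 * (m - t0) \<le> 0" using m by (simp add: set_lebesgue_integral_def mult_ac)
    then have "(m - t0) * (e * h t0) \<le> 0" by (simp add: mult_ac)
    moreover have "0 < (m - t0) * (e * h t0)" using m by (intro mult_pos_pos pos) simp
    ultimately show False by simp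
  qed
  show ?thesis using no[of 1] no[of "-1"] by linarith
qed

section \<open>The Feynman--Kac equation\<close>

text \<open>Serves the explicit antiderivative in \<open>laplace_heat_kernel\<close>. The base point
  \<open>x - 1\<close> is an arbitrary point to the left of \<open>x\<close>, since only the
  behaviour near \<open>x\<close> matters.\<close>

lemma cdf_std_normal_has_derivative:
  "(cdf std_normal_distribution has_real_derivative std_normal_density x) (at x)"
proof -
  interpret N: real_distribution std_normal_distribution by (rule real_dist_normal_dist)
  let ?a = "x - 1" and ?b = "x + 1"
  have eq: "cdf std_normal_distribution y = cdf std_normal_distribution ?a + (LBINT u=?a..y. std_normal_density u)"
    if y: "?a < y" for y
  proof -
    have "cdf std_normal_distribution y - cdf std_normal_distribution ?a = measure std_normal_distribution {?a<..y}"
      by (rule N.cdf_diff_eq[OF y])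
    also have "\<dots> = (LBINT u. std_normal_density u * indicator {?a<..y} u)"
      unfolding measure_def
      by (subst emeasure_density) (auto simp: ennreal_mult'[symmetric] ennreal_indicator[symmetric]
          intro!: integral_eq_nn_integral[symmetric])
    also have "\<dots> = (LBINT u=?a..y. std_normal_density u)"
      using y by (simp add: interval_integral_Ioc set_lebesgue_integral_def mult.commute)
    finally show ?thesis by simp
  qed
  have "((\<lambda>y. LBINT u=?a..y. std_normal_density u) has_vector_derivative std_normal_density x) (at x within {?a..?b})"
    by (rule interval_integral_FTC2) (auto simp: normal_density_def intro!: continuous_intros)
  then have "((\<lambda>y. LBINT u=?a..y. std_normal_density u) has_real_derivative std_normal_density x) (at x within {?a<..<?b})"
    unfolding has_real_derivative_iff_has_vector_derivative by (rule has_vector_derivative_within_subset) auto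
  then have "((\<lambda>y. LBINT u=?a..y. std_normal_density u) has_real_derivative std_normal_density x) (at x)"
    by (simp add: at_within_open[of x "{?a<..<?b}"])
  then have "((\<lambda>y. cdf std_normal_distribution ?a + (LBINT u=?a..y. std_normal_density u)) has_real_derivative std_normal_density x) (at x)"
    by (auto intro!: derivative_eq_intros)
  then show ?thesis
    by (rule DERIV_cong_ev[THEN iffD2, rotated -1, OF _ refl _ refl])
      (use eq in \<open>auto simp: eventually_nhds intro!: exI[of _ "{?a<..}"]\<close>)
qed

text \<open>The resolvent kernel of Brownian motion. It is used twice: with \<open>t\<close> as
  time, and with \<open>t\<close> as the variance \<open>s\<close> of the half-normal
  variable.\<close>

lemma laplace_heat_kernel:
  fixes p x :: real
  assumes p: "0 < p" and x: "x \<noteq> 0"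
  shows "(\<integral>\<^sup>+t. ennreal (exp (- p * t) * normal_density 0 (sqrt t) x) * indicator {0<..} t \<partial>lborel)
    = ennreal (exp (- sqrt (2 * p) * \<bar>x\<bar>) / sqrt (2 * p))"
proof -
  interpret N: real_distribution std_normal_distribution by (rule real_dist_normal_dist)
  define b where "b = sqrt (2 * p)"
  define q where "q = \<bar>x\<bar>"
  have b: "0 < b" "b\<^sup>2 = 2 * p" using p by (auto simp: b_def)
  have q: "0 < q" using x by (simp add: q_def)
  define f where "f t = exp (- p * t) * normal_density 0 (sqrt t) x" for t
  define Nf where "Nf = cdf std_normal_distribution"
  \<comment> \<open>An antiderivative of \<open>f\<close>. By \<open>e1\<close> and
    \<open>e2\<close> both terms carry the same Gaussian factor after completing the square, so in
    the derivative the parts \<open>q / (2 * t * sqrt t)\<close> cancel and the parts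
    \<open>b / (2 * sqrt t)\<close> add up. Because \<open>q > 0\<close>, both arguments tend to
    minus infinity at \<open>t = 0\<close>.\<close>
  define F where "F t = (exp (- b * q) * Nf ((b * t - q) / sqrt t) - exp (b * q) * Nf (- (q + b * t) / sqrt t)) / b" for t
  have f_eq: "f t = exp (- p * t) * exp (- q\<^sup>2 / (2 * t)) / (sqrt (2 * pi) * sqrt t)" if "0 < t" for t
    using that by (simp add: f_def normal_density_def q_def real_sqrt_mult)
  have e1: "exp (- b * q) * std_normal_density ((b * t - q) / sqrt t) = exp (- p * t) * exp (- q\<^sup>2 / (2 * t)) / sqrt (2 * pi)"
    and e2: "exp (b * q) * std_normal_density (- (q + b * t) / sqrt t) = exp (- p * t) * exp (- q\<^sup>2 / (2 * t)) / sqrt (2 * pi)"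
    if t: "0 < t" for t
  proof -
    have "- b * q + - ((b * t - q) / sqrt t)\<^sup>2 / 2 = - p * t + - q\<^sup>2 / (2 * t)"
      using t b(2) by (simp add: power_divide power2_diff power_mult_distrib) (simp add: field_simps power2_eq_square)
    then show "exp (- b * q) * std_normal_density ((b * t - q) / sqrt t) = exp (- p * t) * exp (- q\<^sup>2 / (2 * t)) / sqrt (2 * pi)"
      by (simp add: std_normal_density_def exp_add[symmetric])
    have "b * q + - (- (q + b * t) / sqrt t)\<^sup>2 / 2 = - p * t + - q\<^sup>2 / (2 * t)"
      using t b(2) by (simp add: power_divide power2_sum power_mult_distrib) (simp add: field_simps power2_eq_square)
    then show "exp (b * q) * std_normal_density (- (q + b * t) / sqrt t) = exp (- p * t) * exp (- q\<^sup>2 / (2 * t)) / sqrt (2 * pi)"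
      by (simp add: std_normal_density_def exp_add[symmetric])
  qed
  have deriv: "(F has_real_derivative f t) (at t)" if t: "0 < t" for t
  proof -
    define w where "w = exp (- p * t) * exp (- q\<^sup>2 / (2 * t)) / sqrt (2 * pi)"
    have d1: "((\<lambda>t. (b * t - q) / sqrt t) has_real_derivative (b / (2 * sqrt t) + q / (2 * t * sqrt t))) (at t)"
      using t by (auto intro!: derivative_eq_intros simp: field_simps real_sqrt_pow2)
    have d2: "((\<lambda>t. - (q + b * t) / sqrt t) has_real_derivative (q / (2 * t * sqrt t) - b / (2 * sqrt t))) (at t)"
      using t by (auto intro!: derivative_eq_intros simp: field_simps real_sqrt_pow2)
    have "(F has_real_derivative (exp (- b * q) * (std_normal_density ((b * t - q) / sqrt t) * (b / (2 * sqrt t) + q / (2 * t * sqrt t)))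
       - exp (b * q) * (std_normal_density (- (q + b * t) / sqrt t) * (q / (2 * t * sqrt t) - b / (2 * sqrt t)))) / b) (at t)"
      unfolding F_def Nf_def using b
      by (intro DERIV_cdivide DERIV_diff DERIV_cmult DERIV_chain2[OF cdf_std_normal_has_derivative] d1 d2)
    also have "(exp (- b * q) * (std_normal_density ((b * t - q) / sqrt t) * (b / (2 * sqrt t) + q / (2 * t * sqrt t)))
       - exp (b * q) * (std_normal_density (- (q + b * t) / sqrt t) * (q / (2 * t * sqrt t) - b / (2 * sqrt t)))) / b
      = (w * (b / (2 * sqrt t) + q / (2 * t * sqrt t)) - w * (q / (2 * t * sqrt t) - b / (2 * sqrt t))) / b"
      unfolding w_def e1[OF t, symmetric] mult.assoc[symmetric] unfolding e1[OF t] e2[OF t] ..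
    also have "\<dots> = w / sqrt t" using b(1) t by (simp add: field_simps)
    also have "\<dots> = f t" by (simp add: f_eq[OF t] w_def)
    finally show ?thesis .
  qed
  have lim_top: "(F \<longlongrightarrow> exp (- b * q) / b) at_top"
  proof -
    have "filterlim (\<lambda>t. (b * t - q) / sqrt t) at_top at_top" using b(1) by real_asymp
    moreover have "filterlim (\<lambda>t. - (q + b * t) / sqrt t) at_bot at_top" using b(1) by real_asymp
    ultimately have "(F \<longlongrightarrow> (exp (- b * q) * 1 - exp (b * q) * 0) / b) at_top"
      unfolding F_def Nf_def using b(1)
      by (intro tendsto_intros filterlim_compose[OF N.cdf_lim_at_top_prob] filterlim_compose[OF N.cdf_lim_at_bot]) auto
    then show ?thesis by simp
  qed
  have lim_0: "(F \<longlongrightarrow> 0) (at_right 0)"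
  proof -
    have "filterlim (\<lambda>t. (b * t - q) / sqrt t) at_bot (at_right 0)" using b(1) q by real_asymp
    moreover have "filterlim (\<lambda>t. - (q + b * t) / sqrt t) at_bot (at_right 0)" using b(1) q by real_asymp
    ultimately have "(F \<longlongrightarrow> (exp (- b * q) * 0 - exp (b * q) * 0) / b) (at_right 0)"
      unfolding F_def Nf_def using b(1)
      by (intro tendsto_intros filterlim_compose[OF N.cdf_lim_at_bot]) auto
    then show ?thesis by simp
  qed
  have f0: "0 \<le> f t" for t by (simp add: f_def)
  have cont: "isCont f t" if t: "0 < t" for t
    unfolding f_def normal_density_def using t by (intro continuous_intros) auto
  have A: "((F \<circ> real_of_ereal) \<longlongrightarrow> 0) (at_right 0)"
    using lim_0 by (simp add: zero_ereal_def ereal_tendsto_simps)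
  have B: "((F \<circ> real_of_ereal) \<longlongrightarrow> exp (- b * q) / b) (at_left \<infinity>)"
    using lim_top by (simp add: ereal_tendsto_simps)
  have *: "set_integrable lborel (einterval 0 \<infinity>) f" "(LBINT x=0..\<infinity>. f x) = exp (- b * q) / b - 0"
    by (rule interval_integral_FTC_nonneg[of 0 \<infinity> F f, OF _ _ _ _ A B]; use deriv cont f0 in \<open>simp add: zero_ereal_def\<close>)+
  have "(\<integral>\<^sup>+t. ennreal (f t) * indicator {0<..} t \<partial>lborel) = ennreal (LBINT x:{0<..}. f x)"
    using *(1) f0 unfolding set_integrable_def set_lebesgue_integral_def
    by (subst nn_integral_eq_integral[symmetric])
       (auto simp: indicator_def zero_ereal_def einterval_def intro!: nn_integral_cong split: if_splits)
  also have "(LBINT x:{0<..}. f x) = exp (- b * q) / b"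
    using *(2) by (simp add: interval_lebesgue_integral_0_infty)
  finally show ?thesis unfolding f_def b_def q_def .
qed

text \<open>The bounded \<open>C\<^sup>1\<close> solution of \<open>v'' / 2 = (l + m * 1\<^bsub>{\<bar>x\<bar> \<ge> 1}\<^esub>) v - 1\<close>.\<close>

definition fk_solution :: "real \<Rightarrow> real \<Rightarrow> real \<Rightarrow> real" where
  "fk_solution l m x = (let a = sqrt (2 * l); b = sqrt (2 * (l + m)); Q = b * cosh a + a * sinh a in
     if \<bar>x\<bar> < 1 then 1 / l - 4 * m / (a\<^sup>2 * b * Q) * cosh (a * x)
     else 1 / (l + m) + 4 * m * a * sinh a / (a\<^sup>2 * b\<^sup>2 * Q) * exp (- b * (\<bar>x\<bar> - 1)))"

text \<open>\<open>cosh (a * x) \<le> cosh a \<le> Q / b\<close>, so the term subtracted inside the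
  interval is at most \<open>1 / l - 1 / (l + m)\<close>. Nonnegativity allows the integral equation
  to be stated with nonnegative integrals.\<close>

lemma fk_solution_nonneg:
  assumes l: "0 < l" and m: "0 < m"
  shows "0 \<le> fk_solution l m x"
proof -
  define a where "a = sqrt (2 * l)"
  define b where "b = sqrt (2 * (l + m))"
  define Q where "Q = b * cosh a + a * sinh a"
  have a: "0 < a" "a\<^sup>2 = 2 * l" using l by (auto simp: a_def)
  have b: "0 < b" "b\<^sup>2 = 2 * (l + m)" using l m by (auto simp: b_def)
  have sa: "0 < sinh a" using a by simp
  have Q: "0 < Q" "b * cosh a \<le> Q" using a b sa by (auto simp: Q_def intro!: add_pos_pos)
  have "4 * m / (a\<^sup>2 * b * Q) * cosh (a * x) \<le> 1 / l" if "\<bar>x\<bar> < 1"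
  proof -
    have "\<bar>a * x\<bar> \<le> \<bar>a\<bar>" using that a by (simp add: abs_mult mult_left_le)
    then have "cosh (a * x) \<le> cosh a" by (metis cosh_real_abs cosh_real_nonneg_le_iff abs_ge_zero)
    then have "b * cosh (a * x) \<le> Q" using Q(2) b(1) by (meson mult_left_mono less_imp_le order_trans)
    have "4 * m / (a\<^sup>2 * b * Q) * cosh (a * x) = 2 * m / (l * b\<^sup>2) * (b * cosh (a * x) / Q)"
      unfolding a(2) using b(1) Q(1) l by (simp add: power2_eq_square mult_ac)
    also have "\<dots> \<le> 2 * m / (l * b\<^sup>2) * 1"
      using \<open>b * cosh (a * x) \<le> Q\<close> Q(1) l m b by (intro mult_left_mono) auto
    also have "\<dots> = 1 / l - 1 / (l + m)" using l m add_pos_pos[OF l m] unfolding b(2) by (simp add: divide_simps)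
    also have "\<dots> \<le> 1 / l" using l m by simp
    finally show ?thesis .
  qed
  moreover have "0 \<le> 4 * m * a * sinh a / (a\<^sup>2 * b\<^sup>2 * Q) * exp (- b * (\<bar>x\<bar> - 1))"
    using a(1) b(1) Q sa m by (intro mult_nonneg_nonneg divide_nonneg_nonneg) auto
  ultimately show ?thesis using l m
    unfolding fk_solution_def Let_def a_def[symmetric] b_def[symmetric] Q_def[symmetric] by simp
qed

lemma has_integral_exp_cosh:
  fixes a e c d :: real
  assumes "c \<le> d" and "a\<^sup>2 \<noteq> e\<^sup>2"
  shows "((\<lambda>y. exp (e * y) * cosh (a * y)) has_integral
     exp (e * d) * (e * cosh (a * d) - a * sinh (a * d)) / (e\<^sup>2 - a\<^sup>2)
     - exp (e * c) * (e * cosh (a * c) - a * sinh (a * c)) / (e\<^sup>2 - a\<^sup>2)) {c..d}"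
proof (rule fundamental_theorem_of_calculus[OF assms(1)])
  fix y
  have "e\<^sup>2 - a\<^sup>2 \<noteq> 0" using assms(2) by simp
  then have "((\<lambda>y. exp (e * y) * (e * cosh (a * y) - a * sinh (a * y)) / (e\<^sup>2 - a\<^sup>2)) has_real_derivative
    exp (e * y) * cosh (a * y)) (at y within {c..d})"
    by (auto intro!: derivative_eq_intros simp: divide_simps) (simp add: algebra_simps power2_eq_square)
  then show "((\<lambda>y. exp (e * y) * (e * cosh (a * y) - a * sinh (a * y)) / (e\<^sup>2 - a\<^sup>2)) has_vector_derivative
    exp (e * y) * cosh (a * y)) (at y within {c..d})"
    by (simp add: has_real_derivative_iff_has_vector_derivative)
qed


lemma nn_integral_exp_abs:
  fixes b x :: real
  assumes b: "0 < b"
  shows "(\<integral>\<^sup>+y. ennreal (exp (- b * \<bar>x - y\<bar>) / b) \<partial>lborel) = ennreal (2 / b\<^sup>2)"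
proof -
  have half: "(\<integral>\<^sup>+u. ennreal (exp (- b * u) / b) * indicator {0..} u \<partial>lborel) = ennreal (1 / b\<^sup>2)"
  proof (rule nn_integral_has_integral_lebesgue')
    show "((\<lambda>u. exp (- b * u) / b) has_integral 1 / b\<^sup>2) {0..}"
      using has_integral_divide[OF has_integral_exp_minus_to_infinity[OF b, of 0], of b] by (simp add: power2_eq_square)
  qed (use b in auto)
  have "(\<integral>\<^sup>+y. ennreal (exp (- b * \<bar>x - y\<bar>) / b) \<partial>lborel) = (\<integral>\<^sup>+u. ennreal (exp (- b * \<bar>u\<bar>) / b) \<partial>lborel)"
    by (subst nn_integral_real_affine[where c="-1" and t=x]) auto
  also have "\<dots> = (\<integral>\<^sup>+u. ennreal (exp (- b * u) / b) * indicator {0..} u + ennreal (exp (b * u) / b) * indicator {..<0} u \<partial>lborel)"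
    by (intro nn_integral_cong) (auto simp: indicator_def)
  also have "\<dots> = ennreal (1 / b\<^sup>2) + (\<integral>\<^sup>+u. ennreal (exp (b * u) / b) * indicator {..<0} u \<partial>lborel)"
    using half by (subst nn_integral_add) auto
  also have "(\<integral>\<^sup>+u. ennreal (exp (b * u) / b) * indicator {..<0} u \<partial>lborel)
    = (\<integral>\<^sup>+u. ennreal (exp (- b * u) / b) * indicator {0<..} u \<partial>lborel)"
    by (subst nn_integral_real_affine[where c="-1" and t=0]) (auto simp: indicator_def intro!: nn_integral_cong)
  also have "\<dots> = (\<integral>\<^sup>+u. ennreal (exp (- b * u) / b) * indicator {0..} u \<partial>lborel)"
    by (rule nn_integral_cong_AE) (use AE_lborel_singleton[of 0] in \<open>eventually_elim, auto simp: indicator_def\<close>)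
  also have "ennreal (1 / b\<^sup>2) + \<dots> = ennreal (2 / b\<^sup>2)"
    unfolding half by (simp add: ennreal_plus[symmetric] del: ennreal_plus)
  finally show ?thesis .
qed

lemma fk_solution_measurable [measurable]: "fk_solution l m \<in> borel_measurable borel"
proof -
  have [measurable]: "(cosh :: real \<Rightarrow> real) \<in> borel_measurable borel"
    by (intro borel_measurable_continuous_onI continuous_intros)
  show ?thesis unfolding fk_solution_def[abs_def] Let_def by measurable
qed

text \<open>Written as \<open>v'' / 2 = (l + m) * v - (1 + m * 1 * v)\<close> with the last
  \<open>1\<close> the indicator of the open interval, the equation has its discontinuous part on
  the right, and the resolvent kernel at rate \<open>l + m\<close> inverts the rest. The integral
  form is the one that the Markov property produces.\<close>

lemma fk_solution_integral_equation:
  fixes l m x :: real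
  assumes l: "0 < l" and m: "0 < m"
  defines "b \<equiv> sqrt (2 * (l + m))"
  shows "(\<integral>\<^sup>+y. ennreal (exp (- b * \<bar>x - y\<bar>) / b * (1 + m * indicator {-1<..<1} y * fk_solution l m y)) \<partial>lborel)
    = ennreal (fk_solution l m x)"
proof -
  define a where "a = sqrt (2 * l)"
  define Q where "Q = b * cosh a + a * sinh a"
  define A where "A = - (4 * m / (a\<^sup>2 * b * Q))"
  have a: "0 < a" "a\<^sup>2 = 2 * l" using l by (auto simp: a_def)
  have b: "0 < b" "b\<^sup>2 = 2 * (l + m)" using l m by (auto simp: b_def)
  have sa: "0 < sinh a" using a by simp
  have Q: "0 < Q" using a b sa by (auto simp: Q_def intro!: add_pos_pos)
  \<comment> \<open>\<open>A\<close> is the coefficient enforced by continuous differentiability at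
    \<open>1\<close> and \<open>-1\<close>. In this form it cancels the boundary terms at both ends
    in the two cases below.\<close>
  have AQ: "A * Q = - (2 * m / (l * b))" using Q l b unfolding A_def a(2) by (simp add: field_simps)
  have ba: "b\<^sup>2 - a\<^sup>2 = 2 * m" by (simp add: a b)
  have nz: "a\<^sup>2 \<noteq> b\<^sup>2" "b\<^sup>2 \<noteq> 0" "2 * m \<noteq> 0" using ba m b(1) by auto
  define w where "w y = 1 / l + A * cosh (a * y)" for y
  have v_in: "fk_solution l m y = w y" if "\<bar>y\<bar> < 1" for y
    using that unfolding fk_solution_def Let_def a_def[symmetric] b_def[symmetric] Q_def[symmetric] w_def A_def by simp
  have v_out: "fk_solution l m y = 1 / (l + m) - A / b * (a * sinh a) * exp (- b * (\<bar>y\<bar> - 1))" if "\<not> \<bar>y\<bar> < 1" for y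
    using that Q b unfolding fk_solution_def Let_def a_def[symmetric] b_def[symmetric] Q_def[symmetric] w_def A_def by (simp add: power2_eq_square)
  have w0: "0 \<le> w y" if "\<bar>y\<bar> < 1" for y using fk_solution_nonneg[OF l m, of y] v_in[OF that] by simp
  \<comment> \<open>The value that the integral of the kernel against \<open>w\<close> must have:
    the constant 1 contributes \<open>2 / b^2 = 1 / (l + m)\<close>, and the rest of
    \<open>fk_solution l m x\<close> has to come from the interval.\<close>
  define J where "J = (fk_solution l m x - 1 / (l + m)) * (b / m)"
  \<comment> \<open>The constant part of \<open>w\<close> is integrated as
    \<open>cosh (0 * y)\<close>, so one antiderivative covers both parts of \<open>w\<close> and
    both signs of \<open>e\<close>.\<close>
  have hw: "((\<lambda>y. exp (e * y) * w y) has_integral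
     1 / l * (exp (e * d) * (e * cosh (0 * d) - 0 * sinh (0 * d)) / (e\<^sup>2 - 0\<^sup>2)
     - exp (e * c) * (e * cosh (0 * c) - 0 * sinh (0 * c)) / (e\<^sup>2 - 0\<^sup>2)) +
     A * (exp (e * d) * (e * cosh (a * d) - a * sinh (a * d)) / (e\<^sup>2 - a\<^sup>2)
     - exp (e * c) * (e * cosh (a * c) - a * sinh (a * c)) / (e\<^sup>2 - a\<^sup>2))) {c..d}"
    if "c \<le> d" "e = b \<or> e = - b" for c d e
  proof -
    have "e\<^sup>2 = b\<^sup>2" using that by auto
    then have "((\<lambda>y. 1 / l * (exp (e * y) * cosh (0 * y)) + A * (exp (e * y) * cosh (a * y))) has_integral
     1 / l * (exp (e * d) * (e * cosh (0 * d) - 0 * sinh (0 * d)) / (e\<^sup>2 - 0\<^sup>2)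
     - exp (e * c) * (e * cosh (0 * c) - 0 * sinh (0 * c)) / (e\<^sup>2 - 0\<^sup>2)) +
     A * (exp (e * d) * (e * cosh (a * d) - a * sinh (a * d)) / (e\<^sup>2 - a\<^sup>2)
     - exp (e * c) * (e * cosh (a * c) - a * sinh (a * c)) / (e\<^sup>2 - a\<^sup>2))) {c..d}"
      using nz that by (intro has_integral_add has_integral_mult_right has_integral_exp_cosh) auto
    then show ?thesis by (rule has_integral_eq[rotated]) (simp add: w_def algebra_simps)
  qed
  have J: "((\<lambda>y. exp (- b * \<bar>x - y\<bar>) * w y) has_integral J) {-1..1}"
  proof (cases "\<bar>x\<bar> < 1")
    case True
    define Ex where "Ex = exp (b * x)"
    define Ey where "Ey = exp (- b * x)"
    define Eb where "Eb = exp (- b)"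
    have E: "Ex * Ey = 1" by (simp add: Ex_def Ey_def exp_add[symmetric])
    have 1: "((\<lambda>y. exp (- b * \<bar>x - y\<bar>) * w y) has_integral Ey * (1 / l * ((Ex - Eb) / b) +
       A * (Ex * (b * cosh (a * x) - a * sinh (a * x)) - Eb * Q) / (2 * m))) {-1..x}"
    proof (rule has_integral_eq)
      show "((\<lambda>y. Ey * (exp (b * y) * w y)) has_integral Ey * (1 / l * ((Ex - Eb) / b) +
       A * (Ex * (b * cosh (a * x) - a * sinh (a * x)) - Eb * Q) / (2 * m))) {-1..x}"
      proof (rule has_integral_eq_rhs[OF has_integral_mult_right[OF hw]])
        show "Ey * (1 / l * ((Ex - Eb) / b) + A * (Ex * (b * cosh (a * x) - a * sinh (a * x)) - Eb * Q) / (2 * m))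
          = Ey * (1 / l * (exp (b * x) * (b * cosh (0 * x) - 0 * sinh (0 * x)) / (b\<^sup>2 - 0\<^sup>2)
             - exp (b * - 1) * (b * cosh (0 * - 1) - 0 * sinh (0 * - 1)) / (b\<^sup>2 - 0\<^sup>2)) +
            A * (exp (b * x) * (b * cosh (a * x) - a * sinh (a * x)) / (b\<^sup>2 - a\<^sup>2)
             - exp (b * - 1) * (b * cosh (a * - 1) - a * sinh (a * - 1)) / (b\<^sup>2 - a\<^sup>2)))"
          unfolding ba using b(1) m l
          by (simp add: Ex_def[symmetric] Eb_def[symmetric]) (simp add: Q_def field_simps power2_eq_square)
      qed (use True in auto)
      fix y assume "y \<in> {-1..x}"
      then show "Ey * (exp (b * y) * w y) = exp (- b * \<bar>x - y\<bar>) * w y"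
        by (simp add: Ey_def exp_add[symmetric] algebra_simps)
    qed
    have 2: "((\<lambda>y. exp (- b * \<bar>x - y\<bar>) * w y) has_integral Ex * (1 / l * ((Ey - Eb) / b) +
       A * (Ey * (b * cosh (a * x) + a * sinh (a * x)) - Eb * Q) / (2 * m))) {x..1}"
    proof (rule has_integral_eq)
      show "((\<lambda>y. Ex * (exp (- b * y) * w y)) has_integral Ex * (1 / l * ((Ey - Eb) / b) +
       A * (Ey * (b * cosh (a * x) + a * sinh (a * x)) - Eb * Q) / (2 * m))) {x..1}"
      proof (rule has_integral_eq_rhs[OF has_integral_mult_right[OF hw]])
        have ba': "(- b)\<^sup>2 - a\<^sup>2 = 2 * m" using ba by simp
        show "Ex * (1 / l * ((Ey - Eb) / b) + A * (Ey * (b * cosh (a * x) + a * sinh (a * x)) - Eb * Q) / (2 * m))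
          = Ex * (1 / l * (exp (- b * 1) * (- b * cosh (0 * 1) - 0 * sinh (0 * 1)) / ((- b)\<^sup>2 - 0\<^sup>2)
             - exp (- b * x) * (- b * cosh (0 * x) - 0 * sinh (0 * x)) / ((- b)\<^sup>2 - 0\<^sup>2)) +
            A * (exp (- b * 1) * (- b * cosh (a * 1) - a * sinh (a * 1)) / ((- b)\<^sup>2 - a\<^sup>2)
             - exp (- b * x) * (- b * cosh (a * x) - a * sinh (a * x)) / ((- b)\<^sup>2 - a\<^sup>2)))"
          unfolding ba' Ey_def[symmetric] using b(1) m l
          by (simp add: Eb_def[symmetric]) (simp add: Q_def field_simps power2_eq_square)
      qed (use True in auto)
      fix y assume "y \<in> {x..1}"
      then show "Ex * (exp (- b * y) * w y) = exp (- b * \<bar>x - y\<bar>) * w y"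
        by (simp add: Ex_def exp_add[symmetric] algebra_simps)
    qed
    have "Ey * (1 / l * ((Ex - Eb) / b) + A * (Ex * (b * cosh (a * x) - a * sinh (a * x)) - Eb * Q) / (2 * m))
       + Ex * (1 / l * ((Ey - Eb) / b) + A * (Ey * (b * cosh (a * x) + a * sinh (a * x)) - Eb * Q) / (2 * m))
      = 2 * (Ex * Ey) / (l * b) + A * b * cosh (a * x) * (Ex * Ey) / m - Eb * (Ex + Ey) * (1 / (l * b) + (A * Q) / (2 * m))"
      using l b(1) m by (simp add: field_simps)
    also have "1 / (l * b) + (A * Q) / (2 * m) = 0" unfolding AQ using l b(1) m by (simp add: field_simps)
    also have "2 * (Ex * Ey) / (l * b) + A * b * cosh (a * x) * (Ex * Ey) / m - Eb * (Ex + Ey) * 0 = J"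
    proof -
      have "1 / l - 1 / (l + m) = 2 * m / (l * b\<^sup>2)" using l m add_pos_pos[OF l m] unfolding b(2) by (simp add: divide_simps)
      then have "J = (2 * m / (l * b\<^sup>2) + A * cosh (a * x)) * (b / m)" using v_in[OF True] by (simp add: J_def w_def)
      then have "J = 2 / (l * b) + A * b * cosh (a * x) / m" using b(1) m l by (simp add: distrib_right power2_eq_square) (simp add: add_divide_distrib)
      then show ?thesis by (simp add: E)
    qed
    finally show ?thesis using has_integral_combine[OF _ _ 1 2] True by simp
  next
    case False
    define Ex where "Ex = exp (- b * \<bar>x\<bar>)"
    define Eb where "Eb = exp (- b)"
    define Ec where "Ec = exp b"
    \<comment> \<open>For \<open>\<bar>x\<bar> \<ge> 1\<close> and \<open>y\<close> in
      \<open>[-1, 1]\<close> one has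
      \<open>- b * \<bar>x - y\<bar> = - b * \<bar>x\<bar> + e * y\<close>.\<close>
    define e where "e = (if 0 \<le> x then b else - b)"
    have E: "Eb * Ec = 1" by (simp add: Eb_def Ec_def exp_add[symmetric])
    have 1: "((\<lambda>y. exp (- b * \<bar>x - y\<bar>) * w y) has_integral Ex * (1 / l * ((Ec - Eb) / b) +
       A * (Ec * (b * cosh a - a * sinh a) - Eb * Q) / (2 * m))) {-1..1}"
    proof (rule has_integral_eq)
      show "((\<lambda>y. Ex * (exp (e * y) * w y)) has_integral Ex * (1 / l * ((Ec - Eb) / b) +
       A * (Ec * (b * cosh a - a * sinh a) - Eb * Q) / (2 * m))) {-1..1}"
      proof (rule has_integral_eq_rhs[OF has_integral_mult_right[OF hw]])
        have ba': "e\<^sup>2 - a\<^sup>2 = 2 * m" using ba by (simp add: e_def)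
        show "Ex * (1 / l * ((Ec - Eb) / b) + A * (Ec * (b * cosh a - a * sinh a) - Eb * Q) / (2 * m))
          = Ex * (1 / l * (exp (e * 1) * (e * cosh (0 * 1) - 0 * sinh (0 * 1)) / (e\<^sup>2 - 0\<^sup>2)
             - exp (e * - 1) * (e * cosh (0 * - 1) - 0 * sinh (0 * - 1)) / (e\<^sup>2 - 0\<^sup>2)) +
            A * (exp (e * 1) * (e * cosh (a * 1) - a * sinh (a * 1)) / (e\<^sup>2 - a\<^sup>2)
             - exp (e * - 1) * (e * cosh (a * - 1) - a * sinh (a * - 1)) / (e\<^sup>2 - a\<^sup>2)))"
          unfolding ba' using b(1) m l
          by (cases "0 \<le> x"; simp add: e_def Eb_def[symmetric] Ec_def[symmetric]; simp add: Q_def field_simps power2_eq_square)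
      qed (auto simp: e_def)
      fix y :: real assume "y \<in> {-1..1}"
      then show "Ex * (exp (e * y) * w y) = exp (- b * \<bar>x - y\<bar>) * w y"
        using False by (auto simp: e_def Ex_def exp_add[symmetric] algebra_simps abs_if)
    qed
    have "Ex * (1 / l * ((Ec - Eb) / b) + A * (Ec * (b * cosh a - a * sinh a) - Eb * Q) / (2 * m))
      = Ex * ((Ec - Eb) * (1 / (l * b) + A * Q / (2 * m)) - A * Ec * (a * sinh a) / m)"
      using l b(1) m by (simp add: Q_def field_simps)
    also have "1 / (l * b) + (A * Q) / (2 * m) = 0" unfolding AQ using l b(1) m by (simp add: field_simps)
    also have "Ex * ((Ec - Eb) * 0 - A * Ec * (a * sinh a) / m) = J"
    proof -
      have "Ex * Ec = exp (- b * (\<bar>x\<bar> - 1))" by (simp add: Ex_def Ec_def exp_add[symmetric] algebra_simps)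
      then have "J = - (A / b * (a * sinh a) * (Ex * Ec)) * (b / m)" using v_out[OF False] by (simp add: J_def)
      then show ?thesis using b(1) m by (simp add: field_simps)
    qed
    finally show ?thesis using 1 by simp
  qed
  have "(\<integral>\<^sup>+y. ennreal (exp (- b * \<bar>x - y\<bar>) / b * (m * indicator {-1<..<1} y * fk_solution l m y)) \<partial>lborel)
     = (\<integral>\<^sup>+y. ennreal (m / b * (exp (- b * \<bar>x - y\<bar>) * w y)) * indicator {-1<..<1} y \<partial>lborel)"
    by (intro nn_integral_cong) (auto simp: indicator_def v_in mult_ac)
  also have "\<dots> = ennreal (m / b * J)"
  proof (rule nn_integral_has_integral_lebesgue')
    show "((\<lambda>y. m / b * (exp (- b * \<bar>x - y\<bar>) * w y)) has_integral m / b * J) {-1<..<1}"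
      using has_integral_mult_right[OF J, of "m / b"] has_integral_Icc_iff_Ioo by blast
    show "0 \<le> m / b * (exp (- b * \<bar>x - y\<bar>) * w y)" if "y \<in> {-1<..<1}" for y
      using w0[of y] that m b(1) by (auto intro!: mult_nonneg_nonneg)
  qed
  finally have 2: "(\<integral>\<^sup>+y. ennreal (exp (- b * \<bar>x - y\<bar>) / b * (m * indicator {-1<..<1} y * fk_solution l m y)) \<partial>lborel)
     = ennreal (m / b * J)" .
  have J0: "0 \<le> m / b * J"
  proof -
    have "0 \<le> J"
      by (rule has_integral_nonneg[OF J[unfolded has_integral_Icc_iff_Ioo]]) (use w0 in auto)
    then show ?thesis using m b(1) by simp
  qed
  have "(\<integral>\<^sup>+y. ennreal (exp (- b * \<bar>x - y\<bar>) / b * (1 + m * indicator {-1<..<1} y * fk_solution l m y)) \<partial>lborel)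
   = (\<integral>\<^sup>+y. ennreal (exp (- b * \<bar>x - y\<bar>) / b) + ennreal (exp (- b * \<bar>x - y\<bar>) / b * (m * indicator {-1<..<1} y * fk_solution l m y)) \<partial>lborel)"
    using b(1) m fk_solution_nonneg[OF l m]
    by (intro nn_integral_cong) (simp add: ennreal_plus[symmetric] distrib_left del: ennreal_plus)
  also have "\<dots> = (\<integral>\<^sup>+y. ennreal (exp (- b * \<bar>x - y\<bar>) / b) \<partial>lborel)
     + (\<integral>\<^sup>+y. ennreal (exp (- b * \<bar>x - y\<bar>) / b * (m * indicator {-1<..<1} y * fk_solution l m y)) \<partial>lborel)"
    by (rule nn_integral_add) measurable
  also have "\<dots> = ennreal (2 / b\<^sup>2) + ennreal (m / b * J)"
    unfolding nn_integral_exp_abs[OF b(1)] 2 ..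
  also have "\<dots> = ennreal (2 / b\<^sup>2 + m / b * J)" using J0 by (subst ennreal_plus) auto
  also have "m / b * J = fk_solution l m x - 1 / (l + m)" using b(1) m unfolding J_def by simp
  also have "2 / b\<^sup>2 + (fk_solution l m x - 1 / (l + m)) = fk_solution l m x"
  proof -
    have "2 / (2 * p) = 1 / p" for p :: real by simp
    then show ?thesis unfolding b(2) by (simp only: add_diff_cancel_left' add_diff_eq)
  qed
  finally show ?thesis .
qed

text \<open>Sampling at the grid times \<open>\<lfloor>n * r\<rfloor> / n\<close> involves only
  countably many of the variables \<open>Y r\<close> and is therefore jointly measurable; continuity
  of the paths gives the pointwise limit.\<close>

lemma measurable_continuous_process:
  fixes Y :: "real \<Rightarrow> 'w \<Rightarrow> real"
  assumes meas: "\<And>r. Y r \<in> borel_measurable N"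
    and cont: "\<And>\<omega>. \<omega> \<in> space N \<Longrightarrow> continuous_on UNIV (\<lambda>r. Y r \<omega>)"
  shows "(\<lambda>x. Y (snd x) (fst x)) \<in> borel_measurable (N \<Otimes>\<^sub>M borel)"
proof (rule borel_measurable_LIMSEQ_metric)
  show "(\<lambda>x. Y (real_of_int \<lfloor>real (Suc n) * snd x\<rfloor> / real (Suc n)) (fst x)) \<in> borel_measurable (N \<Otimes>\<^sub>M borel)" for n
  proof (rule measurable_compose_countable[where f="\<lambda>i x. Y (real_of_int i / real (Suc n)) (fst x)"])
    show "(\<lambda>x. Y (real_of_int i / real (Suc n)) (fst x)) \<in> borel_measurable (N \<Otimes>\<^sub>M borel)" for i
      using meas by measurable
    show "(\<lambda>x. \<lfloor>real (Suc n) * snd x\<rfloor>) \<in> measurable (N \<Otimes>\<^sub>M borel) (count_space UNIV)"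
      by measurable
  qed
  fix x assume "x \<in> space (N \<Otimes>\<^sub>M (borel :: real measure))"
  then have w: "fst x \<in> space N" by (auto simp: space_pair_measure)
  have "(\<lambda>n. real_of_int \<lfloor>real (Suc n) * snd x\<rfloor> / real (Suc n)) \<longlonglongrightarrow> snd x"
  proof (rule real_tendsto_sandwich)
    show "\<forall>\<^sub>F n in sequentially. snd x - 1 / real (Suc n) \<le> real_of_int \<lfloor>real (Suc n) * snd x\<rfloor> / real (Suc n)"
    proof (intro always_eventually allI)
      fix n
      have "real (Suc n) * snd x - 1 \<le> real_of_int \<lfloor>real (Suc n) * snd x\<rfloor>" by linarith
      then have "(real (Suc n) * snd x - 1) / real (Suc n) \<le> real_of_int \<lfloor>real (Suc n) * snd x\<rfloor> / real (Suc n)"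
        by (intro divide_right_mono) auto
      then show "snd x - 1 / real (Suc n) \<le> real_of_int \<lfloor>real (Suc n) * snd x\<rfloor> / real (Suc n)"
        by (simp add: diff_divide_distrib del: of_nat_Suc)
    qed
    show "\<forall>\<^sub>F n in sequentially. real_of_int \<lfloor>real (Suc n) * snd x\<rfloor> / real (Suc n) \<le> snd x"
    proof (intro always_eventually allI)
      fix n
      have "real_of_int \<lfloor>real (Suc n) * snd x\<rfloor> \<le> real (Suc n) * snd x" by linarith
      then have "real_of_int \<lfloor>real (Suc n) * snd x\<rfloor> / real (Suc n) \<le> (real (Suc n) * snd x) / real (Suc n)"
        by (intro divide_right_mono) auto
      then show "real_of_int \<lfloor>real (Suc n) * snd x\<rfloor> / real (Suc n) \<le> snd x" by simp
    qed
    show "(\<lambda>n. snd x - 1 / real (Suc n)) \<longlonglongrightarrow> snd x" by real_asymp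
  qed auto
  then show "(\<lambda>n. Y (real_of_int \<lfloor>real (Suc n) * snd x\<rfloor> / real (Suc n)) (fst x)) \<longlonglongrightarrow> Y (snd x) (fst x)"
    by (rule continuous_on_tendsto_compose[OF cont[OF w]]) auto
qed

text \<open>A substitute for differentiating both sides of an integral identity whose integrand is
  only measurable: the difference quotients are of order \<open>y - x\<close>.\<close>

lemma constant_if_quadratic_increments:
  fixes F :: "real \<Rightarrow> real"
  assumes F: "\<And>x y. 0 \<le> x \<Longrightarrow> x \<le> y \<Longrightarrow> y \<le> R \<Longrightarrow> \<bar>F y - F x\<bar> \<le> K * (y - x)\<^sup>2" and R: "0 \<le> R"
  shows "F R = F 0"
proof (rule has_field_derivative_zero_constant[of "{0..R}" F, THEN exE])
  have F': "\<bar>F y - F x\<bar> \<le> K * (y - x)\<^sup>2" if "x \<in> {0..R}" "y \<in> {0..R}" for x y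
    using F[of x y] F[of y x] that by (cases "x \<le> y") (auto simp: abs_minus_commute power2_commute)
  fix x assume x: "x \<in> {0..R}"
  show "(F has_field_derivative 0) (at x within {0..R})"
    unfolding has_field_derivative_iff
  proof (rule Lim_null_comparison)
    show "\<forall>\<^sub>F y in at x within {0..R}. norm ((F y - F x) / (y - x)) \<le> K * \<bar>y - x\<bar>"
      unfolding eventually_at_filter
    proof (intro always_eventually allI impI)
      fix y assume y: "y \<noteq> x" "y \<in> {0..R}"
      have "\<bar>F y - F x\<bar> / \<bar>y - x\<bar> \<le> K * (y - x)\<^sup>2 / \<bar>y - x\<bar>"
        by (intro divide_right_mono F' x y) auto
      also have "(y - x)\<^sup>2 = \<bar>y - x\<bar> * \<bar>y - x\<bar>" by (simp add: power2_eq_square)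
      also have "K * (\<bar>y - x\<bar> * \<bar>y - x\<bar>) / \<bar>y - x\<bar> = K * \<bar>y - x\<bar>"
        using y by (simp del: abs_mult_self_eq abs_mult_self add: mult.assoc[symmetric])
      finally show "norm ((F y - F x) / (y - x)) \<le> K * \<bar>y - x\<bar>" by simp
    qed
    show "((\<lambda>y. K * \<bar>y - x\<bar>) \<longlongrightarrow> 0) (at x within {0..R})"
      by (auto intro!: tendsto_eq_intros)
  qed
qed (use R in auto)

lemma set_integral_Icc_split:
  fixes f :: "real \<Rightarrow> real"
  assumes f: "set_integrable lborel {a..c} f" and "a \<le> b" "b \<le> c"
  shows "(LBINT r:{a..c}. f r) = (LBINT r:{a..b}. f r) + (LBINT r:{b..c}. f r)"
proof -
  have i: "integrable lborel (\<lambda>r. indicator {a..b} r *\<^sub>R f r)" "integrable lborel (\<lambda>r. indicator {b..c} r *\<^sub>R f r)"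
    "integrable lborel (\<lambda>r. indicator {a..c} r *\<^sub>R f r)"
    using set_integrable_subset[OF f, of "{a..b}"] set_integrable_subset[OF f, of "{b..c}"] f assms
    by (auto simp: set_integrable_def)
  show ?thesis unfolding set_lebesgue_integral_def Bochner_Integration.integral_add[OF i(1,2), symmetric]
  proof (rule integral_cong_AE)
    show "AE r in lborel. indicator {a..c} r *\<^sub>R f r = indicator {a..b} r *\<^sub>R f r + indicator {b..c} r *\<^sub>R f r"
      using AE_lborel_singleton[of b] by eventually_elim (use assms in \<open>auto simp: indicator_def\<close>)
  qed (use i in \<open>auto dest: borel_measurable_integrable\<close>)
qed

lemma set_integrable_Icc_bounded:
  fixes f :: "real \<Rightarrow> real"
  assumes [measurable]: "f \<in> borel_measurable borel" and "\<And>r. r \<in> {a..b} \<Longrightarrow> \<bar>f r\<bar> \<le> C"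
  shows "set_integrable lborel {a..b} f"
proof (rule set_integrable_bound)
  show "set_integrable lborel {a..b} (\<lambda>_. C)"
    unfolding set_integrable_def by (intro borel_integrable_compact) auto
  show "set_borel_measurable lborel {a..b} f" unfolding set_borel_measurable_def by measurable
qed (use assms in \<open>force intro!: AE_I2\<close>)

text \<open>The chain rule for \<open>exp (m * A)\<close>. In the application \<open>f\<close> is
  the indicator of a set of times, so \<open>A\<close> need not be differentiable everywhere.
  Instead, the bound \<open>1 + x \<le> exp x\<close> encloses the increments of both sides over
  \<open>[x, y]\<close> between \<open>exp (m * A x) * m * D\<close> and
  \<open>exp (m * A y) * m * D\<close> with \<open>D = A y - A x\<close>, and these differ by a
  quantity of order \<open>(y - x)^2\<close>.\<close>

lemma exp_of_primitive:
  fixes f :: "real \<Rightarrow> real"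
  assumes f[measurable]: "f \<in> borel_measurable borel" and f01: "\<And>t. 0 \<le> f t" "\<And>t. f t \<le> 1"
    and m: "0 < m" and T: "0 \<le> T"
  defines "A \<equiv> \<lambda>t. LBINT r:{0..t}. f r"
  shows "(\<lambda>t. f t * exp (m * A t)) \<in> borel_measurable borel"
    and "exp (m * A T) = 1 + m * (LBINT t:{0..T}. f t * exp (m * A t))"
    and "0 \<le> A T" and "A T \<le> T"
proof -
  have int: "set_integrable lborel {a..b} f" for a b
    using f01 by (intro set_integrable_Icc_bounded[where C=1]) auto
  have A_diff: "A y - A x = (LBINT r:{x..y}. f r)" if "0 \<le> x" "x \<le> y" for x y
    unfolding A_def using set_integral_Icc_split[OF int that] by simp
  have I: "0 \<le> (LBINT r:{x..y}. f r)" "(LBINT r:{x..y}. f r) \<le> y - x" if "x \<le> y" for x y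
  proof -
    show "0 \<le> (LBINT r:{x..y}. f r)" using f01 unfolding set_lebesgue_integral_def by (intro integral_nonneg_AE) auto
    have "(LBINT r:{x..y}. f r) \<le> (LBINT r:{x..y}. 1)"
      by (rule set_integral_mono[OF int]) (use f01 set_integrable_Icc_bounded[of "\<lambda>_. 1" x y 1] in auto)
    then show "(LBINT r:{x..y}. f r) \<le> y - x" using that by (simp add: set_lebesgue_integral_def)
  qed
  have A0: "A 0 = 0" using I[of 0 0] by (simp add: A_def)
  have A_neg: "A t = 0" if "t < 0" for t using that by (simp add: A_def set_lebesgue_integral_def)
  have A_lip: "0 \<le> A y - A x" "A y - A x \<le> y - x" if "0 \<le> x" "x \<le> y" for x y
    using A_diff[OF that] I[OF that(2)] by auto
  have A_mono: "A x \<le> A y" if "x \<le> y" for x y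
    using A_lip(1)[of x y] A_lip(1)[of 0 y] A_neg[of x] A_neg[of y] A0 that by linarith
  have [measurable]: "A \<in> borel_measurable borel"
    by (rule borel_measurable_mono) (auto simp: mono_def A_mono)
  show meas: "(\<lambda>t. f t * exp (m * A t)) \<in> borel_measurable borel" by measurable
  show "0 \<le> A T" "A T \<le> T" using A_lip[of 0 T] A0 T by auto
  have int2: "set_integrable lborel {a..b} (\<lambda>t. f t * exp (m * A t))" for a b
  proof (rule set_integrable_Icc_bounded[OF meas, where C="exp (m * A b)"])
    fix r assume "r \<in> {a..b}"
    then have "f r * exp (m * A r) \<le> 1 * exp (m * A b)"
      using f01 m A_mono[of r b] by (intro mult_mono) auto
    then show "\<bar>f r * exp (m * A r)\<bar> \<le> exp (m * A b)" using f01 by (simp add: abs_mult)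
  qed
  define G where "G t = exp (m * A t) - m * (LBINT r:{0..t}. f r * exp (m * A r))" for t
  have "G T = G 0"
  proof (rule constant_if_quadratic_increments[OF _ T])
    fix x y assume xy: "0 \<le> x" "x \<le> y" "y \<le> T"
    define D where "D = A y - A x"
    define E where "E = exp (m * A x)"
    define K where "K = exp (m * T)"
    have D: "0 \<le> D" "D \<le> y - x" using A_lip[OF xy(1,2)] by (auto simp: D_def)
    have E: "0 < E" "E \<le> exp (m * A y)" "exp (m * A y) \<le> K" "1 \<le> K"
      using A_mono[OF xy(2)] A_lip[of 0 y] A0 xy m T by (auto simp: E_def K_def)
    have incr: "E * (m * D) \<le> exp (m * A y) - E" "exp (m * A y) - E \<le> exp (m * A y) * (m * D)"
    proof -
      have "exp (m * A y) = E * exp (m * D)" by (simp add: E_def D_def exp_add[symmetric] algebra_simps)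
      moreover have "E * (1 + m * D) \<le> E * exp (m * D)" using E(1) by (intro mult_left_mono exp_ge_add_one_self) auto
      ultimately show "E * (m * D) \<le> exp (m * A y) - E" by (simp add: algebra_simps)
      have "E = exp (m * A y) * exp (- (m * D))" by (simp add: E_def D_def exp_add[symmetric] algebra_simps)
      moreover have "exp (m * A y) * (1 + - (m * D)) \<le> exp (m * A y) * exp (- (m * D))"
        by (intro mult_left_mono exp_ge_add_one_self) auto
      ultimately show "exp (m * A y) - E \<le> exp (m * A y) * (m * D)" by (simp add: algebra_simps)
    qed
    have split: "(LBINT r:{0..y}. f r * exp (m * A r)) = (LBINT r:{0..x}. f r * exp (m * A r)) + (LBINT r:{x..y}. f r * exp (m * A r))"
      using set_integral_Icc_split[OF int2 xy(1,2)] .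
    have lo: "E * D \<le> (LBINT r:{x..y}. f r * exp (m * A r))"
    proof -
      have "E * D = (LBINT r:{x..y}. E * f r)" using A_diff[OF xy(1,2)] by (simp add: D_def)
      also have "\<dots> \<le> (LBINT r:{x..y}. f r * exp (m * A r))"
        by (rule set_integral_mono[OF _ int2])
          (use int f01 A_mono m in \<open>auto simp: E_def mult.commute intro!: mult_left_mono set_integrable_mult_left\<close>)
      finally show ?thesis .
    qed
    have hi: "(LBINT r:{x..y}. f r * exp (m * A r)) \<le> exp (m * A y) * D"
    proof -
      have "(LBINT r:{x..y}. f r * exp (m * A r)) \<le> (LBINT r:{x..y}. exp (m * A y) * f r)"
        by (rule set_integral_mono[OF int2])
          (use int f01 A_mono m in \<open>auto simp: mult.commute intro!: mult_left_mono set_integrable_mult_left\<close>)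
      also have "\<dots> = exp (m * A y) * D" using A_diff[OF xy(1,2)] by (simp add: D_def)
      finally show ?thesis .
    qed
    have eq: "G y - G x = exp (m * A y) - E - m * (LBINT r:{x..y}. f r * exp (m * A r))"
      by (simp add: G_def split E_def algebra_simps)
    have lo': "m * (E * D) \<le> m * (LBINT r:{x..y}. f r * exp (m * A r))"
      and hi': "m * (LBINT r:{x..y}. f r * exp (m * A r)) \<le> m * (exp (m * A y) * D)"
      using lo hi m by (auto intro!: mult_left_mono)
    have a: "m * (exp (m * A y) * D) - E * (m * D) = (exp (m * A y) - E) * (m * D)" by (simp add: algebra_simps)
    have "\<bar>G y - G x\<bar> \<le> (exp (m * A y) - E) * (m * D)"
      unfolding eq a[symmetric] using incr lo' hi' by (simp add: abs_le_iff algebra_simps)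
    also have "\<dots> \<le> (K * (m * D)) * (m * D)"
    proof (rule mult_right_mono)
      have "exp (m * A y) * (m * D) \<le> K * (m * D)" using E m D by (intro mult_right_mono) auto
      then show "exp (m * A y) - E \<le> K * (m * D)" using incr by linarith
    qed (use m D in auto)
    also have "\<dots> = K * m\<^sup>2 * D\<^sup>2" by (simp add: power2_eq_square)
    also have "\<dots> \<le> K * m\<^sup>2 * (y - x)\<^sup>2" using D E by (intro mult_left_mono power_mono) auto
    finally show "\<bar>G y - G x\<bar> \<le> exp (m * T) * m\<^sup>2 * (y - x)\<^sup>2" by (simp add: K_def)
  qed
  also have "G 0 = 1"
  proof -
    have "(LBINT r:{0..0}. f r * exp (m * A r)) = 0" unfolding set_lebesgue_integral_def
      by (rule integral_eq_zero_AE) (use AE_lborel_singleton[of 0] in \<open>eventually_elim, auto\<close>)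
    then show ?thesis by (simp add: G_def A0)
  qed
  finally show "exp (m * A T) = 1 + m * (LBINT t:{0..T}. f t * exp (m * A t))" by (simp add: G_def)
qed

section \<open>The Markov property and the occupation time\<close>

context brownian_motion
begin

definition past :: "real \<Rightarrow> 'w measure" where
  "past t = sigma (space M) {B r -` S \<inter> space M | r S. 0 \<le> r \<and> r \<le> t \<and> S \<in> sets borel}"

lemma space_past [simp]: "space (past t) = space M"
  unfolding past_def by (rule space_measure_of) auto

lemma sets_past: "sets (past t) = sigma_sets (space M) {B r -` S \<inter> space M | r S. 0 \<le> r \<and> r \<le> t \<and> S \<in> sets borel}"
  unfolding past_def by (rule sets_measure_of) auto

lemma measurable_past: "0 \<le> r \<Longrightarrow> r \<le> t \<Longrightarrow> B r \<in> borel_measurable (past t)"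
  by (rule measurableI) (auto simp: sets_past intro!: sigma_sets.Basic)

lemma sets_past_subset: "sets (past t) \<subseteq> sets M"
  unfolding sets_past using measurable_B
  by (intro sets.sigma_sets_subset) (auto intro: measurable_sets)

lemma measurable_from_past: "f \<in> measurable (past t) N \<Longrightarrow> f \<in> measurable M N"
  using sets_past_subset[of t] by (auto simp: measurable_def)

text \<open>An intersection-stable generator of \<open>past t\<close>; the preimages in the
  definition of \<open>past\<close> are not closed under intersection when the times differ.\<close>

definition cylinders :: "real \<Rightarrow> 'w set set" where
  "cylinders t = {{\<omega> \<in> space M. \<forall>r\<in>F. B r \<omega> \<in> S r} | F S. finite F \<and> F \<subseteq> {0..t} \<and> (\<forall>r. S r \<in> sets borel)}"

lemma Int_stable_cylinders: "Int_stable (cylinders t)"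
proof (rule Int_stableI)
  fix a b assume "a \<in> cylinders t" "b \<in> cylinders t"
  then obtain F S F' S' where
    a: "a = {\<omega> \<in> space M. \<forall>r\<in>F. B r \<omega> \<in> S r}" "finite F" "F \<subseteq> {0..t}" "\<And>r. S r \<in> sets borel" and
    b: "b = {\<omega> \<in> space M. \<forall>r\<in>F'. B r \<omega> \<in> S' r}" "finite F'" "F' \<subseteq> {0..t}" "\<And>r. S' r \<in> sets borel"
    unfolding cylinders_def by blast
  let ?S = "\<lambda>r. (if r \<in> F then S r else UNIV) \<inter> (if r \<in> F' then S' r else UNIV)"
  have "a \<inter> b = {\<omega> \<in> space M. \<forall>r\<in>F \<union> F'. B r \<omega> \<in> ?S r}" unfolding a(1) b(1) by auto
  moreover have "\<And>r. ?S r \<in> sets borel" using a b by auto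
  ultimately show "a \<inter> b \<in> cylinders t" unfolding cylinders_def using a b
    by (intro CollectI exI[of _ "F \<union> F'"] exI[of _ ?S]) auto
qed

lemma cylinders_in_events: "cylinders t \<subseteq> events"
proof
  fix a assume "a \<in> cylinders t"
  then obtain F S where a: "a = {\<omega> \<in> space M. \<forall>r\<in>F. B r \<omega> \<in> S r}" "finite F" "F \<subseteq> {0..t}" "\<And>r. S r \<in> sets borel"
    unfolding cylinders_def by blast
  show "a \<in> events" unfolding a(1)
  proof (cases "F = {}", goal_cases)
    case 2
    show ?case
    proof (rule sets.sets_Collect_finite_All'[OF _ a(2) 2])
    fix r assume "r \<in> F"
    then show "{\<omega> \<in> space M. B r \<omega> \<in> S r} \<in> events" using measurable_sets[OF measurable_B[of r] a(4)[of r]] a(3) by (auto simp: vimage_def Int_def conj_commute)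
    qed
  qed auto
qed

lemma sets_past_cylinders: "sets (past t) \<subseteq> sigma_sets (space M) (cylinders t)"
  unfolding sets_past
proof (rule sigma_sets_mono, safe)
  fix r and S :: "real set" assume "0 \<le> r" "r \<le> t" "S \<in> sets borel"
  then have "B r -` S \<inter> space M \<in> cylinders t"
    unfolding cylinders_def by (intro CollectI exI[of _ "{r}"] exI[of _ "\<lambda>_. S"]) auto
  then show "B r -` S \<inter> space M \<in> sigma_sets (space M) (cylinders t)" by (rule sigma_sets.Basic)
qed

text \<open>Up to a null set a cylinder is an event in the increments of \<open>B\<close> between
  consecutive times of a finite grid ending in \<open>t\<close>, and \<open>B T - B t\<close> is the
  increment that follows them.\<close>

lemma cylinder_increment_independent:
  assumes t: "0 \<le> t" "t < T" and a: "a \<in> cylinders t" and U: "U \<in> sets borel"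
  shows "prob (a \<inter> ((\<lambda>\<omega>. B T \<omega> - B t \<omega>) -` U \<inter> space M)) = prob a * prob ((\<lambda>\<omega>. B T \<omega> - B t \<omega>) -` U \<inter> space M)"
proof -
  obtain F S where a: "a = {\<omega> \<in> space M. \<forall>r\<in>F. B r \<omega> \<in> S r}" and F: "finite F" "F \<subseteq> {0..t}" and S: "\<And>r. S r \<in> sets borel"
    using a unfolding cylinders_def by blast
  \<comment> \<open>Including 0 lets the partial sums of increments start at \<open>B 0\<close>;
    including \<open>t\<close> makes the increment after the last grid point equal to
    \<open>B T - B t\<close>.\<close>
  define L where "L = sorted_list_of_set (insert 0 (insert t F))"
  define n where "n = length L - 1"
  have fin: "finite (insert 0 (insert t F))" using F by auto
  have L: "set L = insert 0 (insert t F)" "sorted_wrt (<) L" "L \<noteq> []"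
    unfolding L_def using sorted_list_of_set_eq_Nil_iff[OF fin]
    by (simp_all only: set_sorted_list_of_set[OF fin] strict_sorted_list_of_set) blast
  have len: "length L = Suc n" using L(3) by (cases L) (auto simp: n_def)
  define \<tau> where "\<tau> i = (L @ [T]) ! i" for i
  have tau_L: "\<tau> i = L ! i" if "i \<le> n" for i using that len by (simp add: \<tau>_def nth_append)
  have tau_T: "\<tau> (Suc n) = T" by (simp add: \<tau>_def nth_append len)
  have L_le: "L ! i \<in> {0..t}" if "i \<le> n" for i
    using nth_mem[of i L] that len L(1) F t by auto
  have L_mono: "L ! i < L ! j" if "i < j" "j \<le> n" for i j
    using sorted_wrt_nth_less[OF L(2)] that len by auto
  have tau_0: "\<tau> 0 = 0"
  proof -
    obtain j where j: "j \<le> n" "L ! j = 0" using L(1) len by (metis in_set_conv_nth insertI1 less_Suc_eq_le)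
    then have "j = 0" using L_mono[of 0 j] L_le[of 0] by (cases j) auto
    then show ?thesis using j tau_L[of 0] by simp
  qed
  have tau_n: "\<tau> n = t"
  proof -
    obtain j where j: "j \<le> n" "L ! j = t" using L(1) len by (metis in_set_conv_nth insert_iff less_Suc_eq_le)
    then have "j = n" using L_mono[of j n] L_le[of n] by (cases "j = n") auto
    then show ?thesis using j tau_L[of n] by simp
  qed
  have tau_less: "\<tau> i < \<tau> (Suc i)" if "i < Suc n" for i
  proof (cases "i = n")
    case True then show ?thesis using tau_n tau_T t by simp
  next
    case False then show ?thesis using that L_mono[of i "Suc i"] tau_L[of i] tau_L[of "Suc i"] by simp
  qed
  define X where "X i \<omega> = B (\<tau> (Suc i)) \<omega> - B (\<tau> i) \<omega>" for i \<omega>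
  have ind: "indep_vars (\<lambda>_. borel) X {..<Suc n}"
    unfolding X_def[abs_def] by (rule independent_increments) (use tau_0 tau_less in auto)
  have iv: "indep_var (PiM {..<n} (\<lambda>_. borel)) (\<lambda>\<omega>. restrict (\<lambda>i. X i \<omega>) {..<n}) (PiM {n} (\<lambda>_. borel)) (\<lambda>\<omega>. restrict (\<lambda>i. X i \<omega>) {n})"
    by (rule indep_var_restrict[OF ind]) auto
  \<comment> \<open>The sums start from the constant \<open>z\<close> in place of
    \<open>B 0\<close>, so they depend on the increments alone. They agree with the path only almost
    surely, by \<open>start\<close>, which is why probabilities are compared through almost
    everywhere equality below.\<close>
  let ?W = "\<lambda>w j. z + (\<Sum>i<j. w i) :: real"
  define C where "C = {w \<in> space (PiM {..<n} (\<lambda>_. borel)). \<forall>j\<in>{..n}. \<tau> j \<in> F \<longrightarrow> ?W w j \<in> S (\<tau> j)}"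
  define D where "D = {w \<in> space (PiM {n} (\<lambda>_. borel :: real measure)). w n \<in> U}"
  have C: "C \<in> sets (PiM {..<n} (\<lambda>_. borel))" unfolding C_def
  proof (rule sets.sets_Collect_finite_All')
    fix j assume j: "j \<in> {..n}"
    have "(\<lambda>w. ?W w j) \<in> borel_measurable (PiM {..<n} (\<lambda>_. borel))"
      using j by (intro borel_measurable_add borel_measurable_const borel_measurable_sum measurable_component_singleton) auto
    from measurable_sets[OF this S[of "\<tau> j"]]
    have "{w \<in> space (PiM {..<n} (\<lambda>_. borel)). ?W w j \<in> S (\<tau> j)} \<in> sets (PiM {..<n} (\<lambda>_. borel))"
      by (simp add: vimage_def Int_def conj_commute)
    then show "{w \<in> space (PiM {..<n} (\<lambda>_. borel)). \<tau> j \<in> F \<longrightarrow> ?W w j \<in> S (\<tau> j)} \<in> sets (PiM {..<n} (\<lambda>_. borel))"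
      by (cases "\<tau> j \<in> F") auto
  qed auto
  have D: "D \<in> sets (PiM {n} (\<lambda>_. borel))"
    using measurable_sets[OF measurable_component_singleton[of n "{n}" "\<lambda>_. borel"] U]
    by (simp add: D_def vimage_def Int_def conj_commute)
  note ivD = indep_varD[OF iv C D]
  have X_sum: "B 0 \<omega> + (\<Sum>i<j. X i \<omega>) = B (\<tau> j) \<omega>" for j \<omega>
    by (induction j) (auto simp: tau_0 X_def)
  have F_index: "\<exists>j\<le>n. r = \<tau> j" if "r \<in> F" for r
  proof -
    have "r \<in> set L" using that L(1) by auto
    then obtain j where "j < length L" "r = L ! j" by (auto simp: in_set_conv_nth)
    then show ?thesis using len tau_L by (intro exI[of _ j]) auto
  qed
  have inC: "restrict (\<lambda>i. X i \<omega>) {..<n} \<in> C \<longleftrightarrow> (\<forall>r\<in>F. B r \<omega> \<in> S r)" if "B 0 \<omega> = z" for \<omega>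
  proof -
    have W: "?W (restrict (\<lambda>i. X i \<omega>) {..<n}) j = B (\<tau> j) \<omega>" if "j \<le> n" for j
    proof -
      have "(\<Sum>i<j. restrict (\<lambda>i. X i \<omega>) {..<n} i) = (\<Sum>i<j. X i \<omega>)" using that by (intro sum.cong) auto
      then show ?thesis using X_sum[of \<omega> j] \<open>B 0 \<omega> = z\<close> by simp
    qed
    have "restrict (\<lambda>i. X i \<omega>) {..<n} \<in> C \<longleftrightarrow> (\<forall>j\<in>{..n}. \<tau> j \<in> F \<longrightarrow> B (\<tau> j) \<omega> \<in> S (\<tau> j))"
      unfolding C_def using W by (auto simp: space_PiM)
    then show ?thesis using F_index by (metis atMost_iff)
  qed
  have inD: "restrict (\<lambda>i. X i \<omega>) {n} \<in> D \<longleftrightarrow> B T \<omega> - B t \<omega> \<in> U" for \<omega>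
    by (auto simp: D_def space_PiM X_def tau_T tau_n)
  have ZU: "(\<lambda>\<omega>. B T \<omega> - B t \<omega>) -` U \<inter> space M \<in> events"
    using measurable_B[of T] measurable_B[of t] t by (intro measurable_sets[OF _ U] borel_measurable_diff) auto
  have aev: "a \<in> events" using cylinders_in_events[of t] assms(3) by blast
  have rvC: "(\<lambda>\<omega>. restrict (\<lambda>i. X i \<omega>) {..<n}) -` C \<inter> space M \<in> events"
    by (rule measurable_sets[OF indep_var_rv1[OF iv] C])
  have rvD: "(\<lambda>\<omega>. restrict (\<lambda>i. X i \<omega>) {n}) -` D \<inter> space M = (\<lambda>\<omega>. B T \<omega> - B t \<omega>) -` U \<inter> space M"
    using inD by auto
  have 1: "prob ((\<lambda>\<omega>. restrict (\<lambda>i. X i \<omega>) {..<n}) -` C \<inter> space M) = prob a"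
    by (rule finite_measure_eq_AE[OF _ rvC aev]) (use start in \<open>eventually_elim, auto simp: a inC\<close>)
  have "prob (a \<inter> ((\<lambda>\<omega>. B T \<omega> - B t \<omega>) -` U \<inter> space M)) =
     prob ((\<lambda>\<omega>. (restrict (\<lambda>i. X i \<omega>) {..<n}, restrict (\<lambda>i. X i \<omega>) {n})) -` (C \<times> D) \<inter> space M)"
  proof (rule finite_measure_eq_AE)
    have eq: "(\<lambda>\<omega>. (restrict (\<lambda>i. X i \<omega>) {..<n}, restrict (\<lambda>i. X i \<omega>) {n})) -` (C \<times> D) \<inter> space M
      = ((\<lambda>\<omega>. restrict (\<lambda>i. X i \<omega>) {..<n}) -` C \<inter> space M) \<inter> ((\<lambda>\<omega>. restrict (\<lambda>i. X i \<omega>) {n}) -` D \<inter> space M)"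
      by auto
    show "(\<lambda>\<omega>. (restrict (\<lambda>i. X i \<omega>) {..<n}, restrict (\<lambda>i. X i \<omega>) {n})) -` (C \<times> D) \<inter> space M \<in> events"
      unfolding eq rvD using rvC ZU by (rule sets.Int)
    show "AE \<omega> in M. (\<omega> \<in> a \<inter> ((\<lambda>\<omega>. B T \<omega> - B t \<omega>) -` U \<inter> space M)) =
      (\<omega> \<in> (\<lambda>\<omega>. (restrict (\<lambda>i. X i \<omega>) {..<n}, restrict (\<lambda>i. X i \<omega>) {n})) -` (C \<times> D) \<inter> space M)"
      using start by eventually_elim (auto simp: a inC inD)
  qed (use aev ZU in auto)
  also have "\<dots> = prob a * prob ((\<lambda>\<omega>. B T \<omega> - B t \<omega>) -` U \<inter> space M)"
    unfolding ivD 1 rvD ..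
  finally show ?thesis .
qed

text \<open>Extension of the preceding product formula from the intersection-stable cylinders to the
  sigma-algebra they generate.\<close>

lemma past_increment_independent:
  assumes t: "0 \<le> t" "t < T"
    and a: "a \<in> sets (past t)" and U: "U \<in> sets borel"
  shows "prob (a \<inter> ((\<lambda>\<omega>. B T \<omega> - B t \<omega>) -` U \<inter> space M)) = prob a * prob ((\<lambda>\<omega>. B T \<omega> - B t \<omega>) -` U \<inter> space M)"
proof -
  have Z: "(\<lambda>\<omega>. B T \<omega> - B t \<omega>) \<in> borel_measurable M"
    using measurable_B[of T] measurable_B[of t] t by (intro borel_measurable_diff) auto
  let ?Z = "{(\<lambda>\<omega>. B T \<omega> - B t \<omega>) -` U \<inter> space M | U. U \<in> sets borel}"
  have "indep_set (sigma_sets (space M) (cylinders t)) (sigma_sets (space M) ?Z)"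
  proof (rule indep_set_sigma_sets[OF _ Int_stable_cylinders])
    show "indep_set (cylinders t) ?Z"
    proof (rule indep_setI[OF cylinders_in_events])
      show "?Z \<subseteq> events" using Z by (auto intro: measurable_sets)
    qed (use cylinder_increment_independent[OF t] in auto)
    show "Int_stable ?Z"
    proof (rule Int_stableI, safe)
      fix U V :: "real set" assume "U \<in> sets borel" "V \<in> sets borel"
      then show "\<exists>W. (\<lambda>\<omega>. B T \<omega> - B t \<omega>) -` U \<inter> space M \<inter> ((\<lambda>\<omega>. B T \<omega> - B t \<omega>) -` V \<inter> space M) = (\<lambda>\<omega>. B T \<omega> - B t \<omega>) -` W \<inter> space M \<and> W \<in> sets borel"
        by (intro exI[of _ "U \<inter> V"]) auto
    qed
  qed
  then show ?thesis
    by (rule indep_setD) (use a U sets_past_cylinders[of t] in \<open>auto intro: sigma_sets.Basic\<close>)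
qed

end

context brownian_motion
begin

text \<open>By independence, the outcome seen through \<open>past t\<close> and the increment
  \<open>B T - B t\<close> have a joint law that is a product; Fubini's theorem then integrates out
  the increment with its normal density.\<close>

lemma markov_property:
  assumes t: "0 \<le> t" "t < T" and X: "X \<in> borel_measurable (past t)" and [measurable]: "g \<in> borel_measurable borel"
  shows "(\<integral>\<^sup>+\<omega>. X \<omega> * g (B T \<omega>) \<partial>M)
    = (\<integral>\<^sup>+\<omega>. X \<omega> * (\<integral>\<^sup>+y. ennreal (normal_density 0 (sqrt (T - t)) (B t \<omega> - y)) * g y \<partial>lborel) \<partial>M)"
proof -
  let ?Z = "\<lambda>\<omega>. B T \<omega> - B t \<omega>"
  note [measurable] = X measurable_past[OF t(1) order_refl]
  have idm [measurable]: "(\<lambda>\<omega>. \<omega>) \<in> measurable M (past t)" by (rule measurable_from_past[OF measurable_ident_sets[OF refl]])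
  have Zm [measurable]: "?Z \<in> borel_measurable M"
    using measurable_B[of T] measurable_B[of t] t by (intro borel_measurable_diff) auto
  have joint: "distr M (past t) (\<lambda>\<omega>. \<omega>) \<Otimes>\<^sub>M distr M borel ?Z = distr M (past t \<Otimes>\<^sub>M borel) (\<lambda>\<omega>. (\<omega>, ?Z \<omega>))"
  proof (rule pair_measure_eqI)
    show "sigma_finite_measure (distr M (past t) (\<lambda>\<omega>. \<omega>))" "sigma_finite_measure (distr M borel ?Z)"
      by (intro prob_space_imp_sigma_finite prob_space_distr idm Zm)+
    show "sets (distr M (past t) (\<lambda>\<omega>. \<omega>) \<Otimes>\<^sub>M distr M borel ?Z) = sets (distr M (past t \<Otimes>\<^sub>M borel) (\<lambda>\<omega>. (\<omega>, ?Z \<omega>)))"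
      unfolding sets_distr by (rule sets_pair_measure_cong; rule sets_distr)
    fix a U assume "a \<in> sets (distr M (past t) (\<lambda>\<omega>. \<omega>))" "U \<in> sets (distr M borel ?Z)"
    then have aU: "a \<in> sets (past t)" "U \<in> sets borel" by auto
    have a: "a \<in> events" "a \<inter> space M = a" using aU(1) sets_past_subset[of t] sets.sets_into_space by auto
    have "(\<lambda>\<omega>. (\<omega>, ?Z \<omega>)) -` (a \<times> U) \<inter> space M = a \<inter> (?Z -` U \<inter> space M)" using a by auto
    then show "emeasure (distr M (past t) (\<lambda>\<omega>. \<omega>)) a * emeasure (distr M borel ?Z) U
      = emeasure (distr M (past t \<Otimes>\<^sub>M borel) (\<lambda>\<omega>. (\<omega>, ?Z \<omega>))) (a \<times> U)"
      using aU a past_increment_independent[OF t aU]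
      by (simp add: emeasure_distr emeasure_eq_measure ennreal_mult' vimage_def[of "\<lambda>x. x"])
  qed
  have normal: "distr M borel ?Z = density lborel (\<lambda>x. ennreal (normal_density 0 (sqrt (T - t)) x))"
  proof -
    have "distr M borel ?Z = distr M lborel ?Z" by (rule distr_cong[OF refl _ refl]) simp
    then show ?thesis using distributed_distr_eq_density[OF normal_increments[OF t]] by simp
  qed
  interpret Z: prob_space "distr M borel ?Z" by (rule prob_space_distr) measurable
  let ?h = "\<lambda>(\<omega>, x). X \<omega> * g (B t \<omega> + x)"
  have h: "?h \<in> borel_measurable (past t \<Otimes>\<^sub>M borel)" by measurable
  have "(\<integral>\<^sup>+\<omega>. X \<omega> * g (B T \<omega>) \<partial>M) = (\<integral>\<^sup>+\<omega>. ?h (\<omega>, ?Z \<omega>) \<partial>M)" by simp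
  also have "\<dots> = (\<integral>\<^sup>+x. ?h x \<partial>distr M (past t \<Otimes>\<^sub>M borel) (\<lambda>\<omega>. (\<omega>, ?Z \<omega>)))"
    by (subst nn_integral_distr[OF measurable_Pair[OF idm Zm]]) (simp_all only: measurable_distr_eq1 h)
  also have "\<dots> = (\<integral>\<^sup>+x. ?h x \<partial>(distr M (past t) (\<lambda>\<omega>. \<omega>) \<Otimes>\<^sub>M distr M borel ?Z))" unfolding joint ..
  also have "\<dots> = (\<integral>\<^sup>+\<omega>. (\<integral>\<^sup>+x. ?h (\<omega>, x) \<partial>distr M borel ?Z) \<partial>distr M (past t) (\<lambda>\<omega>. \<omega>))"
  proof (rule Z.nn_integral_fst[symmetric])
    show "?h \<in> borel_measurable (distr M (past t) (\<lambda>\<omega>. \<omega>) \<Otimes>\<^sub>M distr M borel ?Z)"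
      using h unfolding measurable_cong_sets[OF sets_pair_measure_cong[OF sets_distr sets_distr] refl] .
  qed
  also have "\<dots> = (\<integral>\<^sup>+\<omega>. (\<integral>\<^sup>+x. ?h (\<omega>, x) \<partial>distr M borel ?Z) \<partial>M)"
  proof (rule nn_integral_distr[OF idm])
    have "?h \<in> borel_measurable (past t \<Otimes>\<^sub>M distr M borel ?Z)"
      using h unfolding measurable_cong_sets[OF sets_pair_measure_cong[OF refl sets_distr] refl] .
    from Z.borel_measurable_nn_integral_fst[OF this]
    show "(\<lambda>\<omega>. \<integral>\<^sup>+x. ?h (\<omega>, x) \<partial>distr M borel ?Z) \<in> borel_measurable (distr M (past t) (\<lambda>\<omega>. \<omega>))"
      unfolding measurable_distr_eq1 .
  qed
  also have "\<dots> = (\<integral>\<^sup>+\<omega>. X \<omega> * (\<integral>\<^sup>+y. ennreal (normal_density 0 (sqrt (T - t)) (B t \<omega> - y)) * g y \<partial>lborel) \<partial>M)"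
  proof (rule nn_integral_cong)
    fix \<omega>
    have "(\<integral>\<^sup>+x. ?h (\<omega>, x) \<partial>distr M borel ?Z) = (\<integral>\<^sup>+x. X \<omega> * (ennreal (normal_density 0 (sqrt (T - t)) x) * g (B t \<omega> + x)) \<partial>lborel)"
      unfolding normal by (subst nn_integral_density) (auto intro!: nn_integral_cong simp: mult_ac)
    also have "\<dots> = X \<omega> * (\<integral>\<^sup>+x. ennreal (normal_density 0 (sqrt (T - t)) x) * g (B t \<omega> + x) \<partial>lborel)"
      by (rule nn_integral_cmult) measurable
    also have "(\<integral>\<^sup>+x. ennreal (normal_density 0 (sqrt (T - t)) x) * g (B t \<omega> + x) \<partial>lborel)
       = (\<integral>\<^sup>+y. ennreal (normal_density 0 (sqrt (T - t)) (B t \<omega> - y)) * g y \<partial>lborel)"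
      by (subst nn_integral_real_affine[where c=1 and t="- B t \<omega>"])
        (auto simp: normal_density_def power2_commute intro!: nn_integral_cong)
    finally show "(\<integral>\<^sup>+x. ?h (\<omega>, x) \<partial>distr M borel ?Z) = X \<omega> * (\<integral>\<^sup>+y. ennreal (normal_density 0 (sqrt (T - t)) (B t \<omega> - y)) * g y \<partial>lborel)" .
  qed
  finally show ?thesis .
qed

end

text \<open>Keeps finite the perturbation term that is cancelled in
  \<open>fk_functional_one\<close>.\<close>

lemma fk_solution_le_inside:
  assumes l: "0 < l" and m: "0 < m" and x: "\<bar>x\<bar> < 1"
  shows "fk_solution l m x \<le> 1 / l"
proof -
  have "0 < sinh (sqrt (2 * l))" using l by simp
  then have "0 \<le> 4 * m / ((sqrt (2 * l))\<^sup>2 * sqrt (2 * (l + m)) * (sqrt (2 * (l + m)) * cosh (sqrt (2 * l)) + sqrt (2 * l) * sinh (sqrt (2 * l)))) * cosh (sqrt (2 * l) * x)"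
    using l m by (intro mult_nonneg_nonneg divide_nonneg_nonneg add_nonneg_nonneg) auto
  then show ?thesis using x unfolding fk_solution_def Let_def by simp
qed

section \<open>Occupation times and the Feynman-Kac formula\<close>

context brownian_motion
begin

text \<open>Freezing the path at negative times, where \<open>B\<close> is unconstrained, makes it continuous on the whole line.\<close>

definition Bc :: "real \<Rightarrow> 'w \<Rightarrow> real" where
  "Bc r \<omega> = B (max 0 r) \<omega>"

lemma measurable_Bc [measurable (raw)]:
  assumes "k \<in> borel_measurable N" "h \<in> measurable N M"
  shows "(\<lambda>x. Bc (k x) (h x)) \<in> borel_measurable N"
proof -
  have "(\<lambda>x. Bc (snd x) (fst x)) \<in> borel_measurable (M \<Otimes>\<^sub>M borel)"
  proof (rule measurable_continuous_process)
    show "Bc r \<in> borel_measurable M" for r using measurable_B[of "max 0 r"] by (simp add: Bc_def[abs_def])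
    show "continuous_on UNIV (\<lambda>r. Bc r \<omega>)" if "\<omega> \<in> space M" for \<omega>
      unfolding Bc_def by (rule continuous_on_compose2[OF continuous_paths[OF that]]) (auto intro!: continuous_intros)
  qed
  from measurable_compose[OF measurable_Pair[OF assms(2,1)] this] show ?thesis by simp
qed

definition inside :: "real \<Rightarrow> 'w \<Rightarrow> real" where
  "inside r \<omega> = indicator {-1<..<1} (Bc r \<omega>)"

lemma measurable_inside [measurable (raw)]:
  assumes [measurable]: "k \<in> borel_measurable N" "h \<in> measurable N M"
  shows "(\<lambda>x. inside (k x) (h x)) \<in> borel_measurable N"
  unfolding inside_def by measurable

lemma inside_bounds: "0 \<le> inside r \<omega>" "inside r \<omega> \<le> 1"
  by (auto simp: inside_def indicator_def)

definition inside_time :: "real \<Rightarrow> 'w \<Rightarrow> real" where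
  "inside_time t \<omega> = (LBINT r:{0..t}. inside r \<omega>)"

lemma measurable_inside_time [measurable (raw)]:
  assumes [measurable]: "k \<in> borel_measurable N" "h \<in> measurable N M"
  shows "(\<lambda>x. inside_time (k x) (h x)) \<in> borel_measurable N"
proof -
  have "(\<lambda>x. LBINT r. (if 0 \<le> r \<and> r \<le> k x then 1 else 0) * inside r (h x)) \<in> borel_measurable N"
    by measurable
  also have "(\<lambda>x. LBINT r. (if 0 \<le> r \<and> r \<le> k x then 1 else 0) * inside r (h x)) = (\<lambda>x. inside_time (k x) (h x))"
    unfolding inside_time_def set_lebesgue_integral_def
    by (intro ext Bochner_Integration.integral_cong) (auto simp: indicator_def)
  finally show ?thesis .
qed

text \<open>The path stopped at \<open>t\<close> is continuous and \<open>past t\<close>-measurable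
  at each time, so the joint measurability argument works over \<open>past t\<close>; on
  \<open>{0..t}\<close> the stopped path is the path.\<close>

lemma inside_time_past:
  assumes t: "0 \<le> t"
  shows "inside_time t \<in> borel_measurable (past t)"
proof -
  let ?Y = "\<lambda>r. B (max 0 (min r t))"
  have Y: "(\<lambda>x. ?Y (snd x) (fst x)) \<in> borel_measurable (past t \<Otimes>\<^sub>M borel)"
  proof (rule measurable_continuous_process)
    show "?Y r \<in> borel_measurable (past t)" for r using t by (intro measurable_past) auto
    show "continuous_on UNIV (\<lambda>r. ?Y r \<omega>)" if "\<omega> \<in> space (past t)" for \<omega>
      using that by (intro continuous_on_compose2[OF continuous_paths]) (auto intro!: continuous_intros)
  qed
  have "(\<lambda>\<omega>. LBINT r. indicator {0..t} r * indicator {-1<..<1} (?Y r \<omega>) :: real) \<in> borel_measurable (past t)"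
  proof (rule lborel.borel_measurable_lebesgue_integral)
    have [measurable]: "(\<lambda>x. ?Y (snd x) (fst x)) \<in> borel_measurable (past t \<Otimes>\<^sub>M lborel)"
      using Y by (simp only: measurable_lborel1 measurable_cong_sets[OF sets_pair_measure_cong[OF refl sets_lborel] refl])
    have "(\<lambda>x. indicator {0..t} (snd x) * indicator {-1<..<1} (?Y (snd x) (fst x)) :: real) \<in> borel_measurable (past t \<Otimes>\<^sub>M lborel)"
      by measurable
    then show "(\<lambda>(\<omega>, r). indicator {0..t} r * indicator {-1<..<1} (?Y r \<omega>) :: real) \<in> borel_measurable (past t \<Otimes>\<^sub>M lborel)"
      by (simp add: case_prod_beta)
  qed
  also have "(\<lambda>\<omega>. LBINT r. indicator {0..t} r * indicator {-1<..<1} (?Y r \<omega>) :: real) = inside_time t"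
    unfolding inside_time_def set_lebesgue_integral_def inside_def Bc_def
    by (intro ext Bochner_Integration.integral_cong) (auto simp: indicator_def min_def)
  finally show ?thesis .
qed

lemma inside_time_properties:
  assumes w: "\<omega> \<in> space M" and m: "0 < m" and T: "0 \<le> T"
  shows "ennreal (exp (m * inside_time T \<omega>)) =
      1 + (\<integral>\<^sup>+t. ennreal (m * (inside t \<omega> * exp (m * inside_time t \<omega>))) * indicator {0<..<T} t \<partial>lborel)"
    and "0 \<le> inside_time T \<omega>" and "inside_time T \<omega> \<le> T"
    and "occupation_time B T \<omega> = T - inside_time T \<omega>"
proof -
  note [measurable] = w
  have f: "(\<lambda>r. inside r \<omega>) \<in> borel_measurable borel" by measurable
  note E = exp_of_primitive[OF f inside_bounds m T, folded inside_time_def]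
  show "0 \<le> inside_time T \<omega>" "inside_time T \<omega> \<le> T" using E by auto
  have int: "set_integrable lborel {0..T} (\<lambda>t. inside t \<omega> * exp (m * inside_time t \<omega>))"
  proof (rule set_integrable_Icc_bounded[OF E(1), where C="exp (m * T)"])
    fix r assume r: "r \<in> {0..T}"
    then have "inside_time r \<omega> \<le> r" using exp_of_primitive(4)[OF f inside_bounds m, of r] by (simp add: inside_time_def)
    then have "inside r \<omega> * exp (m * inside_time r \<omega>) \<le> 1 * exp (m * T)"
      using inside_bounds[of r \<omega>] r m by (intro mult_mono) auto
    then show "\<bar>inside r \<omega> * exp (m * inside_time r \<omega>)\<bar> \<le> exp (m * T)"
      using inside_bounds[of r \<omega>] by (simp add: abs_mult)
  qed
  have "(\<integral>\<^sup>+t. ennreal (m * (inside t \<omega> * exp (m * inside_time t \<omega>))) * indicator {0<..<T} t \<partial>lborel)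
    = (\<integral>\<^sup>+t. ennreal (indicator {0..T} t *\<^sub>R (m * (inside t \<omega> * exp (m * inside_time t \<omega>)))) \<partial>lborel)"
    by (rule nn_integral_cong_AE)
      (use AE_lborel_singleton[of 0] AE_lborel_singleton[of T] in \<open>eventually_elim, auto simp: indicator_def\<close>)
  also have "\<dots> = ennreal (LBINT t:{0..T}. m * (inside t \<omega> * exp (m * inside_time t \<omega>)))"
    unfolding set_lebesgue_integral_def
    by (rule nn_integral_eq_integral)
      (use set_integrable_mult_right[OF int, of m] inside_bounds m in \<open>auto simp: set_integrable_def\<close>)
  finally have nn: "(\<integral>\<^sup>+t. ennreal (m * (inside t \<omega> * exp (m * inside_time t \<omega>))) * indicator {0<..<T} t \<partial>lborel)
    = ennreal (m * (LBINT t:{0..T}. inside t \<omega> * exp (m * inside_time t \<omega>)))" by simp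
  have nonneg: "0 \<le> m * (LBINT t:{0..T}. inside t \<omega> * exp (m * inside_time t \<omega>))"
    unfolding set_lebesgue_integral_def using m inside_bounds by (intro mult_nonneg_nonneg integral_nonneg_AE) auto
  show "ennreal (exp (m * inside_time T \<omega>)) =
      1 + (\<integral>\<^sup>+t. ennreal (m * (inside t \<omega> * exp (m * inside_time t \<omega>))) * indicator {0<..<T} t \<partial>lborel)"
    unfolding nn E(2) using nonneg by (subst ennreal_plus) auto
  have "set_integrable lborel {0..T} (\<lambda>r. inside r \<omega>)"
    using inside_bounds by (intro set_integrable_Icc_bounded[OF f, where C=1]) auto
  moreover have "set_integrable lborel {0..T} (\<lambda>_. 1 :: real)"
    by (rule set_integrable_Icc_bounded[where C=1]) auto
  ultimately have "(LBINT r:{0..T}. 1 - inside r \<omega>) = (LBINT r:{0..T}. 1) - inside_time T \<omega>"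
    unfolding inside_time_def by (intro set_integral_diff) auto
  moreover have "occupation_time B T \<omega> = (LBINT r:{0..T}. 1 - inside r \<omega>)"
    unfolding occupation_time_def set_lebesgue_integral_def
    by (intro Bochner_Integration.integral_cong) (auto simp: inside_def Bc_def indicator_def)
  ultimately show "occupation_time B T \<omega> = T - inside_time T \<omega>"
    using T by (simp add: set_lebesgue_integral_def)
qed

text \<open>Interchange of nonnegative integrals; the diagonal \<open>y = x\<close>, where
  \<open>laplace_heat_kernel\<close> does not apply, is a null set.\<close>

lemma heat_semigroup_laplace:
  assumes p: "0 < p" and [measurable]: "g \<in> borel_measurable borel"
  shows "(\<integral>\<^sup>+T. ennreal (exp (- p * T)) * (\<integral>\<^sup>+y. ennreal (normal_density 0 (sqrt T) (x - y)) * g y \<partial>lborel) * indicator {0<..} T \<partial>lborel)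
    = (\<integral>\<^sup>+y. ennreal (exp (- sqrt (2 * p) * \<bar>x - y\<bar>) / sqrt (2 * p)) * g y \<partial>lborel)"
proof -
  have "(\<integral>\<^sup>+T. ennreal (exp (- p * T)) * (\<integral>\<^sup>+y. ennreal (normal_density 0 (sqrt T) (x - y)) * g y \<partial>lborel) * indicator {0<..} T \<partial>lborel)
    = (\<integral>\<^sup>+T. (\<integral>\<^sup>+y. (ennreal (exp (- p * T) * normal_density 0 (sqrt T) (x - y)) * indicator {0<..} T) * g y \<partial>lborel) \<partial>lborel)"
  proof (rule nn_integral_cong)
    fix T :: real
    have "(\<integral>\<^sup>+y. (ennreal (exp (- p * T) * normal_density 0 (sqrt T) (x - y)) * indicator {0<..} T) * g y \<partial>lborel)
      = (\<integral>\<^sup>+y. (ennreal (exp (- p * T)) * indicator {0<..} T) * (ennreal (normal_density 0 (sqrt T) (x - y)) * g y) \<partial>lborel)"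
      by (intro nn_integral_cong) (simp add: ennreal_mult' mult_ac)
    also have "\<dots> = (ennreal (exp (- p * T)) * indicator {0<..} T) * (\<integral>\<^sup>+y. ennreal (normal_density 0 (sqrt T) (x - y)) * g y \<partial>lborel)"
      by (rule nn_integral_cmult) measurable
    finally show "ennreal (exp (- p * T)) * (\<integral>\<^sup>+y. ennreal (normal_density 0 (sqrt T) (x - y)) * g y \<partial>lborel) * indicator {0<..} T
      = (\<integral>\<^sup>+y. (ennreal (exp (- p * T) * normal_density 0 (sqrt T) (x - y)) * indicator {0<..} T) * g y \<partial>lborel)"
      by (simp add: mult_ac)
  qed
  also have "\<dots> = (\<integral>\<^sup>+y. (\<integral>\<^sup>+T. (ennreal (exp (- p * T) * normal_density 0 (sqrt T) (x - y)) * indicator {0<..} T) * g y \<partial>lborel) \<partial>lborel)"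
    unfolding normal_density_def by (rule lborel_pair.Fubini') measurable
  also have "\<dots> = (\<integral>\<^sup>+y. ennreal (exp (- sqrt (2 * p) * \<bar>x - y\<bar>) / sqrt (2 * p)) * g y \<partial>lborel)"
  proof (rule nn_integral_cong_AE)
    show "AE y in lborel. (\<integral>\<^sup>+T. (ennreal (exp (- p * T) * normal_density 0 (sqrt T) (x - y)) * indicator {0<..} T) * g y \<partial>lborel)
      = ennreal (exp (- sqrt (2 * p) * \<bar>x - y\<bar>) / sqrt (2 * p)) * g y"
      using AE_lborel_singleton[of x]
    proof eventually_elim
      case (elim y)
      have "(\<integral>\<^sup>+T. (ennreal (exp (- p * T) * normal_density 0 (sqrt T) (x - y)) * indicator {0<..} T) * g y \<partial>lborel)
        = (\<integral>\<^sup>+T. (ennreal (exp (- p * T) * normal_density 0 (sqrt T) (x - y)) * indicator {0<..} T) \<partial>lborel) * g y"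
        unfolding normal_density_def by (rule nn_integral_multc) measurable
      then show ?case using laplace_heat_kernel[OF p, of "x - y"] elim by simp
    qed
  qed
  finally show ?thesis .
qed

text \<open>Here \<open>exp (m * inside_time T \<omega>)\<close> grows, but for \<open>p = l + m\<close> the weight is \<open>exp (- l T - m \<Gamma>\<^sub>T)\<close>.\<close>

definition fk_functional :: "real \<Rightarrow> real \<Rightarrow> (real \<Rightarrow> ennreal) \<Rightarrow> ennreal" where
  "fk_functional p m g = (\<integral>\<^sup>+T. (\<integral>\<^sup>+\<omega>. ennreal (exp (- p * T)) * ennreal (exp (m * inside_time T \<omega>)) * g (Bc T \<omega>) \<partial>M) * indicator {0<..} T \<partial>lborel)"

lemma expectation_at_time:
  assumes T: "0 < T" and [measurable]: "g \<in> borel_measurable borel"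
  shows "(\<integral>\<^sup>+\<omega>. g (Bc T \<omega>) \<partial>M) = (\<integral>\<^sup>+y. ennreal (normal_density 0 (sqrt T) (z - y)) * g y \<partial>lborel)"
proof -
  have "(\<integral>\<^sup>+\<omega>. g (Bc T \<omega>) \<partial>M) = (\<integral>\<^sup>+\<omega>. 1 * g (B T \<omega>) \<partial>M)" using T by (simp add: Bc_def)
  also have "\<dots> = (\<integral>\<^sup>+\<omega>. 1 * (\<integral>\<^sup>+y. ennreal (normal_density 0 (sqrt (T - 0)) (B 0 \<omega> - y)) * g y \<partial>lborel) \<partial>M)"
    using T by (intro markov_property) auto
  also have "\<dots> = (\<integral>\<^sup>+\<omega>. (\<integral>\<^sup>+y. ennreal (normal_density 0 (sqrt T) (z - y)) * g y \<partial>lborel) \<partial>M)"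
    by (rule nn_integral_cong_AE) (use start in \<open>eventually_elim, simp\<close>)
  finally show ?thesis by (simp add: emeasure_space_1)
qed

text \<open>Duhamel's formula. The exponential is expanded by \<open>inside_time_properties\<close>,
  the Markov property at time \<open>t\<close> replaces \<open>g (B T)\<close> by the heat semigroup
  over a time \<open>T - t\<close>, and integrating over \<open>T > t\<close> with weight
  \<open>exp (- p * (T - t))\<close> produces the resolvent \<open>V\<close> at
  \<open>B t\<close>.\<close>

lemma fk_functional_identity:
  assumes p: "0 < p" and m: "0 < m" and g[measurable]: "g \<in> borel_measurable borel"
  defines "V \<equiv> \<lambda>x. \<integral>\<^sup>+y. ennreal (exp (- sqrt (2 * p) * \<bar>x - y\<bar>) / sqrt (2 * p)) * g y \<partial>lborel"
  shows "fk_functional p m g = V z + fk_functional p m (\<lambda>x. ennreal (m * indicator {-1<..<1} x) * V x)"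
proof -
  have V[measurable]: "V \<in> borel_measurable borel" unfolding V_def by measurable
  define e where "e T = ennreal (exp (- p * T))" for T
  have [measurable]: "e \<in> borel_measurable borel" unfolding e_def by measurable
  define X where "X t \<omega> = ennreal (m * (inside t \<omega> * exp (m * inside_time t \<omega>)))" for t \<omega>
  have X[measurable (raw)]: "(\<lambda>x. X (k x) (h x)) \<in> borel_measurable N"
    if [measurable]: "k \<in> borel_measurable N" "h \<in> measurable N M" for k h and N :: "'n measure"
    unfolding X_def by measurable
  define H where "H T x = (\<integral>\<^sup>+y. ennreal (normal_density 0 (sqrt T) (x - y)) * g y \<partial>lborel)" for T x
  have H[measurable]: "(\<lambda>x. H (k x) (h x)) \<in> borel_measurable N"
    if [measurable]: "k \<in> borel_measurable N" "h \<in> borel_measurable N" for k h and N :: "'n measure"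
    unfolding H_def normal_density_def by measurable
  interpret PM: pair_sigma_finite M lborel
    by (intro pair_sigma_finite.intro sigma_finite_measure_axioms lborel.sigma_finite_measure_axioms)
  \<comment> \<open>The constraint \<open>0 < t < T\<close> as a factor, so that no domain of
    integration depends on another variable and the integrals can be interchanged.\<close>
  define I where "I t T = (indicator {0<..} t * indicator {t<..} T :: ennreal)" for t T :: real
  have I[measurable (raw)]: "(\<lambda>x. I (k x) (h x)) \<in> borel_measurable N"
    if [measurable]: "k \<in> borel_measurable N" "h \<in> borel_measurable N" for k h and N :: "'n measure"
  proof -
    have "(\<lambda>x. (if 0 < k x \<and> k x < h x then 1 else 0 :: ennreal)) \<in> borel_measurable N" by measurable
    also have "(\<lambda>x. (if 0 < k x \<and> k x < h x then 1 else 0 :: ennreal)) = (\<lambda>x. I (k x) (h x))"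
      by (auto simp: I_def indicator_def fun_eq_iff)
    finally show ?thesis .
  qed
  have "fk_functional p m g = (\<integral>\<^sup>+T. e T * H T z * indicator {0<..} T +
     (\<integral>\<^sup>+\<omega>. \<integral>\<^sup>+t. e T * X t \<omega> * I t T * g (Bc T \<omega>) \<partial>lborel \<partial>M) \<partial>lborel)"
    unfolding fk_functional_def
  proof (rule nn_integral_cong)
    fix T :: real
    show "(\<integral>\<^sup>+\<omega>. ennreal (exp (- p * T)) * ennreal (exp (m * inside_time T \<omega>)) * g (Bc T \<omega>) \<partial>M) * indicator {0<..} T
      = e T * H T z * indicator {0<..} T + (\<integral>\<^sup>+\<omega>. \<integral>\<^sup>+t. e T * X t \<omega> * I t T * g (Bc T \<omega>) \<partial>lborel \<partial>M)"
    proof (cases "0 < T")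
      case False
      then have "I t T = 0" for t by (auto simp: I_def indicator_def)
      then show ?thesis using False by simp
    next
      case True
      have eq: "e T * ennreal (exp (m * inside_time T \<omega>)) * g (Bc T \<omega>)
        = e T * g (Bc T \<omega>) + (\<integral>\<^sup>+t. e T * X t \<omega> * I t T * g (Bc T \<omega>) \<partial>lborel)" if w[measurable]: "\<omega> \<in> space M" for \<omega>
      proof -
        have "ennreal (exp (m * inside_time T \<omega>)) = 1 + (\<integral>\<^sup>+t. X t \<omega> * I t T \<partial>lborel)"
          unfolding inside_time_properties(1)[OF w m less_imp_le[OF True]] X_def
          by (intro arg_cong2[where f="(+)"] refl nn_integral_cong) (auto simp: I_def indicator_def)
        moreover have "(\<integral>\<^sup>+t. e T * X t \<omega> * I t T * g (Bc T \<omega>) \<partial>lborel) = e T * g (Bc T \<omega>) * (\<integral>\<^sup>+t. X t \<omega> * I t T \<partial>lborel)"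
          by (subst nn_integral_cmult[symmetric]) (auto intro!: nn_integral_cong simp: mult_ac)
        ultimately show ?thesis by (simp add: distrib_left distrib_right mult_ac)
      qed
      have "(\<integral>\<^sup>+\<omega>. e T * ennreal (exp (m * inside_time T \<omega>)) * g (Bc T \<omega>) \<partial>M)
        = (\<integral>\<^sup>+\<omega>. e T * g (Bc T \<omega>) + (\<integral>\<^sup>+t. e T * X t \<omega> * I t T * g (Bc T \<omega>) \<partial>lborel) \<partial>M)"
        by (rule nn_integral_cong) (rule eq)
      also have "\<dots> = (\<integral>\<^sup>+\<omega>. e T * g (Bc T \<omega>) \<partial>M) + (\<integral>\<^sup>+\<omega>. (\<integral>\<^sup>+t. e T * X t \<omega> * I t T * g (Bc T \<omega>) \<partial>lborel) \<partial>M)"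
        by (rule nn_integral_add) measurable
      also have "(\<integral>\<^sup>+\<omega>. e T * g (Bc T \<omega>) \<partial>M) = e T * H T z"
        unfolding H_def expectation_at_time[OF True g, symmetric] by (rule nn_integral_cmult) measurable
      finally show ?thesis using True by (simp add: e_def)
    qed
  qed
  also have "\<dots> = (\<integral>\<^sup>+T. e T * H T z * indicator {0<..} T \<partial>lborel)
     + (\<integral>\<^sup>+T. \<integral>\<^sup>+\<omega>. \<integral>\<^sup>+t. e T * X t \<omega> * I t T * g (Bc T \<omega>) \<partial>lborel \<partial>M \<partial>lborel)"
    by (rule nn_integral_add) measurable
  also have "(\<integral>\<^sup>+T. e T * H T z * indicator {0<..} T \<partial>lborel) = V z"
    unfolding e_def H_def V_def by (rule heat_semigroup_laplace[OF p g])
  also have "(\<integral>\<^sup>+T. \<integral>\<^sup>+\<omega>. \<integral>\<^sup>+t. e T * X t \<omega> * I t T * g (Bc T \<omega>) \<partial>lborel \<partial>M \<partial>lborel)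
     = (\<integral>\<^sup>+T. \<integral>\<^sup>+t. \<integral>\<^sup>+\<omega>. e T * X t \<omega> * I t T * g (Bc T \<omega>) \<partial>M \<partial>lborel \<partial>lborel)"
    by (rule nn_integral_cong) (rule PM.Fubini'[symmetric], measurable)
  also have "\<dots> = (\<integral>\<^sup>+t. \<integral>\<^sup>+T. \<integral>\<^sup>+\<omega>. e T * X t \<omega> * I t T * g (Bc T \<omega>) \<partial>M \<partial>lborel \<partial>lborel)"
    by (rule lborel_pair.Fubini') measurable
  also have "\<dots> = (\<integral>\<^sup>+t. \<integral>\<^sup>+T. \<integral>\<^sup>+\<omega>. e T * X t \<omega> * I t T * H (T - t) (Bc t \<omega>) \<partial>M \<partial>lborel \<partial>lborel)"
  proof (rule nn_integral_cong, rule nn_integral_cong)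
    fix t T :: real
    show "(\<integral>\<^sup>+\<omega>. e T * X t \<omega> * I t T * g (Bc T \<omega>) \<partial>M) = (\<integral>\<^sup>+\<omega>. e T * X t \<omega> * I t T * H (T - t) (Bc t \<omega>) \<partial>M)"
    proof (cases "0 < t \<and> t < T")
      case False
      then have "I t T = 0" by (auto simp: I_def indicator_def)
      then show ?thesis by simp
    next
      case True
      have [measurable]: "inside_time t \<in> borel_measurable (past t)" "B t \<in> borel_measurable (past t)"
        using True by (auto intro: inside_time_past measurable_past)
      have "(\<lambda>\<omega>. e T * ennreal (m * (indicator {-1<..<1} (B t \<omega>) * exp (m * inside_time t \<omega>))) * I t T) \<in> borel_measurable (past t)"
        by measurable
      then have "(\<lambda>\<omega>. e T * X t \<omega> * I t T) \<in> borel_measurable (past t)"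
        using True unfolding X_def inside_def Bc_def by simp
      from markov_property[OF _ _ this g, of T] show ?thesis
        using True by (simp add: H_def Bc_def)
    qed
  qed
  also have "\<dots> = (\<integral>\<^sup>+t. \<integral>\<^sup>+\<omega>. \<integral>\<^sup>+T. e T * X t \<omega> * I t T * H (T - t) (Bc t \<omega>) \<partial>lborel \<partial>M \<partial>lborel)"
    by (rule nn_integral_cong) (rule PM.Fubini', measurable)
  also have "\<dots> = fk_functional p m (\<lambda>x. ennreal (m * indicator {-1<..<1} x) * V x)"
    unfolding fk_functional_def
  proof (intro nn_integral_cong)
    fix t :: real
    have inner: "(\<integral>\<^sup>+T. e T * X t \<omega> * I t T * H (T - t) (Bc t \<omega>) \<partial>lborel)
      = ennreal (exp (- p * t)) * ennreal (exp (m * inside_time t \<omega>)) * (ennreal (m * indicator {-1<..<1} (Bc t \<omega>)) * V (Bc t \<omega>)) * indicator {0<..} t"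
      if [measurable]: "\<omega> \<in> space M" for \<omega>
    proof -
      have "(\<integral>\<^sup>+T. e T * X t \<omega> * I t T * H (T - t) (Bc t \<omega>) \<partial>lborel)
        = (\<integral>\<^sup>+u. e (t + u) * X t \<omega> * I t (t + u) * H u (Bc t \<omega>) \<partial>lborel)"
        by (subst nn_integral_real_affine[where c=1 and t=t]) auto
      also have "\<dots> = (\<integral>\<^sup>+u. (e t * X t \<omega> * indicator {0<..} t) * (ennreal (exp (- p * u)) * H u (Bc t \<omega>) * indicator {0<..} u) \<partial>lborel)"
      proof (rule nn_integral_cong)
        fix u :: real
        have "e (t + u) = e t * ennreal (exp (- p * u))"
          unfolding e_def by (subst ennreal_mult[symmetric]) (simp_all add: exp_add[symmetric] algebra_simps)
        then show "e (t + u) * X t \<omega> * I t (t + u) * H u (Bc t \<omega>)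
          = (e t * X t \<omega> * indicator {0<..} t) * (ennreal (exp (- p * u)) * H u (Bc t \<omega>) * indicator {0<..} u)"
          by (auto simp: I_def indicator_def mult_ac)
      qed
      also have "\<dots> = (e t * X t \<omega> * indicator {0<..} t) * (\<integral>\<^sup>+u. ennreal (exp (- p * u)) * H u (Bc t \<omega>) * indicator {0<..} u \<partial>lborel)"
        by (rule nn_integral_cmult) measurable
      also have "(\<integral>\<^sup>+u. ennreal (exp (- p * u)) * H u (Bc t \<omega>) * indicator {0<..} u \<partial>lborel) = V (Bc t \<omega>)"
        unfolding H_def V_def by (rule heat_semigroup_laplace[OF p g])
      finally show ?thesis
        using m by (simp add: e_def X_def inside_def ennreal_mult' mult_ac)
    qed
    have "(\<integral>\<^sup>+\<omega>. \<integral>\<^sup>+T. e T * X t \<omega> * I t T * H (T - t) (Bc t \<omega>) \<partial>lborel \<partial>M)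
      = (\<integral>\<^sup>+\<omega>. ennreal (exp (- p * t)) * ennreal (exp (m * inside_time t \<omega>)) * (ennreal (m * indicator {-1<..<1} (Bc t \<omega>)) * V (Bc t \<omega>)) * indicator {0<..} t \<partial>M)"
      by (rule nn_integral_cong) (rule inner)
    also have "\<dots> = (\<integral>\<^sup>+\<omega>. ennreal (exp (- p * t)) * ennreal (exp (m * inside_time t \<omega>)) * (ennreal (m * indicator {-1<..<1} (Bc t \<omega>)) * V (Bc t \<omega>)) \<partial>M) * indicator {0<..} t"
      by (rule nn_integral_multc) measurable
    finally show "(\<integral>\<^sup>+\<omega>. \<integral>\<^sup>+T. e T * X t \<omega> * I t T * H (T - t) (Bc t \<omega>) \<partial>lborel \<partial>M)
      = (\<integral>\<^sup>+\<omega>. ennreal (exp (- p * t)) * ennreal (exp (m * inside_time t \<omega>)) * (ennreal (m * indicator {-1<..<1} (Bc t \<omega>)) * V (Bc t \<omega>)) \<partial>M) * indicator {0<..} t" .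
  qed
  finally show ?thesis .
qed

text \<open>For \<open>g = 1 + m * indicator {-1<..<1} * v\<close> the resolvent in
  \<open>fk_functional_identity\<close> returns \<open>v\<close> itself, by the integral equation.
  The same perturbation term then stands on both sides; being finite it cancels and leaves the
  functional of the constant 1.\<close>

lemma fk_functional_one:
  assumes l: "0 < l" and m: "0 < m"
  shows "fk_functional (l + m) m (\<lambda>_. 1) = ennreal (fk_solution l m z)"
proof -
  define p where "p = l + m"
  define v where "v = fk_solution l m"
  have p: "0 < p" using l m by (simp add: p_def)
  have v0: "0 \<le> v x" for x using fk_solution_nonneg[OF l m] by (simp add: v_def)
  have v[measurable]: "v \<in> borel_measurable borel" by (simp add: v_def)
  define h where "h x = ennreal (m * indicator {-1<..<1} x * v x)" for x
  define g where "g x = ennreal (1 + m * indicator {-1<..<1} x * v x)" for x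
  have hm [measurable]: "h \<in> borel_measurable borel" "g \<in> borel_measurable borel" unfolding h_def g_def by measurable
  have g_eq: "g x = 1 + h x" for x
    using v0[of x] m unfolding g_def h_def by (subst ennreal_plus) auto
  have V: "(\<integral>\<^sup>+y. ennreal (exp (- sqrt (2 * p) * \<bar>x - y\<bar>) / sqrt (2 * p)) * g y \<partial>lborel) = ennreal (v x)" for x
  proof -
    have "(\<integral>\<^sup>+y. ennreal (exp (- sqrt (2 * p) * \<bar>x - y\<bar>) / sqrt (2 * p)) * g y \<partial>lborel)
      = (\<integral>\<^sup>+y. ennreal (exp (- sqrt (2 * p) * \<bar>x - y\<bar>) / sqrt (2 * p) * (1 + m * indicator {-1<..<1} y * v y)) \<partial>lborel)"
      using v0 m p unfolding g_def by (intro nn_integral_cong ennreal_mult[symmetric]) auto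
    then show ?thesis using fk_solution_integral_equation[OF l m, of x] by (simp add: p_def v_def)
  qed
  have "fk_functional p m g = ennreal (v z) + fk_functional p m (\<lambda>x. ennreal (m * indicator {-1<..<1} x) * ennreal (v x))"
    using fk_functional_identity[OF p m hm(2)] unfolding V .
  also have "(\<lambda>x. ennreal (m * indicator {-1<..<1} x) * ennreal (v x)) = h"
    using v0 m by (auto simp: h_def ennreal_mult[symmetric] fun_eq_iff)
  finally have 1: "fk_functional p m g = ennreal (v z) + fk_functional p m h" .
  have 2: "fk_functional p m g = fk_functional p m (\<lambda>_. 1) + fk_functional p m h"
  proof -
    have "fk_functional p m g = (\<integral>\<^sup>+T. (\<integral>\<^sup>+\<omega>. ennreal (exp (- p * T)) * ennreal (exp (m * inside_time T \<omega>)) * 1 \<partial>M) * indicator {0<..} T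
       + (\<integral>\<^sup>+\<omega>. ennreal (exp (- p * T)) * ennreal (exp (m * inside_time T \<omega>)) * h (Bc T \<omega>) \<partial>M) * indicator {0<..} T \<partial>lborel)"
      unfolding fk_functional_def g_eq distrib_left distrib_right
    proof (rule nn_integral_cong)
      fix T :: real
      have "(\<integral>\<^sup>+\<omega>. ennreal (exp (- p * T)) * ennreal (exp (m * inside_time T \<omega>)) * 1 + ennreal (exp (- p * T)) * ennreal (exp (m * inside_time T \<omega>)) * h (Bc T \<omega>) \<partial>M)
        = (\<integral>\<^sup>+\<omega>. ennreal (exp (- p * T)) * ennreal (exp (m * inside_time T \<omega>)) * 1 \<partial>M) + (\<integral>\<^sup>+\<omega>. ennreal (exp (- p * T)) * ennreal (exp (m * inside_time T \<omega>)) * h (Bc T \<omega>) \<partial>M)"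
        by (rule nn_integral_add) measurable
      then show "(\<integral>\<^sup>+\<omega>. ennreal (exp (- p * T)) * ennreal (exp (m * inside_time T \<omega>)) * 1 + ennreal (exp (- p * T)) * ennreal (exp (m * inside_time T \<omega>)) * h (Bc T \<omega>) \<partial>M) * indicator {0<..} T
        = (\<integral>\<^sup>+\<omega>. ennreal (exp (- p * T)) * ennreal (exp (m * inside_time T \<omega>)) * 1 \<partial>M) * indicator {0<..} T + (\<integral>\<^sup>+\<omega>. ennreal (exp (- p * T)) * ennreal (exp (m * inside_time T \<omega>)) * h (Bc T \<omega>) \<partial>M) * indicator {0<..} T"
        by (simp only: distrib_right)
    qed
    also have "\<dots> = fk_functional p m (\<lambda>_. 1) + fk_functional p m h"
      unfolding fk_functional_def by (rule nn_integral_add) measurable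
    finally show ?thesis .
  qed
  \<comment> \<open>\<open>inside_time T \<omega> \<le> T\<close> reduces the growing weight to at
    most \<open>exp (- l * T)\<close>.\<close>
  have fin1: "fk_functional p m (\<lambda>_. 1) \<le> ennreal (1 / l)"
  proof -
    have "fk_functional p m (\<lambda>_. 1) \<le> (\<integral>\<^sup>+T. ennreal (exp (- l * T)) * indicator {0<..} T \<partial>lborel)"
      unfolding fk_functional_def
    proof (rule nn_integral_mono)
      fix T :: real
      show "(\<integral>\<^sup>+\<omega>. ennreal (exp (- p * T)) * ennreal (exp (m * inside_time T \<omega>)) * 1 \<partial>M) * indicator {0<..} T \<le> ennreal (exp (- l * T)) * indicator {0<..} T"
      proof (cases "0 < T")
        case True
        have "(\<integral>\<^sup>+\<omega>. ennreal (exp (- p * T)) * ennreal (exp (m * inside_time T \<omega>)) * 1 \<partial>M) \<le> (\<integral>\<^sup>+\<omega>. ennreal (exp (- l * T)) \<partial>M)"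
        proof (rule nn_integral_mono)
          fix \<omega> assume w: "\<omega> \<in> space M"
          have "m * inside_time T \<omega> \<le> m * T" using inside_time_properties(3)[OF w m, of T] True m by simp
          then have "exp (- p * T + m * inside_time T \<omega>) \<le> exp (- l * T)" by (simp add: p_def algebra_simps)
          then have "exp (- p * T) * exp (m * inside_time T \<omega>) \<le> exp (- l * T)" by (simp only: exp_add)
          then show "ennreal (exp (- p * T)) * ennreal (exp (m * inside_time T \<omega>)) * 1 \<le> ennreal (exp (- l * T))"
            by (simp add: ennreal_mult[symmetric])
        qed
        then show ?thesis using True by (simp add: emeasure_space_1)
      qed simp
    qed
    also have "\<dots> \<le> (\<integral>\<^sup>+T. ennreal (exp (- l * T)) * indicator {0..} T \<partial>lborel)"
      by (rule nn_integral_mono) (auto simp: indicator_def)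
    also have "\<dots> = ennreal (1 / l)"
      using has_integral_exp_minus_to_infinity[OF l, of 0] by (intro nn_integral_has_integral_lebesgue') auto
    finally show ?thesis .
  qed
  have finh: "fk_functional p m h \<noteq> \<infinity>"
  proof -
    define K where "K = 1 / l"
    have K: "v x \<le> K" if "\<bar>x\<bar> < 1" for x
      using fk_solution_le_inside[OF l m that] by (simp add: v_def K_def)
    have K0: "0 \<le> K" using v0[of 0] K[of 0] by linarith
    have "fk_functional p m h \<le> (\<integral>\<^sup>+T. ennreal (m * K) * ((\<integral>\<^sup>+\<omega>. ennreal (exp (- p * T)) * ennreal (exp (m * inside_time T \<omega>)) * 1 \<partial>M) * indicator {0<..} T) \<partial>lborel)"
      unfolding fk_functional_def
    proof (rule nn_integral_mono)
      fix T :: real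
      have "(\<integral>\<^sup>+\<omega>. ennreal (exp (- p * T)) * ennreal (exp (m * inside_time T \<omega>)) * h (Bc T \<omega>) \<partial>M)
        \<le> (\<integral>\<^sup>+\<omega>. ennreal (m * K) * (ennreal (exp (- p * T)) * ennreal (exp (m * inside_time T \<omega>)) * 1) \<partial>M)"
      proof (rule nn_integral_mono)
        fix \<omega>
        have "h (Bc T \<omega>) \<le> ennreal (m * K)"
          unfolding h_def using K[of "Bc T \<omega>"] K0 m by (intro ennreal_leI) (auto simp: indicator_def)
        then show "ennreal (exp (- p * T)) * ennreal (exp (m * inside_time T \<omega>)) * h (Bc T \<omega>) \<le> ennreal (m * K) * (ennreal (exp (- p * T)) * ennreal (exp (m * inside_time T \<omega>)) * 1)"
          using mult_right_mono[OF _ zero_le, of "h (Bc T \<omega>)" "ennreal (m * K)" "ennreal (exp (- p * T)) * ennreal (exp (m * inside_time T \<omega>))"]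
          by (simp add: mult_ac)
      qed
      also have "\<dots> = ennreal (m * K) * (\<integral>\<^sup>+\<omega>. (ennreal (exp (- p * T)) * ennreal (exp (m * inside_time T \<omega>)) * 1) \<partial>M)"
        by (rule nn_integral_cmult) measurable
      finally show "(\<integral>\<^sup>+\<omega>. ennreal (exp (- p * T)) * ennreal (exp (m * inside_time T \<omega>)) * h (Bc T \<omega>) \<partial>M) * indicator {0<..} T
        \<le> ennreal (m * K) * ((\<integral>\<^sup>+\<omega>. ennreal (exp (- p * T)) * ennreal (exp (m * inside_time T \<omega>)) * 1 \<partial>M) * indicator {0<..} T)"
        by (simp add: indicator_def)
    qed
    also have "\<dots> = ennreal (m * K) * fk_functional p m (\<lambda>_. 1)"
      unfolding fk_functional_def by (rule nn_integral_cmult) measurable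
    also have "\<dots> < \<infinity>" using fin1 by (simp add: ennreal_mult_less_top le_less_trans)
    finally show ?thesis by simp
  qed
  have "fk_functional p m (\<lambda>_. 1) = ennreal (v z)"
    using 1 2 finh by (metis add.commute ennreal_add_left_cancel infinity_ennreal_def)
  then show ?thesis by (simp add: p_def v_def)
qed

lemma laplace_exp_occupation_time:
  assumes l: "0 < l" and m: "0 < m"
  shows "(\<integral>\<^sup>+T. (\<integral>\<^sup>+\<omega>. ennreal (exp (- l * T)) * ennreal (exp (- m * occupation_time B T \<omega>)) \<partial>M) * indicator {0<..} T \<partial>lborel)
    = ennreal (fk_solution l m z)"
  unfolding fk_functional_one[OF l m, symmetric] fk_functional_def
proof (rule nn_integral_cong)
  fix T :: real
  show "(\<integral>\<^sup>+\<omega>. ennreal (exp (- l * T)) * ennreal (exp (- m * occupation_time B T \<omega>)) \<partial>M) * indicator {0<..} T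
    = (\<integral>\<^sup>+\<omega>. ennreal (exp (- (l + m) * T)) * ennreal (exp (m * inside_time T \<omega>)) * 1 \<partial>M) * indicator {0<..} T"
  proof (cases "0 < T")
    case True
    have "(\<integral>\<^sup>+\<omega>. ennreal (exp (- l * T)) * ennreal (exp (- m * occupation_time B T \<omega>)) \<partial>M)
      = (\<integral>\<^sup>+\<omega>. ennreal (exp (- (l + m) * T)) * ennreal (exp (m * inside_time T \<omega>)) * 1 \<partial>M)"
    proof (rule nn_integral_cong)
      fix \<omega> assume w: "\<omega> \<in> space M"
      have "- l * T + - m * occupation_time B T \<omega> = - (l + m) * T + m * inside_time T \<omega>"
        unfolding inside_time_properties(4)[OF w m less_imp_le[OF True]] by (simp add: algebra_simps)
      then show "ennreal (exp (- l * T)) * ennreal (exp (- m * occupation_time B T \<omega>)) = ennreal (exp (- (l + m) * T)) * ennreal (exp (m * inside_time T \<omega>)) * 1"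
        by (simp add: ennreal_mult[symmetric] exp_add[symmetric])
    qed
    then show ?thesis by simp
  qed simp
qed

end

section \<open>The Laplace transform of the distribution function\<close>

text \<open>For \<open>a = sqrt (2 * l)\<close> this is the transform at \<open>l\<close> of the
  first hitting time of \<open>{-1, 1}\<close>. The type is left general so that the real formula
  and its analytic continuation are instances of one definition.\<close>

definition exit_factor :: "real \<Rightarrow> 'a::{real_normed_field,banach} \<Rightarrow> 'a" where
  "exit_factor x a = (if \<bar>x\<bar> < 1 then cosh (of_real x * a) / cosh a else 1)"

text \<open>The Laplace transform of \<open>max 0 (\<bar>N\<bar> - d)\<close> for a centred normal \<open>N\<close> of variance \<open>s\<close>.\<close>

definition half_normal_laplace :: "real \<Rightarrow> real \<Rightarrow> 'a::{real_normed_field,banach,second_countable_topology} \<Rightarrow> 'a" where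
  "half_normal_laplace s d \<theta> = (LBINT l:{0..}. of_real (2 * normal_density 0 (sqrt s) l) * exp (- \<theta> * of_real (max 0 (l - d))))"

lemma half_normal_integral:
  assumes s: "0 < s"
  shows "set_integrable lborel {0..} (\<lambda>l. 2 * normal_density 0 (sqrt s) l)"
    and "(LBINT l:{0..}. 2 * normal_density 0 (sqrt s) l) = 1"
proof -
  let ?f = "normal_density 0 (sqrt s)"
  have i: "integrable lborel ?f" using s by simp
  have i': "set_integrable lborel A (\<lambda>l. ?f l)" if "A \<in> sets borel" for A
    using integrable_mult_indicator[OF _ i, of A] that by (simp add: set_integrable_def)
  show "set_integrable lborel {0..} (\<lambda>l. 2 * ?f l)" using i'[of "{0..}"] by (intro set_integrable_mult_right) auto
  have neg: "(LBINT l:{..0}. ?f l) = (LBINT l:{0..}. ?f l)"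
    unfolding set_lebesgue_integral_def
    by (subst lborel_integral_real_affine[where c="-1" and t=0]) (auto simp: normal_density_def indicator_def intro!: Bochner_Integration.integral_cong)
  have "1 = (LBINT l. ?f l)" using s by simp
  also have "\<dots> = (LBINT l. indicator {..0} l *\<^sub>R ?f l + indicator {0..} l *\<^sub>R ?f l)"
  proof (rule integral_cong_AE)
    show "AE l in lborel. ?f l = indicator {..0} l *\<^sub>R ?f l + indicator {0..} l *\<^sub>R ?f l"
      using AE_lborel_singleton[of 0] by eventually_elim (auto simp: indicator_def)
  qed measurable
  also have "\<dots> = (LBINT l:{..0}. ?f l) + (LBINT l:{0..}. ?f l)"
    unfolding set_lebesgue_integral_def
    by (rule Bochner_Integration.integral_add) (use i'[of "{..0}"] i'[of "{0..}"] in \<open>auto simp: set_integrable_def\<close>)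
  finally show "(LBINT l:{0..}. 2 * ?f l) = 1" unfolding neg by (simp add: set_integral_mult_right)
qed

lemma half_normal_laplace_real:
  fixes \<theta> :: real
  assumes s: "0 < s" and \<theta>: "0 \<le> \<theta>"
  shows "set_integrable lborel {0..} (\<lambda>l. 2 * normal_density 0 (sqrt s) l * exp (- \<theta> * max 0 (l - d)))"
    and "0 \<le> half_normal_laplace s d \<theta>" and "half_normal_laplace s d \<theta> \<le> 1"
proof -
  have le: "2 * normal_density 0 (sqrt s) l * exp (- \<theta> * max 0 (l - d)) \<le> 2 * normal_density 0 (sqrt s) l" for l
    using \<theta> by (intro mult_left_le) (auto intro!: mult_nonneg_nonneg)
  show i: "set_integrable lborel {0..} (\<lambda>l. 2 * normal_density 0 (sqrt s) l * exp (- \<theta> * max 0 (l - d)))"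
  proof (rule set_integrable_bound[OF half_normal_integral(1)[OF s]])
    show "set_borel_measurable lborel {0..} (\<lambda>l. 2 * normal_density 0 (sqrt s) l * exp (- \<theta> * max 0 (l - d)))"
      unfolding set_borel_measurable_def by measurable
  qed (use le in \<open>auto intro!: AE_I2 simp: abs_mult\<close>)
  show "0 \<le> half_normal_laplace s d \<theta>"
    unfolding half_normal_laplace_def set_lebesgue_integral_def by (intro integral_nonneg_AE) auto
  have "(LBINT l:{0..}. 2 * normal_density 0 (sqrt s) l * exp (- \<theta> * max 0 (l - d))) \<le> (LBINT l:{0..}. 2 * normal_density 0 (sqrt s) l)"
    by (rule set_integral_mono[OF i half_normal_integral(1)[OF s]]) (use le in auto)
  then show "half_normal_laplace s d \<theta> \<le> 1"
    unfolding half_normal_laplace_def using half_normal_integral(2)[OF s] by simp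
qed

text \<open>The variance \<open>s\<close> plays the role of time in
  \<open>laplace_heat_kernel\<close>. What remains is an elementary exponential integral in
  \<open>l\<close>, split at \<open>d\<close>.\<close>

lemma nn_integral_half_normal_laplace:
  fixes \<theta> p d :: real
  assumes p: "0 < p" and \<theta>: "0 \<le> \<theta>" and d: "0 \<le> d"
  defines "b \<equiv> sqrt (2 * p)"
  shows "(\<integral>\<^sup>+s. ennreal (exp (- p * s) * half_normal_laplace s d \<theta>) * indicator {0<..} s \<partial>lborel)
    = ennreal (2 / b * ((1 - exp (- b * d)) / b + exp (- b * d) / (b + \<theta>)))"
proof -
  have b: "0 < b" using p by (simp add: b_def)
  let ?E = "\<lambda>l. exp (- \<theta> * max 0 (l - d))"
  have "(\<integral>\<^sup>+s. ennreal (exp (- p * s) * half_normal_laplace s d \<theta>) * indicator {0<..} s \<partial>lborel)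
    = (\<integral>\<^sup>+s. (\<integral>\<^sup>+l. ennreal (exp (- p * s) * normal_density 0 (sqrt s) l) * indicator {0<..} s * (ennreal (2 * ?E l) * indicator {0..} l) \<partial>lborel) \<partial>lborel)"
  proof (rule nn_integral_cong)
    fix s :: real
    show "ennreal (exp (- p * s) * half_normal_laplace s d \<theta>) * indicator {0<..} s
      = (\<integral>\<^sup>+l. ennreal (exp (- p * s) * normal_density 0 (sqrt s) l) * indicator {0<..} s * (ennreal (2 * ?E l) * indicator {0..} l) \<partial>lborel)"
    proof (cases "0 < s")
      case True
      have "(\<integral>\<^sup>+l. ennreal (exp (- p * s) * normal_density 0 (sqrt s) l) * indicator {0<..} s * (ennreal (2 * ?E l) * indicator {0..} l) \<partial>lborel)
        = (\<integral>\<^sup>+l. ennreal (exp (- p * s)) * ennreal (indicator {0..} l *\<^sub>R (2 * normal_density 0 (sqrt s) l * ?E l)) \<partial>lborel)"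
        using True by (intro nn_integral_cong) (auto simp: ennreal_mult'[symmetric] indicator_def mult_ac)
      also have "\<dots> = ennreal (exp (- p * s)) * (\<integral>\<^sup>+l. ennreal (indicator {0..} l *\<^sub>R (2 * normal_density 0 (sqrt s) l * ?E l)) \<partial>lborel)"
        by (rule nn_integral_cmult) measurable
      also have "(\<integral>\<^sup>+l. ennreal (indicator {0..} l *\<^sub>R (2 * normal_density 0 (sqrt s) l * ?E l)) \<partial>lborel) = ennreal (half_normal_laplace s d \<theta>)"
        using half_normal_laplace_real(1)[OF True \<theta>, of d] unfolding half_normal_laplace_def set_lebesgue_integral_def set_integrable_def
        by (subst nn_integral_eq_integral) auto
      finally show ?thesis using True half_normal_laplace_real(2)[OF True \<theta>, of d] by (simp add: ennreal_mult)
    qed simp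
  qed
  also have "\<dots> = (\<integral>\<^sup>+l. (\<integral>\<^sup>+s. ennreal (exp (- p * s) * normal_density 0 (sqrt s) l) * indicator {0<..} s * (ennreal (2 * ?E l) * indicator {0..} l) \<partial>lborel) \<partial>lborel)"
    unfolding normal_density_def by (rule lborel_pair.Fubini') measurable
  also have "\<dots> = (\<integral>\<^sup>+l. ennreal (2 / b * (exp (- b * l) * ?E l)) * indicator {0..} l \<partial>lborel)"
  proof (rule nn_integral_cong_AE)
    show "AE l in lborel. (\<integral>\<^sup>+s. ennreal (exp (- p * s) * normal_density 0 (sqrt s) l) * indicator {0<..} s * (ennreal (2 * ?E l) * indicator {0..} l) \<partial>lborel)
      = ennreal (2 / b * (exp (- b * l) * ?E l)) * indicator {0..} l"
      using AE_lborel_singleton[of 0]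
    proof eventually_elim
      case (elim l)
      have "(\<integral>\<^sup>+s. ennreal (exp (- p * s) * normal_density 0 (sqrt s) l) * indicator {0<..} s * (ennreal (2 * ?E l) * indicator {0..} l) \<partial>lborel)
        = (\<integral>\<^sup>+s. ennreal (exp (- p * s) * normal_density 0 (sqrt s) l) * indicator {0<..} s \<partial>lborel) * (ennreal (2 * ?E l) * indicator {0..} l)"
        unfolding normal_density_def by (rule nn_integral_multc) measurable
      also have "\<dots> = ennreal (exp (- b * \<bar>l\<bar>) / b) * (ennreal (2 * ?E l) * indicator {0..} l)"
        using laplace_heat_kernel[OF p elim] by (simp add: b_def)
      also have "\<dots> = ennreal (2 / b * (exp (- b * l) * ?E l)) * indicator {0..} l"
        using b by (auto simp: indicator_def ennreal_mult'[symmetric])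
      finally show ?case .
    qed
  qed
  also have "\<dots> = ennreal (2 / b * ((1 - exp (- b * d)) / b + exp (- b * d) / (b + \<theta>)))"
  proof (rule nn_integral_has_integral_lebesgue')
    have 1: "((\<lambda>l. exp (- b * l) * ?E l) has_integral (1 - exp (- b * d)) / b) {0..d}"
    proof (rule has_integral_eq)
      have "((\<lambda>l. exp (- b * l)) has_integral - exp (- b * d) / b - (- exp (- b * 0) / b)) {0..d}"
        using b d by (intro fundamental_theorem_of_calculus)
          (auto intro!: derivative_eq_intros simp: has_real_derivative_iff_has_vector_derivative[symmetric])
      then show "((\<lambda>l. exp (- b * l)) has_integral (1 - exp (- b * d)) / b) {0..d}" by (simp add: diff_divide_distrib)
    qed auto
    have 2: "((\<lambda>l. exp (- b * l) * ?E l) has_integral exp (- b * d) / (b + \<theta>)) {d..}"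
    proof (rule has_integral_eq)
      have bt: "0 < b + \<theta>" using b \<theta> by simp
      have "((\<lambda>l. exp (\<theta> * d) * exp (- (b + \<theta>) * l)) has_integral exp (\<theta> * d) * (exp (- (b + \<theta>) * d) / (b + \<theta>))) {d..}"
        by (intro has_integral_mult_right has_integral_exp_minus_to_infinity bt)
      also have "exp (\<theta> * d) * (exp (- (b + \<theta>) * d) / (b + \<theta>)) = exp (- b * d) / (b + \<theta>)"
        by (simp add: exp_add[symmetric] algebra_simps)
      finally show "((\<lambda>l. exp (\<theta> * d) * exp (- (b + \<theta>) * l)) has_integral exp (- b * d) / (b + \<theta>)) {d..}" .
    qed (auto simp: exp_add[symmetric] algebra_simps)
    have "{0..} = {0..d} \<union> {d..}" using d by auto
    moreover have "negligible ({0..d} \<inter> {d..})" using d by (auto intro: negligible_subset[of "{d}"])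
    ultimately have "((\<lambda>l. exp (- b * l) * ?E l) has_integral (1 - exp (- b * d)) / b + exp (- b * d) / (b + \<theta>)) {0..}"
      using has_integral_Un[OF 1 2] by simp
    then show "((\<lambda>l. 2 / b * (exp (- b * l) * ?E l)) has_integral 2 / b * ((1 - exp (- b * d)) / b + exp (- b * d) / (b + \<theta>))) {0..}"
      by (rule has_integral_mult_right)
  qed (use b in auto)
  finally show ?thesis .
qed

text \<open>This is \<open>\<integral> exp (- m * s) * P (\<Gamma> > s) ds = (1 - E exp (- m *
  \<Gamma>)) / m\<close> after transformation in \<open>T\<close>, with the candidate for
  \<open>P (\<Gamma> > s)\<close> inserted: the first summand is its double transform, where the
  factor \<open>exp (- l * s)\<close> has shifted \<open>m\<close> to \<open>l + m\<close>.\<close>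

lemma fk_solution_tail:
  fixes l m x :: real
  assumes l: "0 < l" and m: "0 < m"
  defines "a \<equiv> sqrt (2 * l)" and "b \<equiv> sqrt (2 * (l + m))" and "d \<equiv> max 0 (\<bar>x\<bar> - 1)"
  shows "exit_factor x a / l * (2 / b * ((1 - exp (- b * d)) / b + exp (- b * d) / (b + a * tanh a))) + fk_solution l m x / m = 1 / (l * m)"
proof -
  define C where "C = cosh a"
  define S where "S = sinh a"
  have a: "0 < a" "l = a\<^sup>2 / 2" using l by (auto simp: a_def)
  have b: "0 < b" "l + m = b\<^sup>2 / 2" using l m by (auto simp: b_def)
  have C: "0 < C" by (simp add: C_def)
  have S: "0 < S" using a by (simp add: S_def)
  have Q: "b * C + a * S \<noteq> 0" using a b C S by (simp add: add_pos_pos less_imp_neq[symmetric])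
  have m': "m = (b\<^sup>2 - a\<^sup>2) / 2" using a b by simp
  have mnz: "b\<^sup>2 - a\<^sup>2 \<noteq> 0" using m m' by auto
  have tnh: "a * tanh a = a * S / C" by (simp add: tanh_def C_def S_def)
  have bt: "b + a * tanh a = (b * C + a * S) / C" unfolding tnh using C by (simp add: field_simps)
  show ?thesis
  proof (cases "\<bar>x\<bar> < 1")
    case True
    then have "d = 0" by (simp add: d_def)
    then have "2 / b * ((1 - exp (- b * d)) / b + exp (- b * d) / (b + a * tanh a)) = 2 * C / (b * (b * C + a * S))"
      unfolding bt by simp
    moreover have "exit_factor x a = cosh (a * x) / C" using True by (simp add: exit_factor_def C_def mult.commute)
    moreover have "fk_solution l m x = 1 / l - 4 * m / (a\<^sup>2 * b * (b * C + a * S)) * cosh (a * x)"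
      using True unfolding fk_solution_def Let_def a_def[symmetric] b_def[symmetric] C_def S_def by simp
    moreover have "cosh (a * x) / C / l * (2 * C / (b * (b * C + a * S))) + (1 / l - 4 * m / (a\<^sup>2 * b * (b * C + a * S)) * cosh (a * x)) / m
      = 1 / (l * m) + (cosh (a * x) / (b * (b * C + a * S))) * (2 / l - 4 / a\<^sup>2)"
      using C m Q b(1) l a(1) by (simp add: diff_divide_distrib right_diff_distrib) (simp add: mult_ac)
    moreover have "2 / l - 4 / a\<^sup>2 = 0" unfolding a(2) using a(1) by simp
    ultimately show ?thesis by simp
  next
    case False
    then have d: "d = \<bar>x\<bar> - 1" by (simp add: d_def)
    define E where "E = exp (- b * d)"
    have "fk_solution l m x = 1 / (l + m) + 4 * m * a * S / (a\<^sup>2 * b\<^sup>2 * (b * C + a * S)) * E"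
      using False unfolding fk_solution_def Let_def a_def[symmetric] b_def[symmetric] C_def S_def E_def d by simp
    moreover have "exit_factor x a = 1" using False by (simp add: exit_factor_def)
    moreover have "1 / l * (2 / b * ((1 - E) / b + E / ((b * C + a * S) / C))) + (1 / (l + m) + 4 * m * a * S / (a\<^sup>2 * b\<^sup>2 * (b * C + a * S)) * E) / m
      = 1 / (l * m)"
    proof -
      have i: "2 / b * ((1 - E) / b + E / ((b * C + a * S) / C)) = 2 / b\<^sup>2 - 2 * E * a * S / (b\<^sup>2 * (b * C + a * S))"
      proof -
        define q where "q = b * C + a * S"
        have q: "q \<noteq> 0" using Q by (simp add: q_def)
        have "2 / b * ((1 - E) / b + E / (q / C)) = 2 / b\<^sup>2 - 2 * E * (q - b * C) / (b\<^sup>2 * q)"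
          using b(1) q C by (simp add: divide_simps power2_eq_square) (simp add: algebra_simps)
        then show ?thesis by (simp add: q_def mult.assoc)
      qed
      have ii: "(1 / (l + m) + 4 * m * a * S / (a\<^sup>2 * b\<^sup>2 * (b * C + a * S)) * E) / m = 1 / ((l + m) * m) + 4 * a * S * E / (a\<^sup>2 * b\<^sup>2 * (b * C + a * S))"
        using m by (simp add: add_divide_distrib)
      have iii: "1 / l * (2 / b\<^sup>2) + 1 / ((l + m) * m) = 1 / (l * m)"
      proof -
        have "2 / b\<^sup>2 = 1 / (l + m)" unfolding b(2) by simp
        then have "1 / l * (2 / b\<^sup>2) + 1 / ((l + m) * m) = 1 / l * (1 / (l + m)) + 1 / ((l + m) * m)" by (simp only:)
        also have "\<dots> = 1 / (l * m)" using l m add_pos_pos[OF l m] by (simp add: divide_simps)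
        finally show ?thesis .
      qed
      have iv: "1 / l * (2 * E * a * S / (b\<^sup>2 * (b * C + a * S))) = 4 * a * S * E / (a\<^sup>2 * b\<^sup>2 * (b * C + a * S))"
        unfolding a(2) by (simp add: mult_ac)
      show ?thesis unfolding i ii using iii iv by (simp only: right_diff_distrib)
    qed
    ultimately show ?thesis unfolding bt E_def[symmetric] by simp
  qed
qed

text \<open>Along a decreasing sequence of variances \<open>S 0\<close> has the widest tail and
  \<open>s\<close> the largest normalising factor; together they give the dominating
  function.\<close>

lemma half_normal_laplace_right_continuous:
  fixes \<theta> :: real
  assumes s: "0 < s" and \<theta>: "0 \<le> \<theta>" and S: "\<And>n. s < S n" "decseq S" "S \<longlonglongrightarrow> s"
  shows "(\<lambda>n. half_normal_laplace (S n) d \<theta>) \<longlonglongrightarrow> half_normal_laplace s d \<theta>"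
  unfolding half_normal_laplace_def set_lebesgue_integral_def of_real_eq_id id_apply
proof (rule integral_dominated_convergence[where w="\<lambda>l. 2 * (sqrt (S 0) / sqrt s) * normal_density 0 (sqrt (S 0)) l"])
  show "integrable lborel (\<lambda>l. 2 * (sqrt (S 0) / sqrt s) * normal_density 0 (sqrt (S 0)) l)"
    using s S(1)[of 0] by (intro integrable_mult_right) simp
  show "AE l in lborel. (\<lambda>n. indicator {0..} l *\<^sub>R (2 * normal_density 0 (sqrt (S n)) l * exp (- \<theta> * max 0 (l - d))))
    \<longlonglongrightarrow> indicator {0..} l *\<^sub>R (2 * normal_density 0 (sqrt s) l * exp (- \<theta> * max 0 (l - d)))"
    unfolding normal_density_def using s S(3) by (intro AE_I2 tendsto_intros) (auto simp: S)
  show "AE l in lborel. norm (indicator {0..} l *\<^sub>R (2 * normal_density 0 (sqrt (S n)) l * exp (- \<theta> * max 0 (l - d))))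
    \<le> 2 * (sqrt (S 0) / sqrt s) * normal_density 0 (sqrt (S 0)) l" for n
  proof (rule AE_I2)
    fix l :: real
    have n: "0 < S n" "s \<le> S n" "S n \<le> S 0" using S(1)[of n] s decseqD[OF S(2), of 0 n] by auto
    have "normal_density 0 (sqrt (S n)) l \<le> sqrt (S 0) / sqrt s * normal_density 0 (sqrt (S 0)) l"
    proof -
      have "1 / sqrt (2 * pi * S n) \<le> 1 / sqrt (2 * pi * s)" using n s by (intro divide_left_mono) auto
      moreover have "exp (- l\<^sup>2 / (2 * S n)) \<le> exp (- l\<^sup>2 / (2 * S 0))" using n s by (simp add: frac_le)
      ultimately have "1 / sqrt (2 * pi * S n) * exp (- l\<^sup>2 / (2 * S n)) \<le> 1 / sqrt (2 * pi * s) * exp (- l\<^sup>2 / (2 * S 0))"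
        using n s by (intro mult_mono) auto
      also have "1 / sqrt (2 * pi * s) = sqrt (S 0) / sqrt s * (1 / sqrt (2 * pi * S 0))"
        using n s by (simp add: real_sqrt_mult)
      finally show ?thesis using n by (simp add: normal_density_def)
    qed
    moreover have "2 * normal_density 0 (sqrt (S n)) l * exp (- \<theta> * max 0 (l - d)) \<le> 2 * normal_density 0 (sqrt (S n)) l"
      using \<theta> by (intro mult_left_le) (auto intro!: mult_nonneg_nonneg)
    moreover have "norm (indicator {0..} l *\<^sub>R (2 * normal_density 0 (sqrt (S n)) l * exp (- \<theta> * max 0 (l - d))))
      \<le> 2 * normal_density 0 (sqrt (S n)) l * exp (- \<theta> * max 0 (l - d))"
      by (auto simp: indicator_def abs_mult)
    ultimately show "norm (indicator {0..} l *\<^sub>R (2 * normal_density 0 (sqrt (S n)) l * exp (- \<theta> * max 0 (l - d))))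
    \<le> 2 * (sqrt (S 0) / sqrt s) * normal_density 0 (sqrt (S 0)) l" by linarith
  qed
qed measurable

section \<open>The distribution function of the occupation time\<close>

context brownian_motion
begin

text \<open>Agrees with \<open>occupation_time\<close> on \<open>space M\<close> and is jointly measurable and nonnegative everywhere.\<close>

definition outside_time :: "real \<Rightarrow> 'w \<Rightarrow> real" where
  "outside_time T \<omega> = max 0 (T - inside_time T \<omega>)"

lemma outside_time_nonneg: "0 \<le> outside_time T \<omega>" by (simp add: outside_time_def)

lemma outside_time_eq: "\<omega> \<in> space M \<Longrightarrow> 0 \<le> T \<Longrightarrow> occupation_time B T \<omega> = outside_time T \<omega>"
  using inside_time_properties(3,4)[of \<omega> 1 T] by (simp add: outside_time_def)

lemma measurable_outside_time [measurable (raw)]: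
  assumes [measurable]: "k \<in> borel_measurable N" "h \<in> measurable N M"
  shows "(\<lambda>x. outside_time (k x) (h x)) \<in> borel_measurable N"
  unfolding outside_time_def by measurable

text \<open>Written as an integral of an indicator, so that joint measurability in \<open>s\<close>
  and \<open>T\<close> follows from measurability of parametrised integrals.\<close>

definition surplus :: "real \<Rightarrow> real \<Rightarrow> real" where
  "surplus s T = (LINT \<omega>|M. indicator {s<..} (outside_time T \<omega>))"

lemma measurable_surplus [measurable (raw)]:
  assumes [measurable]: "k \<in> borel_measurable N" "h \<in> borel_measurable N"
  shows "(\<lambda>x. surplus (k x) (h x)) \<in> borel_measurable N"
proof -
  have "(\<lambda>x. LINT \<omega>|M. (if k x < outside_time (h x) \<omega> then 1 else 0 :: real)) \<in> borel_measurable N"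
    by measurable
  also have "(\<lambda>x. LINT \<omega>|M. (if k x < outside_time (h x) \<omega> then 1 else 0 :: real)) = (\<lambda>x. surplus (k x) (h x))"
    unfolding surplus_def by (intro ext Bochner_Integration.integral_cong) (auto simp: indicator_def)
  finally show ?thesis .
qed

lemma surplus_prob: "surplus s T = \<P>(\<omega> in M. s < outside_time T \<omega>)"
proof -
  have "surplus s T = (LINT \<omega>|M. indicator {\<omega> \<in> space M. s < outside_time T \<omega>} \<omega>)"
    unfolding surplus_def by (intro Bochner_Integration.integral_cong) (auto simp: indicator_def)
  then show ?thesis by simp
qed

lemma surplus_bounds: "0 \<le> surplus s T" "surplus s T \<le> 1"
  by (simp_all add: surplus_prob)

lemma surplus_nn: "ennreal (surplus s T) = (\<integral>\<^sup>+\<omega>. indicator {s<..} (outside_time T \<omega>) \<partial>M)"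
proof -
  have "(\<integral>\<^sup>+\<omega>. indicator {s<..} (outside_time T \<omega>) \<partial>M) = (\<integral>\<^sup>+\<omega>. indicator {\<omega> \<in> space M. s < outside_time T \<omega>} \<omega> \<partial>M)"
    by (intro nn_integral_cong) (auto simp: indicator_def)
  then show ?thesis by (simp add: surplus_prob emeasure_eq_measure)
qed

text \<open>Integrating \<open>exp (- m * s)\<close> over \<open>0 < s < \<Gamma>\<close> gives
  \<open>(1 - exp (- m * \<Gamma>)) / m\<close>. The equation is stated as a sum because both terms
  are nonnegative integrals in \<open>ennreal\<close>.\<close>

lemma surplus_laplace:
  assumes l: "0 < l" and m: "0 < m"
  shows "(\<integral>\<^sup>+s. \<integral>\<^sup>+T. ennreal (exp (- m * s) * exp (- l * T) * surplus s T) * indicator {0<..} T * indicator {0<..} s \<partial>lborel \<partial>lborel)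
    + ennreal (fk_solution l m z / m) = ennreal (1 / (l * m))"
proof -
  interpret PM: pair_sigma_finite M lborel
    by (intro pair_sigma_finite.intro sigma_finite_measure_axioms lborel.sigma_finite_measure_axioms)
  have tail: "(\<integral>\<^sup>+s. ennreal (exp (- m * s)) * indicator {s<..} g * indicator {0<..} s \<partial>lborel) + ennreal (exp (- m * g) / m) = ennreal (1 / m)"
    if g: "0 \<le> g" for g :: real
  proof -
    have 1: "(\<integral>\<^sup>+s. ennreal (exp (- m * s)) * indicator {g..} s \<partial>lborel) = ennreal (exp (- m * g) / m)"
      using has_integral_exp_minus_to_infinity[OF m, of g] by (intro nn_integral_has_integral_lebesgue') auto
    have 2: "(\<integral>\<^sup>+s. ennreal (exp (- m * s)) * indicator {0..} s \<partial>lborel) = ennreal (1 / m)"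
      using has_integral_exp_minus_to_infinity[OF m, of 0] by (intro nn_integral_has_integral_lebesgue') auto
    have meas: "(\<lambda>s. ennreal (exp (- m * s)) * indicator {s<..} g * indicator {0<..} s) \<in> borel_measurable lborel"
    proof -
      have "(\<lambda>s. ennreal (exp (- m * s)) * indicator {..<g} s * indicator {0<..} s) \<in> borel_measurable lborel" by measurable
      then show ?thesis by (simp add: indicator_def)
    qed
    have "(\<integral>\<^sup>+s. ennreal (exp (- m * s)) * indicator {s<..} g * indicator {0<..} s \<partial>lborel) + (\<integral>\<^sup>+s. ennreal (exp (- m * s)) * indicator {g..} s \<partial>lborel)
      = (\<integral>\<^sup>+s. ennreal (exp (- m * s)) * indicator {s<..} g * indicator {0<..} s + ennreal (exp (- m * s)) * indicator {g..} s \<partial>lborel)"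
      by (rule nn_integral_add[symmetric]) (use meas in measurable)
    also have "\<dots> = (\<integral>\<^sup>+s. ennreal (exp (- m * s)) * indicator {0..} s \<partial>lborel)"
      by (rule nn_integral_cong_AE) (use AE_lborel_singleton[of 0] in \<open>eventually_elim, use g in \<open>auto simp: indicator_def\<close>\<close>)
    finally show ?thesis unfolding 1 2 .
  qed
  define I where "I s \<omega> T = ennreal (exp (- m * s)) * indicator {s<..} (outside_time T \<omega>) * indicator {0<..} s" for s \<omega> T
  have I[measurable (raw)]: "(\<lambda>x. I (k x) (h x) (j x)) \<in> borel_measurable N"
    if [measurable]: "k \<in> borel_measurable N" "h \<in> measurable N M" "j \<in> borel_measurable N" for k h j and N :: "'n measure"
  proof -
    have "(\<lambda>x. ennreal (exp (- m * k x)) * (if k x < outside_time (j x) (h x) then 1 else 0) * indicator {0<..} (k x)) \<in> borel_measurable N"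
      by measurable
    also have "(\<lambda>x. ennreal (exp (- m * k x)) * (if k x < outside_time (j x) (h x) then 1 else 0) * indicator {0<..} (k x)) = (\<lambda>x. I (k x) (h x) (j x))"
      by (auto simp: I_def indicator_def fun_eq_iff)
    finally show ?thesis .
  qed
  let ?e = "\<lambda>T. ennreal (exp (- l * T)) * indicator {0<..} T"
  have "(\<integral>\<^sup>+s. \<integral>\<^sup>+T. ennreal (exp (- m * s) * exp (- l * T) * surplus s T) * indicator {0<..} T * indicator {0<..} s \<partial>lborel \<partial>lborel)
    = (\<integral>\<^sup>+s. \<integral>\<^sup>+T. ?e T * (\<integral>\<^sup>+\<omega>. I s \<omega> T \<partial>M) \<partial>lborel \<partial>lborel)"
  proof (rule nn_integral_cong, rule nn_integral_cong)
    fix s T :: real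
    have "(\<integral>\<^sup>+\<omega>. I s \<omega> T \<partial>M) = (\<integral>\<^sup>+\<omega>. (ennreal (exp (- m * s)) * indicator {0<..} s) * indicator {s<..} (outside_time T \<omega>) \<partial>M)"
      by (intro nn_integral_cong) (simp add: I_def mult_ac)
    also have "\<dots> = (ennreal (exp (- m * s)) * indicator {0<..} s) * ennreal (surplus s T)"
      unfolding surplus_nn by (rule nn_integral_cmult) measurable
    finally show "ennreal (exp (- m * s) * exp (- l * T) * surplus s T) * indicator {0<..} T * indicator {0<..} s = ?e T * (\<integral>\<^sup>+\<omega>. I s \<omega> T \<partial>M)"
      using surplus_bounds(1)[of s T] by (simp add: ennreal_mult mult_ac)
  qed
  also have "\<dots> = (\<integral>\<^sup>+T. \<integral>\<^sup>+s. ?e T * (\<integral>\<^sup>+\<omega>. I s \<omega> T \<partial>M) \<partial>lborel \<partial>lborel)"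
    by (rule lborel_pair.Fubini') measurable
  also have "\<dots> = (\<integral>\<^sup>+T. ?e T * (\<integral>\<^sup>+\<omega>. \<integral>\<^sup>+s. I s \<omega> T \<partial>lborel \<partial>M) \<partial>lborel)"
  proof (rule nn_integral_cong)
    fix T :: real
    have "(\<integral>\<^sup>+s. ?e T * (\<integral>\<^sup>+\<omega>. I s \<omega> T \<partial>M) \<partial>lborel) = ?e T * (\<integral>\<^sup>+s. \<integral>\<^sup>+\<omega>. I s \<omega> T \<partial>M \<partial>lborel)"
      by (rule nn_integral_cmult) measurable
    also have "(\<integral>\<^sup>+s. \<integral>\<^sup>+\<omega>. I s \<omega> T \<partial>M \<partial>lborel) = (\<integral>\<^sup>+\<omega>. \<integral>\<^sup>+s. I s \<omega> T \<partial>lborel \<partial>M)"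
      by (rule PM.Fubini') measurable
    finally show "(\<integral>\<^sup>+s. ?e T * (\<integral>\<^sup>+\<omega>. I s \<omega> T \<partial>M) \<partial>lborel) = ?e T * (\<integral>\<^sup>+\<omega>. \<integral>\<^sup>+s. I s \<omega> T \<partial>lborel \<partial>M)" .
  qed
  finally have A: "(\<integral>\<^sup>+s. \<integral>\<^sup>+T. ennreal (exp (- m * s) * exp (- l * T) * surplus s T) * indicator {0<..} T * indicator {0<..} s \<partial>lborel \<partial>lborel)
    = (\<integral>\<^sup>+T. ?e T * (\<integral>\<^sup>+\<omega>. \<integral>\<^sup>+s. I s \<omega> T \<partial>lborel \<partial>M) \<partial>lborel)" .
  have Bq: "ennreal (fk_solution l m z / m) = (\<integral>\<^sup>+T. ?e T * (\<integral>\<^sup>+\<omega>. ennreal (exp (- m * outside_time T \<omega>) / m) \<partial>M) \<partial>lborel)"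
  proof -
    have "(\<integral>\<^sup>+T. ?e T * (\<integral>\<^sup>+\<omega>. ennreal (exp (- m * outside_time T \<omega>) / m) \<partial>M) \<partial>lborel)
      = (\<integral>\<^sup>+T. ennreal (1 / m) * ((\<integral>\<^sup>+\<omega>. ennreal (exp (- l * T)) * ennreal (exp (- m * outside_time T \<omega>)) \<partial>M) * indicator {0<..} T) \<partial>lborel)"
    proof (rule nn_integral_cong)
      fix T :: real
      have 1: "(\<integral>\<^sup>+\<omega>. ennreal (exp (- l * T)) * ennreal (exp (- m * outside_time T \<omega>)) \<partial>M) = ennreal (exp (- l * T)) * (\<integral>\<^sup>+\<omega>. ennreal (exp (- m * outside_time T \<omega>)) \<partial>M)"
        by (rule nn_integral_cmult) measurable
      have 2: "(\<integral>\<^sup>+\<omega>. ennreal (exp (- m * outside_time T \<omega>) / m) \<partial>M) = ennreal (1 / m) * (\<integral>\<^sup>+\<omega>. ennreal (exp (- m * outside_time T \<omega>)) \<partial>M)"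
        using m by (subst nn_integral_cmult[symmetric]) (auto intro!: nn_integral_cong simp: ennreal_mult'[symmetric])
      show "?e T * (\<integral>\<^sup>+\<omega>. ennreal (exp (- m * outside_time T \<omega>) / m) \<partial>M)
        = ennreal (1 / m) * ((\<integral>\<^sup>+\<omega>. ennreal (exp (- l * T)) * ennreal (exp (- m * outside_time T \<omega>)) \<partial>M) * indicator {0<..} T)"
        unfolding 1 2 by (simp add: mult_ac)
    qed
    also have "\<dots> = ennreal (1 / m) * (\<integral>\<^sup>+T. ((\<integral>\<^sup>+\<omega>. ennreal (exp (- l * T)) * ennreal (exp (- m * outside_time T \<omega>)) \<partial>M) * indicator {0<..} T) \<partial>lborel)"
      by (rule nn_integral_cmult) measurable
    also have "(\<integral>\<^sup>+T. ((\<integral>\<^sup>+\<omega>. ennreal (exp (- l * T)) * ennreal (exp (- m * outside_time T \<omega>)) \<partial>M) * indicator {0<..} T) \<partial>lborel)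
      = (\<integral>\<^sup>+T. ((\<integral>\<^sup>+\<omega>. ennreal (exp (- l * T)) * ennreal (exp (- m * occupation_time B T \<omega>)) \<partial>M) * indicator {0<..} T) \<partial>lborel)"
    proof (rule nn_integral_cong)
      fix T :: real
      show "(\<integral>\<^sup>+\<omega>. ennreal (exp (- l * T)) * ennreal (exp (- m * outside_time T \<omega>)) \<partial>M) * indicator {0<..} T
        = (\<integral>\<^sup>+\<omega>. ennreal (exp (- l * T)) * ennreal (exp (- m * occupation_time B T \<omega>)) \<partial>M) * indicator {0<..} T"
      proof (cases "0 < T")
        case True
        have "(\<integral>\<^sup>+\<omega>. ennreal (exp (- l * T)) * ennreal (exp (- m * outside_time T \<omega>)) \<partial>M)
          = (\<integral>\<^sup>+\<omega>. ennreal (exp (- l * T)) * ennreal (exp (- m * occupation_time B T \<omega>)) \<partial>M)"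
          by (rule nn_integral_cong) (use outside_time_eq True in simp)
        then show ?thesis by simp
      qed simp
    qed
    also have "\<dots> = ennreal (fk_solution l m z)" by (rule laplace_exp_occupation_time[OF l m])
    finally show ?thesis using m fk_solution_nonneg[OF l m, of z] by (simp add: ennreal_mult[symmetric])
  qed
  have "(\<integral>\<^sup>+T. ?e T * (\<integral>\<^sup>+\<omega>. \<integral>\<^sup>+s. I s \<omega> T \<partial>lborel \<partial>M) \<partial>lborel) + (\<integral>\<^sup>+T. ?e T * (\<integral>\<^sup>+\<omega>. ennreal (exp (- m * outside_time T \<omega>) / m) \<partial>M) \<partial>lborel)
    = (\<integral>\<^sup>+T. ?e T * (\<integral>\<^sup>+\<omega>. \<integral>\<^sup>+s. I s \<omega> T \<partial>lborel \<partial>M) + ?e T * (\<integral>\<^sup>+\<omega>. ennreal (exp (- m * outside_time T \<omega>) / m) \<partial>M) \<partial>lborel)"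
    by (rule nn_integral_add[symmetric]) measurable
  also have "\<dots> = (\<integral>\<^sup>+T. ennreal (1 / m) * ?e T \<partial>lborel)"
  proof (rule nn_integral_cong)
    fix T :: real
    have "(\<integral>\<^sup>+\<omega>. \<integral>\<^sup>+s. I s \<omega> T \<partial>lborel \<partial>M) + (\<integral>\<^sup>+\<omega>. ennreal (exp (- m * outside_time T \<omega>) / m) \<partial>M)
      = (\<integral>\<^sup>+\<omega>. (\<integral>\<^sup>+s. I s \<omega> T \<partial>lborel) + ennreal (exp (- m * outside_time T \<omega>) / m) \<partial>M)"
      by (rule nn_integral_add[symmetric]) measurable
    also have "\<dots> = (\<integral>\<^sup>+\<omega>. ennreal (1 / m) \<partial>M)"
      unfolding I_def by (rule nn_integral_cong) (rule tail[OF outside_time_nonneg])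
    also have "\<dots> = ennreal (1 / m)" by (simp add: emeasure_space_1)
    finally show "?e T * (\<integral>\<^sup>+\<omega>. \<integral>\<^sup>+s. I s \<omega> T \<partial>lborel \<partial>M) + ?e T * (\<integral>\<^sup>+\<omega>. ennreal (exp (- m * outside_time T \<omega>) / m) \<partial>M) = ennreal (1 / m) * ?e T"
      by (simp only: distrib_left[symmetric] mult.commute[of "ennreal (1 / m)"])
  qed
  also have "\<dots> = ennreal (1 / m) * (\<integral>\<^sup>+T. ?e T \<partial>lborel)" by (rule nn_integral_cmult) measurable
  also have "(\<integral>\<^sup>+T. ?e T \<partial>lborel) = (\<integral>\<^sup>+T. ennreal (exp (- l * T)) * indicator {0..} T \<partial>lborel)"
    by (rule nn_integral_cong_AE) (use AE_lborel_singleton[of 0] in \<open>eventually_elim, auto simp: indicator_def\<close>)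
  also have "\<dots> = ennreal (1 / l)"
    using has_integral_exp_minus_to_infinity[OF l, of 0] by (intro nn_integral_has_integral_lebesgue') auto
  finally show ?thesis unfolding A Bq using l m by (simp add: ennreal_mult[symmetric] mult.commute)
qed

text \<open>When \<open>s\<close> is approached from above, the indicators of
  \<open>\<Gamma> > S n\<close> converge pointwise to that of \<open>\<Gamma> > s\<close>, since the
  inequality is strict.\<close>

lemma surplus_right_continuous:
  assumes l: "0 < l" and S: "\<And>n. s < S n" "S \<longlonglongrightarrow> s"
  shows "(\<lambda>n. LBINT T:{0..}. exp (- l * T) * surplus (S n) T) \<longlonglongrightarrow> (LBINT T:{0..}. exp (- l * T) * surplus s T)"
  unfolding set_lebesgue_integral_def
proof (rule integral_dominated_convergence[where w="\<lambda>T. indicator {0..} T *\<^sub>R exp (- l * T)"])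
  show "integrable lborel (\<lambda>T. indicator {0..} T *\<^sub>R exp (- l * T))"
    using exp_ici_integral(1)[OF l] by (simp add: set_integrable_def)
  show "AE T in lborel. (\<lambda>n. indicator {0..} T *\<^sub>R (exp (- l * T) * surplus (S n) T)) \<longlonglongrightarrow> indicator {0..} T *\<^sub>R (exp (- l * T) * surplus s T)"
  proof (intro AE_I2 tendsto_intros)
    fix T
    show "(\<lambda>n. surplus (S n) T) \<longlonglongrightarrow> surplus s T"
      unfolding surplus_def
    proof (rule integral_dominated_convergence[where w="\<lambda>_. 1"])
      show "AE \<omega> in M. (\<lambda>n. indicator {S n<..} (outside_time T \<omega>)) \<longlonglongrightarrow> (indicator {s<..} (outside_time T \<omega>) :: real)"
      proof (rule AE_I2)
        fix \<omega>
        show "(\<lambda>n. indicator {S n<..} (outside_time T \<omega>)) \<longlonglongrightarrow> (indicator {s<..} (outside_time T \<omega>) :: real)"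
        proof (cases "s < outside_time T \<omega>")
          case True
          have "\<forall>\<^sub>F n in sequentially. S n < outside_time T \<omega>" using order_tendstoD(2)[OF S(2) True] .
          then have "\<forall>\<^sub>F n in sequentially. indicator {S n<..} (outside_time T \<omega>) = (indicator {s<..} (outside_time T \<omega>) :: real)"
            by eventually_elim (use True in simp)
          then show ?thesis by (rule tendsto_eventually)
        next
          case False
          then have "indicator {S n<..} (outside_time T \<omega>) = (indicator {s<..} (outside_time T \<omega>) :: real)" for n
            using S(1)[of n] by (simp add: indicator_def)
          then show ?thesis by simp
        qed
      qed
      show "(\<lambda>\<omega>. indicator {s<..} (outside_time T \<omega>) :: real) \<in> borel_measurable M" by measurable
      show "(\<lambda>\<omega>. indicator {S n<..} (outside_time T \<omega>) :: real) \<in> borel_measurable M" for n by measurable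
    qed (auto simp: indicator_def)
  qed
  show "AE T in lborel. norm (indicator {0..} T *\<^sub>R (exp (- l * T) * surplus (S n) T)) \<le> indicator {0..} T *\<^sub>R exp (- l * T)" for n
    using surplus_bounds by (intro AE_I2) (auto simp: indicator_def abs_mult)
qed measurable

text \<open>As functions of \<open>s\<close> both sides have the same Laplace transform, by
  \<open>surplus_laplace\<close>, \<open>nn_integral_half_normal_laplace\<close> and
  \<open>fk_solution_tail\<close>, and both are right continuous.\<close>

lemma laplace_surplus:
  assumes l: "0 < l" and s: "0 < s"
  defines "a \<equiv> sqrt (2 * l)" and "d \<equiv> max 0 (\<bar>z\<bar> - 1)"
  shows "(LBINT T:{0..}. exp (- l * T) * surplus s T) = exp (- l * s) * exit_factor z a * half_normal_laplace s d (a * tanh a) / l"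
proof -
  define \<theta> where "\<theta> = a * tanh a"
  have a: "0 < a" using l by (simp add: a_def)
  have \<theta>: "0 \<le> \<theta>" using a by (simp add: \<theta>_def)
  have d: "0 \<le> d" by (simp add: d_def)
  define c where "c = exit_factor z a / l"
  have c: "0 \<le> c" "c \<le> 1 / l"
  proof -
    have "cosh (z * a) \<le> cosh a" if "\<bar>z\<bar> < 1"
    proof -
      have "\<bar>z * a\<bar> \<le> \<bar>a\<bar>" using that a by (simp add: abs_mult mult_left_le_one_le)
      then show ?thesis by (metis cosh_real_abs cosh_real_nonneg_le_iff abs_ge_zero)
    qed
    then have "0 \<le> exit_factor z a" "exit_factor z a \<le> 1" by (auto simp: exit_factor_def)
    then show "0 \<le> c" "c \<le> 1 / l" using l by (auto simp: c_def divide_right_mono)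
  qed
  define J where "J s = (LBINT T:{0..}. exp (- l * T) * surplus s T)" for s
  \<comment> \<open>The value 0 for \<open>s \<le> 0\<close> is a convention that avoids variance 0;
    the single point \<open>s = 0\<close> does not change the transform.\<close>
  define K where "K s = (if 0 < s then c * (exp (- l * s) * half_normal_laplace s d \<theta>) else 0)" for s
  have J_int: "set_integrable lborel {0..} (\<lambda>T. exp (- l * T) * surplus s T)" for s
  proof (rule set_integrable_bound[OF exp_ici_integral(1)[OF l]])
    show "set_borel_measurable lborel {0..} (\<lambda>T. exp (- l * T) * surplus s T)"
      unfolding set_borel_measurable_def by measurable
  qed (use surplus_bounds in \<open>auto intro!: AE_I2 simp: abs_mult\<close>)
  have J: "0 \<le> J s" "J s \<le> 1 / l" for s
  proof -
    show "0 \<le> J s" unfolding J_def set_lebesgue_integral_def using surplus_bounds by (intro integral_nonneg_AE) auto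
    have "J s \<le> (LBINT T:{0..}. exp (- l * T))" unfolding J_def
      by (rule set_integral_mono[OF J_int exp_ici_integral(1)[OF l]]) (use surplus_bounds in auto)
    then show "J s \<le> 1 / l" using exp_ici_integral(2)[OF l] by simp
  qed
  have K: "0 \<le> K s" "K s \<le> 1 / l" for s
  proof -
    have "c * (exp (- l * s) * half_normal_laplace s d \<theta>) \<le> 1 / l * (1 * 1)" if "0 < s"
      using half_normal_laplace_real[OF that \<theta>, of d] c l that by (intro mult_mono) auto
    then show "0 \<le> K s" "K s \<le> 1 / l"
      using half_normal_laplace_real[OF _ \<theta>, of s d] c l by (auto simp: K_def)
  qed
  have Jm [measurable]: "J \<in> borel_measurable borel" unfolding J_def set_lebesgue_integral_def by measurable
  have Km [measurable]: "K \<in> borel_measurable borel"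
    unfolding K_def half_normal_laplace_def set_lebesgue_integral_def normal_density_def by measurable
  have JK: "(LBINT s:{0..}. exp (- real n * s) * J s) = (LBINT s:{0..}. exp (- real n * s) * K s)" if n: "1 \<le> n" for n
  proof -
    have m: "0 < real n" using n by simp
    define m where "m = real n"
    have m: "0 < m" using n by (simp add: m_def)
    have nnJ: "(\<integral>\<^sup>+s. ennreal (exp (- m * s) * J s) * indicator {0<..} s \<partial>lborel)
      = (\<integral>\<^sup>+s. \<integral>\<^sup>+T. ennreal (exp (- m * s) * exp (- l * T) * surplus s T) * indicator {0<..} T * indicator {0<..} s \<partial>lborel \<partial>lborel)"
    proof (rule nn_integral_cong)
      fix s :: real
      have "(\<integral>\<^sup>+T. ennreal (exp (- m * s) * exp (- l * T) * surplus s T) * indicator {0<..} T * indicator {0<..} s \<partial>lborel)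
        = (\<integral>\<^sup>+T. (ennreal (exp (- m * s)) * indicator {0<..} s) * ennreal (indicator {0..} T *\<^sub>R (exp (- l * T) * surplus s T)) \<partial>lborel)"
        by (rule nn_integral_cong_AE)
          (use AE_lborel_singleton[of 0] in \<open>eventually_elim, use surplus_bounds in \<open>auto simp: indicator_def ennreal_mult'[symmetric] mult_ac\<close>\<close>)
      also have "\<dots> = (ennreal (exp (- m * s)) * indicator {0<..} s) * (\<integral>\<^sup>+T. ennreal (indicator {0..} T *\<^sub>R (exp (- l * T) * surplus s T)) \<partial>lborel)"
        by (rule nn_integral_cmult) measurable
      also have "(\<integral>\<^sup>+T. ennreal (indicator {0..} T *\<^sub>R (exp (- l * T) * surplus s T)) \<partial>lborel) = ennreal (J s)"
        using J_int[of s] surplus_bounds unfolding J_def set_lebesgue_integral_def set_integrable_def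
        by (intro nn_integral_eq_integral) auto
      finally show "ennreal (exp (- m * s) * J s) * indicator {0<..} s
        = (\<integral>\<^sup>+T. ennreal (exp (- m * s) * exp (- l * T) * surplus s T) * indicator {0<..} T * indicator {0<..} s \<partial>lborel)"
        using J(1)[of s] by (simp add: ennreal_mult mult_ac)
    qed
    define b where "b = sqrt (2 * (l + m))"
    have nnK: "(\<integral>\<^sup>+s. ennreal (exp (- m * s) * K s) * indicator {0<..} s \<partial>lborel)
      = ennreal (c * (2 / b * ((1 - exp (- b * d)) / b + exp (- b * d) / (b + \<theta>))))"
    proof -
      have "(\<integral>\<^sup>+s. ennreal (exp (- m * s) * K s) * indicator {0<..} s \<partial>lborel)
        = (\<integral>\<^sup>+s. ennreal c * (ennreal (exp (- (l + m) * s) * half_normal_laplace s d \<theta>) * indicator {0<..} s) \<partial>lborel)"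
      proof (rule nn_integral_cong)
        fix s :: real
        have "exp (- m * s) * (c * (exp (- l * s) * h)) = c * (exp (- (l + m) * s) * h)" for h :: real
          by (simp add: exp_add[symmetric] algebra_simps)
        then have "ennreal (exp (- m * s) * K s) = ennreal c * ennreal (exp (- (l + m) * s) * half_normal_laplace s d \<theta>)" if "0 < s"
          unfolding K_def ennreal_mult'[OF c(1), symmetric] using that by (simp only: if_True)
        then show "ennreal (exp (- m * s) * K s) * indicator {0<..} s = ennreal c * (ennreal (exp (- (l + m) * s) * half_normal_laplace s d \<theta>) * indicator {0<..} s)"
          by (cases "0 < s") (simp_all only: mult.assoc, simp)
      qed
      also have "\<dots> = ennreal c * (\<integral>\<^sup>+s. (ennreal (exp (- (l + m) * s) * half_normal_laplace s d \<theta>) * indicator {0<..} s) \<partial>lborel)"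
        unfolding half_normal_laplace_def set_lebesgue_integral_def normal_density_def by (rule nn_integral_cmult) measurable
      also have "(\<integral>\<^sup>+s. (ennreal (exp (- (l + m) * s) * half_normal_laplace s d \<theta>) * indicator {0<..} s) \<partial>lborel)
        = ennreal (2 / b * ((1 - exp (- b * d)) / b + exp (- b * d) / (b + \<theta>)))"
        using nn_integral_half_normal_laplace[OF add_pos_pos[OF l m] \<theta> d] by (simp add: b_def)
      finally show ?thesis unfolding ennreal_mult'[OF c(1)] .
    qed
    have eq: "c * (2 / b * ((1 - exp (- b * d)) / b + exp (- b * d) / (b + \<theta>))) + fk_solution l m z / m = 1 / (l * m)"
      using fk_solution_tail[OF l m, of z] by (simp add: a_def b_def d_def c_def \<theta>_def)
    have fk: "0 \<le> fk_solution l m z / m" using fk_solution_nonneg[OF l m, of z] m by simp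
    have pos: "0 \<le> c * (2 / b * ((1 - exp (- b * d)) / b + exp (- b * d) / (b + \<theta>)))"
    proof -
      have "0 < b" using l m by (simp add: b_def)
      then show ?thesis using c d \<theta> by (intro mult_nonneg_nonneg add_nonneg_nonneg divide_nonneg_nonneg) auto
    qed
    have "(\<integral>\<^sup>+s. ennreal (exp (- m * s) * J s) * indicator {0<..} s \<partial>lborel) + ennreal (fk_solution l m z / m)
      = ennreal (c * (2 / b * ((1 - exp (- b * d)) / b + exp (- b * d) / (b + \<theta>)))) + ennreal (fk_solution l m z / m)"
      unfolding nnJ surplus_laplace[OF l m] using eq pos fk by (simp add: ennreal_plus[symmetric] del: ennreal_plus)
    then have "(\<integral>\<^sup>+s. ennreal (exp (- m * s) * J s) * indicator {0<..} s \<partial>lborel) = (\<integral>\<^sup>+s. ennreal (exp (- m * s) * K s) * indicator {0<..} s \<partial>lborel)"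
      unfolding nnK add.commute[of _ "ennreal (fk_solution l m z / m)"]
      by (simp only: ennreal_add_left_cancel ennreal_neq_top infinity_ennreal_def simp_thms)
    moreover have conv: "(LBINT s:{0..}. exp (- m * s) * F s) = enn2real (\<integral>\<^sup>+s. ennreal (exp (- m * s) * F s) * indicator {0<..} s \<partial>lborel)"
      if [measurable]: "F \<in> borel_measurable borel" and F: "\<And>s. 0 \<le> F s" for F
    proof -
      have "(LBINT s:{0..}. exp (- m * s) * F s) = enn2real (\<integral>\<^sup>+s. ennreal (indicator {0..} s *\<^sub>R (exp (- m * s) * F s)) \<partial>lborel)"
        unfolding set_lebesgue_integral_def by (rule integral_eq_nn_integral) (use F in auto)
      also have "(\<integral>\<^sup>+s. ennreal (indicator {0..} s *\<^sub>R (exp (- m * s) * F s)) \<partial>lborel) = (\<integral>\<^sup>+s. ennreal (exp (- m * s) * F s) * indicator {0<..} s \<partial>lborel)"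
        by (rule nn_integral_cong_AE) (use AE_lborel_singleton[of 0] in \<open>eventually_elim, auto simp: indicator_def\<close>)
      finally show ?thesis .
    qed
    ultimately show ?thesis unfolding m_def[symmetric] conv[OF Jm J(1)] conv[OF Km K(1)] by (simp only:)
  qed
  have int: "set_integrable lborel {0..} (\<lambda>s. exp (- real n * s) * F s)"
    if [measurable]: "F \<in> borel_measurable borel" and "\<And>s. 0 \<le> F s" "\<And>s. F s \<le> 1 / l" "1 \<le> n" for F n
  proof -
    have "set_integrable lborel {0..} (\<lambda>s. of_real (exp (- real n * s)) * F s)"
    proof (rule set_integrable_exp_linear_bound[where C="1 / l"])
      show "set_borel_measurable lborel {0..} F" unfolding set_borel_measurable_def by measurable
      fix t :: real assume "0 \<le> t"
      then have "1 / l * 1 \<le> 1 / l * (1 + t)" using l by (intro mult_left_mono) auto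
      then show "norm (F t) \<le> 1 / l * (1 + t)" using that(2,3)[of t] by simp
    qed (use that in simp)
    then show ?thesis by simp
  qed
  have "J s - K s = 0"
  proof (rule laplace_uniqueness_right_continuous[where h="\<lambda>s. J s - K s" and C="1 / l"])
    show "set_borel_measurable lborel {0..} (\<lambda>s. J s - K s)" unfolding set_borel_measurable_def by measurable
    show "\<bar>J t - K t\<bar> \<le> 1 / l" for t using J[of t] K[of t] by linarith
    show "(LBINT t:{0..}. exp (- real n * t) * (J t - K t)) = 0" if "1 \<le> n" for n :: nat
      using JK[OF that] int[OF Jm J that] int[OF Km K that] by (simp add: right_diff_distrib set_integral_diff)
    show "continuous (at_right s) (\<lambda>s. J s - K s)" unfolding continuous_within
    proof (rule tendsto_at_right_sequentially[where b="s + 1"])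
      fix S :: "nat \<Rightarrow> real" assume S: "\<And>n. s < S n" "decseq S" "S \<longlonglongrightarrow> s"
      have K_eq: "K (S n) = c * (exp (- l * S n) * half_normal_laplace (S n) d \<theta>)" for n using S(1)[of n] s by (simp add: K_def)
      have "(\<lambda>n. J (S n) - c * (exp (- l * S n) * half_normal_laplace (S n) d \<theta>)) \<longlonglongrightarrow> J s - c * (exp (- l * s) * half_normal_laplace s d \<theta>)"
        unfolding J_def by (intro tendsto_intros surplus_right_continuous[OF l] half_normal_laplace_right_continuous[OF s \<theta>] S)
      then show "(\<lambda>n. J (S n) - K (S n)) \<longlonglongrightarrow> J s - K s" unfolding K_eq using s by (simp add: K_def)
    qed simp
  qed (use s in simp)
  then show ?thesis using s by (simp add: J_def K_def c_def \<theta>_def)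
qed

lemma laplace_occupation_prob:
  assumes l: "0 < l" and s: "0 < s"
  defines "a \<equiv> sqrt (2 * l)" and "d \<equiv> max 0 (\<bar>z\<bar> - 1)"
  shows "(LBINT T:{0..}. exp (- l * T) * \<P>(\<omega> in M. outside_time T \<omega> \<le> s))
    = (1 - exp (- l * s) * exit_factor z a * half_normal_laplace s d (a * tanh a)) / l"
proof -
  have int: "set_integrable lborel {0..} (\<lambda>T. exp (- l * T) * surplus s T)"
  proof (rule set_integrable_bound[OF exp_ici_integral(1)[OF l]])
    show "set_borel_measurable lborel {0..} (\<lambda>T. exp (- l * T) * surplus s T)"
      unfolding set_borel_measurable_def by measurable
  qed (use surplus_bounds in \<open>auto intro!: AE_I2 simp: abs_mult\<close>)
  have "\<P>(\<omega> in M. outside_time T \<omega> \<le> s) = 1 - surplus s T" for T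
  proof -
    have [measurable]: "outside_time T \<in> borel_measurable M" by measurable
    have "\<P>(\<omega> in M. \<not> s < outside_time T \<omega>) = 1 - \<P>(\<omega> in M. s < outside_time T \<omega>)"
      by (rule prob_neg) measurable
    then show ?thesis by (simp add: surplus_prob not_less)
  qed
  then have "(LBINT T:{0..}. exp (- l * T) * \<P>(\<omega> in M. outside_time T \<omega> \<le> s))
    = (LBINT T:{0..}. exp (- l * T) - exp (- l * T) * surplus s T)" by (simp add: right_diff_distrib)
  also have "\<dots> = 1 / l - (LBINT T:{0..}. exp (- l * T) * surplus s T)"
    using set_integral_diff(2)[OF exp_ici_integral(1)[OF l] int] exp_ici_integral(2)[OF l] by simp
  finally show ?thesis using laplace_surplus[OF l s] by (simp add: a_def d_def diff_divide_distrib)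
qed

end

section \<open>Analytic continuation and the pole\<close>

lemma normal_density_exp_tilt:
  assumes s: "0 < s"
  shows "normal_density 0 (sqrt s) l * exp (u * l) = exp (u\<^sup>2 * s / 2) * normal_density (u * s) (sqrt s) l"
proof -
  have "- l\<^sup>2 / (2 * s) + u * l = u\<^sup>2 * s / 2 + - (l - u * s)\<^sup>2 / (2 * s)"
    using s by (simp add: power2_eq_square divide_simps) (simp add: algebra_simps)
  then show ?thesis
    using s by (simp add: normal_density_def exp_add[symmetric] del: minus_diff_eq)
qed

lemma half_normal_tilted_integrable:
  assumes s: "0 < s"
  shows "set_integrable lborel {0..} (\<lambda>l. 2 * normal_density 0 (sqrt s) l * exp (u * l))"
    and "(LBINT l:{0..}. 2 * normal_density 0 (sqrt s) l * exp (u * l)) \<le> 2 * exp (u\<^sup>2 * s / 2)"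
proof -
  have eq: "2 * normal_density 0 (sqrt s) l * exp (u * l) = 2 * exp (u\<^sup>2 * s / 2) * normal_density (u * s) (sqrt s) l" for l
    using normal_density_exp_tilt[OF s, of l u] by (simp add: mult.assoc)
  have i: "integrable lborel (\<lambda>l. 2 * exp (u\<^sup>2 * s / 2) * normal_density (u * s) (sqrt s) l)"
    using s by (intro integrable_mult_right) simp
  show i': "set_integrable lborel {0..} (\<lambda>l. 2 * normal_density 0 (sqrt s) l * exp (u * l))"
    unfolding eq set_integrable_def by (rule integrable_mult_indicator[OF _ i]) simp
  have "(LBINT l:{0..}. 2 * normal_density 0 (sqrt s) l * exp (u * l)) \<le> (LBINT l. 2 * exp (u\<^sup>2 * s / 2) * normal_density (u * s) (sqrt s) l)"
    unfolding set_lebesgue_integral_def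
    by (rule integral_mono[OF i'[unfolded set_integrable_def] i]) (auto simp: eq indicator_def)
  also have "\<dots> = 2 * exp (u\<^sup>2 * s / 2)" using s by simp
  finally show "(LBINT l:{0..}. 2 * normal_density 0 (sqrt s) l * exp (u * l)) \<le> 2 * exp (u\<^sup>2 * s / 2)" .
qed

lemma cmod_half_normal_laplace_integrand_le:
  fixes \<theta> :: complex
  assumes d: "0 \<le> d" and l: "0 \<le> l" and u: "- Re \<theta> \<le> u" "0 \<le> u"
  shows "cmod (of_real (2 * normal_density 0 (sqrt s) l) * exp (- \<theta> * of_real (max 0 (l - d)))) \<le> 2 * normal_density 0 (sqrt s) l * exp (u * l)"
proof -
  have "- Re \<theta> * max 0 (l - d) \<le> u * max 0 (l - d)" using u by (intro mult_right_mono) auto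
  also have "\<dots> \<le> u * l" using d l u by (intro mult_left_mono) auto
  finally have "exp (- Re \<theta> * max 0 (l - d)) \<le> exp (u * l)" by simp
  moreover have "cmod (of_real (2 * normal_density 0 (sqrt s) l) * exp (- \<theta> * of_real (max 0 (l - d)))) = 2 * normal_density 0 (sqrt s) l * exp (- Re \<theta> * max 0 (l - d))"
    by (simp add: norm_mult)
  ultimately show ?thesis by (simp add: mult_left_mono)
qed

text \<open>The Gaussian density integrates every exponential, so the transform exists on the whole
  plane. Only the negative part of \<open>Re \<theta>\<close> enters the bound: it is 2 where
  \<open>Re \<theta> \<ge> 0\<close> and grows like a Gaussian elsewhere, and this growth sets the
  size of the inversion integral.\<close>

lemma half_normal_laplace_complex:
  fixes \<theta> :: complex
  assumes s: "0 < s" and d: "0 \<le> d"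
  shows "set_integrable lborel {0..} (\<lambda>l. of_real (2 * normal_density 0 (sqrt s) l) * exp (- \<theta> * of_real (max 0 (l - d))))"
    and "cmod (half_normal_laplace s d \<theta>) \<le> 2 * exp ((max 0 (- Re \<theta>))\<^sup>2 * s / 2)"
proof -
  let ?u = "max 0 (- Re \<theta>)"
  let ?f = "\<lambda>l. of_real (2 * normal_density 0 (sqrt s) l) * exp (- \<theta> * of_real (max 0 (l - d)))"
  have le: "cmod (?f l) \<le> 2 * normal_density 0 (sqrt s) l * exp (?u * l)" if "0 \<le> l" for l
    by (rule cmod_half_normal_laplace_integrand_le) (use d that in auto)
  show int: "set_integrable lborel {0..} ?f"
  proof (rule set_integrable_bound[OF half_normal_tilted_integrable(1)[OF s, of ?u]])
    show "set_borel_measurable lborel {0..} ?f" unfolding set_borel_measurable_def by measurable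
  qed (use le in \<open>auto intro!: AE_I2 order_trans[OF le]\<close>)
  have "cmod (half_normal_laplace s d \<theta>) \<le> (LBINT l:{0..}. cmod (?f l))"
    unfolding half_normal_laplace_def by (rule set_integral_norm_bound[OF int])
  also have "\<dots> \<le> (LBINT l:{0..}. 2 * normal_density 0 (sqrt s) l * exp (?u * l))"
    by (rule set_integral_mono[OF set_integrable_norm[OF int] half_normal_tilted_integrable(1)[OF s]]) (use le in auto)
  also have "\<dots> \<le> 2 * exp (?u\<^sup>2 * s / 2)" by (rule half_normal_tilted_integrable(2)[OF s])
  finally show "cmod (half_normal_laplace s d \<theta>) \<le> 2 * exp ((max 0 (- Re \<theta>))\<^sup>2 * s / 2)" .
qed

lemma half_normal_laplace_of_real:
  "half_normal_laplace s d (complex_of_real t) = of_real (half_normal_laplace s d t)"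
proof -
  have "half_normal_laplace s d (complex_of_real t) = (LBINT l:{0..}. complex_of_real (2 * normal_density 0 (sqrt s) l * exp (- t * max 0 (l - d))))"
    unfolding half_normal_laplace_def by (simp add: exp_of_real[symmetric])
  also have "\<dots> = of_real (LBINT l:{0..}. 2 * normal_density 0 (sqrt s) l * exp (- t * max 0 (l - d)))"
    by (rule set_integral_complex_of_real)
  finally show ?thesis by (simp add: half_normal_laplace_def)
qed

lemma half_normal_laplace_0: "0 < s \<Longrightarrow> half_normal_laplace s d (0::complex) = 1"
  using half_normal_integral(2)[of s] half_normal_laplace_of_real[of s d 0]
  by (simp add: half_normal_laplace_def)

lemma half_normal_laplace_holomorphic:
  assumes s: "0 < s" and d: "0 \<le> d"
  shows "half_normal_laplace s d holomorphic_on (UNIV :: complex set)"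
proof -
  define f where "f \<theta> l = indicator {0..} l *\<^sub>R (complex_of_real (2 * normal_density 0 (sqrt s) l) * exp (- \<theta> * of_real (max 0 (l - d))))" for \<theta> l
  have fm: "f \<theta> \<in> borel_measurable lborel" for \<theta> unfolding f_def[abs_def] by measurable
  have f_int: "integrable lborel (f \<theta>)" for \<theta>
    using half_normal_laplace_complex(1)[OF s d, of \<theta>] by (simp add: f_def[abs_def] set_integrable_def)
  have L: "half_normal_laplace s d \<theta> = (LBINT l. f \<theta> l)" for \<theta>
    by (simp add: half_normal_laplace_def set_lebesgue_integral_def f_def)
  have "(half_normal_laplace s d has_field_derivative (LBINT l. - of_real (max 0 (l - d)) * f \<theta>0 l)) (at \<theta>0)" for \<theta>0 :: complex
    unfolding has_field_derivative_iff tendsto_at_iff_sequentially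
  proof (intro allI impI)
    fix X :: "nat \<Rightarrow> complex"
    assume X: "\<forall>i. X i \<in> UNIV - {\<theta>0}" "X \<longlonglongrightarrow> \<theta>0"
    have "\<forall>\<^sub>F n in sequentially. dist (X n) \<theta>0 < 1" by (rule tendstoD[OF X(2)]) simp
    then obtain N where N: "\<And>n. N \<le> n \<Longrightarrow> dist (X n) \<theta>0 < 1" by (auto simp: eventually_sequentially)
    \<comment> \<open>Dropping finitely many terms keeps \<open>Y n\<close> within distance 1 of
      \<open>\<theta>0\<close>, as a common dominating function for the difference quotients
      requires.\<close>
    define Y where "Y n = X (n + N)" for n
    have Y: "Y n \<noteq> \<theta>0" "cmod (Y n - \<theta>0) \<le> 1" for n using X(1) N[of "n + N"] by (auto simp: Y_def dist_norm)
    have Y_lim: "Y \<longlonglongrightarrow> \<theta>0" unfolding Y_def using X(2) by (rule LIMSEQ_ignore_initial_segment)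
    define g where "g n l = (f (Y n) l - f \<theta>0 l) / (Y n - \<theta>0)" for n l
    have g_eq: "g n l = f \<theta>0 l * ((exp (- (Y n - \<theta>0) * of_real (max 0 (l - d))) - 1) / (Y n - \<theta>0))" for n l
    proof -
      have "exp (- Y n * of_real (max 0 (l - d))) = exp (- \<theta>0 * of_real (max 0 (l - d))) * exp (- (Y n - \<theta>0) * of_real (max 0 (l - d)))"
        by (simp add: exp_add[symmetric] algebra_simps)
      then have "f (Y n) l = f \<theta>0 l * exp (- (Y n - \<theta>0) * of_real (max 0 (l - d)))"
        by (simp add: f_def)
      then show ?thesis by (simp add: g_def algebra_simps)
    qed
    \<comment> \<open>\<open>cmod \<theta>0\<close> accounts for \<open>f \<theta>0\<close>, and the
      2 for the bound \<open>m * exp m \<le> exp (2 * m)\<close> of the difference quotient.\<close>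
    let ?c = "cmod \<theta>0 + 2"
    have "(\<lambda>n. LBINT l. g n l) \<longlonglongrightarrow> (LBINT l. - of_real (max 0 (l - d)) * f \<theta>0 l)"
    proof (rule integral_dominated_convergence[where w="\<lambda>l. indicator {0..} l *\<^sub>R (2 * normal_density 0 (sqrt s) l * exp (?c * l))"])
      show "integrable lborel (\<lambda>l. indicator {0..} l *\<^sub>R (2 * normal_density 0 (sqrt s) l * exp (?c * l)))"
        using half_normal_tilted_integrable(1)[OF s, of ?c] by (simp add: set_integrable_def)
      show "(\<lambda>l. - of_real (max 0 (l - d)) * f \<theta>0 l) \<in> borel_measurable lborel" unfolding f_def by measurable
      show "g n \<in> borel_measurable lborel" for n unfolding g_def[abs_def] f_def by measurable
      show "AE l in lborel. (\<lambda>n. g n l) \<longlonglongrightarrow> - of_real (max 0 (l - d)) * f \<theta>0 l"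
      proof (rule AE_I2)
        fix l :: real
        let ?m = "complex_of_real (max 0 (l - d))"
        have "((\<lambda>w. exp (- (w - \<theta>0) * ?m)) has_field_derivative - ?m) (at \<theta>0)"
          by (auto intro!: derivative_eq_intros)
        then have "((\<lambda>w. (exp (- (w - \<theta>0) * ?m) - exp (- (\<theta>0 - \<theta>0) * ?m)) / (w - \<theta>0)) \<longlongrightarrow> - ?m) (at \<theta>0)"
          by (simp only: has_field_derivative_iff)
        then have "((\<lambda>w. (exp (- (w - \<theta>0) * ?m) - 1) / (w - \<theta>0)) \<longlongrightarrow> - ?m) (at \<theta>0)" by simp
        moreover have "filterlim Y (at \<theta>0) sequentially"
          using Y_lim Y(1) by (auto simp: filterlim_at)
        ultimately have "(\<lambda>n. (exp (- (Y n - \<theta>0) * ?m) - 1) / (Y n - \<theta>0)) \<longlonglongrightarrow> - ?m" by (rule filterlim_compose)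
        then have "(\<lambda>n. f \<theta>0 l * ((exp (- (Y n - \<theta>0) * ?m) - 1) / (Y n - \<theta>0))) \<longlonglongrightarrow> f \<theta>0 l * - ?m" by (intro tendsto_intros)
        then show "(\<lambda>n. g n l) \<longlonglongrightarrow> - ?m * f \<theta>0 l" unfolding g_eq by (simp only: mult.commute)
      qed
      show "AE l in lborel. norm (g n l) \<le> indicator {0..} l *\<^sub>R (2 * normal_density 0 (sqrt s) l * exp (?c * l))" for n
      proof (rule AE_I2)
        fix l :: real
        show "norm (g n l) \<le> indicator {0..} l *\<^sub>R (2 * normal_density 0 (sqrt s) l * exp (?c * l))"
        proof (cases "0 \<le> l")
          case True
          define m where "m = max 0 (l - d)"
          have m: "0 \<le> m" "m \<le> l" using True d by (auto simp: m_def)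
          let ?w = "- (Y n - \<theta>0) * of_real m"
          have w: "cmod ?w \<le> m" using mult_right_mono[OF Y(2)[of n] m(1)] m(1)
            by (simp add: norm_mult norm_minus_commute)
          have "cmod (exp ?w - 1) \<le> exp (cmod ?w) * cmod ?w" using Taylor_exp_field[of ?w 0] by simp
          also have "\<dots> = exp (cmod ?w) * m * cmod (Y n - \<theta>0)" using m(1) by (simp add: norm_mult norm_minus_commute mult_ac)
          also have "\<dots> \<le> exp m * exp m * cmod (Y n - \<theta>0)"
          proof (intro mult_right_mono mult_mono)
            show "m \<le> exp m" using exp_ge_add_one_self[of m] by linarith
          qed (use w m in auto)
          finally have "cmod ((exp ?w - 1) / (Y n - \<theta>0)) \<le> exp (2 * m)"
            using Y(1)[of n] by (simp add: norm_divide divide_le_eq exp_add[symmetric])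
          also have "\<dots> \<le> exp (2 * l)" using m by simp
          finally have 1: "cmod ((exp ?w - 1) / (Y n - \<theta>0)) \<le> exp (2 * l)" .
          have 2: "cmod (f \<theta>0 l) \<le> 2 * normal_density 0 (sqrt s) l * exp (cmod \<theta>0 * l)"
            using cmod_half_normal_laplace_integrand_le[OF d True, of \<theta>0 "cmod \<theta>0" s] abs_Re_le_cmod[of \<theta>0] True by (simp add: f_def)
          have "cmod (g n l) \<le> (2 * normal_density 0 (sqrt s) l * exp (cmod \<theta>0 * l)) * exp (2 * l)"
            unfolding g_eq norm_mult m_def[symmetric] using 1 2 by (intro mult_mono) auto
          also have "\<dots> = 2 * normal_density 0 (sqrt s) l * exp (?c * l)" by (simp add: exp_add[symmetric] distrib_right)
          finally show ?thesis using True by simp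
        qed (simp add: g_def f_def)
      qed
    qed
    moreover have "(LBINT l. g n l) = (half_normal_laplace s d (Y n) - half_normal_laplace s d \<theta>0) / (Y n - \<theta>0)" for n
      unfolding g_def L by (simp add: Bochner_Integration.integral_diff[OF f_int f_int])
    ultimately have "(\<lambda>n. (half_normal_laplace s d (X (n + N)) - half_normal_laplace s d \<theta>0) / (X (n + N) - \<theta>0)) \<longlonglongrightarrow> (LBINT l. - of_real (max 0 (l - d)) * f \<theta>0 l)"
      by (simp add: Y_def)
    then show "((\<lambda>y. (half_normal_laplace s d y - half_normal_laplace s d \<theta>0) / (y - \<theta>0)) \<circ> X) \<longlonglongrightarrow> (LBINT l. - of_real (max 0 (l - d)) * f \<theta>0 l)"
      unfolding o_def by (rule LIMSEQ_offset)
  qed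
  then show ?thesis by (auto simp: holomorphic_on_open)
qed

text \<open>The shift by \<open>- u * s\<close> and the scaling by \<open>sqrt s\<close> absorb the
  real part \<open>u\<close> of \<open>\<theta>\<close>. What remains is the characteristic function
  of the standard normal law at \<open>- v * sqrt s\<close>.\<close>

lemma complex_gaussian_integral:
  fixes \<theta> :: complex
  assumes s: "0 < s"
  shows "integrable lborel (\<lambda>l. of_real (normal_density 0 (sqrt s) l) * exp (- \<theta> * of_real l))"
    and "(LBINT l. of_real (normal_density 0 (sqrt s) l) * exp (- \<theta> * of_real l)) = exp (\<theta>\<^sup>2 * of_real s / 2)"
proof -
  let ?f = "\<lambda>l. complex_of_real (normal_density 0 (sqrt s) l) * exp (- \<theta> * of_real l)"
  define u where "u = Re \<theta>"
  define v where "v = Im \<theta>"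
  have th: "\<theta> = Complex u v" by (simp add: u_def v_def)
  show "integrable lborel ?f"
  proof (rule Bochner_Integration.integrable_bound)
    show "integrable lborel (\<lambda>l. exp (u\<^sup>2 * s / 2) * normal_density (- u * s) (sqrt s) l)"
      using s by (intro integrable_mult_right) simp
    have "norm (?f l) = normal_density 0 (sqrt s) l * exp (- u * l)" for l by (simp add: norm_mult u_def)
    then show "AE l in lborel. norm (?f l) \<le> norm (exp (u\<^sup>2 * s / 2) * normal_density (- u * s) (sqrt s) l)"
      using normal_density_exp_tilt[OF s, of _ "- u"] by (intro AE_I2) (simp add: abs_mult)
  qed measurable
  define b where "b = sqrt s"
  have b: "0 < b" "b\<^sup>2 = s" using s by (auto simp: b_def)
  have pt: "?f (- u * s + b * x) = exp (\<theta>\<^sup>2 * of_real s / 2) * exp (of_real (v\<^sup>2 * s / 2)) * (std_normal_density x *\<^sub>R iexp (- v * b * x)) / of_real b" for x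
  proof -
    have nd: "normal_density 0 (sqrt s) (- u * s + b * x) = exp (- (- u * s + b * x)\<^sup>2 / (2 * s)) / (sqrt (2 * pi) * b)"
      using s by (simp add: normal_density_def real_sqrt_mult b_def)
    have e: "complex_of_real (- (- u * s + b * x)\<^sup>2 / (2 * s)) + - \<theta> * of_real (- u * s + b * x)
       = \<theta>\<^sup>2 * of_real s / 2 + of_real (v\<^sup>2 * s / 2) + of_real (- x\<^sup>2 / 2) + \<i> * of_real (- v * b * x)"
    proof -
      have "- (- u * s + b * x)\<^sup>2 / (2 * s) = - u\<^sup>2 * s / 2 + u * b * x - x\<^sup>2 / 2"
        using b s by (simp add: power2_sum power_mult_distrib field_simps) (simp add: power2_eq_square algebra_simps)
      then have A: "complex_of_real (- (- u * s + b * x)\<^sup>2 / (2 * s)) = of_real (- u\<^sup>2 * s / 2 + u * b * x - x\<^sup>2 / 2)"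
        by (simp only:)
      show ?thesis
        unfolding A th by (simp add: complex_eq_iff power2_eq_square algebra_simps) (simp add: field_simps)
    qed
    have "?f (- u * s + b * x) = exp (complex_of_real (- (- u * s + b * x)\<^sup>2 / (2 * s)) + - \<theta> * of_real (- u * s + b * x)) / of_real (sqrt (2 * pi) * b)"
    proof -
      have "complex_of_real (exp E / c) * exp W = exp (of_real E + W) / of_real c" for E c W
        by (simp add: exp_add exp_of_real)
      then show ?thesis unfolding nd .
    qed
    also have "\<dots> = exp (\<theta>\<^sup>2 * of_real s / 2) * exp (of_real (v\<^sup>2 * s / 2)) * (exp (of_real (- x\<^sup>2 / 2)) * iexp (- v * b * x)) / of_real (sqrt (2 * pi) * b)"
      unfolding e exp_add by (simp only: mult.assoc)
    finally show ?thesis by (simp add: std_normal_density_def exp_of_real[symmetric] scaleR_conv_of_real)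
  qed
  have "(LBINT l. ?f l) = of_real b * (LBINT x. ?f (- u * s + b * x))"
    using lborel_integral_real_affine[of b ?f "- u * s"] b(1) by (simp add: scaleR_conv_of_real)
  also have "(LBINT x. ?f (- u * s + b * x)) = exp (\<theta>\<^sup>2 * of_real s / 2) * exp (of_real (v\<^sup>2 * s / 2)) * (LBINT x. std_normal_density x *\<^sub>R iexp (- v * b * x)) / of_real b"
    unfolding pt integral_divide_zero integral_mult_right_zero ..
  also have "(LBINT x. std_normal_density x *\<^sub>R iexp (- v * b * x)) = char std_normal_distribution (- v * b)"
    unfolding char_def by (subst integral_density) (auto simp: mult_ac)
  also have "\<dots> = exp (- of_real (v\<^sup>2 * s / 2))"
    unfolding char_std_normal_distribution using b by (simp add: power_mult_distrib exp_of_real[symmetric])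
  finally show "(LBINT l. ?f l) = exp (\<theta>\<^sup>2 * of_real s / 2)"
    using b(1) by (simp add: exp_minus)
qed

text \<open>The reflection of \<open>l\<close> turns the second transform into the integral over the
  negative half line. Near the pole \<open>Re \<theta>\<close> is negative, so
  \<open>half_normal_laplace s 0 (- \<theta>)\<close> is bounded there and
  \<open>2 * exp (\<theta>^2 * s / 2)\<close> is isolated as the main part.\<close>

lemma half_normal_laplace_reflection:
  fixes \<theta> :: complex
  assumes s: "0 < s"
  shows "half_normal_laplace s 0 \<theta> + half_normal_laplace s 0 (- \<theta>) = 2 * exp (\<theta>\<^sup>2 * of_real s / 2)"
proof -
  let ?f = "\<lambda>\<theta> l. complex_of_real (2 * normal_density 0 (sqrt s) l) * exp (- \<theta> * of_real l)"
  have L: "half_normal_laplace s 0 \<theta> = (LBINT l. indicator {0..} l *\<^sub>R ?f \<theta> l)" for \<theta> :: complex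
    unfolding half_normal_laplace_def set_lebesgue_integral_def
    by (intro Bochner_Integration.integral_cong) (auto simp: indicator_def)
  have i: "integrable lborel (\<lambda>l. indicator {0..} l *\<^sub>R ?f \<theta> l)" for \<theta>
  proof -
    have "(\<lambda>l. indicator {0..} l *\<^sub>R (complex_of_real (2 * normal_density 0 (sqrt s) l) * exp (- \<theta> * of_real (max 0 (l - 0)))))
      = (\<lambda>l. indicator {0..} l *\<^sub>R ?f \<theta> l)" by (auto simp: indicator_def fun_eq_iff)
    then show ?thesis using half_normal_laplace_complex(1)[OF s order_refl, of \<theta>] unfolding set_integrable_def by (simp only:)
  qed
  have refl: "half_normal_laplace s 0 (- \<theta>) = (LBINT l. indicator {..0} l *\<^sub>R ?f \<theta> l)"
    unfolding L by (subst lborel_integral_real_affine[where c="-1" and t=0])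
      (auto simp: indicator_def normal_density_def intro!: Bochner_Integration.integral_cong)
  have i2: "integrable lborel (\<lambda>l. indicator {..0} l *\<^sub>R ?f \<theta> l)"
  proof -
    have "(\<lambda>l. indicator {0..} (0 + -1 * l) *\<^sub>R ?f (- \<theta>) (0 + -1 * l)) = (\<lambda>l. indicator {..0} l *\<^sub>R ?f \<theta> l)"
      by (auto simp: indicator_def fun_eq_iff normal_density_def)
    then show ?thesis using lborel_integrable_real_affine[OF i[of "- \<theta>"], of "-1" 0] by (simp only:; simp?)
  qed
  have "half_normal_laplace s 0 \<theta> + half_normal_laplace s 0 (- \<theta>) = (LBINT l. indicator {0..} l *\<^sub>R ?f \<theta> l + indicator {..0} l *\<^sub>R ?f \<theta> l)"
    unfolding refl unfolding L by (rule Bochner_Integration.integral_add[OF i i2, symmetric])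
  also have "\<dots> = (LBINT l. 2 * (of_real (normal_density 0 (sqrt s) l) * exp (- \<theta> * of_real l)))"
  proof (rule integral_cong_AE)
    show "AE l in lborel. indicator {0..} l *\<^sub>R ?f \<theta> l + indicator {..0} l *\<^sub>R ?f \<theta> l = 2 * (of_real (normal_density 0 (sqrt s) l) * exp (- \<theta> * of_real l))"
      using AE_lborel_singleton[of 0] by eventually_elim (auto simp: indicator_def)
  qed measurable
  also have "\<dots> = 2 * exp (\<theta>\<^sup>2 * of_real s / 2)"
    using complex_gaussian_integral(2)[OF s, of \<theta>] by simp
  finally show ?thesis .
qed

text \<open>Evenness makes the branch of the root irrelevant. Across the cut
  \<open>\<i> * csqrt (- z)\<close> is another root that is holomorphic there, and at 0 continuity
  removes the singularity.\<close>

lemma even_entire_csqrt_holomorphic: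
  assumes f: "f holomorphic_on UNIV" and even: "\<And>a. f (- a) = f a"
  shows "(\<lambda>z. f (csqrt z)) holomorphic_on UNIV"
proof (rule no_isolated_singularity'[where K="{0}"])
  have fc: "f holomorphic_on A" for A using f by (rule holomorphic_on_subset) auto
  have eq: "f (csqrt z) = f (\<i> * csqrt (- z))" for z
  proof -
    have "(\<i> * csqrt (- z))\<^sup>2 = (csqrt z)\<^sup>2" by (simp add: power_mult_distrib)
    then have "\<i> * csqrt (- z) = csqrt z \<or> \<i> * csqrt (- z) = - csqrt z" by (rule power2_eq_iff[THEN iffD1])
    then show ?thesis using even by auto
  qed
  show "(\<lambda>z. f (csqrt z)) holomorphic_on UNIV - {0}"
  proof -
    have 1: "(\<lambda>z. f (csqrt z)) holomorphic_on - \<real>\<^sub>\<le>\<^sub>0"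
      by (rule holomorphic_on_compose_gen[OF _ f, unfolded o_def]) (auto intro!: holomorphic_intros)
    have "(\<lambda>z. f (\<i> * csqrt (- z))) holomorphic_on - \<real>\<^sub>\<ge>\<^sub>0"
      by (rule holomorphic_on_compose_gen[OF _ f, unfolded o_def]) (auto intro!: holomorphic_intros)
    then have 2: "(\<lambda>z. f (csqrt z)) holomorphic_on - \<real>\<^sub>\<ge>\<^sub>0" unfolding eq[symmetric] .
    have "(UNIV - {0} :: complex set) = - \<real>\<^sub>\<le>\<^sub>0 \<union> - \<real>\<^sub>\<ge>\<^sub>0"
    proof -
      have "x = 0" if "x \<in> \<real>\<^sub>\<le>\<^sub>0" "x \<in> \<real>\<^sub>\<ge>\<^sub>0" for x :: complex
        using that by (simp add: complex_nonpos_Reals_iff complex_nonneg_Reals_iff complex_eq_iff)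
      note zero = this
      show ?thesis
      proof (rule set_eqI)
        fix x :: complex
        show "x \<in> UNIV - {0} \<longleftrightarrow> x \<in> - \<real>\<^sub>\<le>\<^sub>0 \<union> - \<real>\<^sub>\<ge>\<^sub>0"
          using zero[of x] by (cases "x = 0") (simp, blast)
      qed
    qed
    moreover have "open (- \<real>\<^sub>\<le>\<^sub>0 :: complex set)" "open (- \<real>\<^sub>\<ge>\<^sub>0 :: complex set)"
      by (auto intro!: open_Compl closed_nonpos_Reals_complex closed_nonneg_Reals_complex)
    ultimately show ?thesis using holomorphic_on_Un[OF 1 2] by simp
  qed
  fix z :: complex assume "z \<in> {0}"
  then have z: "z = 0" by simp
  have "((\<lambda>z. csqrt z) \<longlongrightarrow> 0) (at 0)"
  proof (rule tendsto_norm_zero_cancel)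
    have "((\<lambda>z::complex. sqrt (cmod z)) \<longlongrightarrow> sqrt (cmod 0)) (at 0)" by (intro tendsto_intros)
    then show "((\<lambda>z. cmod (csqrt z)) \<longlongrightarrow> 0) (at 0)" by (simp add: norm_csqrt)
  qed
  moreover have "isCont f 0"
    using holomorphic_on_imp_continuous_on[OF f] by (simp add: continuous_on_eq_continuous_at)
  ultimately have "((\<lambda>z. f (csqrt z)) \<longlongrightarrow> f 0) (at 0)"
    using isCont_tendsto_compose by blast
  then show "((\<lambda>z. f (csqrt z)) \<longlongrightarrow> f (csqrt z)) (at z within UNIV)" by (simp add: z)
qed auto

section \<open>The closed half-plane to the right of the pole\<close>

lemma Re_Im_csqrt_squares:
  "(Re (csqrt w))\<^sup>2 = (cmod w + Re w) / 2" "(Im (csqrt w))\<^sup>2 = (cmod w - Re w) / 2"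
proof -
  have a: "(Re (csqrt w))\<^sup>2 - (Im (csqrt w))\<^sup>2 = Re w"
    using arg_cong[OF power2_csqrt[of w], of Re] by (simp add: power2_eq_square del: csqrt.sel)
  have b: "(Re (csqrt w))\<^sup>2 + (Im (csqrt w))\<^sup>2 = cmod w"
    using cmod_power2[of "csqrt w"] by (simp add: norm_csqrt del: csqrt.sel)
  show "(Re (csqrt w))\<^sup>2 = (cmod w + Re w) / 2" "(Im (csqrt w))\<^sup>2 = (cmod w - Re w) / 2"
    using a b by (simp_all add: field_simps del: csqrt.sel)
qed

lemma cmod_cosh_squared: "(cmod (cosh a))\<^sup>2 = (sinh (Re a))\<^sup>2 + (cos (Im a))\<^sup>2"
proof -
  have "(exp (Re a) - inverse (exp (Re a)))\<^sup>2 / 4 = (sinh (Re a))\<^sup>2"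
    by (simp add: sinh_field_def exp_minus power_divide)
  then show ?thesis unfolding cosh_conv_cos norm_cos_squared by simp
qed

text \<open>By \<open>cmod_cosh_squared\<close> a zero forces the root to be purely imaginary with
  imaginary part \<open>v\<close> and \<open>cos v = 0\<close>. Hence \<open>z = - v^2 / 2\<close>
  is real with \<open>\<bar>v\<bar> \<ge> pi / 2\<close>, and the rightmost such point is
  \<open>- pi^2 / 8\<close>.\<close>

lemma cosh_csqrt_nonzero:
  assumes "- (pi\<^sup>2 / 8) \<le> Re z" "z \<noteq> - of_real (pi\<^sup>2 / 8)"
  shows "cosh (csqrt (2 * z)) \<noteq> 0"
proof
  assume "cosh (csqrt (2 * z)) = 0"
  then have z: "(sinh (Re (csqrt (2 * z))))\<^sup>2 + (cos (Im (csqrt (2 * z))))\<^sup>2 = 0"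
    using cmod_cosh_squared[of "csqrt (2 * z)"] by simp
  define v where "v = Im (csqrt (2 * z))"
  have u: "Re (csqrt (2 * z)) = 0" and v: "cos v = 0"
    using z by (auto simp: v_def add_nonneg_eq_0_iff simp del: csqrt.sel)
  have "cmod (2 * z) + Re (2 * z) = 0" using Re_Im_csqrt_squares(1)[of "2 * z"] u by (simp del: csqrt.sel)
  then have m: "cmod z = - Re z" by (simp add: norm_mult)
  then have "(Im z)\<^sup>2 = 0" using cmod_power2[of z] by simp
  then have im: "Im z = 0" by simp
  have v2: "v\<^sup>2 = - 2 * Re z" using Re_Im_csqrt_squares(2)[of "2 * z"] m by (simp add: v_def norm_mult del: csqrt.sel)
  have "\<not> \<bar>v\<bar> < pi / 2"
  proof
    assume "\<bar>v\<bar> < pi / 2"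
    then have "- (pi / 2) < v" "v < pi / 2" by linarith+
    then show False using cos_gt_zero_pi[of v] v by simp
  qed
  then have "(pi / 2)\<^sup>2 \<le> \<bar>v\<bar>\<^sup>2" by (intro power_mono) auto
  then have "Re z \<le> - (pi\<^sup>2 / 8)" using v2 by (simp add: power_divide)
  then have "z = - of_real (pi\<^sup>2 / 8)" using assms(1) im by (simp add: complex_eq_iff)
  then show False using assms(2) by simp
qed

definition theta :: "complex \<Rightarrow> complex" where
  "theta z = csqrt (2 * z) * tanh (csqrt (2 * z))"

lemma cosh_csqrt_holomorphic: "(\<lambda>z. cosh (of_real x * csqrt (2 * z))) holomorphic_on A"
proof -
  have "(\<lambda>z. cosh (of_real x * csqrt z)) holomorphic_on UNIV"
    by (rule even_entire_csqrt_holomorphic) (auto simp: cosh_field_def[abs_def] intro!: holomorphic_intros)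
  from holomorphic_on_compose_gen[OF _ this, of "\<lambda>z. 2 * z" A] show ?thesis
    by (simp add: o_def holomorphic_intros)
qed

lemma theta_holomorphic:
  assumes "\<And>z. z \<in> A \<Longrightarrow> cosh (csqrt (2 * z)) \<noteq> 0"
  shows "theta holomorphic_on A"
proof -
  have "(\<lambda>z. csqrt z * sinh (csqrt z)) holomorphic_on UNIV"
    by (rule even_entire_csqrt_holomorphic) (auto simp: sinh_field_def[abs_def] algebra_simps intro!: holomorphic_intros)
  from holomorphic_on_compose_gen[OF _ this, of "\<lambda>z. 2 * z" A]
  have 1: "(\<lambda>z. csqrt (2 * z) * sinh (csqrt (2 * z))) holomorphic_on A"
    by (simp add: o_def holomorphic_intros)
  have "(\<lambda>z. csqrt (2 * z) * sinh (csqrt (2 * z)) / cosh (csqrt (2 * z))) holomorphic_on A"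
    using cosh_csqrt_holomorphic[of 1 A] assms by (intro holomorphic_on_divide 1) auto
  then show ?thesis by (simp add: theta_def[abs_def] tanh_def)
qed

text \<open>The numerator is at most \<open>cosh (Re a)\<close> and the denominator at least
  \<open>sinh (Re a)\<close>, which for \<open>Re a \<ge> 1\<close> is no less than half of
  \<open>cosh (Re a)\<close>.\<close>

lemma cmod_exit_factor_le:
  assumes u: "1 \<le> Re a" and x: "\<bar>x\<bar> \<le> 1"
  shows "cmod (cosh (of_real x * a) / cosh a) \<le> 2"
proof -
  have s: "0 < sinh (Re a)" using u by simp
  have "cmod (cosh (of_real x * a)) \<le> cosh (x * Re a)"
  proof -
    have "cmod (cosh (of_real x * a)) = cmod (exp (of_real x * a) + exp (- (of_real x * a))) / 2" by (simp add: cosh_field_def norm_divide)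
    also have "\<dots> \<le> (exp (x * Re a) + exp (- (x * Re a))) / 2"
      by (intro divide_right_mono order_trans[OF norm_triangle_ineq]) auto
    finally show ?thesis by (simp add: cosh_field_def)
  qed
  also have "cosh (x * Re a) \<le> cosh (Re a)"
  proof -
    have "\<bar>x * Re a\<bar> \<le> \<bar>Re a\<bar>" using x by (simp add: abs_mult mult_left_le_one_le)
    then show ?thesis by (metis cosh_real_abs cosh_real_nonneg_le_iff abs_ge_zero)
  qed
  also have "cosh (Re a) \<le> 2 * sinh (Re a)"
  proof -
    have "3 * exp (- Re a) \<le> exp (Re a)"
    proof -
      have "3 \<le> 1 + 2 * Re a" using u by simp
      also have "\<dots> \<le> exp (2 * Re a)" by (rule exp_ge_add_one_self)
      finally have "3 * exp (- Re a) \<le> exp (2 * Re a) * exp (- Re a)" by (intro mult_right_mono) auto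
      then show ?thesis by (simp add: exp_add[symmetric])
    qed
    then show ?thesis by (simp add: cosh_field_def sinh_field_def)
  qed
  also have "sinh (Re a) \<le> cmod (cosh a)"
    by (rule power2_le_imp_le) (simp_all add: cmod_cosh_squared)
  finally show ?thesis using s order_less_le_trans[OF s \<open>sinh (Re a) \<le> cmod (cosh a)\<close>]
    by (simp add: norm_divide divide_le_eq)
qed

text \<open>\<open>a * tanh a = a - 2 * a / (exp (2 * a) + 1)\<close>, and here the correction has
  modulus at most 2. The region contains \<open>csqrt (2 * z)\<close> for all large \<open>z\<close>
  with \<open>Re z \<ge> - pi^2 / 8\<close>.\<close>

lemma Re_mult_tanh_ge:
  fixes a :: complex
  assumes u: "1 \<le> Re a" and v: "\<bar>Im a\<bar> \<le> Re a + 2"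
  shows "- 1 \<le> Re (a * tanh a)"
proof -
  define u where "u = Re a"
  have u1: "1 \<le> u" using assms by (simp add: u_def)
  have c0: "cosh a \<noteq> 0"
  proof
    assume "cosh a = 0"
    then have "(sinh u)\<^sup>2 + (cos (Im a))\<^sup>2 = 0" using cmod_cosh_squared[of a] by (simp add: u_def)
    then have "sinh u = 0" by (simp add: add_nonneg_eq_0_iff)
    then show False using u1 by simp
  qed
  have e: "cmod (exp (2 * a)) = exp (2 * u)" by (simp add: u_def)
  have big: "2 * u + 2 * u\<^sup>2 \<le> exp (2 * u) - 1"
    using exp_lower_Taylor_quadratic[of "2 * u"] u1 by (simp add: power2_eq_square)
  have den: "exp (2 * u) - 1 \<le> cmod (exp (2 * a) + 1)"
    using norm_diff_ineq[of "exp (2 * a)" 1] unfolding e by simp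
  have tanh: "a * tanh a = a - a * (2 / (exp (2 * a) + 1))"
  proof -
    have nz: "exp (2 * a) + 1 \<noteq> 0"
    proof
      assume "exp (2 * a) + 1 = 0"
      then have "exp (2 * u) - 1 \<le> 0" using den by simp
      then show False using big u1 zero_le_power2[of u] by linarith
    qed
    have "tanh a = (exp a - exp (- a)) / (exp a + exp (- a))" by (rule tanh_altdef)
    also have "\<dots> = (exp a * (exp a - exp (- a))) / (exp a * (exp a + exp (- a)))" by simp
    also have "\<dots> = (exp (2 * a) - 1) / (exp (2 * a) + 1)"
    proof -
      have "exp (2 * a) = exp a * exp a" by (simp add: exp_double power2_eq_square)
      moreover have "exp a * exp (- a) = 1" by (simp add: exp_minus)
      ultimately show ?thesis by (simp only: distrib_left right_diff_distrib)
    qed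
    also have "\<dots> = ((exp (2 * a) + 1) - 2) / (exp (2 * a) + 1)" by simp
    also have "\<dots> = 1 - 2 / (exp (2 * a) + 1)" by (simp only: diff_divide_distrib divide_self[OF nz])
    finally show ?thesis by (simp add: right_diff_distrib)
  qed
  have na: "cmod a \<le> 2 * u + 2" using cmod_le[of a] assms by (simp add: u_def)
  have "cmod (a * (2 / (exp (2 * a) + 1))) = 2 * cmod a / cmod (exp (2 * a) + 1)" by (simp add: norm_mult norm_divide)
  also have "\<dots> \<le> 2 * (2 * u + 2) / (2 * u + 2 * u\<^sup>2)"
    using na u1 big den by (intro frac_le) (auto intro: add_pos_nonneg)
  also have "2 * u + 2 * u\<^sup>2 = u * (2 * u + 2)" by (simp add: power2_eq_square algebra_simps)
  also have "2 * (2 * u + 2) / (u * (2 * u + 2)) = 2 / u" by (rule nonzero_mult_divide_mult_cancel_right) (use u1 in simp)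
  also have "\<dots> \<le> 2" using u1 by (simp add: divide_le_eq)
  finally have "Re (a * (2 / (exp (2 * a) + 1))) \<le> 2"
    using complex_Re_le_cmod[of "a * (2 / (exp (2 * a) + 1))"] by linarith
  then show ?thesis unfolding tanh using u1 by (simp add: u_def)
qed

text \<open>Compactness on a bounded part and the two preceding estimates beyond it. For
  \<open>theta\<close> only a lower bound of the real part is sought, because the bound of
  \<open>half_normal_laplace\<close> depends on nothing else.\<close>

lemma theta_exit_bounds:
  fixes \<delta> x :: real
  assumes \<delta>: "0 < \<delta>" and x: "\<bar>x\<bar> \<le> 1"
  obtains C where "0 \<le> C"
    and "\<And>z. - (pi\<^sup>2 / 8) \<le> Re z \<Longrightarrow> \<delta> \<le> cmod (z + of_real (pi\<^sup>2 / 8)) \<Longrightarrow> - C \<le> Re (theta z)"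
    and "\<And>z. - (pi\<^sup>2 / 8) \<le> Re z \<Longrightarrow> \<delta> \<le> cmod (z + of_real (pi\<^sup>2 / 8)) \<Longrightarrow> cmod (cosh (of_real x * csqrt (2 * z)) / cosh (csqrt (2 * z))) \<le> C"
proof -
  define \<kappa> where "\<kappa> = pi\<^sup>2 / 8"
  have k: "0 < \<kappa>" "\<kappa> \<le> 2"
  proof -
    show "0 < \<kappa>" by (simp add: \<kappa>_def)
    have "pi\<^sup>2 \<le> 4\<^sup>2" using pi_less_4 by (intro power_mono) auto
    then show "\<kappa> \<le> 2" by (simp add: \<kappa>_def)
  qed
  \<comment> \<open>Beyond the radius \<open>\<kappa> + 1\<close> the root
    \<open>a = csqrt (2 * z)\<close> satisfies \<open>(Re a)^2 = cmod z + Re z \<ge> 1\<close>, the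
    hypothesis of the estimates for large \<open>z\<close>.\<close>
  define S where "S = {z. - \<kappa> \<le> Re z} \<inter> - ball (- of_real \<kappa>) \<delta> \<inter> cball 0 (\<kappa> + 1)"
  have S: "z \<in> S \<longleftrightarrow> - \<kappa> \<le> Re z \<and> \<delta> \<le> cmod (z + of_real \<kappa>) \<and> cmod z \<le> \<kappa> + 1" for z
    by (auto simp: S_def dist_norm norm_minus_commute add.commute)
  have "compact S" unfolding S_def
    by (intro closed_Int_compact closed_Int closed_halfspace_Re_ge closed_Compl open_ball compact_cball)
  have nz: "cosh (csqrt (2 * z)) \<noteq> 0" if "z \<in> S" for z
    using that \<delta> by (intro cosh_csqrt_nonzero) (auto simp: S \<kappa>_def)
  let ?E = "\<lambda>z. cosh (of_real x * csqrt (2 * z)) / cosh (csqrt (2 * z))"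
  have "continuous_on S theta" by (intro holomorphic_on_imp_continuous_on theta_holomorphic nz)
  then have "bounded (theta ` S)" using \<open>compact S\<close> by (intro compact_imp_bounded compact_continuous_image)
  then obtain C1 where "\<forall>w\<in>theta ` S. cmod w \<le> C1" unfolding bounded_iff by blast
  then have C1: "\<And>z. z \<in> S \<Longrightarrow> cmod (theta z) \<le> C1" by blast
  have "continuous_on S ?E"
    using cosh_csqrt_holomorphic[of x S] cosh_csqrt_holomorphic[of 1 S] nz
    by (intro holomorphic_on_imp_continuous_on holomorphic_on_divide) auto
  then have "bounded (?E ` S)" using \<open>compact S\<close> by (intro compact_imp_bounded compact_continuous_image)
  then obtain C2 where "\<forall>w\<in>?E ` S. cmod w \<le> C2" unfolding bounded_iff by blast
  then have C2: "\<And>z. z \<in> S \<Longrightarrow> cmod (?E z) \<le> C2" by blast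
  define C where "C = max 2 (max C1 C2)"
  have outside: "- 1 \<le> Re (theta z)" "cmod (?E z) \<le> 2" if z: "- \<kappa> \<le> Re z" "\<kappa> + 1 \<le> cmod z" for z
  proof -
    define a where "a = csqrt (2 * z)"
    have sq: "(Re a)\<^sup>2 = cmod z + Re z" "(Im a)\<^sup>2 = cmod z - Re z"
      using Re_Im_csqrt_squares[of "2 * z"] by (simp_all add: a_def norm_mult del: csqrt.sel)
    have ra: "0 \<le> Re a" unfolding a_def by (rule Re_csqrt)
    have "1\<^sup>2 \<le> (Re a)\<^sup>2" unfolding sq using z by simp
    then have u: "1 \<le> Re a" using ra by (rule power2_le_imp_le)
    have "\<bar>Im a\<bar>\<^sup>2 \<le> (Re a + 2)\<^sup>2"
    proof -
      have "(Im a)\<^sup>2 = (Re a)\<^sup>2 - 2 * Re z" using sq by simp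
      also have "\<dots> \<le> (Re a)\<^sup>2 + 4" using z k by simp
      also have "\<dots> \<le> (Re a + 2)\<^sup>2" using ra by (simp add: power2_sum)
      finally show ?thesis by simp
    qed
    moreover have "0 \<le> Re a + 2" using ra by simp
    ultimately have v: "\<bar>Im a\<bar> \<le> Re a + 2" by (rule power2_le_imp_le)
    show "- 1 \<le> Re (theta z)" unfolding theta_def a_def[symmetric] by (rule Re_mult_tanh_ge[OF u v])
    show "cmod (?E z) \<le> 2" unfolding a_def[symmetric] by (rule cmod_exit_factor_le[OF u x])
  qed
  show thesis
  proof (rule that[of C])
    show "0 \<le> C" by (simp add: C_def)
    fix z assume z: "- (pi\<^sup>2 / 8) \<le> Re z" "\<delta> \<le> cmod (z + of_real (pi\<^sup>2 / 8))"
    show "- C \<le> Re (theta z)"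
    proof (cases "cmod z \<le> \<kappa> + 1")
      case True
      then have "cmod (theta z) \<le> C1" using z by (intro C1) (simp add: S \<kappa>_def)
      moreover have "C1 \<le> C" by (simp add: C_def)
      ultimately show ?thesis using abs_Re_le_cmod[of "theta z"] by linarith
    next
      case False
      then have "- 1 \<le> Re (theta z)" using z by (intro outside(1)) (auto simp: \<kappa>_def)
      moreover have "2 \<le> C" by (simp add: C_def)
      ultimately show ?thesis by linarith
    qed
    show "cmod (?E z) \<le> C"
    proof (cases "cmod z \<le> \<kappa> + 1")
      case True
      then have "cmod (?E z) \<le> C2" using z by (intro C2) (simp add: S \<kappa>_def)
      moreover have "C2 \<le> C" by (simp add: C_def)
      ultimately show ?thesis by linarith
    next
      case False
      then have "cmod (?E z) \<le> 2" using z by (intro outside(2)) (auto simp: \<kappa>_def)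
      moreover have "2 \<le> C" by (simp add: C_def)
      ultimately show ?thesis by linarith
    qed
  qed
qed

text \<open>The first correction in \<open>e * cot e = 1 - e^2 / 3 + ...\<close>; it is the source
  of the \<open>1 / 3\<close> in \<open>theta_expansion\<close>.\<close>

lemma sin_cos_third_order: "((\<lambda>e::complex. (e * cos e - sin e) / (e\<^sup>2 * sin e)) \<longlongrightarrow> - 1 / 3) (at 0)"
proof -
  have sin3: "cmod (sin e - (e - e ^ 3 / 6)) \<le> exp (cmod e) * cmod e ^ 4 / 6" for e
  proof -
    have "(\<Sum>k\<le>3. complex_of_real (sin_coeff k) * e ^ k) = e - e ^ 3 / 6"
    proof -
      have "{..3::nat} = {0, 1, 2, 3}" by auto
      then show ?thesis by (simp add: sin_coeff_def fact_numeral)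
    qed
    then have "cmod (sin e - (e - e ^ 3 / 6)) \<le> exp \<bar>Im e\<bar> * cmod e ^ 4 / 6"
      using Taylor_sin[of e 3] by (simp add: fact_numeral)
    also have "\<dots> \<le> exp (cmod e) * cmod e ^ 4 / 6"
      using abs_Im_le_cmod[of e] by (intro divide_right_mono mult_right_mono) auto
    finally show ?thesis .
  qed
  have cos3: "cmod (cos e - (1 - e\<^sup>2 / 2)) \<le> exp (cmod e) * cmod e ^ 4 / 6" for e
  proof -
    have "(\<Sum>k\<le>3. complex_of_real (cos_coeff k) * e ^ k) = 1 - e\<^sup>2 / 2"
    proof -
      have "{..3::nat} = {0, 1, 2, 3}" by auto
      then show ?thesis by (simp add: cos_coeff_def fact_numeral)
    qed
    then have "cmod (cos e - (1 - e\<^sup>2 / 2)) \<le> exp \<bar>Im e\<bar> * cmod e ^ 4 / 6"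
      using Taylor_cos[of e 3] by (simp add: fact_numeral)
    also have "\<dots> \<le> exp (cmod e) * cmod e ^ 4 / 6"
      using abs_Im_le_cmod[of e] by (intro divide_right_mono mult_right_mono) auto
    finally show ?thesis .
  qed
  have 1: "((\<lambda>e::complex. (e * cos e - sin e) / e ^ 3 + 1 / 3) \<longlongrightarrow> 0) (at 0)"
  proof (rule Lim_null_comparison)
    show "\<forall>\<^sub>F e in at 0. cmod ((e * cos e - sin e) / e ^ 3 + 1 / 3) \<le> exp (cmod e) * (cmod e ^ 2 + cmod e) / 6"
      unfolding eventually_at_filter
    proof (intro always_eventually allI impI)
      fix e :: complex assume e: "e \<noteq> 0" "e \<in> UNIV"
      have "(e * cos e - sin e) / e ^ 3 + 1 / 3 = (e * (cos e - (1 - e\<^sup>2 / 2)) - (sin e - (e - e ^ 3 / 6))) / e ^ 3"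
        using e by (simp add: field_simps power2_eq_square power3_eq_cube)
      then have "cmod ((e * cos e - sin e) / e ^ 3 + 1 / 3) = cmod (e * (cos e - (1 - e\<^sup>2 / 2)) - (sin e - (e - e ^ 3 / 6))) / cmod e ^ 3"
        by (simp add: norm_divide norm_power)
      also have "\<dots> \<le> (cmod e * (exp (cmod e) * cmod e ^ 4 / 6) + exp (cmod e) * cmod e ^ 4 / 6) / cmod e ^ 3"
      proof (rule divide_right_mono)
        have "cmod (e * (cos e - (1 - e\<^sup>2 / 2))) \<le> cmod e * (exp (cmod e) * cmod e ^ 4 / 6)"
          unfolding norm_mult by (intro mult_left_mono cos3 norm_ge_zero)
        then show "cmod (e * (cos e - (1 - e\<^sup>2 / 2)) - (sin e - (e - e ^ 3 / 6))) \<le> cmod e * (exp (cmod e) * cmod e ^ 4 / 6) + exp (cmod e) * cmod e ^ 4 / 6"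
          using norm_triangle_ineq4[of "e * (cos e - (1 - e\<^sup>2 / 2))" "sin e - (e - e ^ 3 / 6)"] sin3[of e] by linarith
      qed simp
      also have "\<dots> = exp (cmod e) * (cmod e ^ 2 + cmod e) / 6"
        using e by (simp add: field_simps power2_eq_square power3_eq_cube power4_eq_xxxx)
      finally show "cmod ((e * cos e - sin e) / e ^ 3 + 1 / 3) \<le> exp (cmod e) * (cmod e ^ 2 + cmod e) / 6" .
    qed
    have "((\<lambda>e::complex. exp (cmod e) * (cmod e ^ 2 + cmod e) / 6) \<longlongrightarrow> exp (cmod 0) * (cmod 0 ^ 2 + cmod 0) / 6) (at 0)"
      by (intro tendsto_intros) auto
    then show "((\<lambda>e::complex. exp (cmod e) * (cmod e ^ 2 + cmod e) / 6) \<longlongrightarrow> 0) (at 0)" by simp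
  qed
  have 2: "((\<lambda>e::complex. e / sin e) \<longlongrightarrow> 1) (at 0)"
  proof -
    have "((\<lambda>e::complex. sin e / e) \<longlongrightarrow> 1) (at 0)"
      using DERIV_sin[of "0::complex"] by (simp add: has_field_derivative_iff)
    from tendsto_inverse[OF this] show ?thesis by (simp add: inverse_eq_divide)
  qed
  have "((\<lambda>e::complex. (((e * cos e - sin e) / e ^ 3 + 1 / 3) - 1 / 3) * (e / sin e)) \<longlongrightarrow> (0 - 1 / 3) * 1) (at 0)"
    by (intro tendsto_intros 1 2)
  moreover have "\<forall>\<^sub>F e::complex in at 0. (((e * cos e - sin e) / e ^ 3 + 1 / 3) - 1 / 3) * (e / sin e) = (e * cos e - sin e) / (e\<^sup>2 * sin e)"
    unfolding eventually_at_filter by (intro always_eventually) (auto simp: power2_eq_square power3_eq_cube)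
  ultimately show ?thesis by (auto intro: Lim_transform_eventually)
qed

text \<open>The \<open>\<epsilon>\<close> for which \<open>csqrt (2 * (h - \<pi>\<^sup>2 / 8)) = \<plusminus> \<i> (\<pi> / 2 - \<epsilon>)\<close>; it turns hyperbolic functions at the pole into trigonometric functions at 0.\<close>

definition pole_coordinate :: "complex \<Rightarrow> complex" where
  "pole_coordinate h = of_real (pi / 2) - csqrt (of_real (pi\<^sup>2 / 4) - 2 * h)"

lemma pole_coordinate_properties:
  shows "filterlim pole_coordinate (at 0) (at 0)"
    and "h = pole_coordinate h * (of_real pi - pole_coordinate h) / 2"
    and "theta (h - of_real (pi\<^sup>2 / 8)) = - (of_real (pi / 2) - pole_coordinate h) * cos (pole_coordinate h) / sin (pole_coordinate h)"
    and "cosh (of_real x * csqrt (2 * (h - of_real (pi\<^sup>2 / 8)))) = cos (of_real x * (of_real (pi / 2) - pole_coordinate h))"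
    and "cosh (csqrt (2 * (h - of_real (pi\<^sup>2 / 8)))) = sin (pole_coordinate h)"
proof -
  define \<alpha> where "\<alpha> h = csqrt (of_real (pi\<^sup>2 / 4) - 2 * h)" for h
  have \<alpha>2: "(\<alpha> h)\<^sup>2 = of_real (pi\<^sup>2 / 4) - 2 * h" for h by (simp add: \<alpha>_def)
  have eps: "pole_coordinate h = of_real (pi / 2) - \<alpha> h" for h by (simp add: pole_coordinate_def \<alpha>_def)
  have \<alpha>0: "csqrt (of_real (pi\<^sup>2 / 4)) = of_real (pi / 2)"
  proof -
    have "csqrt (of_real (pi\<^sup>2 / 4)) = of_real (sqrt (pi\<^sup>2 / 4))" by (subst csqrt_of_real_nonneg) auto
    also have "sqrt (pi\<^sup>2 / 4) = pi / 2" by (simp add: real_sqrt_divide)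
    finally show ?thesis .
  qed
  show h_eq: "h = pole_coordinate h * (of_real pi - pole_coordinate h) / 2" for h
  proof -
    have "pole_coordinate h * (of_real pi - pole_coordinate h) = of_real (pi\<^sup>2 / 4) - (\<alpha> h)\<^sup>2"
      unfolding eps by (simp add: algebra_simps power2_eq_square)
    then show ?thesis unfolding \<alpha>2 by simp
  qed
  show "filterlim pole_coordinate (at 0) (at 0)" unfolding filterlim_at
  proof
    show "\<forall>\<^sub>F h in at 0. pole_coordinate h \<in> UNIV \<and> pole_coordinate h \<noteq> 0"
      unfolding eventually_at_filter
    proof (intro always_eventually allI impI)
      fix h :: complex assume "h \<noteq> 0"
      then show "pole_coordinate h \<in> UNIV \<and> pole_coordinate h \<noteq> 0" using h_eq[of h] by auto
    qed
    have "isCont csqrt (of_real (pi\<^sup>2 / 4))" by (rule continuous_at_csqrt) (simp add: complex_nonpos_Reals_iff)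
    moreover have "((\<lambda>h::complex. of_real (pi\<^sup>2 / 4) - 2 * h) \<longlongrightarrow> of_real (pi\<^sup>2 / 4) - 2 * 0) (at 0)" by (intro tendsto_intros)
    ultimately have lim: "(\<alpha> \<longlongrightarrow> of_real (pi / 2)) (at 0)"
      unfolding \<alpha>_def \<alpha>0[symmetric] using isCont_tendsto_compose by fastforce
    then have "((\<lambda>h. of_real (pi / 2) - \<alpha> h) \<longlongrightarrow> of_real (pi / 2) - of_real (pi / 2)) (at 0)"
      by (intro tendsto_diff tendsto_const lim)
    then show "(pole_coordinate \<longlongrightarrow> 0) (at 0)" by (simp add: eps[abs_def])
  qed
  define a where "a = csqrt (2 * (h - of_real (pi\<^sup>2 / 8)))"
  have "a\<^sup>2 = (\<i> * \<alpha> h)\<^sup>2" by (simp add: a_def power_mult_distrib \<alpha>2 algebra_simps)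
  \<comment> \<open>Only the square of \<open>a\<close> is known. The sign may stay open because
    \<open>cosh\<close> and \<open>a * tanh a\<close> are even.\<close>
  then have a: "a = \<i> * \<alpha> h \<or> a = - (\<i> * \<alpha> h)" by (rule power2_eq_iff[THEN iffD1])
  have sc: "sin (\<alpha> h) = cos (pole_coordinate h)" "cos (\<alpha> h) = sin (pole_coordinate h)"
    using sin_cos_eq[of "pole_coordinate h"] cos_sin_eq[of "pole_coordinate h"] by (simp_all add: eps)
  have ch: "cosh (of_real y * a) = cos (of_real y * \<alpha> h)" for y
  proof -
    have "\<i> * (of_real y * (\<i> * \<alpha> h)) = - (of_real y * \<alpha> h)" by (simp add: complex_eq_iff)
    note X = this
    from a show ?thesis unfolding cosh_conv_cos
    proof (elim disjE)
      assume "a = \<i> * \<alpha> h"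
      then show "cos (\<i> * (of_real y * a)) = cos (of_real y * \<alpha> h)" by (simp only: X cos_minus)
    next
      assume "a = - (\<i> * \<alpha> h)"
      then show "cos (\<i> * (of_real y * a)) = cos (of_real y * \<alpha> h)" by (simp only: mult_minus_right X minus_minus)
    qed
  qed
  show "cosh (of_real x * csqrt (2 * (h - of_real (pi\<^sup>2 / 8)))) = cos (of_real x * (of_real (pi / 2) - pole_coordinate h))"
    using ch[of x] unfolding a_def by (simp add: eps)
  show "cosh (csqrt (2 * (h - of_real (pi\<^sup>2 / 8)))) = sin (pole_coordinate h)"
    using ch[of 1] sc(2) unfolding a_def by simp
  have th: "theta (h - of_real (pi\<^sup>2 / 8)) = a * tanh a" by (simp add: theta_def a_def)
  have J: "(\<i> * u) * (\<i> * v) = - (u * v)" for u v :: complex by (simp add: complex_eq_iff)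
  have T: "tanh (\<i> * \<alpha> h) = \<i> * tan (\<alpha> h)" unfolding tanh_conv_tan by simp
  have "a * tanh a = (\<i> * \<alpha> h) * tanh (\<i> * \<alpha> h)" using a
  proof (elim disjE)
    assume "a = - (\<i> * \<alpha> h)"
    then show ?thesis by (simp only: tanh_minus minus_mult_minus)
  qed (simp only:)
  then have "a * tanh a = - (\<alpha> h * tan (\<alpha> h))" unfolding T J .
  then show "theta (h - of_real (pi\<^sup>2 / 8)) = - (of_real (pi / 2) - pole_coordinate h) * cos (pole_coordinate h) / sin (pole_coordinate h)"
    unfolding th tan_def sc by (simp add: eps)
qed

text \<open>Algebra for \<open>p = pi\<close>, \<open>C = cos e\<close>, \<open>S = sin e\<close>.
  The singular quotient \<open>C / S\<close> is \<open>1 / e\<close> plus \<open>e\<close> times the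
  quotient of \<open>sin_cos_third_order\<close>; the poles then cancel, and the right-hand side
  visibly has a limit at \<open>e = 0\<close>.\<close>

lemma theta_pole_identity:
  fixes e p C S :: complex
  assumes nz: "e \<noteq> 0" "p - e \<noteq> 0" "S \<noteq> 0" and h: "h = e * (p - e) / 2"
  shows "(- (p / 2 - e) * C / S + p\<^sup>2 / (4 * h) - 3 / 2) / h
    = 1 / (p - e)\<^sup>2 - (p / 2 - e) * ((e * C - S) / (e\<^sup>2 * S)) * (2 / (p - e))"
proof -
  define g where "g = (e * C - S) / (e\<^sup>2 * S)"
  have CS: "C / S = e * g + 1 / e" using nz by (simp add: g_def field_simps power2_eq_square)
  define q where "q = p - e"
  have q: "q \<noteq> 0" "p = q + e" using nz by (auto simp: q_def)
  have "- (p / 2 - e) * C / S + p\<^sup>2 / (4 * h) - 3 / 2 = - (p / 2 - e) * (C / S) + p\<^sup>2 / (2 * e * q) - 3 / 2"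
    unfolding h by (simp add: q_def)
  also have "\<dots> = e / (2 * q) - (p / 2 - e) * (e * g)"
    unfolding CS q(2) using q(1) nz(1) by (simp add: divide_simps) (simp add: algebra_simps power2_eq_square)
  finally have "(- (p / 2 - e) * C / S + p\<^sup>2 / (4 * h) - 3 / 2) / h = (e / (2 * q) - (p / 2 - e) * (e * g)) / (e * q / 2)"
    unfolding h q_def[symmetric] by simp
  also have "\<dots> = 1 / q\<^sup>2 - (p / 2 - e) * g * (2 / q)"
    using q(1) nz(1) by (simp add: divide_simps power2_eq_square) (simp add: algebra_simps)
  finally show ?thesis by (simp add: g_def q_def)
qed

text \<open>The expansion is carried to order \<open>h\<close> because in the square of
  \<open>theta\<close> the product of that term with \<open>- (pi^2 / 4) / h\<close> has order 1 and
  enters the final constant.\<close>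

lemma theta_expansion:
  "((\<lambda>h. (theta (h - of_real (pi\<^sup>2 / 8)) + of_real (pi\<^sup>2 / 4) / h - 3 / 2) / h) \<longlongrightarrow> of_real (1 / 3 + 1 / pi\<^sup>2)) (at 0)"
proof -
  let ?p = "complex_of_real pi"
  define F where "F e = 1 / (?p - e)\<^sup>2 - (?p / 2 - e) * ((e * cos e - sin e) / (e\<^sup>2 * sin e)) * (2 / (?p - e))" for e
  have "(F \<longlongrightarrow> 1 / (?p - 0)\<^sup>2 - (?p / 2 - 0) * (- 1 / 3) * (2 / (?p - 0))) (at 0)"
    unfolding F_def by (intro tendsto_intros sin_cos_third_order) auto
  moreover have "1 / (?p - 0)\<^sup>2 - (?p / 2 - 0) * (- 1 / 3) * (2 / (?p - 0)) = of_real (1 / 3 + 1 / pi\<^sup>2)"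
    by (simp add: field_simps)
  ultimately have "((\<lambda>h. F (pole_coordinate h)) \<longlongrightarrow> of_real (1 / 3 + 1 / pi\<^sup>2)) (at 0)"
    using filterlim_compose[OF _ pole_coordinate_properties(1)] by metis
  moreover have "\<forall>\<^sub>F h in at 0. F (pole_coordinate h) = (theta (h - of_real (pi\<^sup>2 / 8)) + of_real (pi\<^sup>2 / 4) / h - 3 / 2) / h"
  proof -
    have nz: "\<forall>\<^sub>F e in at (0::complex). e \<noteq> 0 \<and> ?p - e \<noteq> 0 \<and> sin e \<noteq> 0"
    proof (intro eventually_conj)
      show "\<forall>\<^sub>F e in at (0::complex). e \<noteq> 0" by (simp add: eventually_at_filter)
      have "((\<lambda>e. ?p - e) \<longlongrightarrow> ?p - 0) (at 0)" by (intro tendsto_intros)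
      then show "\<forall>\<^sub>F e in at (0::complex). ?p - e \<noteq> 0" by (rule tendsto_imp_eventually_ne) simp
      have "((\<lambda>e::complex. sin e / e) \<longlongrightarrow> 1) (at 0)"
        using DERIV_sin[of "0::complex"] by (simp add: has_field_derivative_iff)
      then have "\<forall>\<^sub>F e in at (0::complex). sin e / e \<noteq> 0" by (rule tendsto_imp_eventually_ne) simp
      then show "\<forall>\<^sub>F e in at (0::complex). sin e \<noteq> 0" by eventually_elim auto
    qed
    have "\<forall>\<^sub>F h in at 0. pole_coordinate h \<noteq> 0 \<and> ?p - pole_coordinate h \<noteq> 0 \<and> sin (pole_coordinate h) \<noteq> 0"
      using filterlim_iff[THEN iffD1, OF pole_coordinate_properties(1), rule_format, OF nz] .
    then show ?thesis
    proof eventually_elim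
      case (elim h)
      have "(- (?p / 2 - pole_coordinate h) * cos (pole_coordinate h) / sin (pole_coordinate h) + ?p\<^sup>2 / (4 * h) - 3 / 2) / h = F (pole_coordinate h)"
        unfolding F_def using elim by (intro theta_pole_identity pole_coordinate_properties(2)) auto
      moreover have "theta (h - of_real (pi\<^sup>2 / 8)) = - (?p / 2 - pole_coordinate h) * cos (pole_coordinate h) / sin (pole_coordinate h)"
        using pole_coordinate_properties(3)[of h] by simp
      moreover have "?p\<^sup>2 / (4 * h) = of_real (pi\<^sup>2 / 4) / h" by simp
      ultimately show ?case by (simp only:)
    qed
  qed
  ultimately show ?thesis by (rule Lim_transform_eventually)
qed

text \<open>In the pole coordinate \<open>e\<close> one has \<open>h = e * (pi - e) / 2\<close>
  while the denominator is \<open>sin e\<close>; the limit is the residue of the hitting time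
  transform.\<close>

lemma exit_factor_expansion:
  "((\<lambda>h. h * (cosh (of_real x * csqrt (2 * (h - of_real (pi\<^sup>2 / 8)))) / cosh (csqrt (2 * (h - of_real (pi\<^sup>2 / 8))))))
    \<longlongrightarrow> of_real (pi / 2 * cos (pi * x / 2))) (at 0)"
proof -
  let ?p = "complex_of_real pi"
  define F where "F e = (?p - e) / 2 * (e / sin e) * cos (of_real x * (?p / 2 - e))" for e
  have es: "((\<lambda>e::complex. e / sin e) \<longlongrightarrow> 1) (at 0)"
  proof -
    have "((\<lambda>e::complex. sin e / e) \<longlongrightarrow> 1) (at 0)"
      using DERIV_sin[of "0::complex"] by (simp add: has_field_derivative_iff)
    from tendsto_inverse[OF this] show ?thesis by (simp add: inverse_eq_divide)
  qed
  have "(F \<longlongrightarrow> (?p - 0) / 2 * 1 * cos (of_real x * (?p / 2 - 0))) (at 0)"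
    unfolding F_def by (intro tendsto_intros es) auto
  moreover have "(?p - 0) / 2 * 1 * cos (of_real x * (?p / 2 - 0)) = of_real (pi / 2 * cos (pi * x / 2))"
    by (simp add: cos_of_real[symmetric] mult.commute)
  ultimately have "((\<lambda>h. F (pole_coordinate h)) \<longlongrightarrow> of_real (pi / 2 * cos (pi * x / 2))) (at 0)"
    using filterlim_compose[OF _ pole_coordinate_properties(1)] by metis
  moreover have "F (pole_coordinate h) = h * (cosh (of_real x * csqrt (2 * (h - of_real (pi\<^sup>2 / 8)))) / cosh (csqrt (2 * (h - of_real (pi\<^sup>2 / 8)))))" for h
  proof -
    have "h * (cos (of_real x * (?p / 2 - pole_coordinate h)) / sin (pole_coordinate h))
      = pole_coordinate h * (of_real pi - pole_coordinate h) / 2 * (cos (of_real x * (?p / 2 - pole_coordinate h)) / sin (pole_coordinate h))"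
      using pole_coordinate_properties(2)[of h] by (simp only:)
    also have "\<dots> = F (pole_coordinate h)" by (simp add: F_def)
    finally show ?thesis using pole_coordinate_properties(4)[of x h] pole_coordinate_properties(5)[of h] by simp
  qed
  ultimately show ?thesis by simp
qed

section \<open>Inversion of the Laplace transform\<close>

lemma integrable_inverse_1_plus_square_lborel: "integrable lborel (\<lambda>y::real. 1 / (1 + y\<^sup>2))"
  using integrable_inverse_1_plus_square by (simp add: set_integrable_def einterval_def inverse_eq_divide)

lemma one_plus_square_le_cmod:
  assumes r: "0 < r"
  shows "1 + y\<^sup>2 \<le> (1 + 1 / r\<^sup>2) * (cmod (Complex (- r) y))\<^sup>2"
proof -
  have "(1 + 1 / r\<^sup>2) * (r\<^sup>2 + y\<^sup>2) = r\<^sup>2 + y\<^sup>2 + 1 + y\<^sup>2 / r\<^sup>2"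
    using r by (simp add: field_simps)
  then show ?thesis using r by (simp add: cmod_power2)
qed

text \<open>The line is closed on the right by a rectangle around the double pole 0 and the simple
  pole \<open>l\<close>. With bounded numerator the integrand decays like an inverse cube, so the
  other three sides vanish in the limit.\<close>

lemma vertical_line_integral_residues:
  fixes M :: "complex \<Rightarrow> complex" and l r \<kappa> K :: real
  assumes holo: "M holomorphic_on {z. - \<kappa> < Re z}" and r: "0 < r" "r < \<kappa>" and l: "0 < l"
    and bound: "\<And>z. - r \<le> Re z \<Longrightarrow> cmod (M z) \<le> K"
  defines "f \<equiv> \<lambda>z. M z / (z\<^sup>2 * (z - of_real l))"
  shows "integrable lborel (\<lambda>y. f (Complex (- r) y))"
    and "(LBINT y. f (Complex (- r) y)) = - (2 * pi) * (M (of_real l) / of_real (l\<^sup>2) - deriv M 0 / of_real l - M 0 / of_real (l\<^sup>2))"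
proof -
  let ?S = "{z. - \<kappa> < Re z}"
  have opS: "open ?S" by (rule open_halfspace_Re_gt)
  have K: "0 \<le> K" using order_trans[OF norm_ge_zero bound[of 0]] r by simp
  have contM: "continuous_on ?S M" by (rule holomorphic_on_imp_continuous_on[OF holo])
  have line_cont: "continuous_on UNIV (\<lambda>y. f (Complex (- r) y))"
  proof -
    have line: "continuous_on UNIV (\<lambda>y. Complex (- r) y)" unfolding Complex_eq by (intro continuous_intros)
    have "Complex (- r) y \<noteq> 0" "Complex (- r) y - of_real l \<noteq> 0" for y
      using r l by (simp_all add: complex_eq_iff)
    then show ?thesis unfolding f_def using r
      by (intro continuous_on_divide continuous_on_mult continuous_on_power continuous_on_diff line
          continuous_on_const continuous_on_compose2[OF contM line]) auto
  qed
  have line_bound: "cmod (f (Complex (- r) y)) \<le> K / l * (1 + 1 / r\<^sup>2) * (1 / (1 + y\<^sup>2))" for y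
  proof -
    let ?z = "Complex (- r) y"
    have 1: "l \<le> cmod (?z - of_real l)" using abs_Re_le_cmod[of "?z - of_real l"] r l by simp
    have 2: "1 + y\<^sup>2 \<le> (1 + 1 / r\<^sup>2) * (cmod ?z)\<^sup>2" by (rule one_plus_square_le_cmod[OF r(1)])
    have z0: "0 < (cmod ?z)\<^sup>2" using r by (simp add: complex_eq_iff)
    have "cmod (f ?z) = cmod (M ?z) / ((cmod ?z)\<^sup>2 * cmod (?z - of_real l))" by (simp add: f_def norm_divide norm_mult norm_power)
    also have "\<dots> \<le> K / ((cmod ?z)\<^sup>2 * l)"
      using bound[of ?z] 1 z0 l K by (intro frac_le mult_left_mono) auto
    also have "\<dots> = K / l * (1 / (cmod ?z)\<^sup>2)" by simp
    also have "1 / (cmod ?z)\<^sup>2 \<le> (1 + 1 / r\<^sup>2) * (1 / (1 + y\<^sup>2))"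
      using 2 z0 by (simp add: divide_simps add_pos_nonneg mult.commute)
    finally show ?thesis using K l by (simp add: mult_left_mono mult.assoc divide_right_mono)
  qed
  show int: "integrable lborel (\<lambda>y. f (Complex (- r) y))"
  proof (rule Bochner_Integration.integrable_bound)
    show "integrable lborel (\<lambda>y. K / l * (1 + 1 / r\<^sup>2) * (1 / (1 + y\<^sup>2)))"
      by (intro integrable_mult_right integrable_inverse_1_plus_square_lborel)
    show "(\<lambda>y. f (Complex (- r) y)) \<in> borel_measurable lborel"
      using borel_measurable_continuous_onI[OF line_cont] by simp
  qed (use line_bound K l in \<open>auto intro!: AE_I2 simp: abs_mult\<close>)
  define Rs where "Rs = M (of_real l) / of_real (l\<^sup>2) - deriv M 0 / of_real l - M 0 / of_real (l\<^sup>2)"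
  \<comment> \<open>\<open>R > 2 * l\<close> puts \<open>l\<close> inside the rectangle and gives
    \<open>cmod (z - of_real l) \<ge> R / 2\<close> on the far sides.\<close>
  define R0 where "R0 = max (max (2 * l) r) 1"
  have contour: "cmod (2 * pi * \<i> * Rs + \<i> * (LBINT y=ereal (-R)..ereal R. f (Complex (- r) y))) \<le> 12 * K / R\<^sup>2" if R: "R > R0" for R :: real
  proof -
    have R': "2 * l < R" "r < R" "1 < R" using R by (auto simp: R0_def)
    define a1 where "a1 = Complex (- r) (- R)"
    define a2 where "a2 = Complex R (- R)"
    define a3 where "a3 = Complex R R"
    define a4 where "a4 = Complex (- r) R"
    have rp: "rectpath a1 a3 = linepath a1 a2 +++ linepath a2 a3 +++ linepath a3 a4 +++ linepath a4 a1"
      by (simp add: rectpath_def Let_def a1_def a2_def a3_def a4_def)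
    have in_box: "p \<in> box a1 a3" if "p \<in> {0, of_real l}" for p
      using that r R' l by (auto simp: in_box_complex_iff a1_def a3_def)
    have fholo: "f holomorphic_on ?S - {0, of_real l}"
      unfolding f_def by (intro holomorphic_intros holomorphic_on_subset[OF holo]) auto
    have cbox_S: "cbox a1 a3 \<subseteq> ?S" using r by (auto simp: in_cbox_complex_iff a1_def a3_def)
    have res: "contour_integral (rectpath a1 a3) f = 2 * pi * \<i> * (\<Sum>p\<in>{0, of_real l}. winding_number (rectpath a1 a3) p * residue f p)"
    proof (rule Residue_theorem[OF opS _ _ fholo])
      show "connected ?S" by (intro convex_connected convex_halfspace_Re_gt)
      show "path_image (rectpath a1 a3) \<subseteq> ?S - {0, of_real l}"
        using in_box cbox_S r R' by (subst path_image_rectpath_cbox_minus_box) (auto simp: a1_def a3_def)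
      show "\<forall>z. z \<notin> ?S \<longrightarrow> winding_number (rectpath a1 a3) z = 0"
        using cbox_S r R' by (intro allI impI winding_number_rectpath_outside) (auto simp: a1_def a3_def)
    qed auto
    have res0: "residue f 0 = - deriv M 0 / of_real l - M 0 / of_real (l\<^sup>2)"
    proof -
      let ?A = "{z. - \<kappa> < Re z} \<inter> {z. Re z < l}"
      have A: "open ?A" "0 \<in> ?A" using r l by (auto intro!: open_Int open_halfspace_Re_gt open_halfspace_Re_lt)
      have h: "(\<lambda>z. M z / (z - of_real l)) holomorphic_on ?A"
        by (intro holomorphic_intros holomorphic_on_subset[OF holo]) auto
      have "residue (\<lambda>z. (M z / (z - of_real l)) / z ^ Suc 1) 0 = (deriv ^^ 1) (\<lambda>z. M z / (z - of_real l)) 0 / fact 1"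
        by (rule residue_holomorphic_over_power'[OF A h])
      moreover have "(\<lambda>z. (M z / (z - of_real l)) / z ^ Suc 1) = f"
        by (simp add: f_def power2_eq_square fun_eq_iff)
      moreover have "deriv (\<lambda>z. M z / (z - of_real l)) 0 = - deriv M 0 / of_real l - M 0 / of_real (l\<^sup>2)"
      proof (rule DERIV_imp_deriv)
        have "(M has_field_derivative deriv M 0) (at 0)"
          by (rule holomorphic_derivI[OF holo opS]) (use r in auto)
        then have "((\<lambda>z. M z / (z - of_real l)) has_field_derivative
           (deriv M 0 * (0 - of_real l) - M 0 * (1 - 0)) / ((0 - of_real l) * (0 - of_real l))) (at 0)"
          using l by (intro DERIV_divide DERIV_diff DERIV_ident DERIV_const) auto
        then show "((\<lambda>z. M z / (z - of_real l)) has_field_derivative - deriv M 0 / of_real l - M 0 / of_real (l\<^sup>2)) (at 0)"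
          by (rule DERIV_cong) (use l in \<open>simp add: field_simps power2_eq_square\<close>)
      qed
      ultimately show ?thesis by simp
    qed
    have resl: "residue f (of_real l) = M (of_real l) / of_real (l\<^sup>2)"
    proof -
      have "residue (\<lambda>z. (M z / z\<^sup>2) / (z - of_real l)) (of_real l) = M (of_real l) / (of_real l)\<^sup>2"
        by (rule residue_simple[of "{z. 0 < Re z}"])
          (use l r in \<open>auto intro!: open_halfspace_Re_gt holomorphic_intros holomorphic_on_subset[OF holo]\<close>)
      then show ?thesis by (simp add: f_def)
    qed
    have l0: "(of_real l :: complex) \<noteq> 0" using l by simp
    have total: "contour_integral (rectpath a1 a3) f = 2 * pi * \<i> * Rs"
      unfolding res Rs_def using l0 in_box by (simp add: winding_number_rectpath res0 resl)
    have big: "cmod (f z) \<le> 2 * K / R ^ 3" if z: "- r \<le> Re z" "R \<le> cmod z" for z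
    proof -
      have "R / 2 \<le> cmod (z - of_real l)"
        using norm_triangle_ineq2[of z "of_real l"] R' l z(2) by simp
      moreover have "R\<^sup>2 \<le> (cmod z)\<^sup>2" using z(2) R' by (intro power_mono) auto
      ultimately have "R\<^sup>2 * (R / 2) \<le> (cmod z)\<^sup>2 * cmod (z - of_real l)"
        using R' by (intro mult_mono) auto
      then have "cmod (M z) / ((cmod z)\<^sup>2 * cmod (z - of_real l)) \<le> K / (R\<^sup>2 * (R / 2))"
        using bound[OF z(1)] R' K by (intro frac_le) auto
      then show ?thesis using R' by (simp add: f_def norm_divide norm_mult norm_power power3_eq_cube power2_eq_square mult_ac)
    qed
    have seg_S: "closed_segment p q \<subseteq> ?S - {0, of_real l}" if "closed_segment p q \<subseteq> path_image (rectpath a1 a3)" for p q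
      using that in_box cbox_S r R' by (subst (asm) path_image_rectpath_cbox_minus_box) (auto simp: a1_def a3_def)
    have pi_eq: "path_image (rectpath a1 a3) = closed_segment a1 a2 \<union> closed_segment a2 a3 \<union> closed_segment a3 a4 \<union> closed_segment a4 a1"
      by (simp add: rp path_image_join Un_assoc)
    have contf: "continuous_on (?S - {0, of_real l}) f" by (rule holomorphic_on_imp_continuous_on[OF fholo])
    have ci: "f contour_integrable_on linepath a1 a2" "f contour_integrable_on linepath a2 a3"
      "f contour_integrable_on linepath a3 a4" "f contour_integrable_on linepath a4 a1"
      by (rule contour_integrable_continuous_linepath, rule continuous_on_subset[OF contf], rule seg_S, force simp: pi_eq)+
    have split: "contour_integral (rectpath a1 a3) f = contour_integral (linepath a1 a2) f + contour_integral (linepath a2 a3) f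
       + contour_integral (linepath a3 a4) f + contour_integral (linepath a4 a1) f"
      unfolding rp using ci by (simp add: contour_integrable_joinI)
    have nonneg: "0 \<le> 2 * K / R ^ 3" using K R' by simp
    have b1: "cmod (contour_integral (linepath a1 a2) f) \<le> 2 * K / R ^ 3 * (2 * R)"
    proof (rule order_trans[OF contour_integral_bound_linepath[OF ci(1) nonneg]])
      fix z assume "z \<in> closed_segment a1 a2"
      then have "- r \<le> Re z" "Im z = - R" using r R' by (auto simp: a1_def a2_def closed_segment_same_Im closed_segment_eq_real_ivl)
      then show "cmod (f z) \<le> 2 * K / R ^ 3" using abs_Im_le_cmod[of z] R' by (intro big) auto
    next
      have "a2 - a1 = of_real (R + r)" by (simp add: a1_def a2_def complex_eq_iff)
      then have "cmod (a2 - a1) = R + r" using R' r by (simp only: norm_of_real; simp?)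
      then show "2 * K / R ^ 3 * cmod (a2 - a1) \<le> 2 * K / R ^ 3 * (2 * R)"
        using nonneg R' by (intro mult_left_mono) auto
    qed
    have b2: "cmod (contour_integral (linepath a2 a3) f) \<le> 2 * K / R ^ 3 * (2 * R)"
    proof (rule order_trans[OF contour_integral_bound_linepath[OF ci(2) nonneg]])
      fix z assume "z \<in> closed_segment a2 a3"
      then have "Re z = R" using r R' by (auto simp: a3_def a2_def closed_segment_same_Re)
      then show "cmod (f z) \<le> 2 * K / R ^ 3" using abs_Re_le_cmod[of z] R' r by (intro big) auto
    next
      have "a3 - a2 = \<i> * of_real (2 * R)" by (simp add: a3_def a2_def complex_eq_iff)
      then have "cmod (a3 - a2) = 2 * R" using R' by (simp add: norm_mult del: of_real_mult)
      then show "2 * K / R ^ 3 * cmod (a3 - a2) \<le> 2 * K / R ^ 3 * (2 * R)" by simp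
    qed
    have b3: "cmod (contour_integral (linepath a3 a4) f) \<le> 2 * K / R ^ 3 * (2 * R)"
    proof (rule order_trans[OF contour_integral_bound_linepath[OF ci(3) nonneg]])
      fix z assume "z \<in> closed_segment a3 a4"
      then have "- r \<le> Re z" "Im z = R" using r R' by (auto simp: a3_def a4_def closed_segment_same_Im closed_segment_eq_real_ivl)
      then show "cmod (f z) \<le> 2 * K / R ^ 3" using abs_Im_le_cmod[of z] R' by (intro big) auto
    next
      have "a4 - a3 = of_real (- (R + r))" by (simp add: a3_def a4_def complex_eq_iff)
      then have "cmod (a4 - a3) = R + r" using R' r by (simp only: norm_of_real; simp?)
      then show "2 * K / R ^ 3 * cmod (a4 - a3) \<le> 2 * K / R ^ 3 * (2 * R)"
        using nonneg R' by (intro mult_left_mono) auto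
    qed
    \<comment> \<open>The rectangle is traversed counterclockwise, so its left side runs downwards;
      hence the minus sign.\<close>
    have left: "contour_integral (linepath a4 a1) f = - (\<i> * (LBINT y=ereal (-R)..ereal R. f (Complex (- r) y)))"
    proof -
      have "contour_integral (linepath a4 a1) f = - contour_integral (linepath a1 a4) f"
        using contour_integral_reverse_linepath[of a1 a4 f] continuous_on_subset[OF contf seg_S[of a4 a1]]
        by (simp add: pi_eq closed_segment_commute)
      also have "contour_integral (linepath a1 a4) f = \<i> * integral {-R..R} (\<lambda>y. f (Complex (- r) y))"
        by (rule contour_integral_linepath_same_Re) (use R' in \<open>auto simp: a1_def a4_def\<close>)
      also have "integral {-R..R} (\<lambda>y. f (Complex (- r) y)) = (LBINT y=ereal (-R)..ereal R. f (Complex (- r) y))"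
        using R' set_borel_integral_eq_integral(2)[of "{-R..R}" "\<lambda>y. f (Complex (- r) y)"]
          borel_integrable_compact[of "{-R..R}" "\<lambda>y. f (Complex (- r) y)"] continuous_on_subset[OF line_cont, of "{-R..R}"]
        by (simp add: interval_integral_Icc set_integrable_def)
      finally show ?thesis .
    qed
    have "2 * pi * \<i> * Rs + \<i> * (LBINT y=ereal (-R)..ereal R. f (Complex (- r) y)) = contour_integral (linepath a1 a2) f + contour_integral (linepath a2 a3) f
       + contour_integral (linepath a3 a4) f"
      using split unfolding total left by (simp add: algebra_simps)
    also have "cmod \<dots> \<le> 2 * K / R ^ 3 * (2 * R) + 2 * K / R ^ 3 * (2 * R) + 2 * K / R ^ 3 * (2 * R)"
      by (intro order_trans[OF norm_triangle_ineq] add_mono b1 b2 b3)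
    also have "\<dots> = 12 * K / R\<^sup>2" using R' by (simp add: power2_eq_square power3_eq_cube)
    finally show ?thesis .
  qed
  have lim0: "((\<lambda>R. LBINT y. indicator {-R..R} y *\<^sub>R f (Complex (- r) y)) \<longlongrightarrow> (LBINT y. f (Complex (- r) y))) at_top"
    proof (rule integral_dominated_convergence_at_top[where w="\<lambda>y. cmod (f (Complex (- r) y))"])
      show "integrable lborel (\<lambda>y. cmod (f (Complex (- r) y)))" using int by (rule integrable_norm)
      show "AE y in lborel. ((\<lambda>R. indicator {-R..R} y *\<^sub>R f (Complex (- r) y)) \<longlongrightarrow> f (Complex (- r) y)) at_top"
      proof (rule AE_I2)
        fix y :: real
        have "\<forall>\<^sub>F R in at_top. indicator {-R..R} y *\<^sub>R f (Complex (- r) y) = f (Complex (- r) y)"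
          using eventually_ge_at_top[of "\<bar>y\<bar>"] by eventually_elim (auto simp: indicator_def)
        then show "((\<lambda>R. indicator {-R..R} y *\<^sub>R f (Complex (- r) y)) \<longlongrightarrow> f (Complex (- r) y)) at_top"
          by (rule tendsto_eventually)
      qed
      show "\<forall>\<^sub>F R in at_top. AE y in lborel. norm (indicator {-R..R} y *\<^sub>R f (Complex (- r) y)) \<le> cmod (f (Complex (- r) y))"
        by (intro always_eventually allI AE_I2) (auto simp: indicator_def)
      show "(\<lambda>y. f (Complex (- r) y)) \<in> borel_measurable lborel" using int by (rule borel_measurable_integrable)
      then show "(\<lambda>y. indicator {-R..R} y *\<^sub>R f (Complex (- r) y)) \<in> borel_measurable lborel" for R :: real by measurable
    qed
  have lim: "((\<lambda>R::real. LBINT y=ereal (-R)..ereal R. f (Complex (- r) y)) \<longlongrightarrow> (LBINT y. f (Complex (- r) y))) at_top"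
  proof (rule Lim_transform_eventually[OF lim0])
    show "\<forall>\<^sub>F R::real in at_top. (LBINT y. indicator {-R..R} y *\<^sub>R f (Complex (- r) y)) = (LBINT y=ereal (-R)..ereal R. f (Complex (- r) y))"
      using eventually_ge_at_top[of 0] by eventually_elim (simp add: interval_integral_Icc set_lebesgue_integral_def)
  qed
  have lim2: "((\<lambda>R::real. 2 * pi * \<i> * Rs + \<i> * (LBINT y=ereal (-R)..ereal R. f (Complex (- r) y))) \<longlongrightarrow> 0) at_top"
  proof (rule Lim_null_comparison)
    show "\<forall>\<^sub>F R::real in at_top. cmod (2 * pi * \<i> * Rs + \<i> * (LBINT y=ereal (-R)..ereal R. f (Complex (- r) y))) \<le> 12 * K / R\<^sup>2"
      using eventually_gt_at_top[of R0] by eventually_elim (rule contour)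
    show "((\<lambda>R. 12 * K / R\<^sup>2) \<longlongrightarrow> 0) at_top" by real_asymp
  qed
  have "((\<lambda>R::real. 2 * pi * \<i> * Rs + \<i> * (LBINT y=ereal (-R)..ereal R. f (Complex (- r) y))) \<longlongrightarrow> 2 * pi * \<i> * Rs + \<i> * (LBINT y. f (Complex (- r) y))) at_top"
    by (intro tendsto_intros lim)
  from tendsto_unique[OF _ lim2 this] have "\<i> * (2 * pi * Rs + (LBINT y. f (Complex (- r) y))) = 0"
    by (simp add: algebra_simps)
  then have "2 * pi * Rs + (LBINT y. f (Complex (- r) y)) = 0" by simp
  then show "(LBINT y. f (Complex (- r) y)) = - (2 * pi) * (M (of_real l) / of_real (l\<^sup>2) - deriv M 0 / of_real l - M 0 / of_real (l\<^sup>2))"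
    unfolding Rs_def[symmetric] by (simp add: add_eq_0_iff2)
qed

lemma complex_exp_integral:
  fixes w :: complex
  assumes w: "0 < Re w"
  shows "set_integrable lborel {0..} (\<lambda>t. exp (- w * of_real t))"
    and "(LBINT t:{0..}. exp (- w * of_real t)) = 1 / w"
proof -
  have w0: "w \<noteq> 0" using w by auto
  have cont: "continuous_on UNIV (\<lambda>t. exp (- w * of_real t))" by (intro continuous_intros)
  show int: "set_integrable lborel {0..} (\<lambda>t. exp (- w * of_real t))"
  proof (rule set_integrable_bound[OF exp_ici_integral(1)[OF w]])
    show "set_borel_measurable lborel {0..} (\<lambda>t. exp (- w * of_real t))"
      unfolding set_borel_measurable_def using borel_measurable_continuous_onI[OF cont] by measurable
  qed (auto intro!: AE_I2)
  have cmod_exp: "cmod (exp (- (w * complex_of_real t))) = exp (- (Re w * t))" for t by simp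
  have "(LBINT t=0..\<infinity>. exp (- w * of_real t)) = 0 - (- 1 / w)"
  proof (rule interval_integral_FTC_integrable)
    fix t :: real
    show "((\<lambda>t. - exp (- w * of_real t) / w) has_vector_derivative exp (- w * of_real t)) (at t)"
      using w0 by (auto intro!: derivative_eq_intros has_vector_derivative_real_field)
    show "isCont (\<lambda>t. exp (- w * of_real t)) t" by (intro continuous_intros)
  next
    show "set_integrable lborel (einterval 0 \<infinity>) (\<lambda>t. exp (- w * of_real t))"
      by (rule set_integrable_subset[OF int]) (auto simp: einterval_def zero_ereal_def)
    have "((\<lambda>t. - exp (- w * complex_of_real t) / w) \<longlongrightarrow> - exp (- w * complex_of_real 0) / w) (at_right 0)"
      using w0 by (intro tendsto_intros) auto
    then show "(((\<lambda>t. - exp (- w * of_real t) / w) \<circ> real_of_ereal) \<longlongrightarrow> - 1 / w) (at_right 0)"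
      by (simp add: zero_ereal_def ereal_tendsto_simps)
    have "((\<lambda>t. - exp (- w * complex_of_real t) / w) \<longlongrightarrow> 0) at_top"
    proof (rule tendsto_norm_zero_cancel)
      have "((\<lambda>t. exp (- Re w * t) / cmod w) \<longlongrightarrow> 0) at_top" using w w0 by real_asymp
      then show "((\<lambda>t. cmod (- exp (- w * complex_of_real t) / w)) \<longlongrightarrow> 0) at_top"
        by (simp add: norm_divide)
    qed
    then show "(((\<lambda>t. - exp (- w * of_real t) / w) \<circ> real_of_ereal) \<longlongrightarrow> 0) (at_left \<infinity>)"
      by (simp add: ereal_tendsto_simps)
  qed simp
  moreover have "(LBINT t=0..\<infinity>. exp (- w * of_real t)) = (LBINT t:{0..}. exp (- w * of_real t))"
    unfolding interval_lebesgue_integral_0_infty set_lebesgue_integral_def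
  proof (rule integral_cong_AE)
    have [measurable]: "(\<lambda>t. exp (- w * of_real t)) \<in> borel_measurable borel" by (rule borel_measurable_continuous_onI[OF cont])
    show "(\<lambda>t. indicator {0<..} t *\<^sub>R exp (- w * of_real t)) \<in> borel_measurable lborel"
      "(\<lambda>t. indicator {0..} t *\<^sub>R exp (- w * of_real t)) \<in> borel_measurable lborel" by measurable
    show "AE t in lborel. indicator {0<..} t *\<^sub>R exp (- w * of_real t) = indicator {0..} t *\<^sub>R exp (- w * of_real t)"
      using AE_lborel_singleton[of 0] by eventually_elim (auto simp: indicator_def)
  qed
  ultimately show "(LBINT t:{0..}. exp (- w * of_real t)) = 1 / w" by simp
qed

lemma primitive_lipschitz:
  fixes G :: "real \<Rightarrow> real"
  assumes [measurable]: "G \<in> borel_measurable borel" and G: "\<And>t. 0 \<le> G t" "\<And>t. G t \<le> 1" and ab: "0 \<le> a" "a \<le> b"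
  shows "\<bar>(LBINT t:{0..b}. G t) - (LBINT t:{0..a}. G t)\<bar> \<le> b - a"
proof -
  have int: "set_integrable lborel {x..y} G" for x y using G by (intro set_integrable_Icc_bounded[where C=1]) auto
  have 1: "(LBINT t:{a..b}. G t) \<le> (LBINT t:{a..b}. 1)"
    by (rule set_integral_mono[OF int]) (use G set_integrable_Icc_bounded[of "\<lambda>_. 1" a b 1] in auto)
  have "0 \<le> (LBINT t:{a..b}. G t)" unfolding set_lebesgue_integral_def using G by (intro integral_nonneg_AE) auto
  then show ?thesis using 1 set_integral_Icc_split[OF int ab] ab by (simp add: set_lebesgue_integral_def)
qed

text \<open>The difference of the two sides has Laplace transform 0 at every positive integer. The
  transform of \<open>exp (z * t)\<close> at \<open>l\<close> is \<open>1 / (l - z)\<close>, which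
  reduces the line integral to \<open>vertical_line_integral_residues\<close>. The constant
  \<open>- deriv M 0\<close> is the limit of \<open>(1 - M l) / l\<close> at 0, that is, the
  integral of \<open>G\<close> over the half line.\<close>

lemma laplace_inversion_integrated:
  fixes M :: "complex \<Rightarrow> complex" and r \<kappa> K T :: real and G :: "real \<Rightarrow> real"
  assumes holo: "M holomorphic_on {z. - \<kappa> < Re z}" and r: "0 < r" "r < \<kappa>"
    and bound: "\<And>z. - r \<le> Re z \<Longrightarrow> cmod (M z) \<le> K" and M0: "M 0 = 1"
    and Gm[measurable]: "G \<in> borel_measurable borel" and G: "\<And>t. 0 \<le> G t" "\<And>t. G t \<le> 1"
    and LT: "\<And>l. 0 < l \<Longrightarrow> of_real (LBINT T:{0..}. exp (- l * T) * G T) = (1 - M (of_real l)) / of_real l"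
    and T: "0 \<le> T"
  shows "of_real (LBINT t:{0..T}. G t) = - deriv M 0 - (LBINT y. exp (Complex (- r) y * of_real T) * M (Complex (- r) y) / (Complex (- r) y)\<^sup>2) / (2 * pi)"
proof -
  have K: "0 \<le> K" using order_trans[OF norm_ge_zero bound[of 0]] r by simp
  have contM: "continuous_on {z. - \<kappa> < Re z} M" by (rule holomorphic_on_imp_continuous_on[OF holo])
  have line: "continuous_on UNIV (\<lambda>y. Complex (- r) y)" unfolding Complex_eq by (intro continuous_intros)
  have znz: "Complex (- r) y \<noteq> 0" for y using r by (simp add: complex_eq_iff)
  define q where "q y = M (Complex (- r) y) / (Complex (- r) y)\<^sup>2" for y
  have q_cont: "continuous_on UNIV q" unfolding q_def
    using r by (intro continuous_on_divide continuous_on_power line continuous_on_compose2[OF contM line]) (auto simp: znz)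
  have [measurable]: "q \<in> borel_measurable borel" "(\<lambda>y. Complex (- r) y) \<in> borel_measurable borel"
    using borel_measurable_continuous_onI[OF q_cont] borel_measurable_continuous_onI[OF line] by auto
  define K' where "K' = K * (1 + 1 / r\<^sup>2)"
  have K': "0 \<le> K'" using K by (simp add: K'_def)
  have q_bound: "cmod (q y) \<le> K' * (1 / (1 + y\<^sup>2))" for y
  proof -
    have z0: "0 < (cmod (Complex (- r) y))\<^sup>2" using znz by simp
    have "1 / (cmod (Complex (- r) y))\<^sup>2 \<le> (1 + 1 / r\<^sup>2) * (1 / (1 + y\<^sup>2))"
      using one_plus_square_le_cmod[OF r(1), of y] z0 by (simp add: divide_simps add_pos_nonneg mult.commute)
    then have "cmod (M (Complex (- r) y)) * (1 / (cmod (Complex (- r) y))\<^sup>2) \<le> K * ((1 + 1 / r\<^sup>2) * (1 / (1 + y\<^sup>2)))"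
      using bound[of "Complex (- r) y"] K by (intro mult_mono) auto
    then show ?thesis by (simp add: q_def norm_divide norm_power K'_def mult.assoc)
  qed
  define k where "k t y = exp (Complex (- r) y * of_real t) * q y" for t y
  have k_bound: "cmod (k t y) \<le> K' * (1 / (1 + y\<^sup>2))" if "0 \<le> t" for t y
  proof -
    have "cmod (k t y) = exp (- r * t) * cmod (q y)" by (simp add: k_def norm_mult)
    also have "\<dots> \<le> 1 * (K' * (1 / (1 + y\<^sup>2)))"
      using q_bound[of y] r that by (intro mult_mono) auto
    finally show ?thesis by simp
  qed
  have int_dom: "integrable lborel (\<lambda>y. K' * (1 / (1 + y\<^sup>2)))"
    by (intro integrable_mult_right integrable_inverse_1_plus_square_lborel)
  define \<Phi> where "\<Phi> t = (LBINT y. k t y)" for t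
  have \<Phi>_bound: "cmod (\<Phi> t) \<le> (LBINT y. K' * (1 / (1 + y\<^sup>2)))" if "0 \<le> t" for t
    unfolding \<Phi>_def
  proof -
    have "cmod (LBINT y. k t y) \<le> (LBINT y. cmod (k t y))" by (rule integral_norm_bound)
    also have "\<dots> \<le> (LBINT y. K' * (1 / (1 + y\<^sup>2)))"
    proof (rule integral_mono[OF _ int_dom])
      show "integrable lborel (\<lambda>y. cmod (k t y))"
        by (rule Bochner_Integration.integrable_bound[OF int_dom]) (use k_bound[OF that] K' in \<open>auto simp: k_def intro!: AE_I2\<close>)
    qed (use k_bound[OF that] in auto)
    finally show "cmod (LBINT y. k t y) \<le> (LBINT y. K' * (1 / (1 + y\<^sup>2)))" .
  qed
  have \<Phi>_cont: "continuous_on {0..} \<Phi>"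
    unfolding continuous_on_sequentially
  proof (intro allI ballI impI)
    fix x :: "nat \<Rightarrow> real" and a assume x: "(\<forall>n. x n \<in> {0..}) \<and> x \<longlonglongrightarrow> a"
    show "(\<Phi> \<circ> x) \<longlonglongrightarrow> \<Phi> a" unfolding \<Phi>_def o_def
    proof (rule integral_dominated_convergence[OF _ _ int_dom])
      show "AE y in lborel. (\<lambda>n. k (x n) y) \<longlonglongrightarrow> k a y"
        unfolding k_def using x by (intro AE_I2 tendsto_intros) auto
      show "AE y in lborel. norm (k (x n) y) \<le> K' * (1 / (1 + y\<^sup>2))" for n
        using k_bound x by (intro AE_I2) auto
    qed (auto simp: k_def[abs_def])
  qed
  define I where "I t = (LBINT r:{0..t}. G r)" for t
  have I_cont: "continuous_on {0..} I"
  proof (rule lipschitz_on_continuous_on)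
    show "1-lipschitz_on {0..} I"
    proof (rule lipschitz_onI)
      fix x y :: real assume "x \<in> {0..}" "y \<in> {0..}"
      then show "dist (I x) (I y) \<le> 1 * dist x y"
        using primitive_lipschitz[OF Gm G, of x y] primitive_lipschitz[OF Gm G, of y x]
        unfolding I_def dist_real_def by (cases "x \<le> y") auto
    qed simp
  qed
  have I_bound: "\<bar>I t\<bar> \<le> t" if "0 \<le> t" for t
  proof -
    have "I 0 = 0" unfolding I_def set_lebesgue_integral_def
      by (rule integral_eq_zero_AE) (use AE_lborel_singleton[of 0] in \<open>eventually_elim, auto\<close>)
    then show ?thesis using primitive_lipschitz[OF Gm G, of 0 t] that by (simp add: I_def)
  qed
  \<comment> \<open>The function to be shown zero. Its linear growth, due to \<open>I\<close>, is
    what the uniqueness theorem tolerates.\<close>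
  define F where "F t = of_real (I t) + deriv M 0 + \<Phi> t / (2 * pi)" for t
  have F_cont: "continuous_on {0..} F"
    unfolding F_def by (intro continuous_intros I_cont \<Phi>_cont) auto
  define C where "C = max 1 (cmod (deriv M 0) + (LBINT y. K' * (1 / (1 + y\<^sup>2))))"
  have F_bound: "cmod (F t) \<le> C * (1 + t)" if t: "0 \<le> t" for t
  proof -
    have "cmod (F t) \<le> cmod (of_real (I t)) + cmod (deriv M 0) + cmod (\<Phi> t / (2 * pi))"
      unfolding F_def by (intro order_trans[OF norm_triangle_ineq] add_mono order_refl norm_triangle_ineq)
    also have "cmod (\<Phi> t / (2 * pi)) \<le> cmod (\<Phi> t)"
      using pi_ge_two by (simp add: norm_divide norm_mult divide_le_eq mult_le_cancel_left1)
    also have "cmod (of_real (I t)) \<le> t" using I_bound[OF t] by simp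
    also have "t + cmod (deriv M 0) + cmod (\<Phi> t) \<le> 1 * t + (cmod (deriv M 0) + (LBINT y. K' * (1 / (1 + y\<^sup>2))))"
      using \<Phi>_bound[OF t] by simp
    also have "\<dots> \<le> C * t + C" using t by (intro add_mono mult_right_mono) (auto simp: C_def)
    finally show ?thesis by (simp add: algebra_simps)
  qed
  have setint: "set_integrable lborel {0..} (\<lambda>t. of_real (exp (- real n * t)) * H t)"
    if "continuous_on {0..} H" "\<And>t. 0 \<le> t \<Longrightarrow> cmod (H t) \<le> D * (1 + t)" "1 \<le> n" for H :: "real \<Rightarrow> complex" and D n
    using that by (intro set_integrable_exp_linear_bound[where C=D])
      (auto simp: set_borel_measurable_def intro!: borel_measurable_continuous_on_indicator)
  have LTF: "(LBINT t:{0..}. of_real (exp (- real n * t)) * F t) = 0" if n: "1 \<le> n" for n :: nat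
  proof -
    define c where "c = real n"
    have c: "0 < c" using n by (simp add: c_def)
    have 1: "(LBINT t:{0..}. of_real (exp (- c * t)) * complex_of_real (I t)) = (1 - M (of_real c)) / of_real (c\<^sup>2)"
    proof -
      have "(LBINT t:{0..}. of_real (exp (- c * t)) * complex_of_real (I t)) = (LBINT t:{0..}. complex_of_real (exp (- c * t) * I t))" by simp
      also have "\<dots> = of_real (LBINT t:{0..}. exp (- c * t) * I t)" by (rule set_integral_complex_of_real)
      also have "(LBINT t:{0..}. exp (- c * t) * I t) = (LBINT t:{0..}. exp (- c * t) * G t) / c"
        unfolding I_def by (rule laplace_integral_of_primitive[where C=1]) (use G c in \<open>auto simp: set_borel_measurable_def\<close>)
      finally show ?thesis using LT[OF c] by (simp add: power2_eq_square)
    qed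
    have 2: "(LBINT t:{0..}. of_real (exp (- c * t)) * deriv M 0) = deriv M 0 / of_real c"
    proof -
      have "(LBINT t:{0..}. of_real (exp (- c * t)) * deriv M 0) = (LBINT t:{0..}. of_real (exp (- c * t))) * deriv M 0"
        by (rule set_integral_mult_left)
      also have "(LBINT t:{0..}. complex_of_real (exp (- c * t))) = of_real (1 / c)"
        unfolding exp_ici_integral(2)[OF c, symmetric] by (rule set_integral_complex_of_real)
      finally show ?thesis by simp
    qed
    have 3: "(LBINT t:{0..}. of_real (exp (- c * t)) * \<Phi> t) = (LBINT y. q y / (of_real c - Complex (- r) y))"
    proof -
      let ?g = "\<lambda>y t. indicator {0..} t *\<^sub>R (of_real (exp (- c * t)) * k t y)"
      have gm: "(\<lambda>(y, t). ?g y t) \<in> borel_measurable (lborel \<Otimes>\<^sub>M lborel)" unfolding k_def by measurable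
      have g_le: "norm (?g y t) \<le> K' * (1 / (1 + y\<^sup>2)) * (indicator {0..} t *\<^sub>R exp (- c * t))" for y t
        using mult_left_mono[OF k_bound[of t y], of "exp (- c * t)"] by (auto simp: indicator_def norm_mult mult_ac)
      have e_int: "integrable lborel (\<lambda>t. indicator {0..} t *\<^sub>R exp (- c * t))"
        using exp_ici_integral(1)[OF c] by (simp add: set_integrable_def)
      have g_int: "integrable lborel (?g y)" for y
      proof (rule Bochner_Integration.integrable_bound[OF integrable_mult_right[OF e_int, of "K' * (1 / (1 + y\<^sup>2))"]])
        show "?g y \<in> borel_measurable lborel" unfolding k_def by measurable
        show "AE t in lborel. norm (?g y t) \<le> norm (K' * (1 / (1 + y\<^sup>2)) * (indicator {0..} t *\<^sub>R exp (- c * t)))"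
        proof (rule AE_I2)
          fix t :: real
          have "norm (?g y t) \<le> K' * (1 / (1 + y\<^sup>2)) * (indicator {0..} t *\<^sub>R exp (- c * t))" by (rule g_le)
          also have "\<dots> \<le> norm (K' * (1 / (1 + y\<^sup>2)) * (indicator {0..} t *\<^sub>R exp (- c * t)))"
            unfolding real_norm_def by (rule abs_ge_self)
          finally show "norm (?g y t) \<le> norm (K' * (1 / (1 + y\<^sup>2)) * (indicator {0..} t *\<^sub>R exp (- c * t)))" .
        qed
      qed
      have int: "integrable (lborel \<Otimes>\<^sub>M lborel) (\<lambda>(y, t). ?g y t)"
      proof (rule lborel_pair.Fubini_integrable[OF gm])
        show "integrable lborel (\<lambda>y. LBINT t. norm (case (y, t) of (y, t) \<Rightarrow> ?g y t))"
        proof (rule Bochner_Integration.integrable_bound[OF integrable_mult_left[OF int_dom, of "1 / c"]])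
          show "(\<lambda>y. LBINT t. norm (case (y, t) of (y, t) \<Rightarrow> ?g y t)) \<in> borel_measurable lborel"
            unfolding k_def prod.case by measurable
          show "AE y in lborel. norm (LBINT t. norm (case (y, t) of (y, t) \<Rightarrow> ?g y t)) \<le> norm (K' * (1 / (1 + y\<^sup>2)) * (1 / c))"
          proof (rule AE_I2)
            fix y :: real
            have "(LBINT t. norm (?g y t)) \<le> (LBINT t. K' * (1 / (1 + y\<^sup>2)) * (indicator {0..} t *\<^sub>R exp (- c * t)))"
              by (rule integral_mono[OF integrable_norm[OF g_int] integrable_mult_right[OF e_int] g_le])
            also have "\<dots> = K' * (1 / (1 + y\<^sup>2)) * (1 / c)"
              using exp_ici_integral(2)[OF c] by (simp add: set_lebesgue_integral_def)
            also have "\<dots> \<le> norm (K' * (1 / (1 + y\<^sup>2)) * (1 / c))" unfolding real_norm_def by (rule abs_ge_self)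
            also have "(LBINT t. norm (?g y t)) = norm (LBINT t. norm (?g y t))"
              unfolding real_norm_def by (rule abs_of_nonneg[symmetric]) (intro integral_nonneg_AE AE_I2 norm_ge_zero)
            finally show "norm (LBINT t. norm (case (y, t) of (y, t) \<Rightarrow> ?g y t)) \<le> norm (K' * (1 / (1 + y\<^sup>2)) * (1 / c))"
              unfolding prod.case .
          qed
        qed
        show "AE y in lborel. integrable lborel (\<lambda>t. case (y, t) of (y, t) \<Rightarrow> ?g y t)"
          using g_int by simp
      qed
      have "(LBINT t:{0..}. of_real (exp (- c * t)) * \<Phi> t) = (LBINT t. LBINT y. ?g y t)"
        unfolding set_lebesgue_integral_def \<Phi>_def by (intro Bochner_Integration.integral_cong) auto
      also have "\<dots> = (LBINT y. LBINT t. ?g y t)" using lborel_pair.Fubini_integral[OF int] by simp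
      also have "\<dots> = (LBINT y. q y / (of_real c - Complex (- r) y))"
      proof (rule Bochner_Integration.integral_cong[OF refl])
        fix y :: real
        have w: "0 < Re (of_real c - Complex (- r) y)" using c r by simp
        have "(LBINT t. ?g y t) = (LBINT t:{0..}. exp (- (of_real c - Complex (- r) y) * of_real t) * q y)"
          unfolding set_lebesgue_integral_def
        proof (rule Bochner_Integration.integral_cong[OF refl])
          fix t :: real
          have "of_real (exp (- c * t)) = exp (- of_real c * complex_of_real t)" by (simp add: exp_of_real[symmetric])
          moreover have "- of_real c * complex_of_real t + Complex (- r) y * of_real t = - (of_real c - Complex (- r) y) * of_real t"
            by (simp add: left_diff_distrib)
          ultimately have "of_real (exp (- c * t)) * k t y = exp (- (of_real c - Complex (- r) y) * of_real t) * q y"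
            unfolding k_def by (simp only: mult.assoc[symmetric] exp_add[symmetric])
          then show "?g y t = indicator {0..} t *\<^sub>R (exp (- (of_real c - Complex (- r) y) * of_real t) * q y)" by (simp only:)
        qed
        also have "\<dots> = (LBINT t:{0..}. exp (- (of_real c - Complex (- r) y) * of_real t)) * q y"
          by (rule set_integral_mult_left)
        finally show "(LBINT t. ?g y t) = q y / (of_real c - Complex (- r) y)"
          using complex_exp_integral(2)[OF w] by simp
      qed
      finally show ?thesis .
    qed
    have 4: "(LBINT y. q y / (of_real c - Complex (- r) y)) = (2 * pi) * (M (of_real c) / of_real (c\<^sup>2) - deriv M 0 / of_real c - M 0 / of_real (c\<^sup>2))"
    proof -
      have "(LBINT y. q y / (of_real c - Complex (- r) y)) = (LBINT y. - (M (Complex (- r) y) / ((Complex (- r) y)\<^sup>2 * (Complex (- r) y - of_real c))))"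
      proof (rule Bochner_Integration.integral_cong[OF refl])
        fix y :: real
        show "q y / (of_real c - Complex (- r) y) = - (M (Complex (- r) y) / ((Complex (- r) y)\<^sup>2 * (Complex (- r) y - of_real c)))"
        proof -
          have "of_real c - Complex (- r) y = - (Complex (- r) y - of_real c)" by simp
          then show ?thesis unfolding q_def by (simp only: minus_divide_right[symmetric] divide_divide_eq_left)
        qed
      qed
      also have "\<dots> = - (LBINT y. M (Complex (- r) y) / ((Complex (- r) y)\<^sup>2 * (Complex (- r) y - of_real c)))"
        by (rule Bochner_Integration.integral_minus)
      finally show ?thesis using vertical_line_integral_residues(2)[OF holo r c bound] by simp
    qed
    have s1: "set_integrable lborel {0..} (\<lambda>t. of_real (exp (- c * t)) * complex_of_real (I t))" unfolding c_def
      by (rule setint[where D=1]) (use I_cont n in \<open>auto intro!: continuous_intros order_trans[OF I_bound]\<close>)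
    have s2: "set_integrable lborel {0..} (\<lambda>t. of_real (exp (- c * t)) * deriv M 0)" unfolding c_def
      by (rule setint[where D="cmod (deriv M 0)"]) (use n in \<open>auto intro!: mult_left_mono simp: algebra_simps\<close>)
    have s3: "set_integrable lborel {0..} (\<lambda>t. of_real (exp (- c * t)) * \<Phi> t)" unfolding c_def
    proof (rule setint[OF \<Phi>_cont _ n])
      fix t :: real assume t: "0 \<le> t"
      have "0 \<le> (LBINT y. K' * (1 / (1 + y\<^sup>2)))" using \<Phi>_bound[of 0] norm_ge_zero[of "\<Phi> 0"] by linarith
      then have "(LBINT y. K' * (1 / (1 + y\<^sup>2))) * 1 \<le> (LBINT y. K' * (1 / (1 + y\<^sup>2))) * (1 + t)"
        using t by (intro mult_left_mono) auto
      then show "cmod (\<Phi> t) \<le> (LBINT y. K' * (1 / (1 + y\<^sup>2))) * (1 + t)" using \<Phi>_bound[OF t] by linarith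
    qed
    have s3': "set_integrable lborel {0..} (\<lambda>t. of_real (exp (- c * t)) * \<Phi> t / (2 * pi))"
      using s3 by (rule set_integrable_divide)
    have "(LBINT t:{0..}. of_real (exp (- c * t)) * F t)
      = (LBINT t:{0..}. of_real (exp (- c * t)) * complex_of_real (I t) + of_real (exp (- c * t)) * deriv M 0 + of_real (exp (- c * t)) * \<Phi> t / (2 * pi))"
      by (simp add: F_def distrib_left)
    also have "\<dots> = (LBINT t:{0..}. of_real (exp (- c * t)) * complex_of_real (I t)) + (LBINT t:{0..}. of_real (exp (- c * t)) * deriv M 0)
       + (LBINT t:{0..}. of_real (exp (- c * t)) * \<Phi> t / (2 * pi))"
      using s1 s2 s3' by (simp only: set_integral_add)
    also have "(LBINT t:{0..}. of_real (exp (- c * t)) * \<Phi> t / (2 * pi)) = (LBINT t:{0..}. of_real (exp (- c * t)) * \<Phi> t) / (2 * pi)"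
      by (rule set_integral_divide_zero)
    finally show ?thesis unfolding c_def[symmetric] 1 2 3 4 using c by (simp add: M0 diff_divide_distrib)
  qed
  have "Re (F T) = 0 \<and> Im (F T) = 0"
  proof
    have int: "integrable lborel (\<lambda>t. indicator {0..} t *\<^sub>R (of_real (exp (- real n * t)) * F t))" if "1 \<le> n" for n
      using setint[OF F_cont F_bound that] by (simp add: set_integrable_def)
    show "Re (F T) = 0"
    proof (rule laplace_uniqueness_continuous[OF _ _ _ T])
      show "continuous_on {0..} (\<lambda>t. Re (F t))" by (intro continuous_intros F_cont)
      show "\<bar>Re (F t)\<bar> \<le> C * (1 + t)" if "0 \<le> t" for t using abs_Re_le_cmod[of "F t"] F_bound[OF that] by linarith
      show "(LBINT t:{0..}. exp (- real n * t) * Re (F t)) = 0" if n: "1 \<le> n" for n :: nat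
        using integral_Re[OF int[OF n]] LTF[OF n] by (simp add: set_lebesgue_integral_def)
    qed
    show "Im (F T) = 0"
    proof (rule laplace_uniqueness_continuous[OF _ _ _ T])
      show "continuous_on {0..} (\<lambda>t. Im (F t))" by (intro continuous_intros F_cont)
      show "\<bar>Im (F t)\<bar> \<le> C * (1 + t)" if "0 \<le> t" for t using abs_Im_le_cmod[of "F t"] F_bound[OF that] by linarith
      show "(LBINT t:{0..}. exp (- real n * t) * Im (F t)) = 0" if n: "1 \<le> n" for n :: nat
        using integral_Im[OF int[OF n]] LTF[OF n] by (simp add: set_lebesgue_integral_def)
    qed
  qed
  then have "F T = 0" by (simp add: complex_eq_iff)
  then have "of_real (I T) = - deriv M 0 - \<Phi> T / (2 * pi)" unfolding F_def by (simp add: algebra_simps eq_neg_iff_add_eq_0)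
  moreover have "\<Phi> T = (LBINT y. exp (Complex (- r) y * of_real T) * M (Complex (- r) y) / (Complex (- r) y)\<^sup>2)"
    unfolding \<Phi>_def k_def q_def by simp
  ultimately show ?thesis by (simp add: I_def)
qed

section \<open>The saddle point\<close>

text \<open>One set of constants for the whole closed half-plane: the expansions at the pole for
  small \<open>h\<close>, and \<open>theta_exit_bounds\<close> from distance \<open>\<delta>\<close>
  on. They feed the dominating function of the saddle point integral.\<close>

lemma pole_neighbourhood_bounds:
  fixes x :: real
  obtains C \<delta> where "0 \<le> C" "0 < \<delta>"
    and "\<And>h. 0 \<le> Re h \<Longrightarrow> h \<noteq> 0 \<Longrightarrow> cmod (exit_factor x (csqrt (2 * (h - of_real (pi\<^sup>2 / 8))))) \<le> C * (1 + 1 / cmod h)"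
    and "\<And>h. 0 \<le> Re h \<Longrightarrow> h \<noteq> 0 \<Longrightarrow> cmod h < \<delta> \<Longrightarrow>
      - (pi\<^sup>2 / 4) * Re (1 / h) + 3 / 2 - C * cmod h \<le> Re (theta (h - of_real (pi\<^sup>2 / 8)))"
    and "\<And>h. 0 \<le> Re h \<Longrightarrow> \<delta> \<le> cmod h \<Longrightarrow> - C \<le> Re (theta (h - of_real (pi\<^sup>2 / 8)))"
proof -
  let ?k = "complex_of_real (pi\<^sup>2 / 8)"
  \<comment> \<open>Outside the interval \<open>exit_factor\<close> is 1, which is the quotient of
    hyperbolic cosines at \<open>y = 1\<close>; this choice keeps
    \<open>\<bar>y\<bar> \<le> 1\<close>.\<close>
  define y where "y = (if \<bar>x\<bar> < 1 then x else 1)"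
  have y: "\<bar>y\<bar> \<le> 1" by (auto simp: y_def)
  let ?E = "\<lambda>z. cosh (of_real y * csqrt (2 * z)) / cosh (csqrt (2 * z))"
  define A where "A = cmod (of_real (pi / 2 * cos (pi * y / 2))) + 1"
  define L where "L = cmod (complex_of_real (1 / 3 + 1 / pi\<^sup>2)) + 1"
  have "\<forall>\<^sub>F h in at 0. cmod (h * ?E (h - ?k)) < A"
    using tendsto_norm[OF exit_factor_expansion[of y]] by (rule order_tendstoD) (simp add: A_def)
  moreover have "\<forall>\<^sub>F h in at 0. cmod ((theta (h - ?k) + of_real (pi\<^sup>2 / 4) / h - 3 / 2) / h) < L"
    using tendsto_norm[OF theta_expansion] by (rule order_tendstoD) (simp add: L_def)
  ultimately have "\<forall>\<^sub>F h in at 0. cmod (h * ?E (h - ?k)) < A \<and> cmod ((theta (h - ?k) + of_real (pi\<^sup>2 / 4) / h - 3 / 2) / h) < L"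
    by (rule eventually_conj)
  then obtain \<delta> where \<delta>: "0 < \<delta>" and near: "\<And>h. h \<noteq> 0 \<Longrightarrow> cmod h < \<delta> \<Longrightarrow> cmod (h * ?E (h - ?k)) < A \<and>
      cmod ((theta (h - ?k) + of_real (pi\<^sup>2 / 4) / h - 3 / 2) / h) < L"
    unfolding eventually_at by (auto simp: dist_norm)
  obtain C where C: "0 \<le> C"
    "\<And>z. - (pi\<^sup>2 / 8) \<le> Re z \<Longrightarrow> \<delta> \<le> cmod (z + of_real (pi\<^sup>2 / 8)) \<Longrightarrow> - C \<le> Re (theta z)"
    "\<And>z. - (pi\<^sup>2 / 8) \<le> Re z \<Longrightarrow> \<delta> \<le> cmod (z + of_real (pi\<^sup>2 / 8)) \<Longrightarrow> cmod (?E z) \<le> C"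
    using theta_exit_bounds[OF \<delta> y] by blast
  define C' where "C' = max 1 (max C (max A L))"
  have C': "1 \<le> C'" "C \<le> C'" "A \<le> C'" "L \<le> C'" by (auto simp: C'_def)
  show thesis
  proof (rule that[of C' \<delta>])
    fix h :: complex assume h: "0 \<le> Re h"
    {
      assume h0: "h \<noteq> 0"
      show "cmod (exit_factor x (csqrt (2 * (h - ?k)))) \<le> C' * (1 + 1 / cmod h)"
      proof (cases "\<bar>x\<bar> < 1")
        case True
        then have e: "exit_factor x (csqrt (2 * (h - ?k))) = ?E (h - ?k)" by (simp add: exit_factor_def y_def)
        show ?thesis
        proof (cases "cmod h < \<delta>")
          case True
          have "cmod (h * ?E (h - ?k)) < A" using near[OF h0 True] by blast
          then have "cmod h * cmod (?E (h - ?k)) < A" by (simp only: norm_mult)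
          then have le: "cmod h * cmod (?E (h - ?k)) \<le> C'" using C'(3) by linarith
          have "mm \<le> C' * (1 / cmod h)" if "cmod h * mm \<le> C'" for mm using h0 that by (simp add: le_divide_eq mult.commute)
          from this[OF le] have "cmod (?E (h - ?k)) \<le> C' * (1 / cmod h)" .
          also have "\<dots> \<le> C' * (1 + 1 / cmod h)" using C' by (intro mult_left_mono) auto
          finally show ?thesis unfolding e .
        next
          case False
          then have "cmod (?E (h - ?k)) \<le> C" using h by (intro C(3)) auto
          also have "\<dots> \<le> C' * 1" using C' by simp
          also have "\<dots> \<le> C' * (1 + 1 / cmod h)" using C' by (intro mult_left_mono) auto
          finally show ?thesis unfolding e .
        qed
      next
        case False
        have "1 \<le> C' * 1" using C' by simp
        also have "\<dots> \<le> C' * (1 + 1 / cmod h)" using C' by (intro mult_left_mono) auto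
        finally show ?thesis using False by (simp add: exit_factor_def)
      qed
      assume hd: "cmod h < \<delta>"
      define W where "W = theta (h - ?k) + of_real (pi\<^sup>2 / 4) / h - 3 / 2"
      have "cmod (W / h) \<le> C'" using near[OF h0 hd] C' by (simp add: W_def)
      then have "cmod W \<le> C' * cmod h" using h0 by (simp add: norm_divide divide_le_eq)
      moreover have "- cmod W \<le> Re W" using abs_Re_le_cmod[of W] by linarith
      moreover have "Re W = Re (theta (h - ?k)) + (pi\<^sup>2 / 4) * Re (1 / h) - 3 / 2"
      proof -
        have gen: "Re (of_real u * w) = u * Re w" for u w by simp
        have "of_real (pi\<^sup>2 / 4) / h = of_real (pi\<^sup>2 / 4) * (1 / h)" by simp
        then have "Re (of_real (pi\<^sup>2 / 4) / h) = (pi\<^sup>2 / 4) * Re (1 / h)" by (simp only: gen)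
        then show ?thesis by (simp add: W_def)
      qed
      ultimately show "- (pi\<^sup>2 / 4) * Re (1 / h) + 3 / 2 - C' * cmod h \<le> Re (theta (h - ?k))" by linarith
    }
    assume "\<delta> \<le> cmod h"
    then have "- C \<le> Re (theta (h - ?k))" using h by (intro C(2)) auto
    then show "- C' \<le> Re (theta (h - ?k))" using C' by linarith
  qed (use C' \<delta> in auto)
qed

text \<open>Put \<open>X0 = c / \<rho>\<close> and
  \<open>X = c * Re (1 / h) = X0 / (1 + \<rho>^2 * v^2)\<close>. Near the pole a positive
  \<open>- t\<close> is at most \<open>X - 3 / 2 + C * cmod h\<close>, and up to a bounded error its
  square minus \<open>X0^2 - 3 * X0\<close> is at most \<open>- (X0 - X) * (X0 + X - 3)\<close>. The
  condition \<open>6 * \<rho> \<le> c\<close> means \<open>X0 \<ge> 6\<close>, so the last factor is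
  at least \<open>X0 / 2\<close>, while
  \<open>(X0 - X) * X0 = c^2 * v^2 / (1 + \<rho>^2 * v^2)\<close>. The error stays bounded because
  \<open>X * cmod h \<le> c\<close>.\<close>

lemma saddle_exponent_bound:
  fixes c C \<rho> v t m :: real
  assumes c: "0 < c" and C: "0 \<le> C" and \<rho>: "0 < \<rho>" "6 * \<rho> \<le> c" and d: "0 < \<delta>"
    and h: "h = Complex \<rho> (\<rho>\<^sup>2 * v)"
    and near: "cmod h < \<delta> \<Longrightarrow> - c * Re (1 / h) + 3 / 2 - C * cmod h \<le> t"
    and far: "\<delta> \<le> cmod h \<Longrightarrow> - C \<le> t"
  shows "(max 0 (- t))\<^sup>2 - (c / \<rho>)\<^sup>2 + 3 * (c / \<rho>) \<le> (9 / 4 + 2 * C * c + C\<^sup>2 * \<delta>\<^sup>2 + C\<^sup>2) - c\<^sup>2 * v\<^sup>2 / (2 * (1 + \<rho>\<^sup>2 * v\<^sup>2))"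
proof -
  define m where "m = max 0 (- t)"
  define X0 where "X0 = c / \<rho>"
  define q where "q = 1 + \<rho>\<^sup>2 * v\<^sup>2"
  define X where "X = X0 / q"
  have q: "1 \<le> q" by (simp add: q_def)
  have X0: "6 \<le> X0" using \<rho> by (simp add: X0_def le_divide_eq)
  have X: "0 < X" "X \<le> X0" using X0 q by (auto simp: X_def divide_le_eq)
  have m0: "0 \<le> m" by (simp add: m_def)
  have cmod2: "(cmod h)\<^sup>2 = \<rho>\<^sup>2 * q"
    unfolding h cmod_power2 by (simp add: q_def power2_eq_square algebra_simps)
  have hX: "c * Re (1 / h) = X"
  proof -
    have "Re (1 / h) = \<rho> / (cmod h)\<^sup>2" using cmod_power2[of h] by (simp add: h Re_divide)
    then show ?thesis using \<rho> q unfolding cmod2 by (simp add: X_def X0_def power2_eq_square)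
  qed
  have key: "(X0 - X) * X0 = c\<^sup>2 * v\<^sup>2 / q"
  proof -
    have "X0 * (\<rho>\<^sup>2 * v\<^sup>2) = X0 * q - X0" by (simp add: q_def algebra_simps)
    then have "X0 - X = X0 * (\<rho>\<^sup>2 * v\<^sup>2) / q" using q by (simp add: X_def diff_divide_distrib)
    then have "(X0 - X) * X0 = (X0 * \<rho>)\<^sup>2 * v\<^sup>2 / q" by (simp add: power2_eq_square mult_ac)
    also have "X0 * \<rho> = c" using \<rho> by (simp add: X0_def)
    finally show ?thesis .
  qed
  have half: "c\<^sup>2 * v\<^sup>2 / (2 * q) \<le> X0\<^sup>2 / 2"
  proof -
    have "(X0 - X) * X0 \<le> X0 * X0" using X X0 by (intro mult_right_mono) auto
    then show ?thesis using key by (simp add: power2_eq_square)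
  qed
  have X02: "- X0\<^sup>2 + 3 * X0 \<le> - (X0\<^sup>2 / 2)"
  proof -
    have "6 * X0 \<le> X0 * X0" using X0 by (intro mult_right_mono) auto
    then show ?thesis by (simp add: power2_eq_square)
  qed
  have base: "- X0\<^sup>2 + 3 * X0 \<le> - (c\<^sup>2 * v\<^sup>2 / (2 * q))" using half X02 by linarith
  have pos: "0 \<le> 2 * C * c" "0 \<le> C\<^sup>2 * \<delta>\<^sup>2" "0 \<le> C\<^sup>2" using C c by auto
  have "m\<^sup>2 - X0\<^sup>2 + 3 * X0 \<le> (9 / 4 + 2 * C * c + C\<^sup>2 * \<delta>\<^sup>2 + C\<^sup>2) - c\<^sup>2 * v\<^sup>2 / (2 * q)"
  proof (cases "cmod h < \<delta>")
    case False
    then have "m \<le> C" using far C by (simp add: m_def)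
    then have "m\<^sup>2 \<le> C\<^sup>2" using m0 by (intro power_mono)
    then show ?thesis using base pos by linarith
  next
    case True
    show ?thesis
    proof (cases "m = 0")
      case True
      then have "m\<^sup>2 = 0" by simp
      then show ?thesis using base pos by linarith
    next
      case False
      then have mt: "m = - t" by (auto simp: m_def max_def split: if_splits)
      define e where "e = C * cmod h"
      have e0: "0 \<le> e" using C by (simp add: e_def)
      have m_le: "m \<le> X - 3 / 2 + e" using near[OF True] hX mt by (simp add: e_def)
      have "m\<^sup>2 \<le> (X - 3 / 2 + e)\<^sup>2" using m_le m0 by (intro power_mono)
      also have "\<dots> = X\<^sup>2 - 3 * X + 9 / 4 + 2 * (X * e) - 3 * e + e\<^sup>2" by (simp add: power2_eq_square algebra_simps)
      also have "X * e \<le> C * c"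
      proof -
        have "cmod h * cmod h = \<rho>\<^sup>2 * q" using cmod2 by (simp add: power2_eq_square)
        have "\<rho> \<le> cmod h" using abs_Re_le_cmod[of h] \<rho> by (simp add: h)
        then have "\<rho> * cmod h \<le> cmod h * cmod h" by (intro mult_right_mono) auto
        then have "\<rho> * cmod h \<le> \<rho> * (\<rho> * q)" using cmod2 by (simp add: power2_eq_square mult_ac)
        then have "cmod h \<le> \<rho> * q" using \<rho> by simp
        then have "c * cmod h / (\<rho> * q) \<le> c" using \<rho> q c by (simp add: divide_le_eq)
        then have "X * cmod h \<le> c" by (simp add: X_def X0_def)
        then have "C * (X * cmod h) \<le> C * c" using C by (rule mult_left_mono)
        then show ?thesis by (simp add: e_def mult_ac)
      qed
      also have "e\<^sup>2 \<le> C\<^sup>2 * \<delta>\<^sup>2"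
        unfolding e_def power_mult_distrib using True by (intro mult_left_mono power_mono) auto
      finally have m2: "m\<^sup>2 \<le> X\<^sup>2 - 3 * X + (9 / 4 + 2 * C * c + C\<^sup>2 * \<delta>\<^sup>2)" using e0 by simp
      have "X\<^sup>2 - 3 * X - X0\<^sup>2 + 3 * X0 = - ((X0 - X) * (X0 + X - 3))" by (simp add: power2_eq_square algebra_simps)
      also have "\<dots> \<le> - ((X0 - X) * (X0 / 2))" using X X0 by (intro le_imp_neg_le mult_left_mono) auto
      also have "\<dots> = - (c\<^sup>2 * v\<^sup>2 / (2 * q))" using key by simp
      finally show ?thesis using m2 pos by linarith
    qed
  qed
  then show ?thesis by (simp add: m_def X0_def q_def)
qed

text \<open>The exponent saturates. For \<open>\<rho> * \<bar>v\<bar> \<le> 1\<close> it is at most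
  \<open>- q * v^2 / 2\<close>, which is Gaussian; beyond, it is only known to be at most
  \<open>- q / (2 * \<rho>^2)\<close>. There the exponential is at most
  \<open>8 * \<rho>^4 / q^2\<close>, which makes up for the slow decay of
  \<open>1 / (1 + \<rho>^4 * v^2)\<close>, a factor that stems from \<open>1 / z^2\<close>.\<close>

lemma gaussian_cauchy_domination:
  fixes q \<rho> v :: real
  assumes q: "0 < q" and \<rho>: "0 < \<rho>" "\<rho> \<le> 1"
  shows "exp (- q * v\<^sup>2 / (1 + \<rho>\<^sup>2 * v\<^sup>2)) / (1 + \<rho>^4 * v\<^sup>2) \<le> (1 + 2 / q + 8 / q\<^sup>2) / (1 + v\<^sup>2)"
proof (cases "\<rho>\<^sup>2 * v\<^sup>2 \<le> 1")
  case True
  have p1: "0 < 1 + \<rho>\<^sup>2 * v\<^sup>2" by (simp add: add_pos_nonneg)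
  have "q * v\<^sup>2 / 2 \<le> q * v\<^sup>2 / (1 + \<rho>\<^sup>2 * v\<^sup>2)" using True q by (intro divide_left_mono) (auto intro: add_pos_nonneg)
  then have "1 + q * v\<^sup>2 / 2 \<le> exp (q * v\<^sup>2 / (1 + \<rho>\<^sup>2 * v\<^sup>2))"
    using exp_ge_add_one_self[of "q * v\<^sup>2 / (1 + \<rho>\<^sup>2 * v\<^sup>2)"] by linarith
  then have "exp (- q * v\<^sup>2 / (1 + \<rho>\<^sup>2 * v\<^sup>2)) \<le> 1 / (1 + q * v\<^sup>2 / 2)"
    using q by (simp add: exp_minus inverse_eq_divide frac_le add_pos_nonneg)
  also have "\<dots> \<le> (1 + 2 / q) / (1 + v\<^sup>2)"
  proof -
    have "1 + v\<^sup>2 \<le> (1 + 2 / q) * (1 + q * v\<^sup>2 / 2)" using q by (simp add: field_simps)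
    then show ?thesis using q by (simp add: divide_le_eq le_divide_eq add_pos_nonneg mult.commute)
  qed
  finally have "exp (- q * v\<^sup>2 / (1 + \<rho>\<^sup>2 * v\<^sup>2)) \<le> (1 + 2 / q) / (1 + v\<^sup>2)" .
  moreover have "exp (- q * v\<^sup>2 / (1 + \<rho>\<^sup>2 * v\<^sup>2)) / (1 + \<rho>^4 * v\<^sup>2) \<le> exp (- q * v\<^sup>2 / (1 + \<rho>\<^sup>2 * v\<^sup>2))"
    by (simp add: divide_le_eq add_pos_nonneg mult_le_cancel_left1)
  moreover have "(1 + 2 / q) / (1 + v\<^sup>2) \<le> (1 + 2 / q + 8 / q\<^sup>2) / (1 + v\<^sup>2)"
    by (intro divide_right_mono) auto
  ultimately show ?thesis by linarith
next
  case False
  define E where "E = q * v\<^sup>2 / (1 + \<rho>\<^sup>2 * v\<^sup>2)"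
  have "1 / (2 * \<rho>\<^sup>2) \<le> v\<^sup>2 / (1 + \<rho>\<^sup>2 * v\<^sup>2)"
    using False \<rho> by (simp add: divide_simps add_pos_nonneg)
  then have "q * (1 / (2 * \<rho>\<^sup>2)) \<le> q * (v\<^sup>2 / (1 + \<rho>\<^sup>2 * v\<^sup>2))" using q by (intro mult_left_mono) auto
  then have E: "q / (2 * \<rho>\<^sup>2) \<le> E" by (simp add: E_def)
  have E0: "0 < q / (2 * \<rho>\<^sup>2)" using q \<rho> by simp
  have "(q / (2 * \<rho>\<^sup>2))\<^sup>2 / 2 \<le> E\<^sup>2 / 2" using E E0 by (intro divide_right_mono power_mono) auto
  also have "\<dots> \<le> exp E" using exp_lower_Taylor_quadratic[of E] E E0 by linarith
  finally have "(q / (2 * \<rho>\<^sup>2))\<^sup>2 / 2 \<le> exp E" .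
  moreover have "0 < (q / (2 * \<rho>\<^sup>2))\<^sup>2 / 2" using E0 by (simp only: zero_less_power half_gt_zero)
  ultimately have "exp (- E) \<le> 1 / ((q / (2 * \<rho>\<^sup>2))\<^sup>2 / 2)"
    unfolding exp_minus inverse_eq_divide[symmetric] by (rule le_imp_inverse_le)
  also have "\<dots> = 8 * \<rho>^4 / q\<^sup>2" using q \<rho> by (simp add: power_divide power2_eq_square power4_eq_xxxx)
  finally have "exp (- E) / (1 + \<rho>^4 * v\<^sup>2) \<le> (8 * \<rho>^4 / q\<^sup>2) / (1 + \<rho>^4 * v\<^sup>2)"
    by (intro divide_right_mono) auto
  also have "\<dots> = 8 / q\<^sup>2 * (\<rho>^4 / (1 + \<rho>^4 * v\<^sup>2))" by simp
  also have "\<dots> \<le> 8 / q\<^sup>2 * (1 / (1 + v\<^sup>2))"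
  proof (rule mult_left_mono)
    have "\<rho>^4 \<le> 1" using \<rho> by (intro power_le_one) auto
    then show "\<rho>^4 / (1 + \<rho>^4 * v\<^sup>2) \<le> 1 / (1 + v\<^sup>2)"
      by (simp add: divide_simps add_pos_nonneg) (simp add: algebra_simps)
  qed simp
  also have "8 / q\<^sup>2 * (1 / (1 + v\<^sup>2)) = (8 / q\<^sup>2) / (1 + v\<^sup>2)" by simp
  also have "\<dots> \<le> (1 + 2 / q + 8 / q\<^sup>2) / (1 + v\<^sup>2)"
    using q by (intro divide_right_mono) auto
  finally show ?thesis by (simp add: E_def)
qed

text \<open>The square of the expansion of \<open>theta\<close> at \<open>H = h\<close>. The cross
  terms of \<open>- C / H\<close> with \<open>3 / 2\<close> and with \<open>H * O'\<close> are
  \<open>- 3 * C / H\<close> and the constant \<open>- 2 * C * O'\<close>.\<close>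

lemma saddle_square_identity:
  fixes H C O' S :: complex
  assumes "H \<noteq> 0"
  shows "(- C / H + (3 / 2 + H * O'))\<^sup>2 * S / 2 = C\<^sup>2 * S / (2 * H\<^sup>2) - 3 * C * S / (2 * H) + S / 2 * ((3 / 2 + H * O')\<^sup>2 - 2 * C * O')"
proof -
  define X where "X = C / H"
  define W' where "W' = 3 / 2 + H * O'"
  have C: "C = X * H" using assms by (simp add: X_def)
  have "X * W' = 3 / 2 * X + C * O'" by (simp add: W'_def C algebra_simps)
  then have "(- X + W')\<^sup>2 = X\<^sup>2 - 3 * X - 2 * C * O' + W'\<^sup>2"
    by (simp add: power2_eq_square algebra_simps)
  then have "(- X + W')\<^sup>2 * S / 2 = X\<^sup>2 * S / 2 - 3 * X * S / 2 + S / 2 * (W'\<^sup>2 - 2 * C * O')"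
    by (simp only:) (simp add: algebra_simps add_divide_distrib diff_divide_distrib)
  then show ?thesis by (simp add: X_def W'_def power_divide)
qed

text \<open>With \<open>r = \<rho>\<close>, \<open>W = 1 + \<i> * \<rho> * v\<close> and
  \<open>h = r * W\<close> this is \<open>h * T + K / (2 * h^2)\<close> minus its value at the
  saddle point, where \<open>T = K / r^3\<close>. The numerator
  \<open>2 * (W - 1) * W^2 - W^2 + 1 = (W - 1)^2 * (2 * W + 1)\<close> has a double zero at
  \<open>W = 1\<close>, which compensates \<open>1 / r^2\<close>.\<close>

lemma saddle_cubic_identity:
  fixes K r W :: complex
  assumes r: "r \<noteq> 0" and W: "W \<noteq> 0"
  shows "K * ((W - 1) / r) / r - K / (2 * r\<^sup>2) + K / (2 * (r * W)\<^sup>2) = K / 2 * (3 * ((W - 1) / r)\<^sup>2) * ((1 + 2 * (W - 1) / 3) / W\<^sup>2)"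
proof -
  have "K * ((W - 1) / r) / r - K / (2 * r\<^sup>2) + K / (2 * (r * W)\<^sup>2) = K / (2 * r\<^sup>2) * ((2 * (W - 1) * W\<^sup>2 - W\<^sup>2 + 1) / W\<^sup>2)"
    using r W by (simp add: field_simps power2_eq_square)
  also have "2 * (W - 1) * W\<^sup>2 - W\<^sup>2 + 1 = (W - 1)\<^sup>2 * 3 * (1 + 2 * (W - 1) / 3)"
  proof -
    have "3 * (1 + 2 * (W - 1) / 3) = 2 * W + 1" by (simp add: field_simps)
    then have "(W - 1)\<^sup>2 * 3 * (1 + 2 * (W - 1) / 3) = (W - 1)\<^sup>2 * (2 * W + 1)" by (simp only: mult.assoc)
    then show ?thesis by (simp add: power2_eq_square algebra_simps)
  qed
  finally show ?thesis using r W by (simp add: power_divide mult_ac)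
qed

text \<open>The reflection formula splits the transform into
  \<open>2 * exp (theta^2 * s / 2)\<close>, whose exponent converges once the prefactor is joined to
  it, and a bounded remainder, which the prefactor sends to 0.\<close>

lemma saddle_main_limit:
  fixes s v :: real
  assumes s: "0 < s"
  defines "c \<equiv> pi\<^sup>2 / 4"
  shows "((\<lambda>\<rho>. exp (\<i> * of_real (c\<^sup>2 * s * v / \<rho>) - of_real (c\<^sup>2 * s / (2 * \<rho>\<^sup>2)) + of_real (3 * c * s / (2 * \<rho>)))
      * half_normal_laplace s 0 (theta (Complex \<rho> (\<rho>\<^sup>2 * v) - of_real (pi\<^sup>2 / 8))))
    \<longlongrightarrow> 2 * exp (of_real (s / 2 * (9 / 4 - 2 * c * (1 / 3 + 1 / pi\<^sup>2)) - 3 / 2 * c\<^sup>2 * s * v\<^sup>2) + \<i> * of_real (3 / 2 * c * s * v))) (at_right 0)"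
proof -
  let ?k = "complex_of_real (pi\<^sup>2 / 8)"
  define w where "w \<rho> = \<i> * of_real (\<rho> * v)" for \<rho> :: real
  define h where "h \<rho> = Complex \<rho> (\<rho>\<^sup>2 * v)" for \<rho> :: real
  have c: "0 < c" by (simp add: c_def)
  have h_eq: "h \<rho> = of_real \<rho> * (1 + w \<rho>)" for \<rho>
    by (simp add: h_def w_def complex_eq_iff power2_eq_square)
  have w1: "1 + w \<rho> \<noteq> 0" for \<rho> by (simp add: w_def complex_eq_iff)
  have w_lim: "(w \<longlongrightarrow> 0) (at_right 0)"
  proof -
    have "(w \<longlongrightarrow> \<i> * of_real (0 * v)) (at_right 0)" unfolding w_def by (intro tendsto_intros)
    then show ?thesis by simp
  qed
  have rho_lim: "((\<lambda>\<rho>::real. complex_of_real \<rho>) \<longlongrightarrow> 0) (at_right 0)"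
  proof -
    have "((\<lambda>\<rho>::real. complex_of_real \<rho>) \<longlongrightarrow> of_real 0) (at_right 0)" by (intro tendsto_intros)
    then show ?thesis by simp
  qed
  have h_lim0: "(h \<longlongrightarrow> 0) (at_right 0)"
  proof -
    have "((\<lambda>\<rho>. of_real \<rho> * (1 + w \<rho>)) \<longlongrightarrow> 0 * (1 + 0)) (at_right 0)" by (intro tendsto_intros rho_lim w_lim)
    then show ?thesis by (simp add: h_eq[abs_def])
  qed
  have h_ne: "\<forall>\<^sub>F \<rho> in at_right 0. h \<rho> \<noteq> 0"
    using eventually_at_right_less[of 0] by eventually_elim (simp add: h_eq w1)
  have h_lim: "filterlim h (at 0) (at_right 0)" unfolding filterlim_at using h_lim0 h_ne by simp
  define \<omega> where "\<omega> z = (theta (z - ?k) + of_real c / z - 3 / 2) / z" for z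
  have om: "((\<lambda>\<rho>. \<omega> (h \<rho>)) \<longlongrightarrow> of_real (1 / 3 + 1 / pi\<^sup>2)) (at_right 0)"
    using filterlim_compose[OF theta_expansion h_lim] by (simp add: \<omega>_def c_def)
  define \<theta> where "\<theta> \<rho> = theta (h \<rho> - ?k)" for \<rho>
  have th: "\<theta> \<rho> = - of_real c / h \<rho> + (3 / 2 + h \<rho> * \<omega> (h \<rho>))" if "h \<rho> \<noteq> 0" for \<rho>
    using that by (simp add: \<theta>_def \<omega>_def)
  define pre where "pre \<rho> = exp (\<i> * of_real (c\<^sup>2 * s * v / \<rho>) - of_real (c\<^sup>2 * s / (2 * \<rho>\<^sup>2)) + of_real (3 * c * s / (2 * \<rho>)))" for \<rho>
  \<comment> \<open>The total exponent after the terms of order \<open>1 / \<rho>^2\<close> and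
    \<open>1 / \<rho>\<close> have cancelled exactly; each remaining factor converges.\<close>
  define A where "A \<rho> = of_real (c\<^sup>2 * s / 2) * (- 3 * of_real (v\<^sup>2)) * ((1 + 2 * w \<rho> / 3) / (1 + w \<rho>)\<^sup>2)
     + of_real (3 / 2 * c * s) * (\<i> * of_real v / (1 + w \<rho>))
     + of_real (s / 2) * ((3 / 2 + h \<rho> * \<omega> (h \<rho>))\<^sup>2 - 2 * of_real c * \<omega> (h \<rho>))" for \<rho>
  have A_eq: "\<i> * of_real (c\<^sup>2 * s * v / \<rho>) - of_real (c\<^sup>2 * s / (2 * \<rho>\<^sup>2)) + of_real (3 * c * s / (2 * \<rho>)) + (\<theta> \<rho>)\<^sup>2 * of_real s / 2 = A \<rho>"
    if \<rho>: "0 < \<rho>" for \<rho>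
  proof -
    define r where "r = complex_of_real \<rho>"
    define W where "W = 1 + w \<rho>"
    define O' where "O' = \<omega> (h \<rho>)"
    have r: "r \<noteq> 0" using \<rho> by (simp add: r_def)
    have W: "W \<noteq> 0" using w1 by (simp add: W_def)
    have hr: "h \<rho> = r * W" by (simp add: h_eq r_def W_def)
    have h0: "h \<rho> \<noteq> 0" using r W hr by simp
    have iv: "\<i> * of_real v = (W - 1) / r" using r by (simp add: W_def w_def r_def)
    have v2: "of_real (v\<^sup>2) = - ((W - 1) / r)\<^sup>2" unfolding iv[symmetric] by (simp add: power_mult_distrib)
    have 1: "\<i> * of_real (c\<^sup>2 * s * v / \<rho>) = of_real (c\<^sup>2 * s) * ((W - 1) / r) / r"
      unfolding iv[symmetric] by (simp add: r_def)
    have 2: "of_real (c\<^sup>2 * s / (2 * \<rho>\<^sup>2)) = of_real (c\<^sup>2 * s) / (2 * r\<^sup>2)" by (simp add: r_def)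
    have 3: "of_real (3 * c * s / (2 * \<rho>)) = of_real (3 * c * s) / (2 * r)" by (simp add: r_def)
    have 4: "(\<theta> \<rho>)\<^sup>2 * of_real s / 2 = of_real (c\<^sup>2 * s) / (2 * (r * W)\<^sup>2) - of_real (3 * c * s) / (2 * (r * W))
       + of_real (s / 2) * ((3 / 2 + h \<rho> * O')\<^sup>2 - 2 * of_real c * O')"
    proof -
      have "\<theta> \<rho> = - of_real c / (r * W) + (3 / 2 + r * W * O')" using th[OF h0] by (simp add: hr O'_def)
      then show ?thesis unfolding hr using saddle_square_identity[of "r * W" "of_real c" O' "of_real s"] r W by simp
    qed
    have a: "of_real (c\<^sup>2 * s) * ((W - 1) / r) / r - of_real (c\<^sup>2 * s) / (2 * r\<^sup>2) + of_real (c\<^sup>2 * s) / (2 * (r * W)\<^sup>2)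
      = of_real (c\<^sup>2 * s / 2) * (3 * ((W - 1) / r)\<^sup>2) * ((1 + 2 * (W - 1) / 3) / W\<^sup>2)"
      using saddle_cubic_identity[OF r W, of "of_real (c\<^sup>2 * s)"] by simp
    have b: "of_real (3 * c * s) / (2 * r) - of_real (3 * c * s) / (2 * (r * W)) = of_real (3 / 2 * c * s) * ((W - 1) / r / W)"
      using r W by (simp add: divide_simps) (simp add: algebra_simps)
    have regroup: "a1 - b1 + d1 + (e1 - f1 + g1) = (a1 - b1 + e1) + (d1 - f1) + g1" for a1 b1 d1 e1 f1 g1 :: complex by simp
    have wW: "w \<rho> = W - 1" by (simp add: W_def)
    have Aexp: "A \<rho> = of_real (c\<^sup>2 * s / 2) * (3 * ((W - 1) / r)\<^sup>2) * ((1 + 2 * (W - 1) / 3) / W\<^sup>2)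
      + of_real (3 / 2 * c * s) * ((W - 1) / r / W) + of_real (s / 2) * ((3 / 2 + h \<rho> * O')\<^sup>2 - 2 * of_real c * O')"
      unfolding A_def W_def[symmetric] O'_def[symmetric] iv v2 wW by simp
    show ?thesis unfolding 1 2 3 4 Aexp a[symmetric] b[symmetric] by (rule regroup)
  qed
  have A_lim: "(A \<longlongrightarrow> of_real (s / 2 * (9 / 4 - 2 * c * (1 / 3 + 1 / pi\<^sup>2)) - 3 / 2 * c\<^sup>2 * s * v\<^sup>2) + \<i> * of_real (3 / 2 * c * s * v)) (at_right 0)"
  proof -
    have "(A \<longlongrightarrow> of_real (c\<^sup>2 * s / 2) * (- 3 * of_real (v\<^sup>2)) * ((1 + 2 * 0 / 3) / (1 + 0)\<^sup>2)
     + of_real (3 / 2 * c * s) * (\<i> * of_real v / (1 + 0))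
     + of_real (s / 2) * ((3 / 2 + 0 * of_real (1 / 3 + 1 / pi\<^sup>2))\<^sup>2 - 2 * of_real c * of_real (1 / 3 + 1 / pi\<^sup>2))) (at_right 0)"
      unfolding A_def by (intro tendsto_intros w_lim h_lim0 om) auto
    moreover have "of_real (c\<^sup>2 * s / 2) * (- 3 * of_real (v\<^sup>2)) * ((1 + 2 * 0 / 3) / (1 + 0)\<^sup>2)
     + of_real (3 / 2 * c * s) * (\<i> * of_real v / (1 + 0))
     + of_real (s / 2) * ((3 / 2 + 0 * of_real (1 / 3 + 1 / pi\<^sup>2))\<^sup>2 - 2 * of_real c * of_real (1 / 3 + 1 / pi\<^sup>2))
     = of_real (s / 2 * (9 / 4 - 2 * c * (1 / 3 + 1 / pi\<^sup>2)) - 3 / 2 * c\<^sup>2 * s * v\<^sup>2) + \<i> * complex_of_real (3 / 2 * c * s * v)"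
      by (simp add: complex_eq_iff power2_eq_square algebra_simps)
    ultimately show ?thesis by simp
  qed
  have main: "((\<lambda>\<rho>. 2 * exp (A \<rho>)) \<longlongrightarrow> 2 * exp (of_real (s / 2 * (9 / 4 - 2 * c * (1 / 3 + 1 / pi\<^sup>2)) - 3 / 2 * c\<^sup>2 * s * v\<^sup>2) + \<i> * of_real (3 / 2 * c * s * v))) (at_right 0)"
    by (intro tendsto_intros A_lim)
  \<comment> \<open>Multiplied by \<open>\<rho>\<close>, \<open>\<theta> \<rho>\<close> tends to
    \<open>- c\<close>, so its real part is negative for small \<open>\<rho>\<close>.\<close>
  have neg: "\<forall>\<^sub>F \<rho> in at_right 0. Re (\<theta> \<rho>) \<le> 0"
  proof -
    have "((\<lambda>\<rho>. - of_real c / (1 + w \<rho>) + of_real \<rho> * (3 / 2 + h \<rho> * \<omega> (h \<rho>))) \<longlongrightarrow> - of_real c / (1 + 0) + 0 * (3 / 2 + 0 * of_real (1 / 3 + 1 / pi\<^sup>2))) (at_right 0)"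
      by (intro tendsto_intros w_lim h_lim0 om rho_lim) auto
    then have "((\<lambda>\<rho>. Re (- of_real c / (1 + w \<rho>) + of_real \<rho> * (3 / 2 + h \<rho> * \<omega> (h \<rho>)))) \<longlongrightarrow> - c) (at_right 0)"
      by (auto dest: tendsto_Re)
    then have "\<forall>\<^sub>F \<rho> in at_right 0. Re (- of_real c / (1 + w \<rho>) + of_real \<rho> * (3 / 2 + h \<rho> * \<omega> (h \<rho>))) < 0"
      using c by (intro order_tendstoD(2)) auto
    then show ?thesis using eventually_at_right_less[of 0] h_ne
    proof eventually_elim
      case (elim \<rho>)
      have "of_real \<rho> * \<theta> \<rho> = - of_real c / (1 + w \<rho>) + of_real \<rho> * (3 / 2 + h \<rho> * \<omega> (h \<rho>))"
      proof -
        have "of_real \<rho> * (- of_real c / h \<rho>) = - of_real c / (1 + w \<rho>)" using elim(2) unfolding h_eq by simp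
        then show ?thesis unfolding th[OF elim(3)] by (simp only: distrib_left)
      qed
      then have "Re (of_real \<rho> * \<theta> \<rho>) < 0" using elim(1) by (simp only:)
      then have "\<rho> * Re (\<theta> \<rho>) < 0" by simp
      then show ?case using elim(2) by (simp add: mult_less_0_iff)
    qed
  qed
  have rest: "((\<lambda>\<rho>. pre \<rho> * half_normal_laplace s 0 (- \<theta> \<rho>)) \<longlongrightarrow> 0) (at_right 0)"
  proof (rule Lim_null_comparison)
    show "\<forall>\<^sub>F \<rho> in at_right 0. norm (pre \<rho> * half_normal_laplace s 0 (- \<theta> \<rho>)) \<le> exp (- (c\<^sup>2 * s / (2 * \<rho>\<^sup>2)) + 3 * c * s / (2 * \<rho>)) * 2"
      using neg
    proof eventually_elim
      case (elim \<rho>)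
      have "cmod (half_normal_laplace s 0 (- \<theta> \<rho>)) \<le> 2"
        using half_normal_laplace_complex(2)[OF s order_refl, of "- \<theta> \<rho>"] elim by simp
      moreover have "cmod (pre \<rho>) = exp (- (c\<^sup>2 * s / (2 * \<rho>\<^sup>2)) + 3 * c * s / (2 * \<rho>))" by (simp add: pre_def)
      ultimately show ?case unfolding norm_mult by (simp add: mult_left_mono)
    qed
    have gen: "((\<lambda>\<rho>. exp (- (a / \<rho>\<^sup>2) + b / \<rho>) * 2) \<longlongrightarrow> 0) (at_right 0)" if "0 < a" "0 < b" for a b :: real
      using that by real_asymp
    have "0 < c\<^sup>2 * s / 2" "0 < 3 * c * s / 2" using c s by auto
    from gen[OF this] show "((\<lambda>\<rho>. exp (- (c\<^sup>2 * s / (2 * \<rho>\<^sup>2)) + 3 * c * s / (2 * \<rho>)) * 2) \<longlongrightarrow> 0) (at_right 0)"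
      by (simp only: divide_divide_eq_left)
  qed
  have "((\<lambda>\<rho>. 2 * exp (A \<rho>) - pre \<rho> * half_normal_laplace s 0 (- \<theta> \<rho>)) \<longlongrightarrow>
     2 * exp (of_real (s / 2 * (9 / 4 - 2 * c * (1 / 3 + 1 / pi\<^sup>2)) - 3 / 2 * c\<^sup>2 * s * v\<^sup>2) + \<i> * of_real (3 / 2 * c * s * v)) - 0) (at_right 0)"
    by (intro tendsto_diff main rest)
  moreover have "\<forall>\<^sub>F \<rho> in at_right 0. 2 * exp (A \<rho>) - pre \<rho> * half_normal_laplace s 0 (- \<theta> \<rho>) = pre \<rho> * half_normal_laplace s 0 (\<theta> \<rho>)"
    using eventually_at_right_less[of 0]
  proof eventually_elim
    case (elim \<rho>)
    have L: "half_normal_laplace s 0 (\<theta> \<rho>) = 2 * exp ((\<theta> \<rho>)\<^sup>2 * of_real s / 2) - half_normal_laplace s 0 (- \<theta> \<rho>)"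
      using half_normal_laplace_reflection[OF s, of "\<theta> \<rho>"] by (simp add: algebra_simps)
    have P: "pre \<rho> * exp ((\<theta> \<rho>)\<^sup>2 * of_real s / 2) = exp (A \<rho>)"
      unfolding A_eq[OF elim, symmetric] pre_def by (simp only: exp_add)
    show ?case unfolding L right_diff_distrib mult.left_commute[of "pre \<rho>" 2] P ..
  qed
  ultimately have "((\<lambda>\<rho>. pre \<rho> * half_normal_laplace s 0 (\<theta> \<rho>)) \<longlongrightarrow>
     2 * exp (of_real (s / 2 * (9 / 4 - 2 * c * (1 / 3 + 1 / pi\<^sup>2)) - 3 / 2 * c\<^sup>2 * s * v\<^sup>2) + \<i> * of_real (3 / 2 * c * s * v)) - 0) (at_right 0)"
    by (rule Lim_transform_eventually)
  then show ?thesis by (simp add: pre_def \<theta>_def h_def)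
qed

text \<open>The analytic continuation of the function \<open>M\<close> of the overview, with
  \<open>max 0 (\<bar>x\<bar> - 1)\<close> as the distance \<open>d\<close>.\<close>

definition passage_transform :: "real \<Rightarrow> real \<Rightarrow> complex \<Rightarrow> complex" where
  "passage_transform x s z = exp (- z * of_real s) * exit_factor x (csqrt (2 * z)) * half_normal_laplace s (max 0 (\<bar>x\<bar> - 1)) (theta z)"

lemma passage_transform_holomorphic:
  assumes s: "0 < s"
  shows "passage_transform x s holomorphic_on {z. - (pi\<^sup>2 / 8) < Re z}"
proof -
  let ?S = "{z. - (pi\<^sup>2 / 8) < Re z}"
  have nz: "cosh (csqrt (2 * z)) \<noteq> 0" if "z \<in> ?S" for z using that by (intro cosh_csqrt_nonzero) auto
  have 1: "(\<lambda>z. exit_factor x (csqrt (2 * z))) holomorphic_on ?S"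
    using cosh_csqrt_holomorphic[of x ?S] cosh_csqrt_holomorphic[of 1 ?S] nz
    by (cases "\<bar>x\<bar> < 1") (auto simp: exit_factor_def intro!: holomorphic_on_divide)
  have 2: "(\<lambda>z. half_normal_laplace s (max 0 (\<bar>x\<bar> - 1)) (theta z)) holomorphic_on ?S"
    using holomorphic_on_compose_gen[OF theta_holomorphic half_normal_laplace_holomorphic[OF s, of "max 0 (\<bar>x\<bar> - 1)"], of ?S] nz
    by (simp add: o_def)
  show ?thesis unfolding passage_transform_def[abs_def] by (intro holomorphic_on_mult 1 2 holomorphic_intros)
qed

text \<open>At distance \<open>\<rho>\<close> to the right of the pole \<open>Re (1 / h)\<close> is
  at most \<open>1 / \<rho>\<close>, so \<open>Re (theta z)\<close> is bounded below. The bound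
  degenerates as \<open>r\<close> approaches \<open>pi^2 / 8\<close>; it serves the inversion
  formula on one vertical line at a time.\<close>

lemma passage_transform_bounded:
  assumes s: "0 < s" and r: "0 < r" "r < pi\<^sup>2 / 8"
  obtains K where "\<And>z. - r \<le> Re z \<Longrightarrow> cmod (passage_transform x s z) \<le> K"
proof -
  obtain C \<delta> where C: "0 \<le> C" "0 < \<delta>"
    and E: "\<And>h. 0 \<le> Re h \<Longrightarrow> h \<noteq> 0 \<Longrightarrow> cmod (exit_factor x (csqrt (2 * (h - of_real (pi\<^sup>2 / 8))))) \<le> C * (1 + 1 / cmod h)"
    and near: "\<And>h. 0 \<le> Re h \<Longrightarrow> h \<noteq> 0 \<Longrightarrow> cmod h < \<delta> \<Longrightarrow>
      - (pi\<^sup>2 / 4) * Re (1 / h) + 3 / 2 - C * cmod h \<le> Re (theta (h - of_real (pi\<^sup>2 / 8)))"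
    and far: "\<And>h. 0 \<le> Re h \<Longrightarrow> \<delta> \<le> cmod h \<Longrightarrow> - C \<le> Re (theta (h - of_real (pi\<^sup>2 / 8)))"
    using pole_neighbourhood_bounds[of x] by metis
  define \<rho> where "\<rho> = pi\<^sup>2 / 8 - r"
  have \<rho>: "0 < \<rho>" using r by (simp add: \<rho>_def)
  define D where "D = pi\<^sup>2 / 4 * (1 / \<rho>) + C * \<delta> + C"
  have D: "0 \<le> D" "C \<le> D" "pi\<^sup>2 / 4 * (1 / \<rho>) + C * \<delta> \<le> D" using C \<rho> by (auto simp: D_def)
  show thesis
  proof (rule that[of "exp (r * s) * (C * (1 + 1 / \<rho>)) * (2 * exp (D\<^sup>2 * s / 2))"])
    fix z assume z: "- r \<le> Re z"
    define h where "h = z + of_real (pi\<^sup>2 / 8)"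
    have zh: "z = h - of_real (pi\<^sup>2 / 8)" by (simp add: h_def)
    have Re_h: "\<rho> \<le> Re h" using z by (simp add: h_def \<rho>_def)
    have hn: "\<rho> \<le> cmod h" using Re_h complex_Re_le_cmod[of h] by linarith
    have h0: "h \<noteq> 0" "0 \<le> Re h" using hn \<rho> Re_h by auto
    have inv: "1 / cmod h \<le> 1 / \<rho>" using hn \<rho> by (simp add: frac_le)
    have e: "cmod (exit_factor x (csqrt (2 * z))) \<le> C * (1 + 1 / \<rho>)"
      using E[OF h0(2,1)] mult_left_mono[OF add_left_mono[OF inv, of 1] C(1)] unfolding zh by linarith
    have "- D \<le> Re (theta z)"
    proof (cases "cmod h < \<delta>")
      case True
      have "Re (1 / h) \<le> 1 / cmod h" using complex_Re_le_cmod[of "1 / h"] by (simp add: norm_divide)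
      then have "pi\<^sup>2 / 4 * Re (1 / h) \<le> pi\<^sup>2 / 4 * (1 / \<rho>)" using inv by (intro mult_left_mono) auto
      moreover have "C * cmod h \<le> C * \<delta>" using True C by (intro mult_left_mono) auto
      ultimately show ?thesis using near[OF h0(2,1) True] D unfolding zh by linarith
    next
      case False
      then show ?thesis using far[OF h0(2)] D unfolding zh by linarith
    qed
    then have "max 0 (- Re (theta z)) \<le> D" using D by simp
    then have "(max 0 (- Re (theta z)))\<^sup>2 \<le> D\<^sup>2" by (intro power_mono) auto
    then have "2 * exp ((max 0 (- Re (theta z)))\<^sup>2 * s / 2) \<le> 2 * exp (D\<^sup>2 * s / 2)" using s by simp
    then have f: "cmod (half_normal_laplace s (max 0 (\<bar>x\<bar> - 1)) (theta z)) \<le> 2 * exp (D\<^sup>2 * s / 2)"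
      using half_normal_laplace_complex(2)[OF s, of "max 0 (\<bar>x\<bar> - 1)" "theta z"] by linarith
    have g: "cmod (exp (- z * of_real s)) \<le> exp (r * s)"
      using mult_right_mono[of "- Re z" r s] z s by simp
    show "cmod (passage_transform x s z) \<le> exp (r * s) * (C * (1 + 1 / \<rho>)) * (2 * exp (D\<^sup>2 * s / 2))"
      unfolding passage_transform_def norm_mult using C \<rho> by (intro mult_mono e f g) auto
  qed
qed

lemma passage_transform_0: "0 < s \<Longrightarrow> passage_transform x s 0 = 1"
  by (simp add: passage_transform_def exit_factor_def theta_def half_normal_laplace_0)

lemma passage_transform_of_real:
  assumes l: "0 < l"
  defines "a \<equiv> sqrt (2 * l)"
  shows "passage_transform x s (of_real l) = of_real (exp (- l * s) * exit_factor x a * half_normal_laplace s (max 0 (\<bar>x\<bar> - 1)) (a * tanh a))"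
proof -
  have c: "csqrt (2 * of_real l) = of_real a"
  proof -
    have "csqrt (2 * of_real l) = csqrt (of_real (2 * l))" by simp
    also have "\<dots> = of_real (sqrt (2 * l))" using l by (subst csqrt_of_real_nonneg) auto
    finally show ?thesis by (simp add: a_def)
  qed
  have ch: "cosh (complex_of_real t) = of_real (cosh t)" for t by (simp add: cosh_field_def exp_of_real[symmetric])
  have sh: "sinh (complex_of_real t) = of_real (sinh t)" for t by (simp add: sinh_field_def exp_of_real[symmetric])
  have e: "exit_factor x (complex_of_real a) = of_real (exit_factor x a)"
    using ch[of "x * a"] ch[of a] by (simp add: exit_factor_def)
  have t: "theta (of_real l) = of_real (a * tanh a)" by (simp add: theta_def c tanh_def ch sh)
  have x: "exp (- complex_of_real l * of_real s) = of_real (exp (- l * s))" by (simp add: exp_of_real[symmetric])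
  show ?thesis unfolding passage_transform_def c e t x half_normal_laplace_of_real by simp
qed

text \<open>The integrand of the inversion integral at \<open>h = \<rho> + \<i> \<rho>\<^sup>2 v\<close>, divided by its exponentially large size at the saddle point.\<close>

definition saddle_integrand :: "real \<Rightarrow> real \<Rightarrow> real \<Rightarrow> real \<Rightarrow> complex" where
  "saddle_integrand x s \<rho> v = exp (\<i> * of_real ((pi\<^sup>2 / 4)\<^sup>2 * s * v / \<rho>) - of_real ((pi\<^sup>2 / 4)\<^sup>2 * s / (2 * \<rho>\<^sup>2)) + of_real (3 * (pi\<^sup>2 / 4) * s / (2 * \<rho>)))
      * (of_real \<rho> * (passage_transform x s (Complex \<rho> (\<rho>\<^sup>2 * v) - of_real (pi\<^sup>2 / 8)) / (Complex \<rho> (\<rho>\<^sup>2 * v) - of_real (pi\<^sup>2 / 8))\<^sup>2))"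

text \<open>By \<open>pi^2 \<ge> 9\<close>, the condition \<open>\<rho> \<le> 1 / 4\<close> ensures
  both \<open>6 * \<rho> \<le> pi^2 / 4\<close> and \<open>cmod z \<ge> 1 / 2\<close>. The factor
  \<open>\<rho>\<close> in the integrand balances the simple pole of \<open>exit_factor\<close>; for
  \<open>\<bar>x\<bar> \<ge> 1\<close> there is no pole to balance and \<open>\<rho>\<close>
  survives in the second bound.\<close>

lemma saddle_integrand_bound:
  fixes s x :: real
  assumes s: "0 < s"
  obtains D where "0 \<le> D"
    and "\<And>\<rho> v. 0 < \<rho> \<Longrightarrow> \<rho> \<le> 1 / 4 \<Longrightarrow> cmod (saddle_integrand x s \<rho> v) \<le> D * (1 / (1 + v\<^sup>2))"
    and "\<And>\<rho> v. 0 < \<rho> \<Longrightarrow> \<rho> \<le> 1 / 4 \<Longrightarrow> \<not> \<bar>x\<bar> < 1 \<Longrightarrow> cmod (saddle_integrand x s \<rho> v) \<le> \<rho> * D"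
proof -
  define c where "c = pi\<^sup>2 / 4"
  obtain C \<delta> where C: "0 \<le> C" "0 < \<delta>"
    and E: "\<And>h. 0 \<le> Re h \<Longrightarrow> h \<noteq> 0 \<Longrightarrow> cmod (exit_factor x (csqrt (2 * (h - of_real (pi\<^sup>2 / 8))))) \<le> C * (1 + 1 / cmod h)"
    and near: "\<And>h. 0 \<le> Re h \<Longrightarrow> h \<noteq> 0 \<Longrightarrow> cmod h < \<delta> \<Longrightarrow>
      - (pi\<^sup>2 / 4) * Re (1 / h) + 3 / 2 - C * cmod h \<le> Re (theta (h - of_real (pi\<^sup>2 / 8)))"
    and far: "\<And>h. 0 \<le> Re h \<Longrightarrow> \<delta> \<le> cmod h \<Longrightarrow> - C \<le> Re (theta (h - of_real (pi\<^sup>2 / 8)))"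
    using pole_neighbourhood_bounds[of x] by metis
  have pi9: "9 \<le> pi\<^sup>2" using pi_gt3 power_mono[of 3 pi 2] by simp
  have c: "9 / 4 \<le> c" using pi9 by (simp add: c_def)
  define Q where "Q = 9 / 4 + 2 * C * c + C\<^sup>2 * \<delta>\<^sup>2 + C\<^sup>2"
  define q where "q = s * c\<^sup>2 / 4"
  have q: "0 < q" using s c by (simp add: q_def)
  define U where "U = (2 * exp (s / 2 * Q)) * exp (pi\<^sup>2 / 8 * s) * 4 * (1 + 2 / q + 8 / q\<^sup>2)"
  have U: "0 \<le> U" using q by (simp add: U_def)
  have bound: "cmod (saddle_integrand x s \<rho> v) \<le> \<rho> * cmod (exit_factor x (csqrt (2 * (Complex \<rho> (\<rho>\<^sup>2 * v) - of_real (pi\<^sup>2 / 8))))) * (U * (1 / (1 + v\<^sup>2)))"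
    and exit: "\<rho> * cmod (exit_factor x (csqrt (2 * (Complex \<rho> (\<rho>\<^sup>2 * v) - of_real (pi\<^sup>2 / 8))))) \<le> 2 * C"
    if \<rho>: "0 < \<rho>" "\<rho> \<le> 1 / 4" for \<rho> v
  proof -
    define h where "h = Complex \<rho> (\<rho>\<^sup>2 * v)"
    define z where "z = h - of_real (pi\<^sup>2 / 8)"
    have h0: "0 \<le> Re h" "h \<noteq> 0" using \<rho> by (auto simp: h_def complex_eq_iff)
    have hn: "\<rho> \<le> cmod h" using complex_Re_le_cmod[of h] by (simp add: h_def)
    define m where "m = max 0 (- Re (theta z))"
    have mb: "m\<^sup>2 - (c / \<rho>)\<^sup>2 + 3 * (c / \<rho>) \<le> Q - c\<^sup>2 * v\<^sup>2 / (2 * (1 + \<rho>\<^sup>2 * v\<^sup>2))"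
      unfolding m_def Q_def
      by (rule saddle_exponent_bound[OF _ C(1) \<rho>(1) _ C(2) h_def])
        (use c \<rho> near[OF h0] far[OF h0(1)] in \<open>auto simp: c_def z_def\<close>)
    have pre: "cmod (exp (\<i> * of_real (c\<^sup>2 * s * v / \<rho>) - of_real (c\<^sup>2 * s / (2 * \<rho>\<^sup>2)) + of_real (3 * c * s / (2 * \<rho>))))
      = exp (s / 2 * (- (c / \<rho>)\<^sup>2 + 3 * (c / \<rho>)))"
    proof -
      have "- (c\<^sup>2 * s / (2 * \<rho>\<^sup>2)) + 3 * c * s / (2 * \<rho>) = s / 2 * (- (c / \<rho>)\<^sup>2 + 3 * (c / \<rho>))"
        using \<rho> by (simp add: power_divide algebra_simps)
      then show ?thesis by simp
    qed
    have phi: "cmod (half_normal_laplace s (max 0 (\<bar>x\<bar> - 1)) (theta z)) \<le> 2 * exp (m\<^sup>2 * s / 2)"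
      unfolding m_def by (rule half_normal_laplace_complex(2)[OF s]) simp
    have A1: "exp (s / 2 * (- (c / \<rho>)\<^sup>2 + 3 * (c / \<rho>))) * cmod (half_normal_laplace s (max 0 (\<bar>x\<bar> - 1)) (theta z))
      \<le> 2 * exp (s / 2 * Q) * exp (- q * v\<^sup>2 / (1 + \<rho>\<^sup>2 * v\<^sup>2))"
    proof -
      have "exp (s / 2 * (- (c / \<rho>)\<^sup>2 + 3 * (c / \<rho>))) * cmod (half_normal_laplace s (max 0 (\<bar>x\<bar> - 1)) (theta z))
        \<le> exp (s / 2 * (- (c / \<rho>)\<^sup>2 + 3 * (c / \<rho>))) * (2 * exp (m\<^sup>2 * s / 2))"
        using phi by (intro mult_left_mono) auto
      also have "\<dots> = 2 * exp (s / 2 * (m\<^sup>2 - (c / \<rho>)\<^sup>2 + 3 * (c / \<rho>)))"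
        by (simp add: exp_add[symmetric] algebra_simps)
      also have "\<dots> \<le> 2 * exp (s / 2 * (Q - c\<^sup>2 * v\<^sup>2 / (2 * (1 + \<rho>\<^sup>2 * v\<^sup>2))))"
        using mult_left_mono[OF mb, of "s / 2"] s by simp
      also have "s / 2 * (Q - c\<^sup>2 * v\<^sup>2 / (2 * (1 + \<rho>\<^sup>2 * v\<^sup>2))) = s / 2 * Q + - q * v\<^sup>2 / (1 + \<rho>\<^sup>2 * v\<^sup>2)"
        by (simp add: q_def right_diff_distrib)
      finally show ?thesis by (simp only: exp_add mult.assoc)
    qed
    have A2: "\<rho> * cmod (exit_factor x (csqrt (2 * z))) \<le> 2 * C"
    proof -
      have "\<rho> * cmod (exit_factor x (csqrt (2 * z))) \<le> \<rho> * (C * (1 + 1 / cmod h))"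
        using E[OF h0] \<rho> by (intro mult_left_mono) (auto simp: z_def)
      also have "\<dots> = C * (\<rho> + \<rho> / cmod h)" by (simp add: algebra_simps)
      also have "\<dots> \<le> C * (1 + 1)" using C \<rho> hn h0 by (intro mult_left_mono add_mono) (auto simp: divide_le_eq)
      finally show ?thesis by simp
    qed
    have A3: "cmod (exp (- z * of_real s)) \<le> exp (pi\<^sup>2 / 8 * s)"
      using \<rho> s by (simp add: z_def h_def algebra_simps)
    have A4: "1 / (cmod z)\<^sup>2 \<le> 4 / (1 + \<rho>^4 * v\<^sup>2)"
    proof -
      have "1 / 4 \<le> (pi\<^sup>2 / 8 - \<rho>)\<^sup>2" using power_mono[of "1 / 2" "pi\<^sup>2 / 8 - \<rho>" 2] pi9 \<rho> by (simp add: power_divide)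
      moreover have "(cmod z)\<^sup>2 = (\<rho> - pi\<^sup>2 / 8)\<^sup>2 + \<rho>^4 * v\<^sup>2"
        by (simp add: z_def h_def cmod_power2 power_mult_distrib)
      moreover have "(\<rho> - pi\<^sup>2 / 8)\<^sup>2 = (pi\<^sup>2 / 8 - \<rho>)\<^sup>2" by (rule power2_commute)
      moreover have "0 \<le> \<rho>^4 * v\<^sup>2" by simp
      moreover have "(1 + Y) / 4 \<le> n" if "1 / 4 \<le> X" "n = X' + Y" "X' = X" "0 \<le> Y" for n X X' Y :: real
        using that by simp
      ultimately have "(1 + \<rho>^4 * v\<^sup>2) / 4 \<le> (cmod z)\<^sup>2" by blast
      moreover have "0 < (1 + \<rho>^4 * v\<^sup>2) / 4" by (simp add: add_pos_nonneg)
      ultimately have "1 / (cmod z)\<^sup>2 \<le> 1 / ((1 + \<rho>^4 * v\<^sup>2) / 4)" by (intro frac_le) auto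
      then show ?thesis by simp
    qed
    show "\<rho> * cmod (exit_factor x (csqrt (2 * (Complex \<rho> (\<rho>\<^sup>2 * v) - of_real (pi\<^sup>2 / 8))))) \<le> 2 * C"
      using A2 by (simp only: z_def h_def)
    define N where "N = \<rho> * cmod (exit_factor x (csqrt (2 * z)))"
    have N: "0 \<le> N" using \<rho> by (simp add: N_def)
    have "cmod (saddle_integrand x s \<rho> v) = N * ((exp (s / 2 * (- (c / \<rho>)\<^sup>2 + 3 * (c / \<rho>))) * cmod (half_normal_laplace s (max 0 (\<bar>x\<bar> - 1)) (theta z)))
      * cmod (exp (- z * of_real s)) * (1 / (cmod z)\<^sup>2))"
      unfolding saddle_integrand_def[folded c_def] h_def[symmetric] z_def[symmetric] norm_mult norm_divide norm_power pre passage_transform_def N_def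
      using \<rho> by simp
    also have "\<dots> \<le> N * ((2 * exp (s / 2 * Q) * exp (- q * v\<^sup>2 / (1 + \<rho>\<^sup>2 * v\<^sup>2))) * exp (pi\<^sup>2 / 8 * s) * (4 / (1 + \<rho>^4 * v\<^sup>2)))"
      by (intro mult_left_mono mult_mono A1 A3 A4 N) auto
    also have "\<dots> = N * ((2 * exp (s / 2 * Q)) * exp (pi\<^sup>2 / 8 * s) * 4 * (exp (- q * v\<^sup>2 / (1 + \<rho>\<^sup>2 * v\<^sup>2)) / (1 + \<rho>^4 * v\<^sup>2)))"
      by simp
    also have "\<dots> \<le> N * ((2 * exp (s / 2 * Q)) * exp (pi\<^sup>2 / 8 * s) * 4 * ((1 + 2 / q + 8 / q\<^sup>2) / (1 + v\<^sup>2)))"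
      using gaussian_cauchy_domination[OF q \<rho>(1), of v] \<rho> by (intro mult_left_mono N) auto
    also have "\<dots> = N * (U * (1 / (1 + v\<^sup>2)))" by (simp add: U_def)
    finally show "cmod (saddle_integrand x s \<rho> v) \<le> \<rho> * cmod (exit_factor x (csqrt (2 * (Complex \<rho> (\<rho>\<^sup>2 * v) - of_real (pi\<^sup>2 / 8))))) * (U * (1 / (1 + v\<^sup>2)))"
      by (simp only: N_def z_def h_def)
  qed
  have D: "U \<le> (1 + 2 * C) * U" "2 * C * U \<le> (1 + 2 * C) * U" using U C by (auto simp: algebra_simps)
  have w: "0 < 1 / (1 + v\<^sup>2)" "1 / (1 + v\<^sup>2) \<le> 1" for v :: real by (auto simp: add_pos_nonneg)
  show thesis
  proof (rule that[of "(1 + 2 * C) * U"])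
    show "0 \<le> (1 + 2 * C) * U" using C U by simp
    fix \<rho> v :: real assume \<rho>: "0 < \<rho>" "\<rho> \<le> 1 / 4"
    have "cmod (saddle_integrand x s \<rho> v) \<le> 2 * C * (U * (1 / (1 + v\<^sup>2)))"
      using bound[OF \<rho>, of v] mult_right_mono[OF exit[OF \<rho>, of v], of "U * (1 / (1 + v\<^sup>2))"] U w(1)[of v] by simp
    also have "\<dots> \<le> (1 + 2 * C) * U * (1 / (1 + v\<^sup>2))"
      using mult_right_mono[OF D(2), of "1 / (1 + v\<^sup>2)"] w(1)[of v] by (simp only: mult.assoc)
    finally show "cmod (saddle_integrand x s \<rho> v) \<le> (1 + 2 * C) * U * (1 / (1 + v\<^sup>2))" .
    show "cmod (saddle_integrand x s \<rho> v) \<le> \<rho> * ((1 + 2 * C) * U)" if x: "\<not> \<bar>x\<bar> < 1"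
    proof -
      have "cmod (saddle_integrand x s \<rho> v) \<le> \<rho> * (U * (1 / (1 + v\<^sup>2)))"
        using bound[OF \<rho>, of v] x by (simp add: exit_factor_def)
      also have "U * (1 / (1 + v\<^sup>2)) \<le> U * 1" using U w(2) by (intro mult_left_mono) auto
      also have "U * 1 \<le> (1 + 2 * C) * U" using D(1) by simp
      finally show ?thesis using \<rho> by simp
    qed
  qed
qed

text \<open>With \<open>c = pi^2 / 4\<close>, the factors are in order: the residue of the hitting
  time transform; the 2 of \<open>2 * exp (theta^2 * s / 2)\<close> over \<open>z^2\<close> at the
  pole; the integral of \<open>exp (- 3 * c^2 * s * v^2 / 2)\<close>; and the constants of the
  exponent. The latter are \<open>s / 2 * (9 / 4 - 2 * c * (1 / 3 + 1 / pi^2))\<close> from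
  \<open>theta^2\<close>, \<open>pi^2 / 8 * s\<close> from \<open>exp (- z * s)\<close> at the pole,
  and \<open>- 3 / 8 * s\<close> from averaging the phase
  \<open>exp (3 * \<i> * c * s * v / 2)\<close>.\<close>

definition saddle_constant :: "real \<Rightarrow> real \<Rightarrow> real" where
  "saddle_constant x s = (if \<bar>x\<bar> < 1 then pi / 2 * cos (pi * x / 2) else 0) * (2 / (pi\<^sup>2 / 8)\<^sup>2)
     * sqrt (2 * pi / (3 * (pi\<^sup>2 / 4)\<^sup>2 * s)) * exp ((pi\<^sup>2 + 12) / 24 * s)"

text \<open>The factor \<open>exp (3 / 8 * s)\<close> stands outside \<open>saddle_constant\<close>
  because it is cancelled when the phase is integrated against the normal density. For
  \<open>\<bar>x\<bar> \<ge> 1\<close> the limit is 0, by the second bound of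
  \<open>saddle_integrand_bound\<close>.\<close>

lemma saddle_integrand_limit:
  fixes s x v :: real
  assumes s: "0 < s"
  defines "c \<equiv> pi\<^sup>2 / 4"
  shows "((\<lambda>\<rho>. saddle_integrand x s \<rho> v) \<longlongrightarrow> of_real (saddle_constant x s * exp (3 / 8 * s)) *
     (of_real (normal_density 0 (sqrt (1 / (3 * c\<^sup>2 * s))) v) * exp (\<i> * of_real (3 / 2 * c * s * v)))) (at_right 0)"
proof -
  let ?k = "complex_of_real (pi\<^sup>2 / 8)"
  define h where "h \<rho> = Complex \<rho> (\<rho>\<^sup>2 * v)" for \<rho> :: real
  have c: "0 < c" by (simp add: c_def)
  have h_eq: "h \<rho> = of_real \<rho> * (1 + \<i> * of_real (\<rho> * v))" for \<rho>
    by (simp add: h_def complex_eq_iff power2_eq_square)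
  have w1: "1 + \<i> * of_real (\<rho> * v) \<noteq> 0" for \<rho> by (simp add: complex_eq_iff)
  have w_lim: "((\<lambda>\<rho>. \<i> * of_real (\<rho> * v)) \<longlongrightarrow> \<i> * of_real (0 * v)) (at_right 0)" by (intro tendsto_intros)
  have h_lim0: "(h \<longlongrightarrow> 0) (at_right 0)"
  proof -
    have "((\<lambda>\<rho>::real. of_real \<rho> * (1 + \<i> * of_real (\<rho> * v))) \<longlongrightarrow> of_real 0 * (1 + \<i> * of_real (0 * v))) (at_right 0)" by (intro tendsto_intros)
    then show ?thesis by (simp add: h_eq[abs_def])
  qed
  have h_ne: "\<forall>\<^sub>F \<rho> in at_right 0. h \<rho> \<noteq> 0"
    using eventually_at_right_less[of 0] by eventually_elim (simp add: h_def complex_eq_iff)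
  have h_lim: "filterlim h (at 0) (at_right 0)" unfolding filterlim_at using h_lim0 h_ne by simp
  define z where "z \<rho> = h \<rho> - ?k" for \<rho>
  have z_lim: "(z \<longlongrightarrow> 0 - ?k) (at_right 0)" unfolding z_def by (intro tendsto_intros h_lim0)
  show ?thesis
  proof (cases "\<bar>x\<bar> < 1")
    case True
    then have d: "max 0 (\<bar>x\<bar> - 1) = 0" by simp
    define E where "E \<rho> = exit_factor x (csqrt (2 * z \<rho>))" for \<rho>
    have E_lim: "((\<lambda>\<rho>. of_real \<rho> * E \<rho>) \<longlongrightarrow> of_real (pi / 2 * cos (pi * x / 2))) (at_right 0)"
    proof -
      have "((\<lambda>\<rho>. h \<rho> * E \<rho>) \<longlongrightarrow> of_real (pi / 2 * cos (pi * x / 2))) (at_right 0)"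
        using filterlim_compose[OF exit_factor_expansion[of x] h_lim] True by (simp add: E_def exit_factor_def z_def)
      then have "((\<lambda>\<rho>. (1 / (1 + \<i> * of_real (\<rho> * v))) * (h \<rho> * E \<rho>)) \<longlongrightarrow> (1 / (1 + \<i> * of_real (0 * v))) * of_real (pi / 2 * cos (pi * x / 2))) (at_right 0)"
        by (intro tendsto_intros w1)
      moreover have "(1 / (1 + \<i> * of_real (\<rho> * v))) * (h \<rho> * E \<rho>) = of_real \<rho> * E \<rho>" for \<rho>
        using w1[of \<rho>] by (simp add: h_eq)
      ultimately show ?thesis by simp
    qed
    define pre where "pre \<rho> = exp (\<i> * of_real (c\<^sup>2 * s * v / \<rho>) - of_real (c\<^sup>2 * s / (2 * \<rho>\<^sup>2)) + of_real (3 * c * s / (2 * \<rho>)))" for \<rho>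
    define G where "G = 2 * exp (of_real (s / 2 * (9 / 4 - 2 * c * (1 / 3 + 1 / pi\<^sup>2)) - 3 / 2 * c\<^sup>2 * s * v\<^sup>2) + \<i> * of_real (3 / 2 * c * s * v))"
    have main: "((\<lambda>\<rho>. pre \<rho> * half_normal_laplace s 0 (theta (z \<rho>))) \<longlongrightarrow> G) (at_right 0)"
      using saddle_main_limit[OF s, of v] by (simp add: pre_def G_def z_def h_def c_def)
    have "((\<lambda>\<rho>. (pre \<rho> * half_normal_laplace s 0 (theta (z \<rho>))) * (of_real \<rho> * E \<rho>) * exp (- z \<rho> * of_real s) / (z \<rho>)\<^sup>2)
      \<longlongrightarrow> G * of_real (pi / 2 * cos (pi * x / 2)) * exp (- (0 - ?k) * of_real s) / (0 - ?k)\<^sup>2) (at_right 0)"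
      by (intro tendsto_intros main E_lim z_lim) simp
    moreover have "(pre \<rho> * half_normal_laplace s 0 (theta (z \<rho>))) * (of_real \<rho> * E \<rho>) * exp (- z \<rho> * of_real s) / (z \<rho>)\<^sup>2 = saddle_integrand x s \<rho> v" for \<rho>
      unfolding saddle_integrand_def[folded c_def] passage_transform_def d h_def[symmetric] z_def[symmetric] pre_def[symmetric] E_def[symmetric] by simp
    moreover have "G * of_real (pi / 2 * cos (pi * x / 2)) * exp (- (0 - ?k) * of_real s) / (0 - ?k)\<^sup>2
      = of_real (saddle_constant x s * exp (3 / 8 * s)) *
     (of_real (normal_density 0 (sqrt (1 / (3 * c\<^sup>2 * s))) v) * exp (\<i> * of_real (3 / 2 * c * s * v)))"
    proof -
      define R where "R = sqrt (2 * pi / (3 * c\<^sup>2 * s))"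
      have R: "0 < R" using s c by (simp add: R_def)
      have nd: "normal_density 0 (sqrt (1 / (3 * c\<^sup>2 * s))) v = exp (- (3 / 2 * c\<^sup>2 * s * v\<^sup>2)) / R"
      proof -
        have "2 * pi * (sqrt (1 / (3 * c\<^sup>2 * s)))\<^sup>2 = 2 * pi / (3 * c\<^sup>2 * s)" using s c by simp
        moreover have "- (v - 0)\<^sup>2 / (2 * (sqrt (1 / (3 * c\<^sup>2 * s)))\<^sup>2) = - (3 / 2 * c\<^sup>2 * s * v\<^sup>2)" using s c by simp
        ultimately show ?thesis unfolding normal_density_def R_def by (simp only:) simp
      qed
      have ex: "s / 2 * (9 / 4 - 2 * c * (1 / 3 + 1 / pi\<^sup>2)) + pi\<^sup>2 / 8 * s = (pi\<^sup>2 + 12) / 24 * s + 3 / 8 * s"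
      proof -
        have "c * (1 / pi\<^sup>2) = 1 / 4" by (simp add: c_def)
        then have "c * (1 / 3 + 1 / pi\<^sup>2) = c / 3 + 1 / 4" by (simp only: distrib_left)
        then have k: "2 * c * (1 / 3 + 1 / pi\<^sup>2) = pi\<^sup>2 / 6 + 1 / 2" unfolding mult.assoc by (simp add: c_def)
        show ?thesis unfolding k by (simp add: field_simps)
      qed
      have "G = of_real (2 * (exp (s / 2 * (9 / 4 - 2 * c * (1 / 3 + 1 / pi\<^sup>2))) * exp (- (3 / 2 * c\<^sup>2 * s * v\<^sup>2)))) * exp (\<i> * of_real (3 / 2 * c * s * v))"
      proof -
        have "exp (a - b) = exp a * exp (- b)" for a b :: real by (simp add: exp_add[symmetric])
        then show ?thesis unfolding G_def by (simp only: exp_add exp_of_real of_real_mult of_real_numeral mult.assoc)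
      qed
      moreover have "exp (- (0 - ?k) * of_real s) = of_real (exp (pi\<^sup>2 / 8 * s))" by (simp add: exp_of_real[symmetric])
      moreover have "(0 - ?k)\<^sup>2 = of_real ((pi\<^sup>2 / 8)\<^sup>2)" by simp
      ultimately have "G * of_real (pi / 2 * cos (pi * x / 2)) * exp (- (0 - ?k) * of_real s) / (0 - ?k)\<^sup>2
        = of_real (2 * (exp (s / 2 * (9 / 4 - 2 * c * (1 / 3 + 1 / pi\<^sup>2))) * exp (- (3 / 2 * c\<^sup>2 * s * v\<^sup>2))) * (pi / 2 * cos (pi * x / 2)) * exp (pi\<^sup>2 / 8 * s) / (pi\<^sup>2 / 8)\<^sup>2) * exp (\<i> * of_real (3 / 2 * c * s * v))"
        by (simp only: of_real_mult of_real_divide) (simp add: mult_ac)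
      also have "2 * (exp (s / 2 * (9 / 4 - 2 * c * (1 / 3 + 1 / pi\<^sup>2))) * exp (- (3 / 2 * c\<^sup>2 * s * v\<^sup>2))) * (pi / 2 * cos (pi * x / 2)) * exp (pi\<^sup>2 / 8 * s) / (pi\<^sup>2 / 8)\<^sup>2
        = saddle_constant x s * exp (3 / 8 * s) * normal_density 0 (sqrt (1 / (3 * c\<^sup>2 * s))) v"
      proof -
        have "exp (s / 2 * (9 / 4 - 2 * c * (1 / 3 + 1 / pi\<^sup>2))) * exp (pi\<^sup>2 / 8 * s) = exp ((pi\<^sup>2 + 12) / 24 * s) * exp (3 / 8 * s)"
          unfolding exp_add[symmetric] ex ..
        then have "2 * (exp (s / 2 * (9 / 4 - 2 * c * (1 / 3 + 1 / pi\<^sup>2))) * exp (- (3 / 2 * c\<^sup>2 * s * v\<^sup>2))) * (pi / 2 * cos (pi * x / 2)) * exp (pi\<^sup>2 / 8 * s) / (pi\<^sup>2 / 8)\<^sup>2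
          = (2 / (pi\<^sup>2 / 8)\<^sup>2) * exp (- (3 / 2 * c\<^sup>2 * s * v\<^sup>2)) * (pi / 2 * cos (pi * x / 2)) * (exp ((pi\<^sup>2 + 12) / 24 * s) * exp (3 / 8 * s))"
          by (simp add: mult_ac)
        also have "\<dots> = saddle_constant x s * exp (3 / 8 * s) * normal_density 0 (sqrt (1 / (3 * c\<^sup>2 * s))) v"
          unfolding nd saddle_constant_def c_def[symmetric] R_def[symmetric] using True R by simp
        finally show ?thesis .
      qed
      finally show ?thesis by (simp add: mult.assoc)
    qed
    ultimately show ?thesis by simp
  next
    case False
    then have sc: "saddle_constant x s = 0" by (simp add: saddle_constant_def)
    obtain D where D: "\<And>\<rho>. 0 < \<rho> \<Longrightarrow> \<rho> \<le> 1 / 4 \<Longrightarrow> cmod (saddle_integrand x s \<rho> v) \<le> \<rho> * D"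
      using saddle_integrand_bound[OF s, of x] False by metis
    have "((\<lambda>\<rho>. saddle_integrand x s \<rho> v) \<longlongrightarrow> 0) (at_right 0)"
    proof (rule Lim_null_comparison)
      show "\<forall>\<^sub>F \<rho> in at_right 0. cmod (saddle_integrand x s \<rho> v) \<le> \<rho> * D"
        by (rule eventually_mono[OF eventually_at_right_real[of 0 "1 / 4"]]) (auto intro!: D)
      have "((\<lambda>\<rho>. \<rho> * D) \<longlongrightarrow> 0 * D) (at_right (0::real))" by (intro tendsto_intros)
      then show "((\<lambda>\<rho>. \<rho> * D) \<longlongrightarrow> 0) (at_right (0::real))" by simp
    qed
    then show ?thesis by (simp add: sc)
  qed
qed

lemma contour_integral_asymptotics:
  fixes s x :: real
  assumes s: "0 < s" and R: "filterlim R (at_right 0) at_top"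
  shows "((\<lambda>T. LBINT v. saddle_integrand x s (R T) v) \<longlongrightarrow> of_real (saddle_constant x s)) (at_top :: real filter)"
proof -
  define c where "c = pi\<^sup>2 / 4"
  obtain D where D: "\<And>\<rho> v. 0 < \<rho> \<Longrightarrow> \<rho> \<le> 1 / 4 \<Longrightarrow> cmod (saddle_integrand x s \<rho> v) \<le> D * (1 / (1 + v\<^sup>2))"
    using saddle_integrand_bound[OF s, of x] by metis
  have c: "0 < c" by (simp add: c_def)
  define g where "g v = of_real (normal_density 0 (sqrt (1 / (3 * c\<^sup>2 * s))) v) * exp (\<i> * of_real (3 / 2 * c * s * v))" for v
  define L where "L v = of_real (saddle_constant x s * exp (3 / 8 * s)) * g v" for v
  have pos: "\<forall>\<^sub>F \<rho> in at_right 0. 0 < \<rho> \<and> \<rho> < (1 / 4 :: real)"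
    by (rule eventually_mono[OF eventually_at_right_real[of 0 "1 / 4"]]) auto
  have posT: "\<forall>\<^sub>F T in at_top. 0 < R T \<and> R T < 1 / 4"
    using R pos unfolding filterlim_iff by blast
  \<comment> \<open>Replacing the integrand by 0 for the remaining \<open>T\<close> gives
    measurability and the dominating bound for every \<open>T\<close>, and changes nothing for large
    \<open>T\<close>.\<close>
  define w where "w T = (if 0 < R T \<and> R T < 1 / 4 then saddle_integrand x s (R T) else (\<lambda>_. 0))" for T
  have meas: "w T \<in> borel_measurable lborel" for T
  proof (cases "0 < R T \<and> R T < 1 / 4")
    case True
    have ne: "Complex (R T) y - of_real (pi\<^sup>2 / 8) \<noteq> 0" for y
    proof -
      have "9 \<le> pi\<^sup>2" using pi_gt3 power_mono[of 3 pi 2] by simp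
      then show ?thesis using True by (auto simp: complex_eq_iff)
    qed
    have cont: "continuous_on UNIV (\<lambda>v. Complex (R T) ((R T)\<^sup>2 * v) - of_real (pi\<^sup>2 / 8))"
      unfolding complex_eq_iff Complex_eq by (intro continuous_intros)
    have hol: "continuous_on {z. - (pi\<^sup>2 / 8) < Re z} (passage_transform x s)"
      by (rule holomorphic_on_imp_continuous_on[OF passage_transform_holomorphic[OF s]])
    have "continuous_on UNIV (\<lambda>v. passage_transform x s (Complex (R T) ((R T)\<^sup>2 * v) - of_real (pi\<^sup>2 / 8)))"
      by (rule continuous_on_compose2[OF hol cont]) (use True in auto)
    then have "continuous_on UNIV (saddle_integrand x s (R T))"
      unfolding saddle_integrand_def[folded c_def] using ne True by (intro continuous_intros cont) auto
    then show ?thesis using True by (simp add: w_def borel_measurable_continuous_onI)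
  next
    case False
    then show ?thesis by (auto simp: w_def)
  qed
  have gauss: "(LBINT v. g v) = exp (- of_real (3 / 8 * s))" "integrable lborel g"
  proof -
    have s': "0 < 1 / (3 * c\<^sup>2 * s)" using s c by simp
    have "g = (\<lambda>v. of_real (normal_density 0 (sqrt (1 / (3 * c\<^sup>2 * s))) v) * exp (- (- \<i> * of_real (3 / 2 * c * s)) * of_real v))"
      unfolding g_def fun_eq_iff by (simp add: mult.assoc)
    moreover have "(- \<i> * of_real (3 / 2 * c * s))\<^sup>2 * of_real (1 / (3 * c\<^sup>2 * s)) / 2 = - complex_of_real (3 / 8 * s)"
      using s c by (simp add: power_mult_distrib power2_eq_square field_simps)
    ultimately show "(LBINT v. g v) = exp (- of_real (3 / 8 * s))" "integrable lborel g"
      using complex_gaussian_integral[OF s', of "- \<i> * of_real (3 / 2 * c * s)"] by simp_all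
  qed
  have "((\<lambda>T. integral\<^sup>L lborel (w T)) \<longlongrightarrow> integral\<^sup>L lborel L) at_top"
  proof (rule integral_dominated_convergence_at_top[where w = "\<lambda>v. \<bar>D\<bar> * (1 / (1 + v\<^sup>2))"])
    show "L \<in> borel_measurable lborel" unfolding L_def using gauss(2) by auto
    show "w T \<in> borel_measurable lborel" for T by (rule meas)
    show "integrable lborel (\<lambda>v. \<bar>D\<bar> * (1 / (1 + v\<^sup>2)))"
      by (intro integrable_mult_right integrable_inverse_1_plus_square_lborel)
    have "((\<lambda>T. saddle_integrand x s (R T) v) \<longlongrightarrow> L v) at_top" for v
      using filterlim_compose[OF saddle_integrand_limit[OF s, of x v] R] unfolding L_def g_def c_def .
    moreover have "\<forall>\<^sub>F T in at_top. saddle_integrand x s (R T) v = w T v" for v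
      using posT by eventually_elim (simp add: w_def)
    ultimately have "((\<lambda>T. w T v) \<longlongrightarrow> L v) at_top" for v by (rule Lim_transform_eventually)
    then show "AE v in lborel. ((\<lambda>T. w T v) \<longlongrightarrow> L v) at_top" by simp
    have "norm (w T v) \<le> \<bar>D\<bar> * (1 / (1 + v\<^sup>2))" for T v
    proof (cases "0 < R T \<and> R T < 1 / 4")
      case True
      then have "cmod (saddle_integrand x s (R T) v) \<le> D * (1 / (1 + v\<^sup>2))" by (intro D) auto
      also have "\<dots> \<le> \<bar>D\<bar> * (1 / (1 + v\<^sup>2))" by (intro mult_right_mono) (auto intro: add_nonneg_nonneg)
      finally show ?thesis using True by (simp add: w_def)
    qed (auto simp: w_def)
    then show "\<forall>\<^sub>F T in at_top. AE v in lborel. norm (w T v) \<le> \<bar>D\<bar> * (1 / (1 + v\<^sup>2))" by simp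
  qed
  moreover have "integral\<^sup>L lborel L = of_real (saddle_constant x s)"
  proof -
    have "integral\<^sup>L lborel L = of_real (saddle_constant x s * exp (3 / 8 * s)) * exp (- of_real (3 / 8 * s))"
      unfolding L_def gauss(1)[symmetric] by (rule integral_mult_right_zero)
    also have "exp (- of_real (3 / 8 * s)) = complex_of_real (exp (- (3 / 8 * s)))" by (simp add: exp_of_real[symmetric])
    also have "of_real (saddle_constant x s * exp (3 / 8 * s)) * complex_of_real (exp (- (3 / 8 * s))) = of_real (saddle_constant x s * (exp (3 / 8 * s) * exp (- (3 / 8 * s))))"
      by (simp only: of_real_mult[symmetric] mult.assoc)
    finally show ?thesis by (simp add: exp_add[symmetric])
  qed
  moreover have "\<forall>\<^sub>F T in at_top. integral\<^sup>L lborel (w T) = (LBINT v. saddle_integrand x s (R T) v)"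
    using posT by eventually_elim (simp add: w_def)
  ultimately show ?thesis by (simp only:) (rule Lim_transform_eventually)
qed

text \<open>The substitution \<open>y = \<rho>^2 * v\<close>. The condition on \<open>T\<close> says
  that \<open>\<rho>\<close> is the saddle point; it turns the phase \<open>\<rho>^2 * v * T\<close>
  into \<open>c^2 * s * v / \<rho>\<close>.\<close>

lemma contour_integral_scaling:
  fixes s x T :: real
  assumes s: "0 < s" and \<rho>: "0 < \<rho>" and T: "\<rho>^3 * T = (pi\<^sup>2 / 4)\<^sup>2 * s"
  defines "c \<equiv> pi\<^sup>2 / 4"
  defines "r \<equiv> pi\<^sup>2 / 8 - \<rho>"
  shows "(LBINT y. exp (Complex (- r) y * of_real T) * passage_transform x s (Complex (- r) y) / (Complex (- r) y)\<^sup>2)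
    = of_real (\<rho> * exp (- r * T + c\<^sup>2 * s / (2 * \<rho>\<^sup>2) - 3 * c * s / (2 * \<rho>))) * (LBINT v. saddle_integrand x s \<rho> v)"
proof -
  have T2: "\<rho>\<^sup>2 * T = c\<^sup>2 * s / \<rho>" using T \<rho> by (simp add: c_def field_simps power2_eq_square power3_eq_cube)
  define f where "f y = exp (Complex (- r) y * of_real T) * passage_transform x s (Complex (- r) y) / (Complex (- r) y)\<^sup>2" for y
  define e where "e = exp (- r * T + c\<^sup>2 * s / (2 * \<rho>\<^sup>2) - 3 * c * s / (2 * \<rho>))"
  have f: "of_real (\<rho>\<^sup>2) * f (\<rho>\<^sup>2 * v) = of_real (\<rho> * e) * saddle_integrand x s \<rho> v" for v
  proof -
    have z: "Complex (- r) (\<rho>\<^sup>2 * v) = Complex \<rho> (\<rho>\<^sup>2 * v) - of_real (pi\<^sup>2 / 8)" by (simp add: complex_eq_iff r_def)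
    have "exp (Complex (- r) (\<rho>\<^sup>2 * v) * of_real T) = of_real e * exp (\<i> * of_real (c\<^sup>2 * s * v / \<rho>) - of_real (c\<^sup>2 * s / (2 * \<rho>\<^sup>2)) + of_real (3 * c * s / (2 * \<rho>)))"
    proof -
      have im: "\<rho>\<^sup>2 * v * T = c\<^sup>2 * s * v / \<rho>" using T2 by (metis (no_types, opaque_lifting) mult.assoc mult.commute times_divide_eq_right)
      have "Complex (- r) (\<rho>\<^sup>2 * v) * of_real T = of_real (- r * T + c\<^sup>2 * s / (2 * \<rho>\<^sup>2) - 3 * c * s / (2 * \<rho>)) + (\<i> * of_real (c\<^sup>2 * s * v / \<rho>) - of_real (c\<^sup>2 * s / (2 * \<rho>\<^sup>2)) + of_real (3 * c * s / (2 * \<rho>)))"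
        unfolding im[symmetric] by (simp add: complex_eq_iff)
      then show ?thesis unfolding e_def by (simp only: exp_add exp_of_real)
    qed
    then show ?thesis unfolding f_def saddle_integrand_def[folded c_def] z by (simp add: power2_eq_square)
  qed
  have "(LBINT y. f y) = \<bar>\<rho>\<^sup>2\<bar> *\<^sub>R (LBINT v. f (0 + \<rho>\<^sup>2 * v))"
    by (rule lborel_integral_real_affine) (use \<rho> in simp)
  also have "\<dots> = (LBINT v. of_real (\<rho>\<^sup>2) * f (\<rho>\<^sup>2 * v))" by (simp add: scaleR_conv_of_real)
  also have "\<dots> = (LBINT v. of_real (\<rho> * e) * saddle_integrand x s \<rho> v)" unfolding f ..
  also have "\<dots> = of_real (\<rho> * e) * (LBINT v. saddle_integrand x s \<rho> v)" by simp
  finally show ?thesis unfolding f_def e_def .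
qed

section \<open>Asymptotics of the distribution function\<close>

text \<open>\<open>G T\<close> lies between the negated difference quotients of \<open>H\<close>
  over \<open>[T, T + \<delta>]\<close> and over \<open>[T - \<delta>, T]\<close>. For fixed
  \<open>\<delta>\<close> the shift property of \<open>b\<close> determines their limits relative to
  \<open>b\<close>; letting \<open>\<delta>\<close> tend to 0 afterwards brings both to
  \<open>\<kappa> * L\<close>. Stated as a limit, the result also covers
  \<open>L = 0\<close>.\<close>

lemma asymptotics_of_monotone_derivative:
  fixes G H b :: "real \<Rightarrow> real"
  assumes lower: "\<And>t u. 0 \<le> t \<Longrightarrow> t \<le> u \<Longrightarrow> (u - t) * G u \<le> H t - H u"
    and upper: "\<And>t u. 0 \<le> t \<Longrightarrow> t \<le> u \<Longrightarrow> H t - H u \<le> (u - t) * G t"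
    and pos: "\<forall>\<^sub>F T in at_top. 0 < b T"
    and H: "((\<lambda>T. H T / b T) \<longlongrightarrow> L) at_top"
    and b: "\<And>\<delta>. ((\<lambda>T. b (T + \<delta>) / b T) \<longlongrightarrow> exp (- (\<kappa> * \<delta>))) at_top"
  shows "((\<lambda>T. G T / b T) \<longlongrightarrow> \<kappa> * L) at_top"
proof -
  have shift: "((\<lambda>T. H (T + \<delta>) / b T) \<longlongrightarrow> L * exp (- (\<kappa> * \<delta>))) at_top" for \<delta>
  proof -
    have tr: "filterlim (\<lambda>T. T + \<delta>) at_top at_top" by real_asymp
    have "((\<lambda>T. H (T + \<delta>) / b (T + \<delta>) * (b (T + \<delta>) / b T)) \<longlongrightarrow> L * exp (- (\<kappa> * \<delta>))) at_top"
      by (intro tendsto_mult b filterlim_compose[OF H tr])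
    moreover have "\<forall>\<^sub>F T in at_top. H (T + \<delta>) / b (T + \<delta>) * (b (T + \<delta>) / b T) = H (T + \<delta>) / b T"
      using eventually_compose_filterlim[OF pos tr] by eventually_elim simp
    ultimately show ?thesis by (rule Lim_transform_eventually)
  qed
  have deriv: "((\<lambda>\<delta>. L * (1 - exp (- (\<kappa> * \<delta>))) / \<delta>) \<longlongrightarrow> \<kappa> * L) (at_right 0)"
    "((\<lambda>\<delta>. L * (exp (\<kappa> * \<delta>) - 1) / \<delta>) \<longlongrightarrow> \<kappa> * L) (at_right 0)"
    by real_asymp+
  have pos_right: "\<forall>\<^sub>F \<delta> in at_right 0. (0::real) < \<delta>" by (rule eventually_at_right_less)
  show ?thesis
  proof (rule order_tendstoI)
    fix a assume "a < \<kappa> * L"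
    then have "\<forall>\<^sub>F \<delta> in at_right 0. a < L * (1 - exp (- (\<kappa> * \<delta>))) / \<delta>" by (rule order_tendstoD[OF deriv(1)])
    then have "\<forall>\<^sub>F \<delta> in at_right 0. a < L * (1 - exp (- (\<kappa> * \<delta>))) / \<delta> \<and> 0 < \<delta>" using pos_right by (rule eventually_conj)
    then obtain \<delta> where \<delta>: "a < L * (1 - exp (- (\<kappa> * \<delta>))) / \<delta>" "0 < \<delta>"
      using eventually_happens[of _ "at_right (0::real)"] trivial_limit_at_right_real by blast
    have "((\<lambda>T. (H T / b T - H (T + \<delta>) / b T) / \<delta>) \<longlongrightarrow> (L - L * exp (- (\<kappa> * \<delta>))) / \<delta>) at_top"
      using \<delta>(2) by (intro tendsto_intros H shift) simp
    then have "\<forall>\<^sub>F T in at_top. a < (H T / b T - H (T + \<delta>) / b T) / \<delta>"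
      by (rule order_tendstoD) (use \<delta>(1) in \<open>simp add: algebra_simps\<close>)
    then show "\<forall>\<^sub>F T in at_top. a < G T / b T"
      using pos eventually_ge_at_top[of 0]
    proof eventually_elim
      case (elim T)
      have "(H T - H (T + \<delta>)) / \<delta> \<le> G T"
        using upper[of T "T + \<delta>"] elim(3) \<delta>(2) by (simp add: divide_le_eq mult.commute)
      then have "(H T - H (T + \<delta>)) / \<delta> / b T \<le> G T / b T" using elim(2) by (intro divide_right_mono) auto
      then show ?case using elim(1) by (simp add: diff_divide_distrib mult.commute)
    qed
  next
    fix a assume "\<kappa> * L < a"
    then have "\<forall>\<^sub>F \<delta> in at_right 0. L * (exp (\<kappa> * \<delta>) - 1) / \<delta> < a" by (rule order_tendstoD[OF deriv(2)])
    then have "\<forall>\<^sub>F \<delta> in at_right 0. L * (exp (\<kappa> * \<delta>) - 1) / \<delta> < a \<and> 0 < \<delta>" using pos_right by (rule eventually_conj)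
    then obtain \<delta> where \<delta>: "L * (exp (\<kappa> * \<delta>) - 1) / \<delta> < a" "0 < \<delta>"
      using eventually_happens[of _ "at_right (0::real)"] trivial_limit_at_right_real by blast
    have "((\<lambda>T. (H (T + - \<delta>) / b T - H T / b T) / \<delta>) \<longlongrightarrow> (L * exp (- (\<kappa> * - \<delta>)) - L) / \<delta>) at_top"
      using \<delta>(2) by (intro tendsto_intros H shift) simp
    then have "\<forall>\<^sub>F T in at_top. (H (T + - \<delta>) / b T - H T / b T) / \<delta> < a"
      by (rule order_tendstoD) (use \<delta>(1) in \<open>simp add: algebra_simps\<close>)
    then show "\<forall>\<^sub>F T in at_top. G T / b T < a"
      using pos eventually_ge_at_top[of \<delta>]
    proof eventually_elim
      case (elim T)
      have "G T \<le> (H (T - \<delta>) - H T) / \<delta>"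
        using lower[of "T - \<delta>" T] elim(3) \<delta>(2) by (simp add: le_divide_eq mult.commute)
      then have "G T / b T \<le> (H (T - \<delta>) - H T) / \<delta> / b T" using elim(2) by (intro divide_right_mono) auto
      then show ?case using elim(1) by (simp add: diff_divide_distrib mult.commute)
    qed
  qed
qed

lemma set_integral_antimono_bounds:
  fixes G :: "real \<Rightarrow> real"
  assumes [measurable]: "G \<in> borel_measurable borel" and G: "\<And>t. 0 \<le> G t" "\<And>t. G t \<le> 1"
    and anti: "\<And>t u. 0 \<le> t \<Longrightarrow> t \<le> u \<Longrightarrow> G u \<le> G t" and t: "0 \<le> t" "t \<le> u"
  shows "(u - t) * G u \<le> (LBINT r:{0..u}. G r) - (LBINT r:{0..t}. G r)"
    and "(LBINT r:{0..u}. G r) - (LBINT r:{0..t}. G r) \<le> (u - t) * G t"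
proof -
  have int: "set_integrable lborel {a..b} G" for a b
    by (rule set_integrable_Icc_bounded[where C = 1]) (use G in auto)
  have eq: "(LBINT r:{0..u}. G r) - (LBINT r:{0..t}. G r) = (LBINT r:{t..u}. G r)"
    using set_integral_Icc_split[OF int t] by simp
  have const: "(LBINT r:{t..u}. C) = (u - t) * C" "set_integrable lborel {t..u} (\<lambda>_. C)" for C :: real
    using t by (auto simp: set_lebesgue_integral_def set_integrable_def)
  show "(u - t) * G u \<le> (LBINT r:{0..u}. G r) - (LBINT r:{0..t}. G r)"
    unfolding eq const(1)[symmetric] by (rule set_integral_mono[OF const(2) int]) (use t anti in auto)
  show "(LBINT r:{0..u}. G r) - (LBINT r:{0..t}. G r) \<le> (u - t) * G t"
    unfolding eq const(1)[symmetric] by (rule set_integral_mono[OF int const(2)]) (use t anti in auto)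
qed

text \<open>This is \<open>\<rho> exp (- (\<pi>\<^sup>2 / 8 - \<rho>) T + c\<^sup>2 s / (2 \<rho>\<^sup>2) - 3 c s / (2 \<rho>))\<close> with \<open>\<rho>\<^sup>3 T = K\<close>, \<open>K = c\<^sup>2 s\<close>.\<close>

definition saddle_rate :: "real \<Rightarrow> real \<Rightarrow> real" where
  "saddle_rate s T = (let K = (pi\<^sup>2 / 4)\<^sup>2 * s in
     K powr (1 / 3) * T powr (- (1 / 3)) * exp (- (pi\<^sup>2 / 8) * T + 3 / 2 * K powr (1 / 3) * T powr (2 / 3)
       - 3 / 2 * (pi\<^sup>2 / 4) * s * K powr (- (1 / 3)) * T powr (1 / 3)))"

lemma saddle_rate_pos: "0 < s \<Longrightarrow> 0 < T \<Longrightarrow> 0 < saddle_rate s T"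
  by (simp add: saddle_rate_def Let_def)

text \<open>Over a fixed length the increments of \<open>T powr (2 / 3)\<close> and
  \<open>T powr (1 / 3)\<close> tend to 0, so only the linear term of the exponent
  contributes.\<close>

lemma saddle_rate_shift:
  assumes s: "0 < s"
  shows "((\<lambda>T. saddle_rate s (T + \<delta>) / saddle_rate s T) \<longlongrightarrow> exp (- (pi\<^sup>2 / 8 * \<delta>))) at_top"
proof -
  define a where "a = 3 / 2 * ((pi\<^sup>2 / 4)\<^sup>2 * s) powr (1 / 3)"
  define b where "b = 3 / 2 * (pi\<^sup>2 / 4) * s * ((pi\<^sup>2 / 4)\<^sup>2 * s) powr (- (1 / 3))"
  define k where "k = pi\<^sup>2 / 8"
  have lim: "((\<lambda>T. ((T + \<delta>) powr (- (1 / 3)) / T powr (- (1 / 3)))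
      * exp (- (k * \<delta>) + a * ((T + \<delta>) powr (2 / 3) - T powr (2 / 3)) - b * ((T + \<delta>) powr (1 / 3) - T powr (1 / 3))))
      \<longlongrightarrow> 1 * exp (- (k * \<delta>) + a * 0 - b * 0)) at_top"
    by (intro tendsto_intros; real_asymp)
  have "saddle_rate s (T + \<delta>) / saddle_rate s T = ((T + \<delta>) powr (- (1 / 3)) / T powr (- (1 / 3)))
      * exp (- (k * \<delta>) + a * ((T + \<delta>) powr (2 / 3) - T powr (2 / 3)) - b * ((T + \<delta>) powr (1 / 3) - T powr (1 / 3)))" for T
  proof -
    have e: "exp (- (k * \<delta>) + a * ((T + \<delta>) powr (2 / 3) - T powr (2 / 3)) - b * ((T + \<delta>) powr (1 / 3) - T powr (1 / 3)))
      = exp (- k * (T + \<delta>) + a * (T + \<delta>) powr (2 / 3) - b * (T + \<delta>) powr (1 / 3)) / exp (- k * T + a * T powr (2 / 3) - b * T powr (1 / 3))"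
      unfolding exp_diff[symmetric] by (rule arg_cong[of _ _ exp]) (simp add: algebra_simps)
    show ?thesis unfolding e saddle_rate_def Let_def a_def[symmetric] b_def[symmetric] k_def[symmetric]
      using s by simp
  qed
  then show ?thesis using lim by (simp add: k_def)
qed

lemma saddle_rate_eq:
  fixes s T :: real
  assumes s: "0 < s" and T: "0 < T"
  defines "c \<equiv> pi\<^sup>2 / 4"
  defines "\<rho> \<equiv> (c\<^sup>2 * s / T) powr (1 / 3)"
  shows "\<rho>^3 * T = c\<^sup>2 * s"
    and "\<rho> * exp (- (pi\<^sup>2 / 8 - \<rho>) * T + c\<^sup>2 * s / (2 * \<rho>\<^sup>2) - 3 * c * s / (2 * \<rho>)) = saddle_rate s T"
proof -
  define K where "K = c\<^sup>2 * s"
  have K: "0 < K" using s by (simp add: K_def c_def)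
  have \<rho>: "0 < \<rho>" using K T unfolding \<rho>_def K_def[symmetric] by simp
  have "\<rho>^3 = \<rho> powr 3" using \<rho> by (simp add: powr_numeral)
  also have "\<dots> = K / T" unfolding \<rho>_def K_def[symmetric] powr_powr using K T by simp
  finally have cube: "\<rho>^3 = K / T" .
  then show 1: "\<rho>^3 * T = c\<^sup>2 * s" using T by (simp add: K_def)
  have r: "\<rho> = K powr (1 / 3) * T powr (- (1 / 3))"
    unfolding \<rho>_def K_def[symmetric] using K T by (simp add: powr_divide powr_minus_divide)
  have r': "1 / \<rho> = K powr (- (1 / 3)) * T powr (1 / 3)"
    unfolding r by (simp add: powr_minus_divide)
  have rT: "\<rho> * T = K powr (1 / 3) * T powr (2 / 3)"
  proof -
    have "T powr (- (1 / 3)) * T = T powr (- (1 / 3)) * T powr 1" using T by simp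
    also have "\<dots> = T powr (2 / 3)" unfolding powr_add[symmetric] by simp
    finally show ?thesis unfolding r by (simp only: mult.assoc)
  qed
  \<comment> \<open>At the saddle point \<open>c^2 * s / (2 * \<rho>^2)\<close> is half of
    \<open>\<rho> * T\<close>, whence the coefficient \<open>3 / 2\<close> of the leading
    correction.\<close>
  have sq: "c\<^sup>2 * s / (2 * \<rho>\<^sup>2) = \<rho> * T / 2"
    using 1 \<rho> by (simp add: field_simps power2_eq_square power3_eq_cube)
  have "- (pi\<^sup>2 / 8 - \<rho>) * T + c\<^sup>2 * s / (2 * \<rho>\<^sup>2) - 3 * c * s / (2 * \<rho>)
    = - (pi\<^sup>2 / 8) * T + 3 / 2 * (\<rho> * T) - 3 / 2 * c * s * (1 / \<rho>)"
    unfolding sq by (simp add: left_diff_distrib)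
  also have "\<dots> = - (pi\<^sup>2 / 8) * T + 3 / 2 * K powr (1 / 3) * T powr (2 / 3) - 3 / 2 * c * s * K powr (- (1 / 3)) * T powr (1 / 3)"
    unfolding rT r' by simp
  finally show "\<rho> * exp (- (pi\<^sup>2 / 8 - \<rho>) * T + c\<^sup>2 * s / (2 * \<rho>\<^sup>2) - 3 * c * s / (2 * \<rho>)) = saddle_rate s T"
    unfolding saddle_rate_def Let_def K_def[symmetric] c_def[symmetric] using r by simp
qed

lemma tauberian_asymptotics:
  fixes G :: "real \<Rightarrow> real" and x s :: real
  assumes s: "0 < s" and Gm: "G \<in> borel_measurable borel" and G: "\<And>t. 0 \<le> G t" "\<And>t. G t \<le> 1"
    and anti: "\<And>t u. 0 \<le> t \<Longrightarrow> t \<le> u \<Longrightarrow> G u \<le> G t"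
    and LT: "\<And>l. 0 < l \<Longrightarrow> of_real (LBINT T:{0..}. exp (- l * T) * G T) = (1 - passage_transform x s (of_real l)) / of_real l"
  shows "((\<lambda>T. G T / saddle_rate s T) \<longlongrightarrow> pi\<^sup>2 / 8 * (saddle_constant x s / (2 * pi))) at_top"
proof (rule asymptotics_of_monotone_derivative)
  define c where "c = pi\<^sup>2 / 4"
  \<comment> \<open>The integral of \<open>G\<close> beyond \<open>T\<close>, since
    \<open>- deriv (passage_transform x s) 0\<close> is the integral over the whole half
    line.\<close>
  define H where "H T = - Re (deriv (passage_transform x s) 0) - (LBINT t:{0..T}. G t)" for T
  show "(u - t) * G u \<le> H t - H u" "H t - H u \<le> (u - t) * G t" if "0 \<le> t" "t \<le> u" for t u
    using set_integral_antimono_bounds[OF Gm G anti that] by (simp_all add: H_def)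
  show "\<forall>\<^sub>F T in at_top. 0 < saddle_rate s T"
    using eventually_gt_at_top[of 0] by eventually_elim (rule saddle_rate_pos[OF s])
  show "((\<lambda>T. saddle_rate s (T + \<delta>) / saddle_rate s T) \<longlongrightarrow> exp (- (pi\<^sup>2 / 8 * \<delta>))) at_top" for \<delta>
    by (rule saddle_rate_shift[OF s])
  define R where "R T = (c\<^sup>2 * s / T) powr (1 / 3)" for T
  have R: "filterlim R (at_right 0) at_top"
  proof -
    have "filterlim (\<lambda>T. (K / T) powr (1 / 3)) (at_right 0) at_top" if "0 < K" for K :: real
      using that by real_asymp
    then show ?thesis unfolding R_def using s by (simp add: c_def)
  qed
  define J where "J T = (LBINT v. saddle_integrand x s (R T) v)" for T
  have J: "(J \<longlongrightarrow> of_real (saddle_constant x s)) at_top"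
    unfolding J_def by (rule contour_integral_asymptotics[OF s R])
  have "((\<lambda>T. Re (J T) / (2 * pi)) \<longlongrightarrow> Re (of_real (saddle_constant x s)) / (2 * pi)) at_top"
    by (intro tendsto_intros J) simp
  then have "((\<lambda>T. Re (J T) / (2 * pi)) \<longlongrightarrow> saddle_constant x s / (2 * pi)) at_top" by simp
  moreover have "\<forall>\<^sub>F T in at_top. Re (J T) / (2 * pi) = H T / saddle_rate s T"
  proof -
    have k: "0 < pi\<^sup>2 / 8" by simp
    have "\<forall>\<^sub>F T in at_top. R T \<in> {0<..<pi\<^sup>2 / 8}"
      using R eventually_at_right_real[OF k] unfolding filterlim_iff by blast
    then show ?thesis using eventually_gt_at_top[of 0]
    proof eventually_elim
      case (elim T)
      \<comment> \<open>For each \<open>T\<close> the inversion formula is used on its own vertical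
        line, the one through the saddle point.\<close>
      define r where "r = pi\<^sup>2 / 8 - R T"
      have r: "0 < r" "r < pi\<^sup>2 / 8" using elim by (auto simp: r_def)
      obtain K where K: "\<And>z. - r \<le> Re z \<Longrightarrow> cmod (passage_transform x s z) \<le> K"
        using passage_transform_bounded[OF s r, of x] by blast
      define Q where "Q = (LBINT y. exp (Complex (- r) y * of_real T) * passage_transform x s (Complex (- r) y) / (Complex (- r) y)\<^sup>2)"
      have "complex_of_real (LBINT t:{0..T}. G t) = - deriv (passage_transform x s) 0 - Q / (2 * pi)"
        unfolding Q_def
        by (rule laplace_inversion_integrated[OF passage_transform_holomorphic[OF s] r K passage_transform_0[OF s] Gm G LT])
          (use elim in auto)
      then have "(LBINT t:{0..T}. G t) = Re (- deriv (passage_transform x s) 0 - Q / (2 * pi))"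
        by (metis Re_complex_of_real)
      then have HQ: "H T = Re Q / (2 * pi)" by (simp add: H_def)
      have "Q = of_real (saddle_rate s T) * J T"
      proof -
        have e: "R T ^ 3 * T = (pi\<^sup>2 / 4)\<^sup>2 * s" "R T * exp (- r * T + c\<^sup>2 * s / (2 * (R T)\<^sup>2) - 3 * c * s / (2 * R T)) = saddle_rate s T"
          using saddle_rate_eq[OF s elim(2)] unfolding R_def c_def r_def by auto
        have "0 < R T" using elim by simp
        from contour_integral_scaling[OF s this e(1), of x]
        show ?thesis unfolding Q_def J_def e(2)[symmetric] r_def c_def .
      qed
      then show ?case using HQ saddle_rate_pos[OF s elim(2)] by simp
    qed
  qed
  ultimately show "((\<lambda>T. H T / saddle_rate s T) \<longlongrightarrow> saddle_constant x s / (2 * pi)) at_top"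
    by (rule Lim_transform_eventually)
qed

lemma saddle_rate_explicit:
  fixes s T y :: real
  assumes s: "0 < s" and T: "0 < T" and y: "\<bar>y\<bar> < 1"
  shows "pi\<^sup>2 / 8 * (saddle_constant y s / (2 * pi)) * saddle_rate s T =
     cos (pi * y / 2) * 2 powr (19 / 6)
              / (sqrt 3 * pi powr (13 / 6) * s powr (1 / 6) * T powr (1 / 3))
            * exp (- (pi\<^sup>2 / 8) * T
                   + 3 / 2 powr (7 / 3) * pi powr (4 / 3) * s powr (1 / 3) * T powr (2 / 3)
                   - 3 / 2 powr (5 / 3) * pi powr (2 / 3) * s powr (2 / 3) * T powr (1 / 3)
                   + (pi\<^sup>2 + 12) / 24 * s)"
proof -
  define K where "K = (pi\<^sup>2 / 4)\<^sup>2 * s"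
  have K0: "0 < K" using s by (simp add: K_def)
  have K: "K = pi powr 4 * s / 2 powr 4" by (simp add: K_def power_divide flip: power_mult)
  have "16 powr (1 / 3 :: real) = 2 powr (4 / 3)" "16 powr (1 / 6 :: real) = 2 powr (2 / 3)"
    "(pi ^ 4) powr (1 / 3) = pi powr (4 / 3)" "(pi ^ 4) powr (1 / 6) = pi powr (2 / 3)"
    using powr_powr[of pi 4 "1 / 3"] powr_powr[of pi 4 "1 / 6"] powr_powr[of "2 :: real" 4 "1 / 3"] powr_powr[of "2 :: real" 4 "1 / 6"] by simp_all
  note powr_16 = this
  have K3: "K powr (1 / 3) = pi powr (4 / 3) * s powr (1 / 3) / 2 powr (4 / 3)"
    unfolding K using s by (simp add: powr_divide powr_mult powr_powr powr_16)
  have K3': "K powr (- (1 / 3)) = 2 powr (4 / 3) / (pi powr (4 / 3) * s powr (1 / 3))"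
    unfolding powr_minus_divide K3 by simp
  have two: "2 powr (7 / 3) = 2 * 2 powr (4 / 3 :: real)"
    using powr_add[of 2 1 "4 / 3 :: real"] by simp
  have a: "3 / 2 * K powr (1 / 3) = 3 / 2 powr (7 / 3) * pi powr (4 / 3) * s powr (1 / 3)"
    unfolding K3 two by simp
  have p2: "pi\<^sup>2 = pi powr (2 / 3) * pi powr (4 / 3)" unfolding powr_add[symmetric] by (simp add: powr_numeral)
  have s1: "s = s powr (2 / 3) * s powr (1 / 3)" unfolding powr_add[symmetric] using s by simp
  have two': "8 = 2 powr (5 / 3) * 2 powr (4 / 3 :: real)" unfolding powr_add[symmetric] by (simp add: powr_numeral)
  have b: "3 / 2 * (pi\<^sup>2 / 4) * s * K powr (- (1 / 3)) = 3 / 2 powr (5 / 3) * pi powr (2 / 3) * s powr (2 / 3)"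
  proof -
    have "3 / 2 * (pi\<^sup>2 / 4) * s * K powr (- (1 / 3)) = 3 * pi\<^sup>2 * s * K powr (- (1 / 3)) / 8" by simp
    also have "\<dots> = 3 * (pi powr (2 / 3) * pi powr (4 / 3)) * (s powr (2 / 3) * s powr (1 / 3)) * (2 powr (4 / 3) / (pi powr (4 / 3) * s powr (1 / 3))) / (2 powr (5 / 3) * 2 powr (4 / 3))"
      unfolding K3' p2[symmetric] s1[symmetric] two'[symmetric] ..
    also have "\<dots> = 3 / 2 powr (5 / 3) * pi powr (2 / 3) * s powr (2 / 3)" using s by simp
    finally show ?thesis .
  qed
  \<comment> \<open>The \<open>K powr (1 / 3)\<close> of the rate over the
    \<open>K powr (1 / 2)\<close> of the Gaussian integral leaves \<open>K powr (- (1 / 6))\<close>,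
    the source of \<open>s powr (1 / 6)\<close> and of the sixths in the other exponents.\<close>
  have pre: "pi\<^sup>2 / 8 * ((pi / 2 * C) * (2 / (pi\<^sup>2 / 8)\<^sup>2) * sqrt (2 * pi / (3 * K)) / (2 * pi)) * (K powr (1 / 3) * T powr (- (1 / 3)))
    = C * 2 powr (19 / 6) / (sqrt 3 * pi powr (13 / 6) * s powr (1 / 6) * T powr (1 / 3))" for C
  proof -
    have sq: "sqrt (2 * pi / (3 * K)) = 2 powr (1 / 2) * pi powr (1 / 2) / (sqrt 3 * K powr (1 / 2))"
      using K0 by (simp add: real_sqrt_divide real_sqrt_mult powr_half_sqrt)
    have KK: "K powr (1 / 3) = K powr (1 / 2) / K powr (1 / 6)" unfolding powr_diff[symmetric] by simp
    have K6: "K powr (1 / 6) = pi powr (2 / 3) * s powr (1 / 6) / 2 powr (2 / 3)"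
      unfolding K using s by (simp add: powr_divide powr_mult powr_powr powr_16)
    have "pi\<^sup>2 / 8 * ((pi / 2 * C) * (2 / (pi\<^sup>2 / 8)\<^sup>2) * sqrt (2 * pi / (3 * K)) / (2 * pi)) * (K powr (1 / 3) * T powr (- (1 / 3)))
      = C * (4 / pi\<^sup>2) * sqrt (2 * pi / (3 * K)) * (K powr (1 / 3) * T powr (- (1 / 3)))"
      by (simp add: power2_eq_square)
    also have "\<dots> = C * (4 / pi\<^sup>2) * (2 powr (1 / 2) * pi powr (1 / 2) / sqrt 3) * (1 / K powr (1 / 6) * (1 / T powr (1 / 3)))"
      unfolding sq KK powr_minus_divide using K0 by simp
    also have "\<dots> = C * (4 * 2 powr (1 / 2) * 2 powr (2 / 3)) / (sqrt 3 * (pi\<^sup>2 * pi powr (2 / 3) / pi powr (1 / 2)) * s powr (1 / 6) * T powr (1 / 3))"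
      unfolding K6 by (simp add: mult_ac)
    also have "4 * 2 powr (1 / 2) * 2 powr (2 / 3 :: real) = 2 powr (19 / 6)"
      using powr_add[of 2 2 "1 / 2 :: real"] powr_add[of 2 "5 / 2" "2 / 3 :: real"] by (simp add: powr_numeral)
    also have "pi\<^sup>2 * pi powr (2 / 3) / pi powr (1 / 2) = pi powr (13 / 6)"
      using powr_add[of pi 2 "2 / 3"] powr_diff[of pi "8 / 3" "1 / 2"] by (simp add: powr_numeral)
    finally show ?thesis .
  qed
  have ex: "exp (u + v) = exp v * exp u" for u v :: real by (simp add: exp_add)
  have "pi\<^sup>2 / 8 * (saddle_constant y s / (2 * pi)) * saddle_rate s T
    = (pi\<^sup>2 / 8 * ((pi / 2 * cos (pi * y / 2)) * (2 / (pi\<^sup>2 / 8)\<^sup>2) * sqrt (2 * pi / (3 * K)) / (2 * pi)) * (K powr (1 / 3) * T powr (- (1 / 3))))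
      * exp (- (pi\<^sup>2 / 8) * T + 3 / 2 * K powr (1 / 3) * T powr (2 / 3) - 3 / 2 * (pi\<^sup>2 / 4) * s * K powr (- (1 / 3)) * T powr (1 / 3)
        + (pi\<^sup>2 + 12) / 24 * s)"
    unfolding saddle_constant_def saddle_rate_def Let_def K_def[symmetric] if_P[OF y] mult.assoc[of 3 K s, symmetric] ex
    by (simp add: K_def mult.assoc)
  then show ?thesis unfolding pre a b .
qed

section \<open>The occupation time of Brownian motion\<close>

context brownian_motion
begin

text \<open>Makes \<open>T - inside_time T \<omega>\<close> nondecreasing in \<open>T\<close>; the
  probability of staying below \<open>s\<close> is then nonincreasing, which is the monotonicity
  that \<open>tauberian_asymptotics\<close> requires.\<close>

lemma inside_time_increment:
  assumes \<omega>: "\<omega> \<in> space M" and t: "0 \<le> t" "t \<le> u"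
  shows "inside_time u \<omega> \<le> inside_time t \<omega> + (u - t)"
proof -
  note [measurable] = \<omega>
  have f: "(\<lambda>r. inside r \<omega>) \<in> borel_measurable borel" by measurable
  have int: "set_integrable lborel {a..b} (\<lambda>r. inside r \<omega>)" for a b
    by (rule set_integrable_Icc_bounded[OF f, where C = 1]) (use inside_bounds in auto)
  have one: "(LBINT r:{t..u}. 1) = u - t" "set_integrable lborel {t..u} (\<lambda>_. 1 :: real)"
    using t by (auto simp: set_lebesgue_integral_def set_integrable_def)
  have "(LBINT r:{t..u}. inside r \<omega>) \<le> (LBINT r:{t..u}. 1)"
    by (rule set_integral_mono[OF int one(2)]) (use inside_bounds in auto)
  then show ?thesis unfolding one(1) inside_time_def using set_integral_Icc_split[OF int t] by simp
qed

lemma occupation_time_tail: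
  assumes s: "0 < s"
  shows "((\<lambda>T. \<P>(\<omega> in M. occupation_time B T \<omega> \<le> s) / saddle_rate s T) \<longlongrightarrow> pi\<^sup>2 / 8 * (saddle_constant z s / (2 * pi))) at_top"
proof -
  define G where "G T = \<P>(\<omega> in M. outside_time T \<omega> \<le> s)" for T
  have [measurable]: "outside_time T \<in> borel_measurable M" for T by measurable
  have G1: "G T = 1 - surplus s T" for T
  proof -
    have "\<P>(\<omega> in M. \<not> s < outside_time T \<omega>) = 1 - \<P>(\<omega> in M. s < outside_time T \<omega>)"
      by (rule prob_neg) measurable
    then show ?thesis by (simp add: G_def surplus_prob not_less)
  qed
  have "((\<lambda>T. G T / saddle_rate s T) \<longlongrightarrow> pi\<^sup>2 / 8 * (saddle_constant z s / (2 * pi))) at_top"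
  proof (rule tauberian_asymptotics[OF s])
    show "G \<in> borel_measurable borel" unfolding G1[abs_def] by measurable
    show "0 \<le> G t" "G t \<le> 1" for t by (simp_all add: G_def)
    show "G u \<le> G t" if "0 \<le> t" "t \<le> u" for t u
      unfolding G_def
      by (intro finite_measure_mono) (use inside_time_increment[OF _ that] in \<open>force simp: outside_time_def\<close>, measurable)
    show "of_real (LBINT T:{0..}. exp (- l * T) * G T) = (1 - passage_transform z s (of_real l)) / of_real l" if "0 < l" for l
      unfolding G_def laplace_occupation_prob[OF that s] passage_transform_of_real[OF that] by simp
  qed
  moreover have "\<forall>\<^sub>F T in at_top. G T / saddle_rate s T = \<P>(\<omega> in M. occupation_time B T \<omega> \<le> s) / saddle_rate s T"
    using eventually_ge_at_top[of 0]
  proof eventually_elim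
    case (elim T)
    have "{\<omega> \<in> space M. occupation_time B T \<omega> \<le> s} = {\<omega> \<in> space M. outside_time T \<omega> \<le> s}"
      using outside_time_eq[OF _ elim] by auto
    then show ?case by (simp add: G_def)
  qed
  ultimately show ?thesis by (rule Lim_transform_eventually)
qed

end

theorem proposition2:
  fixes P :: "real \<Rightarrow> 'w measure" and B :: "real \<Rightarrow> 'w \<Rightarrow> real" and s :: real
  assumes BM: "\<And>z. brownian_motion (P z) B z"
    and s: "s > 0"
  shows
    "(\<forall>y\<in>{-1<..<1}.
       (\<lambda>T. \<P>(\<omega> in P y. occupation_time B T \<omega> \<le> s)) \<sim>[at_top]
       (\<lambda>T. cos (pi * y / 2) * 2 powr (19 / 6)
              / (sqrt 3 * pi powr (13 / 6) * s powr (1 / 6) * T powr (1 / 3))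
            * exp (- (pi\<^sup>2 / 8) * T
                   + 3 / 2 powr (7 / 3) * pi powr (4 / 3) * s powr (1 / 3) * T powr (2 / 3)
                   - 3 / 2 powr (5 / 3) * pi powr (2 / 3) * s powr (2 / 3) * T powr (1 / 3)
                   + (pi\<^sup>2 + 12) / 24 * s)))
     \<and> (\<forall>x\<in>UNIV - {-1<..<1}. \<forall>y\<in>{-1<..<1}.
       ((\<lambda>T. \<P>(\<omega> in P x. occupation_time B T \<omega> \<le> s)
              / \<P>(\<omega> in P y. occupation_time B T \<omega> \<le> s)) \<longlongrightarrow> 0) at_top)"
proof (intro conjI ballI)
  define A where "A z = pi\<^sup>2 / 8 * (saddle_constant z s / (2 * pi))" for z
  have tail: "((\<lambda>T. \<P>(\<omega> in P z. occupation_time B T \<omega> \<le> s) / saddle_rate s T) \<longlongrightarrow> A z) at_top" for z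
    unfolding A_def by (rule brownian_motion.occupation_time_tail[OF BM s])
  have pos: "0 < A y" if y: "y \<in> {-1<..<1}" for y
  proof -
    have "0 < cos (pi * y / 2)"
    proof (rule cos_gt_zero_pi)
      show "- (pi / 2) < pi * y / 2" "pi * y / 2 < pi / 2"
        using mult_strict_left_mono[of "-1" y pi] mult_strict_left_mono[of y 1 pi] y by auto
    qed
    moreover have "\<bar>y\<bar> < 1" using y by auto
    ultimately show ?thesis using s by (simp add: A_def saddle_constant_def)
  qed
  fix y :: real assume y: "y \<in> {-1<..<1}"
  {
    have "((\<lambda>T. (\<P>(\<omega> in P y. occupation_time B T \<omega> \<le> s) / saddle_rate s T) / (A y))
      \<longlongrightarrow> (A y) / (A y)) at_top"
      using pos[OF y] by (intro tendsto_divide tail tendsto_const) simp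
    then have lim: "((\<lambda>T. (\<P>(\<omega> in P y. occupation_time B T \<omega> \<le> s) / saddle_rate s T) / (A y)) \<longlongrightarrow> 1) at_top"
      using pos[OF y] by simp
    have "((\<lambda>T. \<P>(\<omega> in P y. occupation_time B T \<omega> \<le> s) / (cos (pi * y / 2) * 2 powr (19 / 6)
              / (sqrt 3 * pi powr (13 / 6) * s powr (1 / 6) * T powr (1 / 3))
            * exp (- (pi\<^sup>2 / 8) * T
                   + 3 / 2 powr (7 / 3) * pi powr (4 / 3) * s powr (1 / 3) * T powr (2 / 3)
                   - 3 / 2 powr (5 / 3) * pi powr (2 / 3) * s powr (2 / 3) * T powr (1 / 3)
                   + (pi\<^sup>2 + 12) / 24 * s))) \<longlongrightarrow> 1) at_top"
    proof (rule Lim_transform_eventually[OF lim])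
      show "\<forall>\<^sub>F T in at_top. (\<P>(\<omega> in P y. occupation_time B T \<omega> \<le> s) / saddle_rate s T) / (A y) =
        \<P>(\<omega> in P y. occupation_time B T \<omega> \<le> s) / (cos (pi * y / 2) * 2 powr (19 / 6)
              / (sqrt 3 * pi powr (13 / 6) * s powr (1 / 6) * T powr (1 / 3))
            * exp (- (pi\<^sup>2 / 8) * T
                   + 3 / 2 powr (7 / 3) * pi powr (4 / 3) * s powr (1 / 3) * T powr (2 / 3)
                   - 3 / 2 powr (5 / 3) * pi powr (2 / 3) * s powr (2 / 3) * T powr (1 / 3)
                   + (pi\<^sup>2 + 12) / 24 * s))"
        using eventually_gt_at_top[of 0]
      proof eventually_elim
        case (elim T)
        have "\<bar>y\<bar> < 1" using y by auto
        show ?case unfolding A_def saddle_rate_explicit[OF s elim \<open>\<bar>y\<bar> < 1\<close>, symmetric] divide_divide_eq_left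
          by (simp only: mult.commute)
      qed
    qed
    then show "(\<lambda>T. \<P>(\<omega> in P y. occupation_time B T \<omega> \<le> s)) \<sim>[at_top]
       (\<lambda>T. cos (pi * y / 2) * 2 powr (19 / 6)
              / (sqrt 3 * pi powr (13 / 6) * s powr (1 / 6) * T powr (1 / 3))
            * exp (- (pi\<^sup>2 / 8) * T
                   + 3 / 2 powr (7 / 3) * pi powr (4 / 3) * s powr (1 / 3) * T powr (2 / 3)
                   - 3 / 2 powr (5 / 3) * pi powr (2 / 3) * s powr (2 / 3) * T powr (1 / 3)
                   + (pi\<^sup>2 + 12) / 24 * s))"
      by (rule asymp_equivI')
  next
    fix x :: real assume x: "x \<in> UNIV - {-1<..<1}"
    \<comment> \<open>On the common scale \<open>saddle_rate s\<close> the probability from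
      \<open>x\<close> has limit 0 and the one from \<open>y\<close> a positive limit, so the
      quotient tends to 0.\<close>
    then have x0: "A x = 0" by (auto simp: A_def saddle_constant_def)
    have "((\<lambda>T. (\<P>(\<omega> in P x. occupation_time B T \<omega> \<le> s) / saddle_rate s T) / (\<P>(\<omega> in P y. occupation_time B T \<omega> \<le> s) / saddle_rate s T))
      \<longlongrightarrow> (A x) / (A y)) at_top"
      using pos[OF y] by (intro tendsto_divide tail) simp
    then have "((\<lambda>T. (\<P>(\<omega> in P x. occupation_time B T \<omega> \<le> s) / saddle_rate s T) / (\<P>(\<omega> in P y. occupation_time B T \<omega> \<le> s) / saddle_rate s T)) \<longlongrightarrow> 0) at_top"
      by (simp add: x0)
    then show "((\<lambda>T. \<P>(\<omega> in P x. occupation_time B T \<omega> \<le> s) / \<P>(\<omega> in P y. occupation_time B T \<omega> \<le> s)) \<longlongrightarrow> 0) at_top"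
    proof (rule Lim_transform_eventually)
      show "\<forall>\<^sub>F T in at_top. (\<P>(\<omega> in P x. occupation_time B T \<omega> \<le> s) / saddle_rate s T) / (\<P>(\<omega> in P y. occupation_time B T \<omega> \<le> s) / saddle_rate s T)
        = \<P>(\<omega> in P x. occupation_time B T \<omega> \<le> s) / \<P>(\<omega> in P y. occupation_time B T \<omega> \<le> s)"
        using eventually_gt_at_top[of 0]
      proof eventually_elim
        case (elim T)
        show ?case using saddle_rate_pos[OF s elim] by simp
      qed
    qed
  }
qed

end
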